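(* Let $(p_n)_{n\in\mathbb{N}}$ be a sequence of positive integers with $p_n\to\infty$ as $n\to\infty$. Then $$\{\widetilde H_n(s,t)\}_{s,t\in[0,1]}:=\frac{1}{\sqrt n}\big\{H_n(s,t)-\mathbb{E}[H_n(s,t)]\big\}_{s,t\in[0,1]}\ \Longrightarrow\ \{\mathcal{G}(s,t)\}_{s,t\in[0,1]}$$ weakly in $l^\infty([0,1]^2)$ as $n\to\infty$, where $\mathcal{G}$ is a centered continuous Gaussian process with covariance kernel $$\operatorname{cov}(\mathcal{G}(s_1,t_1),\mathcal{G}(s_2,t_2))=\frac{(s_1\wedge s_2)^2\,c(t_1,t_2)}{2},\qquad c(t_1,t_2)=\int_0^{t_1\wedge t_2}\frac{(t_1-x)(t_2-x)}{(1-x)^2}\,dx.$$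
   Context: For each $n$, let $p_{2n+1,i,j}$ ($1\le i\le 2n$, $0\le j\le p_n-1$) and $r_{2n+1,i,j}$ ($1\le i\le 2n$, $1\le j\le p_n-1$) be independent random variables with $$p_{2n+1,i,j}\sim\beta\Big(\tfrac{p_n+1}{2}(2n-i+2)-\tfrac j2,\ \tfrac{p_n+1}{2}(2n-i+2)\Big),\qquad r_{2n+1,i,j}\sim\beta\Big(\tfrac{p_n+1}{2}(2n-i+2)-\tfrac j2,\ \tfrac j2\Big),$$ where $\beta(\cdot,\cdot)$ is the Beta distribution on $[0,1]$. For $s,t\in[0,1]$ define $$\begin{aligned}H_n(s,t)=\sum_{i=1}^{\lfloor nt\rfloor}\Big\{&\sum_{j=1}^{\lfloor p_ns\rfloor-1}\Big(\log\big(r_{2n+1,2i,j}^{\lfloor nt\rfloor-i}\big)+\log\big(r_{2n+1,2i-1,j}^{\lfloor nt\rfloor-i+1}\big)\Big)\\&+\sum_{j=0}^{\lfloor p_ns\rfloor-1}\log\big(p_{2n+1,2i,j}^{\lfloor nt\rfloor-i+1}(1-p_{2n+1,2i,j})^{\lfloor nt\rfloor-i}\big)\\&+\sum_{j=0}^{\lfloor p_ns\rfloor-1}\log\big(p_{2n+1,2i-1,j}^{\lfloor nt\rfloor-i+1}(1-p_{2n+1,2i-1,j})^{\lfloor nt\rfloor-i+1}\big)\Big\},\end{aligned}$$ with empty sums equal to $0$ and $H_n(0,t)=0$. Here $l^\infty(T)$ is the space of bounded real functions on $T$ with the supremum norm, and weak convergence is in the usual sense of empirical process theory (van der Vaart and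 Wellner). *)

theory Defs
  imports "HOL-Probability.Probability"
begin

section \<open>Weak convergence of arbitrary maps into a metric space\<close>

text \<open>The outer expectation of van der Vaart and Wellner: the infimum of \<open>E U\<close> over all
  measurable extended real majorants \<open>U\<close> of \<open>Z\<close> for which \<open>E U\<close> exists, that is, for which the
  positive and the negative part do not both have infinite expectation. Note that
  \<open>e2ennreal\<close> sends negative numbers to 0, so it yields the positive part.\<close>

definition outer_expectation :: "'a measure \<Rightarrow> ('a \<Rightarrow> real) \<Rightarrow> ereal" where
  "outer_expectation M Z =
     Inf {enn2ereal (\<integral>\<^sup>+ \<omega>. e2ennreal (U \<omega>) \<partial>M) - enn2ereal (\<integral>\<^sup>+ \<omega>. e2ennreal (- U \<omega>) \<partial>M) | U :: 'a \<Rightarrow> ereal.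
       U \<in> borel_measurable M \<and> (\<forall>\<omega>\<in>space M. ereal (Z \<omega>) \<le> U \<omega>) \<and>
       \<not> ((\<integral>\<^sup>+ \<omega>. e2ennreal (U \<omega>) \<partial>M) = \<infinity> \<and> (\<integral>\<^sup>+ \<omega>. e2ennreal (- U \<omega>) \<partial>M) = \<infinity>)}"

definition metric_borel :: "'d metric \<Rightarrow> 'd measure" where
  "metric_borel D = sigma (mspace D) {S. openin (mtopology_of D) S}"

text \<open>The maps \<open>X n\<close> need not be measurable, and each may live on its own probability space;
  only the limit \<open>Y\<close> has to be Borel measurable.\<close>

definition converges_weakly ::
  "'d metric \<Rightarrow> (nat \<Rightarrow> 'a measure) \<Rightarrow> (nat \<Rightarrow> 'a \<Rightarrow> 'd) \<Rightarrow> 'b measure \<Rightarrow> ('b \<Rightarrow> 'd) \<Rightarrow> bool" where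
  "converges_weakly D M X N Y \<longleftrightarrow>
     (\<forall>n. X n \<in> space (M n) \<rightarrow> mspace D) \<and>
     Y \<in> measurable N (metric_borel D) \<and>
     (\<forall>f :: 'd \<Rightarrow> real. continuous_map (mtopology_of D) euclideanreal f \<and> bounded (f ` mspace D) \<longrightarrow>
        (\<lambda>n. outer_expectation (M n) (\<lambda>\<omega>. f (X n \<omega>))) \<longlonglongrightarrow> ereal (\<integral>\<omega>. f (Y \<omega>) \<partial>N))"

text \<open>The elements of \<open>l_infinity T\<close> are the bounded real functions on \<open>T\<close>, represented as
  extensional functions; the metric is the supremum metric.\<close>

definition l_infinity :: "'t set \<Rightarrow> ('t \<Rightarrow> real) metric" where
  "l_infinity T = funspace T euclidean_metric"


section \<open>Gaussian processes\<close>

text \<open>Point masses count as normal distributions with variance 0.\<close>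

definition gaussian_rv :: "'a measure \<Rightarrow> ('a \<Rightarrow> real) \<Rightarrow> bool" where
  "gaussian_rv M X \<longleftrightarrow> X \<in> borel_measurable M \<and>
     (\<exists>\<mu> \<sigma>. \<sigma> \<ge> 0 \<and>
        distr M borel X = (if \<sigma> = 0 then return borel \<mu> else density lborel (normal_density \<mu> \<sigma>)))"

definition gaussian_process :: "'a measure \<Rightarrow> 't set \<Rightarrow> ('a \<Rightarrow> 't \<Rightarrow> real) \<Rightarrow> bool" where
  "gaussian_process M T G \<longleftrightarrow>
     (\<forall>J a. finite J \<and> J \<subseteq> T \<longrightarrow> gaussian_rv M (\<lambda>\<omega>. \<Sum>t\<in>J. a t * G \<omega> t))"

definition cov :: "'a measure \<Rightarrow> ('a \<Rightarrow> real) \<Rightarrow> ('a \<Rightarrow> real) \<Rightarrow> real" where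
  "cov M X Y = (\<integral>\<omega>. (X \<omega> - (\<integral>\<omega>'. X \<omega>' \<partial>M)) * (Y \<omega> - (\<integral>\<omega>'. Y \<omega>' \<partial>M)) \<partial>M)"

definition centered_continuous_gaussian_process ::
  "'a measure \<Rightarrow> 't::topological_space set \<Rightarrow> ('t \<Rightarrow> 't \<Rightarrow> real) \<Rightarrow> ('a \<Rightarrow> 't \<Rightarrow> real) \<Rightarrow> bool" where
  "centered_continuous_gaussian_process M T K G \<longleftrightarrow>
     prob_space M \<and> gaussian_process M T G \<and>
     (\<forall>\<omega>\<in>space M. continuous_on T (G \<omega>)) \<and>
     (\<forall>t\<in>T. (\<integral>\<omega>. G \<omega> t \<partial>M) = 0) \<and>
     (\<forall>t\<in>T. \<forall>u\<in>T. cov M (\<lambda>\<omega>. G \<omega> t) (\<lambda>\<omega>. G \<omega> u) = K t u)"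


section \<open>The process and its limit\<close>

definition beta_density :: "real \<Rightarrow> real \<Rightarrow> real \<Rightarrow> real" where
  "beta_density a b x =
     (if 0 < x \<and> x < 1 then x powr (a - 1) * (1 - x) powr (b - 1) / Beta a b else 0)"

text \<open>The arguments \<open>P\<close> and \<open>R\<close> are the (realized) arrays \<open>p\<^bsub>2n+1,i,j\<^esub>\<close> and \<open>r\<^bsub>2n+1,i,j\<^esub>\<close>
  as functions of \<open>i\<close> and \<open>j\<close>, and \<open>q\<close> is \<open>p\<^sub>n\<close>. The upper limits \<open>k - 1\<close> of the sums over \<open>j\<close> are
  expressed by the strict bound \<open>j < k\<close>, which makes the sums empty for \<open>k = 0\<close>.\<close>

definition H :: "nat \<Rightarrow> nat \<Rightarrow> (nat \<Rightarrow> nat \<Rightarrow> real) \<Rightarrow> (nat \<Rightarrow> nat \<Rightarrow> real) \<Rightarrow> real \<Rightarrow> real \<Rightarrow> real" where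
  "H n q P R s t =
     (let m = nat \<lfloor>real n * t\<rfloor>; k = nat \<lfloor>real q * s\<rfloor> in
      \<Sum>i = 1..m.
        (\<Sum>j = 1..<k. ln (R (2 * i) j ^ (m - i)) + ln (R (2 * i - 1) j ^ (m - i + 1)))
      + (\<Sum>j = 0..<k. ln (P (2 * i) j ^ (m - i + 1) * (1 - P (2 * i) j) ^ (m - i)))
      + (\<Sum>j = 0..<k. ln (P (2 * i - 1) j ^ (m - i + 1) * (1 - P (2 * i - 1) j) ^ (m - i + 1))))"

definition c :: "real \<Rightarrow> real \<Rightarrow> real" where
  "c t\<^sub>1 t\<^sub>2 = (LINT x:{0..min t\<^sub>1 t\<^sub>2}|lborel. (t\<^sub>1 - x) * (t\<^sub>2 - x) / (1 - x)\<^sup>2)"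

definition limit_kernel :: "real \<times> real \<Rightarrow> real \<times> real \<Rightarrow> real" where
  "limit_kernel = (\<lambda>(s\<^sub>1, t\<^sub>1) (s\<^sub>2, t\<^sub>2). (min s\<^sub>1 s\<^sub>2)\<^sup>2 * c t\<^sub>1 t\<^sub>2 / 2)"

abbreviation unit_square :: "(real \<times> real) set" where
  "unit_square \<equiv> {0..1} \<times> {0..1}"

end

theory Submission
  imports Defs
begin

text \<open>
  Sorting the logarithms by the row \<open>r = \<lceil>i/2\<rceil>\<close> and the column \<open>j\<close> of the variable that they
  contain, the centred process is \<open>W k m = \<Sum> ((m - r) \<xi> + \<eta>)\<close>, summed over the cells with
  \<open>r \<le> m\<close> and \<open>j < k\<close>, at \<open>k = \<lfloor>p\<^sub>n s\<rfloor>\<close> and \<open>m = \<lfloor>n t\<rfloor>\<close>. The \<open>\<xi>\<close> and \<open>\<eta>\<close> are independent over the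
  cells, and in the row at distance \<open>N = n - r + 1\<close> from the end their variances, given by polygamma
  functions, add up to \<open>O(1/N\<^sup>2)\<close> and \<open>O(1/N)\<close>. The cells that carry a variable \<open>p\<close> contribute
  \<open>o(n)\<close> to the variance. For the cells that carry a variable \<open>r\<close>, the covariances are Riemann sums that
  converge to the stated kernel, and Lyapunov's condition yields the finite-dimensional limits.

  Tightness comes from Ottaviani's inequality over the columns. In the direction of \<open>t\<close> it is
  combined with a weighted Cauchy-Schwarz inequality for the increments of \<open>W\<close> over short windows,
  in the direction of \<open>s\<close> with a fourth moment bound for blocks of columns.

  The limit process is a white noise expanded in the tensor product Haar basis of \<open>[0,1]\<^sup>2\<close>.
\<close>

section \<open>Gaussian variables and processes\<close>

text \<open>The weight of a cell depends on \<open>m\<close>, so \<open>W\<close> has no independent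
  increments in the direction of t; in the direction of s it has, which is why the maximal
  inequality runs over columns and treats all windows in \<open>m\<close> at once. In the direction
  of t second moments suffice, because up to a small remainder \<open>W\<close> is a sum over
  \<open>l < m\<close> of partial sums of the \<xi> and hence smooth like an integral. The obstacle
  is that the variance of these partial sums grows like \<open>1 / (n - l + 1)\<close> near t = 1;
  the weights absorb this. In the direction of s the process behaves like Brownian motion at time
  s^2: for K blocks, second moments would give K times 1/K, fourth moments give K times 1/K^2. The
  time s^2 appears because the variance of the logarithm of a variable \<open>r\<close> in column
  \<open>j\<close> is nearly proportional to \<open>j\<close>. The ratio (t - x) / (1 - x) is the
  factor \<open>m - r\<close> divided by the distance of the row from the end. Since the process is
  constant on the cells of a finite grid, it is Borel measurable as a map into l_infinity, and its
  outer expectations are ordinary integrals.\<close>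

lemma sets_std_normal [simp, measurable_cong]: "sets std_normal_distribution = sets borel"
  by simp

interpretation std_normal: prob_space std_normal_distribution
  by (rule prob_space_normal_density) simp

text \<open>Affine images of the standard normal law include the point masses
  (\<open>\<sigma> = 0\<close>), so that moments and characteristic functions need no case
  distinction later.\<close>

lemma distr_std_normal_affine:
  assumes "\<sigma> \<ge> 0"
  shows "distr std_normal_distribution borel (\<lambda>z. \<mu> + \<sigma> * z) =
    (if \<sigma> = 0 then return borel \<mu> else density lborel (normal_density \<mu> \<sigma>))"
proof (cases "\<sigma> = 0")
  case True
  have "distr std_normal_distribution borel (\<lambda>z. \<mu>) = return borel \<mu>"
    by (rule std_normal.distr_const) simp
  then show ?thesis using True by simp
next
  case False
  then have \<sigma>: "\<sigma> > 0" using assms by simp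
  have "distributed std_normal_distribution lborel (\<lambda>x. x) std_normal_density"
    by (auto simp: distributed_def intro!: distr_id2)
  from std_normal.normal_density_affine[OF this, of \<sigma> \<mu>] \<sigma>
  have "distributed std_normal_distribution lborel (\<lambda>x. \<mu> + \<sigma> * x) (normal_density \<mu> \<sigma>)"
    by simp
  then have "distr std_normal_distribution lborel (\<lambda>z. \<mu> + \<sigma> * z) = density lborel (normal_density \<mu> \<sigma>)"
    by (simp add: distributed_def)
  moreover have "distr std_normal_distribution lborel (\<lambda>z. \<mu> + \<sigma> * z) = distr std_normal_distribution borel (\<lambda>z. \<mu> + \<sigma> * z)"
    by (rule distr_cong) auto
  ultimately show ?thesis using False by simp
qed

lemma gaussian_rv_iff:
  "gaussian_rv M X \<longleftrightarrow> X \<in> borel_measurable M \<and>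
     (\<exists>\<mu> \<sigma>. \<sigma> \<ge> 0 \<and> distr M borel X = distr std_normal_distribution borel (\<lambda>z. \<mu> + \<sigma> * z))"
  unfolding gaussian_rv_def using distr_std_normal_affine by metis

lemma integrable_std_normal_power: "integrable std_normal_distribution (\<lambda>z. z ^ k)"
  by (rule integrable_std_normal_distribution_moment)

lemma std_normal_moment_1: "(\<integral>z. z \<partial>std_normal_distribution) = 0"
  using integral_std_normal_distribution_moment_odd[of 1] by simp

lemma std_normal_moment_2: "(\<integral>z. z\<^sup>2 \<partial>std_normal_distribution) = 1"
  using std_normal_distribution_even_moments[of 1] by (simp add: numeral_eq_Suc)

lemma integral_via_normal:
  fixes f :: "real \<Rightarrow> 'c::{banach, second_countable_topology}"
  assumes X: "X \<in> borel_measurable M" and f: "f \<in> borel_measurable borel"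
    and d: "distr M borel X = distr std_normal_distribution borel (\<lambda>z. \<mu> + \<sigma> * z)"
  shows "(\<integral>\<omega>. f (X \<omega>) \<partial>M) = (\<integral>z. f (\<mu> + \<sigma> * z) \<partial>std_normal_distribution)"
    and "integrable M (\<lambda>\<omega>. f (X \<omega>)) \<longleftrightarrow> integrable std_normal_distribution (\<lambda>z. f (\<mu> + \<sigma> * z))"
proof -
  have "(\<integral>\<omega>. f (X \<omega>) \<partial>M) = (\<integral>x. f x \<partial>distr M borel X)"
    using X f by (simp add: integral_distr)
  also have "\<dots> = (\<integral>z. f (\<mu> + \<sigma> * z) \<partial>std_normal_distribution)"
    unfolding d using f by (subst integral_distr) auto
  finally show "(\<integral>\<omega>. f (X \<omega>) \<partial>M) = (\<integral>z. f (\<mu> + \<sigma> * z) \<partial>std_normal_distribution)" .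
  have "integrable M (\<lambda>\<omega>. f (X \<omega>)) \<longleftrightarrow> integrable (distr M borel X) f"
    using X f by (simp add: integrable_distr_eq)
  also have "\<dots> \<longleftrightarrow> integrable std_normal_distribution (\<lambda>z. f (\<mu> + \<sigma> * z))"
    unfolding d using f by (subst integrable_distr_eq) auto
  finally show "integrable M (\<lambda>\<omega>. f (X \<omega>)) \<longleftrightarrow> integrable std_normal_distribution (\<lambda>z. f (\<mu> + \<sigma> * z))" .
qed

lemma std_normal_iexp:
  "(\<integral>z. iexp (t * (\<mu> + \<sigma> * z)) \<partial>std_normal_distribution) = iexp (t * \<mu>) * exp (- (t\<^sup>2 * \<sigma>\<^sup>2) / 2)"
proof -
  have "(\<integral>z. iexp (t * (\<mu> + \<sigma> * z)) \<partial>std_normal_distribution)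
      = (\<integral>z. iexp (t * \<mu>) * iexp ((t * \<sigma>) * z) \<partial>std_normal_distribution)"
    by (intro Bochner_Integration.integral_cong refl)
      (simp add: exp_add[symmetric] algebra_simps)
  also have "\<dots> = iexp (t * \<mu>) * char std_normal_distribution (t * \<sigma>)"
    by (simp add: char_def)
  finally show ?thesis by (simp add: char_std_normal_distribution power_mult_distrib)
qed

lemma (in prob_space) gaussian_rv_facts:
  assumes "gaussian_rv M X"
  shows "integrable M (\<lambda>\<omega>. X \<omega> ^ k)"
    and "(\<integral>\<omega>. iexp (t * X \<omega>) \<partial>M) = iexp (t * expectation X) * exp (- (t\<^sup>2 * variance X) / 2)"
proof -
  obtain \<mu> \<sigma> where X: "X \<in> borel_measurable M" and "\<sigma> \<ge> 0"
    and d: "distr M borel X = distr std_normal_distribution borel (\<lambda>z. \<mu> + \<sigma> * z)"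
    using assms unfolding gaussian_rv_iff by blast
  have int: "integrable std_normal_distribution (\<lambda>z. (\<mu> + \<sigma> * z) ^ k)" for k
    unfolding binomial_ring power_mult_distrib
    by (intro Bochner_Integration.integrable_sum integrable_mult_right integrable_std_normal_power)
  show "integrable M (\<lambda>\<omega>. X \<omega> ^ k)"
    using integral_via_normal(2)[OF X _ d, of "\<lambda>x. x ^ k"] int by simp
  have z1: "integrable std_normal_distribution (\<lambda>z. z)"
    using integrable_std_normal_power[of 1] by simp
  have E: "expectation X = \<mu>"
  proof -
    have "expectation X = (\<integral>z. \<mu> + \<sigma> * z \<partial>std_normal_distribution)"
      using integral_via_normal(1)[OF X _ d, of "\<lambda>x. x"] by simp
    also have "\<dots> = (\<integral>z. \<mu> \<partial>std_normal_distribution) + (\<integral>z. \<sigma> * z \<partial>std_normal_distribution)"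
      by (intro Bochner_Integration.integral_add integrable_mult_right z1 std_normal.integrable_const)
    also have "\<dots> = \<mu>"
      using std_normal_moment_1 std_normal.prob_space
      by (simp only: integral_mult_right_zero lebesgue_integral_const) simp
    finally show ?thesis .
  qed
  have "variance X = (\<integral>z. (\<sigma> * z)\<^sup>2 \<partial>std_normal_distribution)"
    using integral_via_normal(1)[OF X _ d, of "\<lambda>x. (x - \<mu>)\<^sup>2"] by (simp add: E)
  also have "\<dots> = \<sigma>\<^sup>2" by (simp add: power_mult_distrib std_normal_moment_2)
  finally have V: "variance X = \<sigma>\<^sup>2" .
  show "(\<integral>\<omega>. iexp (t * X \<omega>) \<partial>M) = iexp (t * expectation X) * exp (- (t\<^sup>2 * variance X) / 2)"
    using integral_via_normal(1)[OF X _ d, of "\<lambda>x. iexp (t * x)"] std_normal_iexp[of t \<mu> \<sigma>]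
    unfolding V unfolding E by simp
qed

text \<open>Levy's uniqueness theorem identifies the law with that of \<open>sqrt v\<close> times a
  standard normal variable, \<open>v = 0\<close> included, and the moments are read off
  there.\<close>

lemma (in prob_space) gaussian_rvI_char:
  assumes X: "X \<in> borel_measurable M" and "v \<ge> 0"
    and char: "\<And>t. (\<integral>\<omega>. iexp (t * X \<omega>) \<partial>M) = exp (- (t\<^sup>2 * v) / 2)"
  shows "gaussian_rv M X" and "expectation X = 0"
    and "expectation (\<lambda>\<omega>. (X \<omega>)\<^sup>2) = v"
proof -
  have d: "distr M borel X = distr std_normal_distribution borel (\<lambda>z. 0 + sqrt v * z)"
  proof (rule Levy_uniqueness)
    show "real_distribution (distr M borel X)" using X by (rule real_distribution_distr)
    show "real_distribution (distr std_normal_distribution borel (\<lambda>z. 0 + sqrt v * z))"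
      by (rule std_normal.real_distribution_distr) simp
    show "char (distr M borel X) = char (distr std_normal_distribution borel (\<lambda>z. 0 + sqrt v * z))"
    proof
      fix t
      show "char (distr M borel X) t = char (distr std_normal_distribution borel (\<lambda>z. 0 + sqrt v * z)) t"
        unfolding char_def using X char[of t] std_normal_iexp[of t 0 "sqrt v"] \<open>v \<ge> 0\<close>
        by (simp add: integral_distr)
    qed
  qed
  show "gaussian_rv M X" unfolding gaussian_rv_iff using X d \<open>v \<ge> 0\<close>
    by (intro conjI exI[of _ 0] exI[of _ "sqrt v"]) auto
  show "expectation X = 0"
    using integral_via_normal(1)[OF X _ d, of "\<lambda>x. x"] std_normal_moment_1 by simp
  show "expectation (\<lambda>\<omega>. (X \<omega>)\<^sup>2) = v"
    using integral_via_normal(1)[OF X _ d, of "\<lambda>x. x\<^sup>2"] std_normal_moment_2 \<open>v \<ge> 0\<close>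
    by (simp add: power_mult_distrib)
qed

lemma (in prob_space) square_integrable_mult:
  fixes X Y :: "'a \<Rightarrow> real"
  assumes [measurable]: "X \<in> borel_measurable M" "Y \<in> borel_measurable M"
    and "integrable M (\<lambda>\<omega>. (X \<omega>)\<^sup>2)" "integrable M (\<lambda>\<omega>. (Y \<omega>)\<^sup>2)"
  shows "integrable M (\<lambda>\<omega>. X \<omega> * Y \<omega>)"
proof (rule Bochner_Integration.integrable_bound)
  show "integrable M (\<lambda>\<omega>. (X \<omega>)\<^sup>2 + (Y \<omega>)\<^sup>2)" using assms by simp
  show "AE \<omega> in M. norm (X \<omega> * Y \<omega>) \<le> norm ((X \<omega>)\<^sup>2 + (Y \<omega>)\<^sup>2)"
  proof (rule AE_I2)
    fix \<omega>
    have "2 * (\<bar>X \<omega>\<bar> * \<bar>Y \<omega>\<bar>) \<le> (X \<omega>)\<^sup>2 + (Y \<omega>)\<^sup>2"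
      using sum_squares_bound[of "\<bar>X \<omega>\<bar>" "\<bar>Y \<omega>\<bar>"] by (simp add: mult.assoc)
    moreover have "0 \<le> \<bar>X \<omega>\<bar> * \<bar>Y \<omega>\<bar>" by (intro mult_nonneg_nonneg) auto
    ultimately have "\<bar>X \<omega>\<bar> * \<bar>Y \<omega>\<bar> \<le> (X \<omega>)\<^sup>2 + (Y \<omega>)\<^sup>2" by linarith
    then show "norm (X \<omega> * Y \<omega>) \<le> norm ((X \<omega>)\<^sup>2 + (Y \<omega>)\<^sup>2)" by (simp add: abs_mult)
  qed
qed simp

lemma square_sum: "(\<Sum>i\<in>A. f i)\<^sup>2 = (\<Sum>i\<in>A. \<Sum>j\<in>A. f i * (f j :: real))"
  by (simp add: power2_eq_square sum_product)

lemma (in prob_space) expectation_square_sum: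
  fixes X :: "'i \<Rightarrow> 'a \<Rightarrow> real"
  assumes "finite A" "\<And>i. i \<in> A \<Longrightarrow> X i \<in> borel_measurable M"
    and "\<And>i. i \<in> A \<Longrightarrow> integrable M (\<lambda>\<omega>. (X i \<omega>)\<^sup>2)"
  shows "expectation (\<lambda>\<omega>. (\<Sum>i\<in>A. u i * X i \<omega>)\<^sup>2) =
      (\<Sum>i\<in>A. \<Sum>j\<in>A. u i * u j * expectation (\<lambda>\<omega>. X i \<omega> * X j \<omega>))"
    and "integrable M (\<lambda>\<omega>. (\<Sum>i\<in>A. u i * X i \<omega>)\<^sup>2)"
proof -
  have int: "integrable M (\<lambda>\<omega>. u i * X i \<omega> * (u j * X j \<omega>))" if "i \<in> A" "j \<in> A" for i j
  proof -
    have "integrable M (\<lambda>\<omega>. u i * u j * (X i \<omega> * X j \<omega>))"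
      using that assms by (intro integrable_mult_right square_integrable_mult) auto
    then show ?thesis by (simp add: mult_ac)
  qed
  show "integrable M (\<lambda>\<omega>. (\<Sum>i\<in>A. u i * X i \<omega>)\<^sup>2)"
    unfolding square_sum by (intro Bochner_Integration.integrable_sum int)
  have "expectation (\<lambda>\<omega>. (\<Sum>i\<in>A. u i * X i \<omega>)\<^sup>2) =
     (\<Sum>i\<in>A. \<Sum>j\<in>A. expectation (\<lambda>\<omega>. u i * X i \<omega> * (u j * X j \<omega>)))"
    unfolding square_sum
    by (subst Bochner_Integration.integral_sum, intro Bochner_Integration.integrable_sum int; simp?)
       (intro sum.cong refl Bochner_Integration.integral_sum int, auto)
  also have "\<dots> = (\<Sum>i\<in>A. \<Sum>j\<in>A. expectation (\<lambda>\<omega>. (u i * u j) * (X i \<omega> * X j \<omega>)))"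
    by (simp add: mult_ac)
  finally show "expectation (\<lambda>\<omega>. (\<Sum>i\<in>A. u i * X i \<omega>)\<^sup>2) =
      (\<Sum>i\<in>A. \<Sum>j\<in>A. u i * u j * expectation (\<lambda>\<omega>. X i \<omega> * X j \<omega>))" by simp
qed

text \<open>Together with the continuity of the paths, this is all that the convergence proof uses
  about the limit; the kernel alone determines the joint characteristic functions. Hence every
  version of the limit, on any probability space, will do.\<close>

lemma centered_gaussian_process_facts:
  assumes G: "centered_continuous_gaussian_process N T K G"
  shows "\<And>t. t \<in> T \<Longrightarrow> (\<lambda>\<omega>. G \<omega> t) \<in> borel_measurable N"
    and "\<And>t. t \<in> T \<Longrightarrow> integrable N (\<lambda>\<omega>. (G \<omega> t)\<^sup>2)"
    and "\<And>J u. finite J \<Longrightarrow> J \<subseteq> T \<Longrightarrow> (\<integral>\<omega>. iexp (\<Sum>t\<in>J. u t * G \<omega> t) \<partial>N) =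
      exp (- (\<Sum>s\<in>J. \<Sum>t\<in>J. u s * u t * K s t) / 2)"
proof -
  interpret prob_space N using G by (simp add: centered_continuous_gaussian_process_def)
  have gp: "gaussian_rv N (\<lambda>\<omega>. \<Sum>t\<in>J. a t * G \<omega> t)" if "finite J" "J \<subseteq> T" for J a
    using G that by (auto simp: centered_continuous_gaussian_process_def gaussian_process_def)
  have rv: "gaussian_rv N (\<lambda>\<omega>. G \<omega> t)" if "t \<in> T" for t
    using gp[of "{t}" "\<lambda>_. 1"] that by simp
  show meas: "(\<lambda>\<omega>. G \<omega> t) \<in> borel_measurable N" if "t \<in> T" for t
    using rv[OF that] by (simp add: gaussian_rv_def)
  show sq: "integrable N (\<lambda>\<omega>. (G \<omega> t)\<^sup>2)" if "t \<in> T" for t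
    using gaussian_rv_facts(1)[OF rv[OF that]] by simp
  have int: "integrable N (\<lambda>\<omega>. G \<omega> t)" if "t \<in> T" for t
    using gaussian_rv_facts(1)[OF rv[OF that], of 1] by simp
  have E0: "expectation (\<lambda>\<omega>. G \<omega> t) = 0" if "t \<in> T" for t
    using G that by (auto simp: centered_continuous_gaussian_process_def)
  have cv: "expectation (\<lambda>\<omega>. G \<omega> s * G \<omega> t) = K s t" if "s \<in> T" "t \<in> T" for s t
    using G that by (auto simp: centered_continuous_gaussian_process_def cov_def E0)
  show "(\<integral>\<omega>. iexp (\<Sum>t\<in>J. u t * G \<omega> t) \<partial>N) =
      exp (- (\<Sum>s\<in>J. \<Sum>t\<in>J. u s * u t * K s t) / 2)" if J: "finite J" "J \<subseteq> T" for J u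
  proof -
    have E: "expectation (\<lambda>\<omega>. \<Sum>t\<in>J. u t * G \<omega> t) = 0"
      using J int E0 by (subst Bochner_Integration.integral_sum) (auto intro!: sum.neutral)
    have V: "variance (\<lambda>\<omega>. \<Sum>t\<in>J. u t * G \<omega> t) = (\<Sum>s\<in>J. \<Sum>t\<in>J. u s * u t * K s t)"
      unfolding E using J meas sq cv
      by (simp add: expectation_square_sum subset_iff)
    show ?thesis
      using gaussian_rv_facts(2)[OF gp[OF J, of u], of 1] V[unfolded E diff_0_right]
      unfolding E by (simp only: diff_0_right) simp
  qed
qed

section \<open>Convergence of finite-dimensional distributions\<close>

text \<open>A cosine with a phase covers sine and cosine of linear forms, and products of cosines
  are sums of cosines, so this class is an algebra. Integrals of its members are governed by joint
  characteristic functions, and Stone-Weierstrass leads from it to Lipschitz functions.\<close>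

inductive trig_poly :: "nat \<Rightarrow> ((nat \<Rightarrow> real) \<Rightarrow> real) \<Rightarrow> bool" for d where
  trig_poly_cos: "trig_poly d (\<lambda>x. k * cos ((\<Sum>i<d. u i * x i) + b))"
| trig_poly_add: "trig_poly d f \<Longrightarrow> trig_poly d g \<Longrightarrow> trig_poly d (\<lambda>x. f x + g x)"

lemma trig_poly_const: "trig_poly d (\<lambda>_. k)"
  using trig_poly_cos[of d k "\<lambda>_. 0" 0] by simp

lemma trig_poly_sin:
  assumes "i < d" shows "trig_poly d (\<lambda>x. sin (x i / l))"
proof -
  have "(\<lambda>x. 1 * cos ((\<Sum>j<d. (if j = i then - 1 / l else 0) * x j) + pi / 2)) = (\<lambda>x. sin (x i / l))"
  proof
    fix x :: "nat \<Rightarrow> real"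
    have "(\<Sum>j<d. (if j = i then - 1 / l else 0) * x j) = (\<Sum>j<d. if j = i then - x j / l else 0)"
      by (intro sum.cong) auto
    also have "\<dots> = - x i / l" using assms by simp
    finally show "1 * cos ((\<Sum>j<d. (if j = i then - 1 / l else 0) * x j) + pi / 2) = sin (x i / l)"
      by (simp add: sin_cos_eq algebra_simps)
  qed
  then show ?thesis using trig_poly_cos[of d 1 "\<lambda>j. if j = i then - 1 / l else 0" "pi / 2"] by simp
qed

lemma trig_poly_mult:
  assumes "trig_poly d f" "trig_poly d g"
  shows "trig_poly d (\<lambda>x. f x * g x)"
  using assms(1)
proof induction
  case (trig_poly_cos k u b)
  show ?case using assms(2)
  proof induction
    case (trig_poly_cos k' u' b')
    have "(\<lambda>x. k * cos ((\<Sum>i<d. u i * x i) + b) * (k' * cos ((\<Sum>i<d. u' i * x i) + b')))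
      = (\<lambda>x. (k * k' / 2) * cos ((\<Sum>i<d. (u i - u' i) * x i) + (b - b'))
           + (k * k' / 2) * cos ((\<Sum>i<d. (u i + u' i) * x i) + (b + b')))"
    proof
      fix x :: "nat \<Rightarrow> real"
      have e: "(\<Sum>i<d. (u i - u' i) * x i) + (b - b') = ((\<Sum>i<d. u i * x i) + b) - ((\<Sum>i<d. u' i * x i) + b')"
        "(\<Sum>i<d. (u i + u' i) * x i) + (b + b') = ((\<Sum>i<d. u i * x i) + b) + ((\<Sum>i<d. u' i * x i) + b')"
        by (simp_all add: algebra_simps sum.distrib sum_subtractf)
      have prod: "k * cos A * (k' * cos B) = (k * k' / 2) * cos (A - B) + (k * k' / 2) * cos (A + B)" for A B
        by (simp add: cos_add cos_diff algebra_simps)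
      show "k * cos ((\<Sum>i<d. u i * x i) + b) * (k' * cos ((\<Sum>i<d. u' i * x i) + b'))
        = (k * k' / 2) * cos ((\<Sum>i<d. (u i - u' i) * x i) + (b - b'))
           + (k * k' / 2) * cos ((\<Sum>i<d. (u i + u' i) * x i) + (b + b'))"
        unfolding e by (rule prod)
    qed
    then show ?case by (simp only:) (intro trig_poly.intros)
  next
    case (trig_poly_add f g)
    then show ?case using trig_poly.trig_poly_add by (fastforce simp: distrib_left)
  qed
next
  case (trig_poly_add f1 f2)
  then show ?case using trig_poly.trig_poly_add by (fastforce simp: distrib_right)
qed

lemma trig_poly_facts:
  assumes "trig_poly d f"
  shows "\<exists>B. \<forall>x. \<bar>f x\<bar> \<le> B"
    and "\<And>M X. (\<And>i. i < d \<Longrightarrow> (\<lambda>\<omega>. X \<omega> i) \<in> borel_measurable M) \<Longrightarrow> (\<lambda>\<omega>. f (X \<omega>)) \<in> borel_measurable M"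
  using assms
proof induction
  case (trig_poly_cos k u b)
  { case 1
    have "\<bar>k * cos y\<bar> \<le> \<bar>k\<bar>" for y by (simp add: abs_mult mult_left_le)
    then show ?case by blast }
  { case (2 X M) then show ?case by (intro measurable) auto }
next
  case (trig_poly_add f g)
  { case 1
    obtain B1 B2 where "\<forall>x. \<bar>f x\<bar> \<le> B1" "\<forall>x. \<bar>g x\<bar> \<le> B2" using trig_poly_add by blast
    then have "\<forall>x. \<bar>f x + g x\<bar> \<le> B1 + B2" by (meson abs_triangle_ineq add_mono order_trans)
    then show ?case by blast }
  { case (2 X M) then show ?case using trig_poly_add by (intro borel_measurable_add) auto }
qed

lemma trig_poly_integrable:
  assumes "trig_poly d f" "prob_space M" "\<And>i. i < d \<Longrightarrow> (\<lambda>\<omega>. X \<omega> i) \<in> borel_measurable M"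
  shows "integrable M (\<lambda>\<omega>. f (X \<omega>))"
proof -
  interpret prob_space M by fact
  obtain B where "\<forall>x. \<bar>f x\<bar> \<le> B" using trig_poly_facts(1)[OF assms(1)] by blast
  then show ?thesis using trig_poly_facts(2)[OF assms(1), of X M] assms(3)
    by (intro integrable_const_bound[of _ B]) auto
qed

lemma trig_poly_convergence:
  fixes X :: "nat \<Rightarrow> 'a \<Rightarrow> nat \<Rightarrow> real" and Y :: "'b \<Rightarrow> nat \<Rightarrow> real"
  assumes f: "trig_poly d f"
    and M: "\<And>n. prob_space (M n)" "prob_space N"
    and X: "\<And>n i. i < d \<Longrightarrow> (\<lambda>\<omega>. X n \<omega> i) \<in> borel_measurable (M n)"
    and Y: "\<And>i. i < d \<Longrightarrow> (\<lambda>\<omega>. Y \<omega> i) \<in> borel_measurable N"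
    and conv: "\<And>u. (\<lambda>n. \<integral>\<omega>. iexp (\<Sum>i<d. u i * X n \<omega> i) \<partial>M n) \<longlonglongrightarrow> (\<integral>\<omega>. iexp (\<Sum>i<d. u i * Y \<omega> i) \<partial>N)"
  shows "(\<lambda>n. \<integral>\<omega>. f (X n \<omega>) \<partial>M n) \<longlonglongrightarrow> (\<integral>\<omega>. f (Y \<omega>) \<partial>N)"
  using f
proof induction
  case (trig_poly_cos k u b)
  \<comment> \<open>The phase \<open>b\<close> becomes a rotation of the characteristic function, of
    which the real part is taken.\<close>
  have eq: "(\<integral>\<omega>. k * cos ((\<Sum>i<d. u i * Z \<omega> i) + b) \<partial>Q) = k * Re (iexp b * (\<integral>\<omega>. iexp (\<Sum>i<d. u i * Z \<omega> i) \<partial>Q))"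
    if "prob_space Q" "\<And>i. i < d \<Longrightarrow> (\<lambda>\<omega>. Z \<omega> i) \<in> borel_measurable Q" for Q :: "'x measure" and Z
  proof -
    interpret prob_space Q by fact
    have m: "(\<lambda>\<omega>. \<Sum>i<d. u i * Z \<omega> i) \<in> borel_measurable Q"
      using that(2) by (intro borel_measurable_sum borel_measurable_times) auto
    have i: "integrable Q (\<lambda>\<omega>. iexp (\<Sum>i<d. u i * Z \<omega> i))"
      using measurable_compose[OF m borel_measurable_of_real] by (intro integrable_iexp) (simp_all only: Im_complex_of_real)
    have "Re (iexp b * (\<integral>\<omega>. iexp (\<Sum>i<d. u i * Z \<omega> i) \<partial>Q)) = Re (\<integral>\<omega>. iexp b * iexp (\<Sum>i<d. u i * Z \<omega> i) \<partial>Q)"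
      by simp
    also have "\<dots> = (\<integral>\<omega>. Re (iexp b * iexp (\<Sum>i<d. u i * Z \<omega> i)) \<partial>Q)"
      using i by (intro integral_Re[symmetric] integrable_mult_right) auto
    also have "\<dots> = (\<integral>\<omega>. cos ((\<Sum>i<d. u i * Z \<omega> i) + b) \<partial>Q)"
      by (intro Bochner_Integration.integral_cong refl)
        (simp only: exp_add[symmetric] distrib_left[symmetric] of_real_add[symmetric] Re_exp add.commute, simp)
    finally show ?thesis by simp
  qed
  have eX: "(\<integral>\<omega>. k * cos ((\<Sum>i<d. u i * X n \<omega> i) + b) \<partial>M n) = k * Re (iexp b * (\<integral>\<omega>. iexp (\<Sum>i<d. u i * X n \<omega> i) \<partial>M n))" for n
    by (intro eq M X)
  have eY: "(\<integral>\<omega>. k * cos ((\<Sum>i<d. u i * Y \<omega> i) + b) \<partial>N) = k * Re (iexp b * (\<integral>\<omega>. iexp (\<Sum>i<d. u i * Y \<omega> i) \<partial>N))"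
    by (intro eq M Y)
  show ?case unfolding eX eY by (intro tendsto_intros conv)
next
  case (trig_poly_add f g)
  have "(\<integral>\<omega>. f (Z \<omega>) + g (Z \<omega>) \<partial>Q) = (\<integral>\<omega>. f (Z \<omega>) \<partial>Q) + (\<integral>\<omega>. g (Z \<omega>) \<partial>Q)"
    if "prob_space Q" "\<And>i. i < d \<Longrightarrow> (\<lambda>\<omega>. Z \<omega> i) \<in> borel_measurable Q" for Q :: "'x measure" and Z
    using trig_poly_add(1,2) that by (intro Bochner_Integration.integral_add trig_poly_integrable) auto
  then have eX: "(\<integral>\<omega>. f (X n \<omega>) + g (X n \<omega>) \<partial>M n) = (\<integral>\<omega>. f (X n \<omega>) \<partial>M n) + (\<integral>\<omega>. g (X n \<omega>) \<partial>M n)"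
    and eY: "(\<integral>\<omega>. f (Y \<omega>) + g (Y \<omega>) \<partial>N) = (\<integral>\<omega>. f (Y \<omega>) \<partial>N) + (\<integral>\<omega>. g (Y \<omega>) \<partial>N)" for n
    using M X Y by blast+
  show ?case unfolding eX eY by (rule tendsto_add[OF trig_poly_add.IH])
qed

text \<open>The error is cubic near 0, but a quadratic bound valid on the whole line is what second
  moments can control.\<close>

lemma abs_diff_sin_le: "\<bar>x - sin x\<bar> \<le> x\<^sup>2 / 2" for x :: real
proof -
  have pos: "\<bar>x - sin x\<bar> \<le> x\<^sup>2 / 2" if "x \<ge> 0" for x :: real
  proof -
    have c1: "1 - cos y \<le> y" if "y \<ge> 0" for y :: real
    proof -
      have "(\<lambda>y. y + cos y) 0 \<le> (\<lambda>y. y + cos y) y" using that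
      proof (rule DERIV_nonneg_imp_nondecreasing)
        show "\<exists>D. ((\<lambda>y. y + cos y) has_real_derivative D) (at z) \<and> 0 \<le> D" for z :: real
          by (rule exI[of _ "1 - sin z"]) (auto intro!: derivative_eq_intros)
      qed
      then show ?thesis by simp
    qed
    have "(\<lambda>y. y\<^sup>2 / 2 - (y - sin y)) 0 \<le> (\<lambda>y. y\<^sup>2 / 2 - (y - sin y)) x"
      using that
    proof (rule DERIV_nonneg_imp_nondecreasing)
      show "\<exists>D. ((\<lambda>y. y\<^sup>2 / 2 - (y - sin y)) has_real_derivative D) (at z) \<and> 0 \<le> D" if "0 \<le> z" for z :: real
        using c1[OF that] by (intro exI[of _ "z - (1 - cos z)"]) (auto intro!: derivative_eq_intros)
    qed
    moreover have "sin x \<le> x" using that by (rule sin_x_le_x)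
    ultimately show ?thesis by simp
  qed
  show ?thesis
  proof (cases "x \<ge> 0")
    case False
    then show ?thesis using pos[of "- x"] abs_minus_commute[of x "sin x"] by simp
  qed (rule pos)
qed

lemma continuous_on_coordinate: "continuous_on S (\<lambda>x :: nat \<Rightarrow> real. x i)"
  by (rule continuous_on_subset[OF continuous_on_product_coordinates subset_UNIV])

lemma continuous_on_lipschitz_coords:
  fixes g :: "(nat \<Rightarrow> real) \<Rightarrow> real"
  assumes "\<And>x y. \<bar>g x - g y\<bar> \<le> L * (\<Sum>i<d. \<bar>x i - y i\<bar>)"
  shows "continuous_on S g"
  unfolding continuous_on_def
proof
  fix x assume "x \<in> S"
  have k: "((\<lambda>y. y i) \<longlongrightarrow> x i) (at x within S)" for i
    using continuous_on_subset[OF continuous_on_product_coordinates subset_UNIV, of S i] \<open>x \<in> S\<close>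
    by (auto simp: continuous_on_def)
  have "((\<lambda>y. L * (\<Sum>i<d. \<bar>y i - x i\<bar>)) \<longlongrightarrow> L * (\<Sum>i<d. \<bar>x i - x i\<bar>)) (at x within S)"
    by (intro tendsto_intros k)
  then have "((\<lambda>y. L * (\<Sum>i<d. \<bar>y i - x i\<bar>)) \<longlongrightarrow> 0) (at x within S)" by simp
  then have "((\<lambda>y. g y - g x) \<longlongrightarrow> 0) (at x within S)"
    by (rule Lim_null_comparison[rotated]) (use assms in auto)
  then show "(g \<longlongrightarrow> g x) (at x within S)" by (rule LIM_zero_cancel)
qed

text \<open>The Lipschitz bound makes \<open>g\<close> blind to the coordinates from
  \<open>d\<close> on, so these can be set to 0, and measurability is asked of the first
  \<open>d\<close> coordinates only.\<close>

lemma lipschitz_coords_measurable: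
  fixes g :: "(nat \<Rightarrow> real) \<Rightarrow> real"
  assumes "\<And>x y. \<bar>g x - g y\<bar> \<le> L * (\<Sum>i<d. \<bar>x i - y i\<bar>)"
    and X: "\<And>i. i < d \<Longrightarrow> (\<lambda>\<omega>. X \<omega> i) \<in> borel_measurable M"
  shows "(\<lambda>\<omega>. g (X \<omega>)) \<in> borel_measurable M"
proof -
  have g: "g \<in> borel_measurable borel"
    using continuous_on_lipschitz_coords[OF assms(1)] by (intro borel_measurable_continuous_onI)
  have "g (X \<omega>) = g (\<lambda>i. if i < d then X \<omega> i else 0)" for \<omega>
    using assms(1)[of "X \<omega>" "\<lambda>i. if i < d then X \<omega> i else 0"] by simp
  moreover have "(\<lambda>\<omega> i. if i < d then X \<omega> i else 0) \<in> borel_measurable M"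
  proof (rule measurable_coordinatewise_then_product)
    show "(\<lambda>\<omega>. if i < d then X \<omega> i else 0) \<in> borel_measurable M" for i
      using X[of i] by (cases "i < d") auto
  qed
  ultimately show ?thesis using measurable_compose[OF _ g] by simp
qed

text \<open>The map \<open>x \<mapsto> l sin (x / l)\<close> sends every coordinate to a compact interval, where the
  Stone-Weierstrass theorem applies, and moves \<open>x\<close> by at most \<open>x\<^sup>2 / (2 l)\<close>.\<close>

lemma trig_poly_approximation:
  fixes g :: "(nat \<Rightarrow> real) \<Rightarrow> real"
  assumes lip: "\<And>x y. \<bar>g x - g y\<bar> \<le> L * (\<Sum>i<d. \<bar>x i - y i\<bar>)" and "e > 0" "l > 0" "L \<ge> 0"
  obtains q where "trig_poly d q" "\<And>x. \<bar>g x - q x\<bar> \<le> e + L / (2 * l) * (\<Sum>i<d. (x i)\<^sup>2)"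
proof -
  define S :: "(nat \<Rightarrow> real) set" where "S = PiE UNIV (\<lambda>i. if i < d then {-1..1} else {0})"
  define cut where "cut x = (\<lambda>i. if i < d then sin (x i / l) else 0)" for x :: "nat \<Rightarrow> real"
  \<comment> \<open>The continuous functions on the compact box \<open>S\<close> whose composition
    with \<open>cut\<close> is a trigonometric polynomial. They form a function ring, so the
    approximant found by Stone-Weierstrass has the desired form by construction.\<close>
  define R where "R = {h. continuous_on S h \<and> trig_poly d (\<lambda>x. h (cut x))}"
  have cutS: "cut x \<in> S" for x by (auto simp: S_def cut_def)
  interpret function_ring_on R S
  proof
    show "compact S" unfolding S_def
      using compactin_PiE[of "\<lambda>_. euclideanreal" UNIV "\<lambda>i. if i < d then {-1..1} else {0}"]
      by (simp add: euclidean_product_topology)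
    show "\<exists>f\<in>R. f x \<noteq> f y" if xy: "x \<in> S" "y \<in> S" "x \<noteq> y" for x y
    proof -
      obtain i where i: "x i \<noteq> y i" using xy by auto
      have "z i = 0" if "z \<in> S" "\<not> i < d" for z
        using that unfolding S_def PiE_iff by (metis UNIV_I singletonD)
      then have "i < d" using xy i by metis
      have "trig_poly d (\<lambda>x. cut x i)" using trig_poly_sin[OF \<open>i < d\<close>, of l] \<open>i < d\<close> by (simp add: cut_def)
      then have "(\<lambda>x. x i) \<in> R"
        unfolding R_def using continuous_on_coordinate by (intro CollectI conjI)
      then show ?thesis using i by (intro bexI[where x = "\<lambda>x. x i"])
    qed
  qed (auto simp: R_def intro: continuous_on_add continuous_on_mult trig_poly_add trig_poly_mult trig_poly_const)
  have "\<bar>g (\<lambda>i. l * x i) - g (\<lambda>i. l * y i)\<bar> \<le> (L * l) * (\<Sum>i<d. \<bar>x i - y i\<bar>)" for x y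
  proof -
    have "\<bar>l * x i - l * y i\<bar> = l * \<bar>x i - y i\<bar>" for i
      using \<open>l > 0\<close> by (simp add: abs_mult flip: right_diff_distrib)
    then show ?thesis using lip[of "\<lambda>i. l * x i" "\<lambda>i. l * y i"] by (simp add: sum_distrib_left mult_ac)
  qed
  then have "continuous_on S (\<lambda>y. g (\<lambda>i. l * y i))" by (rule continuous_on_lipschitz_coords)
  then obtain h where h: "h \<in> R" "\<forall>y\<in>S. \<bar>g (\<lambda>i. l * y i) - h y\<bar> < e"
    using Stone_Weierstrass_basic \<open>e > 0\<close> by blast
  have "\<bar>g x - h (cut x)\<bar> \<le> e + L / (2 * l) * (\<Sum>i<d. (x i)\<^sup>2)" for x
  proof -
    have k: "\<bar>x i - l * cut x i\<bar> \<le> (x i)\<^sup>2 / (2 * l)" if "i < d" for i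
    proof -
      have "\<bar>x i - l * cut x i\<bar> = l * \<bar>x i / l - sin (x i / l)\<bar>"
      proof -
        have "x i - l * cut x i = l * (x i / l - sin (x i / l))"
          using \<open>l > 0\<close> that by (simp add: cut_def right_diff_distrib)
        then show ?thesis using \<open>l > 0\<close> by (simp only: abs_mult abs_of_pos)
      qed
      also have "\<dots> \<le> l * ((x i / l)\<^sup>2 / 2)" using \<open>l > 0\<close> by (intro mult_left_mono abs_diff_sin_le) auto
      finally show ?thesis using \<open>l > 0\<close> by (simp add: power2_eq_square field_simps)
    qed
    have "\<bar>g x - g (\<lambda>i. l * cut x i)\<bar> \<le> L * (\<Sum>i<d. \<bar>x i - l * cut x i\<bar>)" by (rule lip)
    also have "\<dots> \<le> L * (\<Sum>i<d. (x i)\<^sup>2 / (2 * l))" using \<open>L \<ge> 0\<close> k by (intro mult_left_mono sum_mono) auto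
    finally have "\<bar>g x - g (\<lambda>i. l * cut x i)\<bar> \<le> L / (2 * l) * (\<Sum>i<d. (x i)\<^sup>2)"
      by (simp add: sum_divide_distrib[symmetric])
    moreover have "\<bar>g (\<lambda>i. l * cut x i) - h (cut x)\<bar> < e" using h cutS by blast
    ultimately show ?thesis by linarith
  qed
  then show ?thesis using that[of "\<lambda>x. h (cut x)"] h(1) by (auto simp: R_def)
qed

text \<open>Bounded second moments take the place of tightness: they make the cost of replacing
  \<open>g\<close> by a trigonometric polynomial uniform in \<open>n\<close>, and for the polynomial
  the characteristic functions suffice.\<close>

theorem fdd_convergence:
  fixes X :: "nat \<Rightarrow> 'a \<Rightarrow> nat \<Rightarrow> real" and Y :: "'b \<Rightarrow> nat \<Rightarrow> real"
  assumes M: "\<And>n. prob_space (M n)" "prob_space N"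
    and X: "\<And>n i. i < d \<Longrightarrow> (\<lambda>\<omega>. X n \<omega> i) \<in> borel_measurable (M n)"
    and Y: "\<And>i. i < d \<Longrightarrow> (\<lambda>\<omega>. Y \<omega> i) \<in> borel_measurable N"
    and conv: "\<And>u. (\<lambda>n. \<integral>\<omega>. iexp (\<Sum>i<d. u i * X n \<omega> i) \<partial>M n) \<longlonglongrightarrow> (\<integral>\<omega>. iexp (\<Sum>i<d. u i * Y \<omega> i) \<partial>N)"
    and X2: "\<forall>\<^sub>F n in sequentially. \<forall>i<d. integrable (M n) (\<lambda>\<omega>. (X n \<omega> i)\<^sup>2) \<and> (\<integral>\<omega>. (X n \<omega> i)\<^sup>2 \<partial>M n) \<le> K"
    and Y2: "\<And>i. i < d \<Longrightarrow> integrable N (\<lambda>\<omega>. (Y \<omega> i)\<^sup>2)"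
    and lip: "\<And>x y. \<bar>g x - g y\<bar> \<le> L * (\<Sum>i<d. \<bar>x i - y i\<bar>)"
    and bdd: "\<And>x. \<bar>g x\<bar> \<le> B"
  shows "(\<lambda>n. \<integral>\<omega>. g (X n \<omega>) \<partial>M n) \<longlonglongrightarrow> (\<integral>\<omega>. g (Y \<omega>) \<partial>N)"
proof (rule LIMSEQ_I)
  fix r :: real assume "r > 0"
  define L' where "L' = max L 0"
  have lip': "\<bar>g x - g y\<bar> \<le> L' * (\<Sum>i<d. \<bar>x i - y i\<bar>)" for x y
    using lip[of x y] by (rule order_trans) (auto simp: L'_def intro!: mult_right_mono sum_nonneg)
  \<comment> \<open>Replacing \<open>g\<close> costs \<open>2 * e\<close> on either side and the
    convergence for the polynomial another \<open>e\<close>: five sixths of \<open>r\<close> in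
    all.\<close>
  define e where "e = r / 6"
  have "e > 0" using \<open>r > 0\<close> by (simp add: e_def)
  define V where "V = \<bar>K\<bar> + (\<Sum>i<d. \<integral>\<omega>. (Y \<omega> i)\<^sup>2 \<partial>N)"
  have V0: "V \<ge> 0" "K \<le> V" unfolding V_def by (auto intro!: add_nonneg_nonneg sum_nonneg add_increasing2)
  have VY: "(\<integral>\<omega>. (Y \<omega> i)\<^sup>2 \<partial>N) \<le> V" if "i < d" for i
  proof -
    have "(\<integral>\<omega>. (Y \<omega> i)\<^sup>2 \<partial>N) \<le> (\<Sum>i<d. \<integral>\<omega>. (Y \<omega> i)\<^sup>2 \<partial>N)"
      using that by (intro member_le_sum) auto
    then show ?thesis by (simp add: V_def)
  qed
  define l where "l = L' * real d * V / e + 1"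
  have "l > 0" using \<open>e > 0\<close> V0 unfolding l_def L'_def by (intro add_nonneg_pos divide_nonneg_pos mult_nonneg_nonneg) auto
  obtain q where q: "trig_poly d q" and gq: "\<And>x. \<bar>g x - q x\<bar> \<le> e + L' / (2 * l) * (\<Sum>i<d. (x i)\<^sup>2)"
    using trig_poly_approximation[OF lip' \<open>e > 0\<close> \<open>l > 0\<close>] L'_def by auto
  have small: "L' / (2 * l) * (real d * V) \<le> e"
  proof -
    have "L' * real d * V \<le> e * l" using \<open>e > 0\<close> by (simp add: l_def field_simps)
    then have "L' * (real d * V) \<le> e * (2 * l)" using mult_pos_pos[OF \<open>e > 0\<close> \<open>l > 0\<close>] by (simp add: mult_ac)
    then show ?thesis using \<open>l > 0\<close> by (simp add: divide_le_eq)
  qed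
  have close: "\<bar>(\<integral>\<omega>. g (Z \<omega>) \<partial>Q) - (\<integral>\<omega>. q (Z \<omega>) \<partial>Q)\<bar> \<le> 2 * e"
    if Q: "prob_space Q" "\<And>i. i < d \<Longrightarrow> (\<lambda>\<omega>. Z \<omega> i) \<in> borel_measurable Q"
      "\<And>i. i < d \<Longrightarrow> integrable Q (\<lambda>\<omega>. (Z \<omega> i)\<^sup>2)" "\<And>i. i < d \<Longrightarrow> (\<integral>\<omega>. (Z \<omega> i)\<^sup>2 \<partial>Q) \<le> V"
    for Q :: "'x measure" and Z
  proof -
    interpret prob_space Q by fact
    have ig: "integrable Q (\<lambda>\<omega>. g (Z \<omega>))"
      using lipschitz_coords_measurable[OF lip Q(2)] bdd by (intro integrable_const_bound[of _ B]) auto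
    have iq: "integrable Q (\<lambda>\<omega>. q (Z \<omega>))" using trig_poly_integrable[OF q Q(1,2)] .
    have i2: "integrable Q (\<lambda>\<omega>. L' / (2 * l) * (\<Sum>i<d. (Z \<omega> i)\<^sup>2))"
      using Q(3) by (intro integrable_mult_right Bochner_Integration.integrable_sum) auto
    have "\<bar>(\<integral>\<omega>. g (Z \<omega>) \<partial>Q) - (\<integral>\<omega>. q (Z \<omega>) \<partial>Q)\<bar> = \<bar>\<integral>\<omega>. g (Z \<omega>) - q (Z \<omega>) \<partial>Q\<bar>"
      using ig iq by simp
    also have "\<dots> \<le> (\<integral>\<omega>. \<bar>g (Z \<omega>) - q (Z \<omega>)\<bar> \<partial>Q)" by (rule integral_abs_bound)
    also have "\<dots> \<le> (\<integral>\<omega>. e + L' / (2 * l) * (\<Sum>i<d. (Z \<omega> i)\<^sup>2) \<partial>Q)"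
      using ig iq gq i2 by (intro integral_mono integrable_abs Bochner_Integration.integrable_diff
        Bochner_Integration.integrable_add integrable_const)
    also have "\<dots> = e + L' / (2 * l) * (\<Sum>i<d. \<integral>\<omega>. (Z \<omega> i)\<^sup>2 \<partial>Q)"
      using Q(3) i2 by (subst Bochner_Integration.integral_add) (simp_all add: Bochner_Integration.integral_sum prob_space)
    also have "\<dots> \<le> e + L' / (2 * l) * (real d * V)"
    proof -
      have "(\<Sum>i<d. \<integral>\<omega>. (Z \<omega> i)\<^sup>2 \<partial>Q) \<le> (\<Sum>i<d. V)" by (intro sum_mono Q(4)) auto
      then show ?thesis using \<open>l > 0\<close> L'_def by (intro add_left_mono mult_left_mono) auto
    qed
    finally show ?thesis using small by linarith
  qed
  have gqY: "\<bar>(\<integral>\<omega>. g (Y \<omega>) \<partial>N) - (\<integral>\<omega>. q (Y \<omega>) \<partial>N)\<bar> \<le> 2 * e"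
    by (intro close[of N Y] M(2) Y Y2 VY)
  have "\<forall>\<^sub>F n in sequentially. \<bar>(\<integral>\<omega>. q (X n \<omega>) \<partial>M n) - (\<integral>\<omega>. q (Y \<omega>) \<partial>N)\<bar> < e"
    using trig_poly_convergence[OF q M X Y conv] \<open>e > 0\<close> by (auto simp: tendsto_iff dist_real_def)
  moreover have "\<forall>\<^sub>F n in sequentially. \<bar>(\<integral>\<omega>. g (X n \<omega>) \<partial>M n) - (\<integral>\<omega>. q (X n \<omega>) \<partial>M n)\<bar> \<le> 2 * e"
    using X2
  proof eventually_elim
    case (elim n)
    have "integrable (M n) (\<lambda>\<omega>. (X n \<omega> i)\<^sup>2)" "(\<integral>\<omega>. (X n \<omega> i)\<^sup>2 \<partial>M n) \<le> V" if "i < d" for i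
      using elim V0(2) that by (blast, meson order_trans)
    then show ?case by (intro close[of "M n" "X n"] M(1) X)
  qed
  ultimately have "\<forall>\<^sub>F n in sequentially. \<bar>(\<integral>\<omega>. g (X n \<omega>) \<partial>M n) - (\<integral>\<omega>. g (Y \<omega>) \<partial>N)\<bar> < r"
  proof eventually_elim
    case (elim n)
    then show ?case using gqY unfolding e_def by linarith
  qed
  then show "\<exists>no. \<forall>n\<ge>no. norm ((\<integral>\<omega>. g (X n \<omega>) \<partial>M n) - (\<integral>\<omega>. g (Y \<omega>) \<partial>N)) < r"
    by (auto simp: eventually_sequentially)
qed

section \<open>Weak convergence of bounded processes\<close>

lemma mspace_l_infinity: "mspace (l_infinity T) = {f. f \<in> extensional T \<and> bounded (f ` T)}"
  by (auto simp: l_infinity_def Metric_space.fspace_def[OF Met_TC.Metric_space_axioms])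

lemma mdist_l_infinity_le:
  assumes "f \<in> mspace (l_infinity T)" "g \<in> mspace (l_infinity T)" "T \<noteq> {}"
  shows "mdist (l_infinity T) f g \<le> e \<longleftrightarrow> (\<forall>t\<in>T. \<bar>f t - g t\<bar> \<le> e)"
  using funspace_mdist_le[of f T euclidean_metric g e] assms
  unfolding l_infinity_def by (simp add: dist_real_def)

lemma openin_metric_iff:
  "openin (mtopology_of D) U \<longleftrightarrow>
    U \<subseteq> mspace D \<and> (\<forall>x\<in>U. \<exists>r>0. \<forall>y\<in>mspace D. mdist D x y < r \<longrightarrow> y \<in> U)"
proof -
  interpret Metric_space "mspace D" "mdist D" by simp
  have eq: "(mball x r \<subseteq> U) = (\<forall>y\<in>mspace D. mdist D x y < r \<longrightarrow> y \<in> U)" if "x \<in> mspace D" for x r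
    using that by (auto simp: in_mball)
  have "(\<forall>x. x \<in> U \<longrightarrow> (\<exists>r>0. mball x r \<subseteq> U)) = (\<forall>x\<in>U. \<exists>r>0. \<forall>y\<in>mspace D. mdist D x y < r \<longrightarrow> y \<in> U)"
    if "U \<subseteq> mspace D"
    unfolding Ball_def[of U] by (intro all_cong ex_cong1 conj_cong refl imp_cong eq subsetD[OF that])
  then show ?thesis
    unfolding mtopology_of_def openin_mtopology by (rule conj_cong[OF refl])
qed

lemma openin_subset_mspace: "openin (mtopology_of D) U \<Longrightarrow> U \<subseteq> mspace D"
  by (simp add: openin_metric_iff)

lemma space_metric_borel [simp]: "space (metric_borel D) = mspace D"
  unfolding metric_borel_def by (rule space_measure_of) (auto dest: openin_subset_mspace)

lemma measurable_metric_borelI: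
  assumes "\<And>\<omega>. \<omega> \<in> space M \<Longrightarrow> F \<omega> \<in> mspace D"
    and "\<And>U. openin (mtopology_of D) U \<Longrightarrow> F -` U \<inter> space M \<in> sets M"
  shows "F \<in> measurable M (metric_borel D)"
  unfolding metric_borel_def
proof (rule measurable_measure_of)
  show "{S. openin (mtopology_of D) S} \<subseteq> Pow (mspace D)" by (auto dest: openin_subset_mspace)
qed (use assms in auto)

lemma open_in_metric_borel:
  assumes "openin (mtopology_of D) U"
  shows "U \<in> sets (metric_borel D)"
  unfolding metric_borel_def using assms
  by (subst sets_measure_of) (auto dest: openin_subset_mspace)

lemma continuous_map_metric_borel:
  assumes "continuous_map (mtopology_of D) euclideanreal f"
  shows "f \<in> borel_measurable (metric_borel D)"
proof (rule borel_measurableI)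
  fix S :: "real set" assume "open S"
  then have "openin (mtopology_of D) {x \<in> topspace (mtopology_of D). f x \<in> S}"
    using assms by (auto simp: continuous_map_def)
  then show "f -` S \<inter> space (metric_borel D) \<in> sets (metric_borel D)"
    using open_in_metric_borel by (auto simp: vimage_def Int_def conj_commute)
qed

lemma discretised_mspace:
  assumes "finite (\<rho> ` T)"
  shows "restrict (\<lambda>t. z (\<rho> t)) T \<in> mspace (l_infinity T)"
proof -
  have "(\<lambda>t. restrict (\<lambda>t. z (\<rho> t)) T t) ` T = z ` (\<rho> ` T)" by (auto simp: image_iff)
  then show ?thesis using assms by (auto simp: mspace_l_infinity intro!: finite_imp_bounded)
qed

text \<open>Numbering the values of \<rho> turns a discretised function into a point of
  \<open>nat => real\<close>, where the finite-dimensional results apply. Beyond \<open>d\<close>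
  the enumeration is padded with some point of \<open>T\<close>, because \<tau> has to stay in
  \<open>T\<close> at every index.\<close>

lemma finite_range_enumeration:
  assumes "finite (\<rho> ` T)" "\<rho> ` T \<subseteq> T" "T \<noteq> {}"
  obtains d :: nat and \<tau> idx where "\<And>k. \<tau> k \<in> T" "\<And>t. t \<in> T \<Longrightarrow> idx t < d \<and> \<tau> (idx t) = \<rho> t"
proof -
  obtain e and d :: nat where e: "\<rho> ` T = e ` {i. i < d}" "inj_on e {i. i < d}"
    using finite_imp_nat_seg_image_inj_on[OF assms(1)] by metis
  obtain t0 where "t0 \<in> T" using ex_in_conv[THEN iffD2, OF assms(3)] by (rule exE)
  define \<tau> where "\<tau> k = (if k < d then e k else t0)" for k
  define idx where "idx t = (SOME k. k < d \<and> e k = \<rho> t)" for t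
  have "idx t < d \<and> e (idx t) = \<rho> t" if "t \<in> T" for t
  proof -
    have "\<rho> t \<in> e ` {i. i < d}" using e(1) that by (metis imageI)
    then have "\<exists>k. k < d \<and> e k = \<rho> t" by auto
    then show ?thesis unfolding idx_def by (rule someI_ex)
  qed
  moreover have "\<tau> k \<in> T" for k using e(1) assms(2) \<open>t0 \<in> T\<close> by (auto simp: \<tau>_def)
  ultimately show ?thesis using that[of \<tau> idx d] by (auto simp: \<tau>_def)
qed

text \<open>The space is not separable for infinite \<open>T\<close>, so coordinatewise
  measurability is not enough in general. Here the map factors through a continuous map \<Psi> of
  finitely many real coordinates.\<close>

lemma measurable_discretised:
  fixes Z :: "'a \<Rightarrow> 't \<Rightarrow> real"
  assumes "finite (\<rho> ` T)" "\<rho> ` T \<subseteq> T" "T \<noteq> {}"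
    and Z: "\<And>t. t \<in> T \<Longrightarrow> (\<lambda>\<omega>. Z \<omega> t) \<in> borel_measurable M"
  shows "(\<lambda>\<omega>. restrict (\<lambda>t. Z \<omega> (\<rho> t)) T) \<in> measurable M (metric_borel (l_infinity T))"
proof (rule measurable_metric_borelI)
  show "restrict (\<lambda>t. Z \<omega> (\<rho> t)) T \<in> mspace (l_infinity T)" for \<omega> using assms(1) by (rule discretised_mspace)
  fix U assume U: "openin (mtopology_of (l_infinity T)) U"
  obtain d :: nat and \<tau> idx where \<tau>: "\<And>k. \<tau> k \<in> T" and idx: "\<And>t. t \<in> T \<Longrightarrow> idx t < d \<and> \<tau> (idx t) = \<rho> t"
    using finite_range_enumeration[OF assms(1-3)] by metis
  define \<Psi> where "\<Psi> y = restrict (\<lambda>t. y (idx t)) T" for y :: "nat \<Rightarrow> real"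
  have \<Psi>_in: "\<Psi> y \<in> mspace (l_infinity T)" for y
    unfolding \<Psi>_def using idx by (intro discretised_mspace finite_subset[of "idx ` T" "{..<d}"]) auto
  have "open (\<Psi> -` U)"
    unfolding open_subopen[of "\<Psi> -` U"]
  proof (intro ballI)
    fix y assume y: "y \<in> \<Psi> -` U"
    then obtain r where r: "r > 0" "\<forall>x\<in>mspace (l_infinity T). mdist (l_infinity T) (\<Psi> y) x < r \<longrightarrow> x \<in> U"
      using U unfolding openin_metric_iff by auto
    define O' where "O' = (\<Inter>k<d. {z. \<bar>z k - y k\<bar> < r / 2})"
    have "open {z. \<bar>z k - y k\<bar> < r / 2}" for k :: nat
      by (intro open_Collect_less continuous_intros continuous_on_product_coordinates)
    then have "open O'" unfolding O'_def by (intro open_INT) auto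
    moreover have "y \<in> O'" using r by (auto simp: O'_def)
    moreover have "O' \<subseteq> \<Psi> -` U"
    proof
      fix z assume z: "z \<in> O'"
      have "mdist (l_infinity T) (\<Psi> y) (\<Psi> z) \<le> r / 2"
      proof (subst mdist_l_infinity_le[OF \<Psi>_in \<Psi>_in \<open>T \<noteq> {}\<close>], intro ballI)
        fix t assume t: "t \<in> T"
        then have "\<bar>z (idx t) - y (idx t)\<bar> < r / 2" using z idx[OF t] by (auto simp: O'_def)
        then show "\<bar>\<Psi> y t - \<Psi> z t\<bar> \<le> r / 2" using t by (simp add: \<Psi>_def abs_minus_commute)
      qed
      then show "z \<in> \<Psi> -` U" using r \<Psi>_in by auto
    qed
    ultimately show "\<exists>O'. open O' \<and> y \<in> O' \<and> O' \<subseteq> \<Psi> -` U" by blast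
  qed
  moreover have "(\<lambda>\<omega> k. Z \<omega> (\<tau> k)) \<in> borel_measurable M"
    using Z \<tau> by (intro measurable_coordinatewise_then_product) auto
  ultimately have "(\<lambda>\<omega> k. Z \<omega> (\<tau> k)) -` (\<Psi> -` U) \<inter> space M \<in> sets M"
    by (intro measurable_sets[of _ _ borel]) auto
  moreover have "\<Psi> (\<lambda>k. Z \<omega> (\<tau> k)) = restrict (\<lambda>t. Z \<omega> (\<rho> t)) T" for \<omega>
    unfolding \<Psi>_def using idx by (intro restrict_ext) auto
  ultimately show "(\<lambda>\<omega>. restrict (\<lambda>t. Z \<omega> (\<rho> t)) T) -` U \<inter> space M \<in> sets M"
    by (simp add: vimage_def)
qed

text \<open>This holds without separability. An open set \<open>U\<close> is exhausted by open sets
  \<open>W m\<close>, the points with a margin of more than \<open>1 / (m + 1)\<close> inside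
  \<open>U\<close>; the limit lies in \<open>U\<close> exactly if the sequence eventually stays in
  one of them.\<close>

lemma measurable_metric_limit:
  assumes F: "\<And>j::nat. F j \<in> measurable M (metric_borel D)"
    and G: "\<And>\<omega>. \<omega> \<in> space M \<Longrightarrow> G \<omega> \<in> mspace D"
    and lim: "\<And>\<omega>. \<omega> \<in> space M \<Longrightarrow> (\<lambda>j. mdist D (F j \<omega>) (G \<omega>)) \<longlonglongrightarrow> 0"
  shows "G \<in> measurable M (metric_borel D)"
proof (rule measurable_metric_borelI[OF G])
  interpret Metric_space "mspace D" "mdist D" by simp
  have Fin: "F j \<omega> \<in> mspace D" if "\<omega> \<in> space M" for j \<omega>
    using measurable_space[OF F that] by simp
  fix U assume U: "openin (mtopology_of D) U"
  then have Usub: "U \<subseteq> mspace D" by (simp add: openin_metric_iff)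
  \<comment> \<open>The strict inequality for the radius leaves room to move the centre and makes
    \<open>W m\<close> open.\<close>
  define W where "W m = {x \<in> mspace D. \<exists>r > inverse (real (Suc m)). \<forall>y\<in>mspace D. mdist D x y < r \<longrightarrow> y \<in> U}" for m
  have W: "openin (mtopology_of D) (W m)" for m
    unfolding openin_metric_iff
  proof (intro conjI ballI)
    show "W m \<subseteq> mspace D" by (auto simp: W_def)
    fix x assume "x \<in> W m"
    then obtain r where r: "r > inverse (real (Suc m))" "\<forall>y\<in>mspace D. mdist D x y < r \<longrightarrow> y \<in> U" and x: "x \<in> mspace D"
      by (auto simp: W_def)
    have "\<exists>s>0. u - s > v" if "u > v" for u v :: real
      using that by (intro exI[of _ "(u - v) / 2"]) (simp add: field_simps)
    from this[OF r(1)] obtain s where s: "s > 0" "r - s > inverse (real (Suc m))" by blast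
    have "y \<in> W m" if y: "y \<in> mspace D" "mdist D x y < s" for y
    proof -
      have "z \<in> U" if z: "z \<in> mspace D" "mdist D y z < r - s" for z
        using triangle[OF x y(1) z(1)] z y r(2) by auto
      then show ?thesis using y s unfolding W_def by blast
    qed
    then show "\<exists>r>0. \<forall>y\<in>mspace D. mdist D x y < r \<longrightarrow> y \<in> W m" using s by blast
  qed
  have "G \<omega> \<in> U \<longleftrightarrow> (\<exists>m. \<exists>j0. \<forall>j\<ge>j0. F j \<omega> \<in> W m)" if \<omega>: "\<omega> \<in> space M" for \<omega>
  proof
    assume "G \<omega> \<in> U"
    then obtain r where r: "r > 0" "\<forall>y\<in>mspace D. mdist D (G \<omega>) y < r \<longrightarrow> y \<in> U"
      using U by (auto simp: openin_metric_iff)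
    obtain m where m: "inverse (real (Suc m)) < r / 2" using r(1) reals_Archimedean[of "r / 2"] by auto
    obtain j0 where j0: "\<And>j. j \<ge> j0 \<Longrightarrow> mdist D (F j \<omega>) (G \<omega>) < r / 2"
      using order_tendstoD(2)[OF lim[OF \<omega>], of "r / 2"] r(1) unfolding eventually_sequentially by auto
    have "F j \<omega> \<in> W m" if j: "j \<ge> j0" for j
    proof -
      have "y \<in> U" if y: "y \<in> mspace D" "mdist D (F j \<omega>) y < r / 2" for y
      proof -
        have "mdist D (G \<omega>) y < r"
          using triangle[OF G[OF \<omega>] Fin[OF \<omega>, of j] y(1)] j0[OF j] y(2) commute[of "G \<omega>" "F j \<omega>"] by linarith
        then show ?thesis using r(2) y by blast
      qed
      then show ?thesis using m Fin[OF \<omega>] unfolding W_def by blast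
    qed
    then show "\<exists>m. \<exists>j0. \<forall>j\<ge>j0. F j \<omega> \<in> W m" by blast
  next
    assume "\<exists>m. \<exists>j0. \<forall>j\<ge>j0. F j \<omega> \<in> W m"
    then obtain m j0 where j0: "\<And>j. j \<ge> j0 \<Longrightarrow> F j \<omega> \<in> W m" by blast
    obtain j1 where j1: "\<And>j. j \<ge> j1 \<Longrightarrow> mdist D (F j \<omega>) (G \<omega>) < inverse (real (Suc m))"
      using order_tendstoD(2)[OF lim[OF \<omega>], of "inverse (real (Suc m))"] unfolding eventually_sequentially by auto
    have "F (max j0 j1) \<omega> \<in> W m" "mdist D (F (max j0 j1) \<omega>) (G \<omega>) < inverse (real (Suc m))"
      using j0 j1 by auto
    then show "G \<omega> \<in> U" using G[OF \<omega>] by (auto simp: W_def)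
  qed
  then have "G -` U \<inter> space M = {\<omega> \<in> space M. \<exists>m. \<exists>j0. \<forall>j. j \<ge> j0 \<longrightarrow> F j \<omega> \<in> W m}"
    by auto
  moreover have "{\<omega> \<in> space M. F j \<omega> \<in> W m} \<in> sets M" for j m
    using measurable_sets[OF F open_in_metric_borel[OF W], of j m] by (simp add: vimage_def Int_def conj_commute)
  ultimately show "G -` U \<inter> space M \<in> sets M"
    by (simp only:) (intro sets.sets_Collect_countable_Ex sets.sets_Collect_countable_All
      sets.sets_Collect_imp sets.sets_Collect_const)
qed

text \<open>\<open>Z\<close> is its own least measurable majorant. Positive and negative parts are
  compared separately, which avoids subtracting infinities for a majorant that is not
  integrable.\<close>

lemma outer_expectation_eq_integral:
  assumes "prob_space M" and Z: "Z \<in> borel_measurable M" and B: "\<And>\<omega>. \<omega> \<in> space M \<Longrightarrow> \<bar>Z \<omega>\<bar> \<le> B"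
  shows "outer_expectation M Z = ereal (\<integral>\<omega>. Z \<omega> \<partial>M)"
proof -
  interpret prob_space M by fact
  define A where "A = {enn2ereal (\<integral>\<^sup>+ \<omega>. e2ennreal (U \<omega>) \<partial>M) - enn2ereal (\<integral>\<^sup>+ \<omega>. e2ennreal (- U \<omega>) \<partial>M) | U :: 'a \<Rightarrow> ereal.
       U \<in> borel_measurable M \<and> (\<forall>\<omega>\<in>space M. ereal (Z \<omega>) \<le> U \<omega>) \<and>
       \<not> ((\<integral>\<^sup>+ \<omega>. e2ennreal (U \<omega>) \<partial>M) = \<infinity> \<and> (\<integral>\<^sup>+ \<omega>. e2ennreal (- U \<omega>) \<partial>M) = \<infinity>)}"
  have iZ: "integrable M Z" using Z B by (intro integrable_const_bound[of _ B]) auto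
  have e2: "e2ennreal (ereal x) = ennreal x" for x by (simp add: ennreal_def max_def e2ennreal_neg)
  have fin: "(\<integral>\<^sup>+\<omega>. ennreal (Z \<omega>) \<partial>M) < \<infinity>" "(\<integral>\<^sup>+\<omega>. ennreal (- Z \<omega>) \<partial>M) < \<infinity>"
    using iZ by (simp_all add: real_integrable_def less_top)
  have int: "ereal (\<integral>\<omega>. Z \<omega> \<partial>M) = enn2ereal (\<integral>\<^sup>+\<omega>. ennreal (Z \<omega>) \<partial>M) - enn2ereal (\<integral>\<^sup>+\<omega>. ennreal (- Z \<omega>) \<partial>M)"
  proof -
    have "ereal (enn2real a - enn2real b) = enn2ereal a - enn2ereal b" if "a < \<infinity>" "b < \<infinity>" for a b
      using that by (cases a; cases b) (auto simp: enn2ereal_ennreal)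
    then show ?thesis unfolding real_lebesgue_integral_def[OF iZ] using fin by simp
  qed
  have "Inf A = ereal (\<integral>\<omega>. Z \<omega> \<partial>M)"
  proof (rule antisym)
    have "ereal (\<integral>\<omega>. Z \<omega> \<partial>M) \<in> A"
      unfolding A_def using Z fin int
      by (intro CollectI exI[of _ "\<lambda>\<omega>. ereal (Z \<omega>)"]) (auto simp: e2)
    then show "Inf A \<le> ereal (\<integral>\<omega>. Z \<omega> \<partial>M)" by (rule Inf_lower)
    show "ereal (\<integral>\<omega>. Z \<omega> \<partial>M) \<le> Inf A"
    proof (rule Inf_greatest)
      fix a assume "a \<in> A"
      then obtain U where U: "U \<in> borel_measurable M" "\<And>\<omega>. \<omega> \<in> space M \<Longrightarrow> ereal (Z \<omega>) \<le> U \<omega>"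
        and a: "a = enn2ereal (\<integral>\<^sup>+ \<omega>. e2ennreal (U \<omega>) \<partial>M) - enn2ereal (\<integral>\<^sup>+ \<omega>. e2ennreal (- U \<omega>) \<partial>M)"
        unfolding A_def by blast
      have "(\<integral>\<^sup>+\<omega>. ennreal (Z \<omega>) \<partial>M) \<le> (\<integral>\<^sup>+ \<omega>. e2ennreal (U \<omega>) \<partial>M)"
        using U(2) by (intro nn_integral_mono) (metis e2 e2ennreal_mono)
      moreover have "(\<integral>\<^sup>+ \<omega>. e2ennreal (- U \<omega>) \<partial>M) \<le> (\<integral>\<^sup>+\<omega>. ennreal (- Z \<omega>) \<partial>M)"
      proof (intro nn_integral_mono)
        fix \<omega> assume "\<omega> \<in> space M"
        then have "- U \<omega> \<le> ereal (- Z \<omega>)" using U(2)[of \<omega>] by (simp flip: uminus_ereal.simps)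
        then show "e2ennreal (- U \<omega>) \<le> ennreal (- Z \<omega>)" using e2ennreal_mono e2 by metis
      qed
      ultimately show "ereal (\<integral>\<omega>. Z \<omega> \<partial>M) \<le> a"
        unfolding a int by (intro ereal_minus_mono) (simp_all add: less_eq_ennreal.rep_eq)
    qed
  qed
  then show ?thesis unfolding A_def outer_expectation_def .
qed


section \<open>Reduction of weak convergence to Lipschitz functions\<close>

lemma lipschitz_continuous_map_real:
  assumes "\<And>x y. x \<in> mspace D \<Longrightarrow> y \<in> mspace D \<Longrightarrow> \<bar>h x - h y\<bar> \<le> L * mdist D x y"
  shows "continuous_map (mtopology_of D) euclideanreal h"
proof -
  have "Lipschitz_continuous_map D euclidean_metric h"
    unfolding Lipschitz_continuous_map_def using assms by (auto simp: dist_real_def)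
  then show ?thesis
    using Lipschitz_continuous_imp_continuous_map by fastforce
qed

text \<open>\<open>F m\<close> is the infimal convolution of \<open>f\<close> with \<open>m\<close>
  times the metric, the greatest \<open>m\<close>-Lipschitz minorant of \<open>f\<close>. It rises
  to \<open>f\<close> pointwise because for large \<open>m\<close> the penalty excludes all points
  outside a given ball.\<close>

lemma lipschitz_minorants:
  fixes f :: "'d \<Rightarrow> real"
  assumes f: "continuous_map (mtopology_of D) euclideanreal f"
    and B: "\<And>x. x \<in> mspace D \<Longrightarrow> \<bar>f x\<bar> \<le> B"
  obtains F :: "nat \<Rightarrow> 'd \<Rightarrow> real" where
    "\<And>m x y. x \<in> mspace D \<Longrightarrow> y \<in> mspace D \<Longrightarrow> \<bar>F m x - F m y\<bar> \<le> real m * mdist D x y"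
    "\<And>m x. x \<in> mspace D \<Longrightarrow> F m x \<le> f x" "\<And>m x. x \<in> mspace D \<Longrightarrow> \<bar>F m x\<bar> \<le> B"
    "\<And>x. x \<in> mspace D \<Longrightarrow> (\<lambda>m. F m x) \<longlonglongrightarrow> f x"
proof
  interpret Metric_space "mspace D" "mdist D" by simp
  have nn: "0 \<le> real m * mdist D x y" for m x y by simp
  define F where "F m x = (INF y\<in>mspace D. f y + real m * mdist D x y)" for m x
  have bdd: "bdd_below ((\<lambda>y. f y + real m * mdist D x y) ` mspace D)" for m x
  proof (rule bdd_belowI2)
    fix y assume "y \<in> mspace D"
    then show "- B \<le> f y + real m * mdist D x y" using B[of y] nn[of m x y] by linarith
  qed
  have low: "F m x \<le> f y + real m * mdist D x y" if "y \<in> mspace D" for m x y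
    unfolding F_def by (intro cINF_lower bdd that)
  have geI: "z \<le> F m x" if "x \<in> mspace D" "\<And>y. y \<in> mspace D \<Longrightarrow> z \<le> f y + real m * mdist D x y" for m x z
    unfolding F_def using that by (intro cINF_greatest) auto
  show le: "F m x \<le> f x" if "x \<in> mspace D" for m x
    using low[of x m x] that by simp
  have "- B \<le> F m x" if "x \<in> mspace D" for m x
  proof (rule geI[OF that])
    fix y assume "y \<in> mspace D"
    then show "- B \<le> f y + real m * mdist D x y" using B[of y] nn[of m x y] by linarith
  qed
  then show "\<bar>F m x\<bar> \<le> B" if "x \<in> mspace D" for m x
    using le[OF that, of m] B[OF that] that unfolding abs_le_iff by (smt (verit))
  have lip1: "F m x - real m * mdist D x y \<le> F m y" if xy: "x \<in> mspace D" "y \<in> mspace D" for m x y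
  proof (rule geI[OF xy(2)])
    fix z assume z: "z \<in> mspace D"
    have "real m * mdist D x z \<le> real m * (mdist D x y + mdist D y z)"
      using triangle[OF xy z] by (intro mult_left_mono) auto
    then show "F m x - real m * mdist D x y \<le> f z + real m * mdist D y z"
      using low[OF z, of m x] by (simp add: distrib_left)
  qed
  show "\<bar>F m x - F m y\<bar> \<le> real m * mdist D x y" if "x \<in> mspace D" "y \<in> mspace D" for m x y
    using lip1[of x y m] lip1[of y x m] that commute[of x y] by (simp add: abs_le_iff)
  show "(\<lambda>m. F m x) \<longlonglongrightarrow> f x" if x: "x \<in> mspace D" for x
  proof (rule LIMSEQ_I)
    fix e :: real assume "e > 0"
    have "openin (mtopology_of D) {y \<in> topspace (mtopology_of D). f y \<in> {f x - e / 2<..}}"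
      using f open_greaterThan[of "f x - e / 2"] unfolding continuous_map_def by (metis open_openin)
    then obtain r where r: "r > 0" "\<And>y. y \<in> mspace D \<Longrightarrow> mdist D x y < r \<Longrightarrow> f y > f x - e / 2"
      using x \<open>e > 0\<close> unfolding openin_metric_iff by fastforce
    \<comment> \<open>From this index on, leaving the ball of radius \<open>r\<close> costs at least
      \<open>2 * B\<close>, the largest possible gain in \<open>f\<close>.\<close>
    obtain m0 :: nat where m0: "2 * B / r \<le> real m0" using real_arch_simple by blast
    have "norm (F m x - f x) < e" if "m \<ge> m0" for m
    proof -
      have mr: "2 * B \<le> real m * r" using m0 that r(1) by (smt (verit) divide_le_eq of_nat_le_iff)
      have "f x - e / 2 \<le> F m x"
      proof (rule geI[OF x])
        fix y assume y: "y \<in> mspace D"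
        show "f x - e / 2 \<le> f y + real m * mdist D x y"
        proof (cases "mdist D x y < r")
          case True
          then show ?thesis using r(2)[OF y] nn[of m x y] \<open>e > 0\<close> by linarith
        next
          case False
          then have "2 * B \<le> real m * mdist D x y"
            using mr mult_left_mono[of r "mdist D x y" "real m"] by simp
          then show ?thesis using B[OF x] B[OF y] \<open>e > 0\<close> by linarith
        qed
      qed
      then show ?thesis using le[OF x, of m] \<open>e > 0\<close> by simp
    qed
    then show "\<exists>m0. \<forall>m\<ge>m0. norm (F m x - f x) < e" by blast
  qed
qed

text \<open>One half of the portmanteau theorem: Lipschitz minorants bound the lower limit for a
  continuous \<open>f\<close>, and the same for \<open>- f\<close> bounds the upper limit.
  Measurability of \<open>X n\<close> turns outer expectations into integrals.\<close>

theorem converges_weakly_if_lipschitz: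
  fixes D :: "'d metric"
  assumes M: "\<And>n. prob_space (M n)" "prob_space N"
    and X: "\<And>n. X n \<in> measurable (M n) (metric_borel D)"
    and Y: "Y \<in> measurable N (metric_borel D)"
    and lip: "\<And>h L B. (\<And>x y. x \<in> mspace D \<Longrightarrow> y \<in> mspace D \<Longrightarrow> \<bar>h x - h y\<bar> \<le> L * mdist D x y) \<Longrightarrow>
        (\<And>x. x \<in> mspace D \<Longrightarrow> \<bar>h x\<bar> \<le> B) \<Longrightarrow>
        (\<lambda>n. \<integral>\<omega>. h (X n \<omega>) \<partial>M n) \<longlonglongrightarrow> (\<integral>\<omega>. h (Y \<omega>) \<partial>N)"
  shows "converges_weakly D M X N Y"
proof -
  interpret N: prob_space N by fact
  have Xin: "X n \<omega> \<in> mspace D" if "\<omega> \<in> space (M n)" for n \<omega> using measurable_space[OF X that] by simp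
  have Yin: "Y \<omega> \<in> mspace D" if "\<omega> \<in> space N" for \<omega> using measurable_space[OF Y that] by simp
  have liminf: "\<forall>\<^sub>F n in sequentially. (\<integral>\<omega>. f (Y \<omega>) \<partial>N) - e < (\<integral>\<omega>. f (X n \<omega>) \<partial>M n)"
    if f: "continuous_map (mtopology_of D) euclideanreal f" and B: "\<And>x. x \<in> mspace D \<Longrightarrow> \<bar>f x\<bar> \<le> B" and "e > 0"
    for f :: "'d \<Rightarrow> real" and B e
  proof -
    obtain F :: "nat \<Rightarrow> 'd \<Rightarrow> real" where
      F: "\<And>m x y. x \<in> mspace D \<Longrightarrow> y \<in> mspace D \<Longrightarrow> \<bar>F m x - F m y\<bar> \<le> real m * mdist D x y"
      "\<And>m x. x \<in> mspace D \<Longrightarrow> F m x \<le> f x" "\<And>m x. x \<in> mspace D \<Longrightarrow> \<bar>F m x\<bar> \<le> B"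
      "\<And>x. x \<in> mspace D \<Longrightarrow> (\<lambda>m. F m x) \<longlonglongrightarrow> f x"
      using lipschitz_minorants[OF f B] by blast
    have mf: "f \<in> borel_measurable (metric_borel D)" by (rule continuous_map_metric_borel[OF f])
    have mF: "F m \<in> borel_measurable (metric_borel D)" for m
      by (rule continuous_map_metric_borel[OF lipschitz_continuous_map_real[OF F(1)]])
    have "(\<lambda>m. \<integral>\<omega>. F m (Y \<omega>) \<partial>N) \<longlonglongrightarrow> (\<integral>\<omega>. f (Y \<omega>) \<partial>N)"
    proof (rule integral_dominated_convergence[where w = "\<lambda>_. B"])
      show "(\<lambda>\<omega>. f (Y \<omega>)) \<in> borel_measurable N" by (rule measurable_compose[OF Y mf])
      show "(\<lambda>\<omega>. F m (Y \<omega>)) \<in> borel_measurable N" for m by (rule measurable_compose[OF Y mF])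
    qed (use F Yin in auto)
    then have "\<forall>\<^sub>F m in sequentially. (\<integral>\<omega>. f (Y \<omega>) \<partial>N) - e / 2 < (\<integral>\<omega>. F m (Y \<omega>) \<partial>N)"
      using \<open>e > 0\<close> by (intro order_tendstoD(1)) auto
    then obtain m where m: "(\<integral>\<omega>. f (Y \<omega>) \<partial>N) - e / 2 < (\<integral>\<omega>. F m (Y \<omega>) \<partial>N)"
      by (auto simp: eventually_sequentially)
    have "\<forall>\<^sub>F n in sequentially. (\<integral>\<omega>. F m (Y \<omega>) \<partial>N) - e / 2 < (\<integral>\<omega>. F m (X n \<omega>) \<partial>M n)"
      using \<open>e > 0\<close> by (intro order_tendstoD(1)[OF lip[OF F(1,3)]]) auto
    then show ?thesis
    proof eventually_elim
      case (elim n)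
      interpret prob_space "M n" by fact
      have "(\<integral>\<omega>. F m (X n \<omega>) \<partial>M n) \<le> (\<integral>\<omega>. f (X n \<omega>) \<partial>M n)"
      proof (rule integral_mono)
        show "integrable (M n) (\<lambda>\<omega>. F m (X n \<omega>))"
          using F(3) Xin measurable_compose[OF X mF] by (intro integrable_const_bound[of _ B]) auto
        show "integrable (M n) (\<lambda>\<omega>. f (X n \<omega>))"
          using B Xin measurable_compose[OF X mf] by (intro integrable_const_bound[of _ B]) auto
      qed (use F(2) Xin in auto)
      then show ?case using m elim by linarith
    qed
  qed
  have "(\<lambda>n. outer_expectation (M n) (\<lambda>\<omega>. f (X n \<omega>))) \<longlonglongrightarrow> ereal (\<integral>\<omega>. f (Y \<omega>) \<partial>N)"
    if f: "continuous_map (mtopology_of D) euclideanreal f" and "bounded (f ` mspace D)" for f :: "'d \<Rightarrow> real"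
  proof -
    obtain B where B: "\<And>x. x \<in> mspace D \<Longrightarrow> \<bar>f x\<bar> \<le> B"
      using \<open>bounded (f ` mspace D)\<close> by (auto simp: bounded_iff)
    have outer: "outer_expectation (M n) (\<lambda>\<omega>. f (X n \<omega>)) = ereal (\<integral>\<omega>. f (X n \<omega>) \<partial>M n)" for n
      using B Xin by (intro outer_expectation_eq_integral[where B = B] M
        measurable_compose[OF X continuous_map_metric_borel[OF f]]) auto
    have "(\<lambda>n. \<integral>\<omega>. f (X n \<omega>) \<partial>M n) \<longlonglongrightarrow> (\<integral>\<omega>. f (Y \<omega>) \<partial>N)"
    proof (rule LIMSEQ_I)
      fix e :: real assume e: "e > 0"
      have f': "continuous_map (mtopology_of D) euclideanreal (\<lambda>x. - f x)"
        using f by (rule continuous_map_minus)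
      have "\<forall>\<^sub>F n in sequentially. norm ((\<integral>\<omega>. f (X n \<omega>) \<partial>M n) - (\<integral>\<omega>. f (Y \<omega>) \<partial>N)) < e"
      proof -
        have "\<forall>\<^sub>F n in sequentially. - (\<integral>\<omega>. f (Y \<omega>) \<partial>N) - e < - (\<integral>\<omega>. f (X n \<omega>) \<partial>M n)"
          using liminf[OF f' _ e, of B] B by simp
        moreover have "\<forall>\<^sub>F n in sequentially. (\<integral>\<omega>. f (Y \<omega>) \<partial>N) - e < (\<integral>\<omega>. f (X n \<omega>) \<partial>M n)"
          using liminf[OF f _ e, of B] B by simp
        ultimately show ?thesis
          by eventually_elim (simp add: abs_less_iff)
      qed
      then show "\<exists>n0. \<forall>n\<ge>n0. norm ((\<integral>\<omega>. f (X n \<omega>) \<partial>M n) - (\<integral>\<omega>. f (Y \<omega>) \<partial>N)) < e"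
        by (simp add: eventually_sequentially)
    qed
    then show ?thesis unfolding outer by simp
  qed
  then show ?thesis using Xin Y unfolding converges_weakly_def by blast
qed

lemma (in prob_space) integral_close:
  fixes f g :: "'a \<Rightarrow> real"
  assumes [measurable]: "f \<in> borel_measurable M" "g \<in> borel_measurable M" "A \<in> sets M"
    and B: "\<And>\<omega>. \<omega> \<in> space M \<Longrightarrow> \<bar>f \<omega>\<bar> \<le> B" "\<And>\<omega>. \<omega> \<in> space M \<Longrightarrow> \<bar>g \<omega>\<bar> \<le> B"
    and A: "prob A \<ge> 1 - e" "\<And>\<omega>. \<omega> \<in> A \<Longrightarrow> \<bar>f \<omega> - g \<omega>\<bar> \<le> a" and "a \<ge> 0"
  shows "\<bar>expectation f - expectation g\<bar> \<le> a + 2 * B * e"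
proof -
  obtain \<omega>0 where "\<omega>0 \<in> space M" using not_empty by auto
  then have "B \<ge> 0" using B(1)[of \<omega>0] by simp
  have int: "integrable M f" "integrable M g"
    using B by (auto intro!: integrable_const_bound[of _ B])
  have "\<bar>expectation f - expectation g\<bar> = \<bar>expectation (\<lambda>\<omega>. f \<omega> - g \<omega>)\<bar>" using int by simp
  also have "\<dots> \<le> expectation (\<lambda>\<omega>. \<bar>f \<omega> - g \<omega>\<bar>)" by (rule integral_abs_bound)
  also have "\<dots> \<le> expectation (\<lambda>\<omega>. a + 2 * B * indicator (space M - A) \<omega>)"
  proof (rule integral_mono)
    show "integrable M (\<lambda>\<omega>. \<bar>f \<omega> - g \<omega>\<bar>)" using int by simp
    show "integrable M (\<lambda>\<omega>. a + 2 * B * indicator (space M - A) \<omega>)"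
      by (intro Bochner_Integration.integrable_add integrable_mult_right integrable_const integrable_real_indicator)
         (simp_all add: emeasure_eq_measure)
    show "\<bar>f \<omega> - g \<omega>\<bar> \<le> a + 2 * B * indicator (space M - A) \<omega>" if "\<omega> \<in> space M" for \<omega>
      using B[OF that] A(2)[of \<omega>] \<open>a \<ge> 0\<close> that by (cases "\<omega> \<in> A") (auto simp: abs_le_iff)
  qed
  also have "\<dots> = a + 2 * B * prob (space M - A)"
    by (subst Bochner_Integration.integral_add)
      (auto intro!: integrable_mult_right integrable_real_indicator simp: prob_space emeasure_eq_measure)
  also have "\<dots> \<le> a + 2 * B * e"
    using A(1) \<open>B \<ge> 0\<close> by (intro add_left_mono mult_left_mono) (auto simp: prob_compl)
  finally show ?thesis .
qed

text \<open>Tightness enters as one finite-range discretisation \<rho> that with high probability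
  nearly reproduces both the processes and the limit. A Lipschitz functional hardly notices \<rho>,
  and on discretised functions it is a Lipschitz function of finitely many coordinates. As the limit
  is given and satisfies the same condition, no compactness argument in the function space is
  involved.\<close>

theorem converges_weakly_l_infinityI:
  fixes X :: "nat \<Rightarrow> 'a \<Rightarrow> 't \<Rightarrow> real" and Y :: "'b \<Rightarrow> 't \<Rightarrow> real"
  assumes M: "\<And>n. prob_space (M n)" "prob_space N" and T: "T \<noteq> {}"
    and X: "\<And>n. X n \<in> measurable (M n) (metric_borel (l_infinity T))"
    and Y: "Y \<in> measurable N (metric_borel (l_infinity T))"
    and Xt: "\<And>n t. t \<in> T \<Longrightarrow> (\<lambda>\<omega>. X n \<omega> t) \<in> borel_measurable (M n)"
    and Yt: "\<And>t. t \<in> T \<Longrightarrow> (\<lambda>\<omega>. Y \<omega> t) \<in> borel_measurable N"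
    and approx: "\<And>e. e > 0 \<Longrightarrow> \<exists>\<rho>. finite (\<rho> ` T) \<and> \<rho> ` T \<subseteq> T \<and>
      (\<forall>\<^sub>F n in sequentially. \<exists>A\<in>sets (M n). measure (M n) A \<ge> 1 - e \<and>
         (\<forall>\<omega>\<in>A. \<forall>t\<in>T. \<bar>X n \<omega> t - X n \<omega> (\<rho> t)\<bar> \<le> e)) \<and>
      (\<exists>A\<in>sets N. measure N A \<ge> 1 - e \<and> (\<forall>\<omega>\<in>A. \<forall>t\<in>T. \<bar>Y \<omega> t - Y \<omega> (\<rho> t)\<bar> \<le> e))"
    and fdd: "\<And>d \<tau> g L B. (\<And>k::nat. \<tau> k \<in> T) \<Longrightarrow>
      (\<And>x y :: nat \<Rightarrow> real. \<bar>g x - g y\<bar> \<le> L * (\<Sum>k<d. \<bar>x k - y k\<bar>)) \<Longrightarrow> (\<And>x. \<bar>g x\<bar> \<le> B) \<Longrightarrow>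
      (\<lambda>n. \<integral>\<omega>. g (\<lambda>k. X n \<omega> (\<tau> k)) \<partial>M n) \<longlonglongrightarrow> (\<integral>\<omega>. g (\<lambda>k. Y \<omega> (\<tau> k)) \<partial>N)"
  shows "converges_weakly (l_infinity T) M X N Y"
proof (rule converges_weakly_if_lipschitz[OF M X Y])
  let ?D = "l_infinity T"
  fix h :: "('t \<Rightarrow> real) \<Rightarrow> real" and L B
  assume lip: "\<And>x y. x \<in> mspace ?D \<Longrightarrow> y \<in> mspace ?D \<Longrightarrow> \<bar>h x - h y\<bar> \<le> L * mdist ?D x y"
    and B: "\<And>x. x \<in> mspace ?D \<Longrightarrow> \<bar>h x\<bar> \<le> B"
  interpret D: Metric_space "mspace ?D" "mdist ?D" by simp
  define L' where "L' = max L 0"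
  have L': "L' \<ge> 0" by (simp add: L'_def)
  have lip': "\<bar>h x - h y\<bar> \<le> L' * e"
    if "x \<in> mspace ?D" "y \<in> mspace ?D" "\<And>t. t \<in> T \<Longrightarrow> \<bar>x t - y t\<bar> \<le> e" for x y e
  proof -
    have "\<bar>h x - h y\<bar> \<le> L' * mdist ?D x y"
      using lip[OF that(1,2)] by (rule order_trans) (auto simp: L'_def intro: mult_right_mono)
    also have "\<dots> \<le> L' * e"
      using that mdist_l_infinity_le[OF that(1,2) T, of e] L' by (intro mult_left_mono) auto
    finally show ?thesis .
  qed
  have mh: "h \<in> borel_measurable (metric_borel ?D)"
    by (rule continuous_map_metric_borel[OF lipschitz_continuous_map_real[OF lip]])
  define B' where "B' = max B 0"
  have B': "\<bar>h x\<bar> \<le> B'" if "x \<in> mspace ?D" for x using B[OF that] by (simp add: B'_def)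
  have [simp]: "B' \<ge> 0" by (simp add: B'_def)
  show "(\<lambda>n. \<integral>\<omega>. h (X n \<omega>) \<partial>M n) \<longlonglongrightarrow> (\<integral>\<omega>. h (Y \<omega>) \<partial>N)"
  proof (rule LIMSEQ_I)
    fix r :: real assume "r > 0"
    \<comment> \<open>The discretisation costs \<open>L' * q\<close> on the good event and
      \<open>2 * B' * q\<close> for its complement; with this \<open>b\<close> both together stay
      below \<open>b * q = r / 4\<close>.\<close>
    define b where "b = L' + 2 * B' + 1"
    have b: "b > 0" using L' by (simp add: b_def add_nonneg_pos)
    define q where "q = r / (4 * b)"
    have q: "q > 0" using \<open>r > 0\<close> b by (simp add: q_def)
    have qr: "L' * q + 2 * B' * q \<le> r / 4"
    proof -
      have "b * q = r / 4" using b by (simp add: q_def)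
      then show ?thesis using q unfolding b_def by (simp add: algebra_simps)
    qed
    obtain \<rho> where \<rho>: "finite (\<rho> ` T)" "\<rho> ` T \<subseteq> T"
      and AX: "\<forall>\<^sub>F n in sequentially. \<exists>A\<in>sets (M n). measure (M n) A \<ge> 1 - q \<and>
         (\<forall>\<omega>\<in>A. \<forall>t\<in>T. \<bar>X n \<omega> t - X n \<omega> (\<rho> t)\<bar> \<le> q)"
      and AY: "\<exists>A\<in>sets N. measure N A \<ge> 1 - q \<and> (\<forall>\<omega>\<in>A. \<forall>t\<in>T. \<bar>Y \<omega> t - Y \<omega> (\<rho> t)\<bar> \<le> q)"
      using approx[OF q] by blast
    define \<pi> where "\<pi> x = restrict (\<lambda>t. x (\<rho> t)) T" for x :: "'t \<Rightarrow> real"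
    have \<pi>_in: "\<pi> x \<in> mspace ?D" for x unfolding \<pi>_def by (rule discretised_mspace[OF \<rho>(1)])
    have close: "\<bar>(\<integral>\<omega>. h (Z \<omega>) \<partial>Q) - (\<integral>\<omega>. h (\<pi> (Z \<omega>)) \<partial>Q)\<bar> \<le> r / 4"
      if Q: "prob_space Q" and Z: "Z \<in> measurable Q (metric_borel ?D)"
        and Zt: "\<And>t. t \<in> T \<Longrightarrow> (\<lambda>\<omega>. Z \<omega> t) \<in> borel_measurable Q"
        and A: "\<exists>A\<in>sets Q. measure Q A \<ge> 1 - q \<and> (\<forall>\<omega>\<in>A. \<forall>t\<in>T. \<bar>Z \<omega> t - Z \<omega> (\<rho> t)\<bar> \<le> q)"
      for Q :: "'x measure" and Z
    proof -
      interpret prob_space Q by fact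
      obtain A where A: "A \<in> sets Q" "measure Q A \<ge> 1 - q" "\<And>\<omega> t. \<omega> \<in> A \<Longrightarrow> t \<in> T \<Longrightarrow> \<bar>Z \<omega> t - Z \<omega> (\<rho> t)\<bar> \<le> q"
        using A by blast
      have Zin: "Z \<omega> \<in> mspace ?D" if "\<omega> \<in> space Q" for \<omega> using measurable_space[OF Z that] by simp
      have m\<pi>: "(\<lambda>\<omega>. \<pi> (Z \<omega>)) \<in> measurable Q (metric_borel ?D)"
        unfolding \<pi>_def by (rule measurable_discretised[OF \<rho> T Zt])
      have "\<bar>(\<integral>\<omega>. h (Z \<omega>) \<partial>Q) - (\<integral>\<omega>. h (\<pi> (Z \<omega>)) \<partial>Q)\<bar> \<le> L' * q + 2 * B' * q"
      proof (rule integral_close[where A = A])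
        show "(\<lambda>\<omega>. h (Z \<omega>)) \<in> borel_measurable Q" by (rule measurable_compose[OF Z mh])
        show "(\<lambda>\<omega>. h (\<pi> (Z \<omega>))) \<in> borel_measurable Q" by (rule measurable_compose[OF m\<pi> mh])
        show "\<bar>h (Z \<omega>) - h (\<pi> (Z \<omega>))\<bar> \<le> L' * q" if "\<omega> \<in> A" for \<omega>
          using A(3)[OF that] Zin[of \<omega>] \<pi>_in sets.sets_into_space[OF A(1)] that
          by (intro lip') (auto simp: \<pi>_def)
      qed (use A B' Zin \<pi>_in L' q in auto)
      then show ?thesis using qr by linarith
    qed
    obtain d :: nat and \<tau> idx where \<tau>: "\<And>k. \<tau> k \<in> T" and idx: "\<And>t. t \<in> T \<Longrightarrow> idx t < d \<and> \<tau> (idx t) = \<rho> t"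
      using finite_range_enumeration[OF \<rho> T] by metis
    define \<Psi> where "\<Psi> y = restrict (\<lambda>t. y (idx t)) T" for y :: "nat \<Rightarrow> real"
    have \<Psi>_in: "\<Psi> y \<in> mspace ?D" for y
      unfolding \<Psi>_def using idx by (intro discretised_mspace finite_subset[of "idx ` T" "{..<d}"]) auto
    have \<pi>_eq: "\<pi> x = \<Psi> (\<lambda>k. x (\<tau> k))" for x
      unfolding \<pi>_def \<Psi>_def using idx by (intro restrict_ext) auto
    have conv: "(\<lambda>n. \<integral>\<omega>. h (\<pi> (X n \<omega>)) \<partial>M n) \<longlonglongrightarrow> (\<integral>\<omega>. h (\<pi> (Y \<omega>)) \<partial>N)"
      unfolding \<pi>_eq
    proof (rule fdd[OF \<tau>, of "\<lambda>y. h (\<Psi> y)" L' d B'])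
      show "\<bar>h (\<Psi> x) - h (\<Psi> y)\<bar> \<le> L' * (\<Sum>k<d. \<bar>x k - y k\<bar>)" for x y
      proof (rule lip'[OF \<Psi>_in \<Psi>_in])
        fix t assume t: "t \<in> T"
        have "\<bar>x (idx t) - y (idx t)\<bar> \<le> (\<Sum>k<d. \<bar>x k - y k\<bar>)"
          using idx[OF t] by (intro member_le_sum) auto
        then show "\<bar>\<Psi> x t - \<Psi> y t\<bar> \<le> (\<Sum>k<d. \<bar>x k - y k\<bar>)" using t by (simp add: \<Psi>_def)
      qed
    qed (use B' \<Psi>_in in auto)
    have cY: "\<bar>(\<integral>\<omega>. h (Y \<omega>) \<partial>N) - (\<integral>\<omega>. h (\<pi> (Y \<omega>)) \<partial>N)\<bar> \<le> r / 4"
      by (intro close[of N Y] M(2) Y Yt AY)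
    have "\<forall>\<^sub>F n in sequentially. \<bar>(\<integral>\<omega>. h (X n \<omega>) \<partial>M n) - (\<integral>\<omega>. h (\<pi> (X n \<omega>)) \<partial>M n)\<bar> \<le> r / 4"
      using AX
    proof eventually_elim
      case (elim n)
      show ?case by (intro close[of "M n" "X n"] M(1) X Xt elim)
    qed
    moreover have "\<forall>\<^sub>F n in sequentially. \<bar>(\<integral>\<omega>. h (\<pi> (X n \<omega>)) \<partial>M n) - (\<integral>\<omega>. h (\<pi> (Y \<omega>)) \<partial>N)\<bar> < r / 4"
      using conv[unfolded tendsto_iff dist_real_def, rule_format, of "r / 4"] \<open>r > 0\<close> by simp
    ultimately have "\<forall>\<^sub>F n in sequentially. norm ((\<integral>\<omega>. h (X n \<omega>) \<partial>M n) - (\<integral>\<omega>. h (Y \<omega>) \<partial>N)) < r"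
    proof eventually_elim
      case (elim n)
      then show ?case using cY \<open>r > 0\<close> unfolding real_norm_def by linarith
    qed
    then show "\<exists>n0. \<forall>n\<ge>n0. norm ((\<integral>\<omega>. h (X n \<omega>) \<partial>M n) - (\<integral>\<omega>. h (Y \<omega>) \<partial>N)) < r"
      by (simp add: eventually_sequentially)
  qed
qed

section \<open>Haar coefficients\<close>

text \<open>Total variation at most 1 on the unit interval is the only regularity used below: sums
  of drops over dyadic intervals telescope. Values outside \<open>{0..1}\<close> are free, hence the
  separate measurability.\<close>

definition decreasing01 :: "(real \<Rightarrow> real) \<Rightarrow> bool" where
  "decreasing01 f \<longleftrightarrow> f \<in> borel_measurable borel \<and> antimono_on {0..1} f \<and> f ` {0..1} \<subseteq> {0..1}"

lemma decreasing01D: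
  assumes "decreasing01 f"
  shows "f \<in> borel_measurable borel" "\<And>x y. 0 \<le> x \<Longrightarrow> x \<le> y \<Longrightarrow> y \<le> 1 \<Longrightarrow> f y \<le> f x"
    "\<And>x. 0 \<le> x \<Longrightarrow> x \<le> 1 \<Longrightarrow> 0 \<le> f x" "\<And>x. 0 \<le> x \<Longrightarrow> x \<le> 1 \<Longrightarrow> f x \<le> 1"
  using assms unfolding decreasing01_def by (auto simp: monotone_on_def image_subset_iff)

lemma decreasing01_const: "decreasing01 (\<lambda>_. 1)"
  by (auto simp: decreasing01_def monotone_on_def)

lemma decreasing01_mult_integrable:
  assumes f: "decreasing01 f" and g: "decreasing01 g" and uv: "0 \<le> u" "v \<le> 1"
  shows "set_integrable lborel {u..v} (\<lambda>x. f x * g x)" "(\<lambda>x. f x * g x) integrable_on {u..v}"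
    "integral {u..v} (\<lambda>x. f x * g x) = (LINT x:{u..v}|lborel. f x * g x)"
proof -
  show s: "set_integrable lborel {u..v} (\<lambda>x. f x * g x)"
    unfolding set_integrable_def
  proof (rule Bochner_Integration.integrable_bound)
    show "integrable lborel (\<lambda>x. indicator {u..v} x :: real)"
      by (intro integrable_real_indicator) (auto simp: emeasure_lborel_Icc_eq)
    show "(\<lambda>x. indicator {u..v} x *\<^sub>R (f x * g x)) \<in> borel_measurable lborel"
      using decreasing01D(1)[OF f] decreasing01D(1)[OF g] by measurable
    show "AE x in lborel. norm (indicator {u..v} x *\<^sub>R (f x * g x)) \<le> norm (indicator {u..v} x :: real)"
      using decreasing01D(3,4)[OF f] decreasing01D(3,4)[OF g] uv
      by (intro AE_I2) (auto simp: indicator_def abs_mult mult_le_one)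
  qed
  show "(\<lambda>x. f x * g x) integrable_on {u..v}" "integral {u..v} (\<lambda>x. f x * g x) = (LINT x:{u..v}|lborel. f x * g x)"
    using set_borel_integral_eq_integral[OF s] by auto
qed

lemma decreasing01_integrable:
  assumes f: "decreasing01 f" and uv: "0 \<le> u" "v \<le> 1"
  shows "f integrable_on {u..v}" "integral {u..v} f = (LINT x:{u..v}|lborel. f x)"
  using decreasing01_mult_integrable[OF f decreasing01_const uv] by simp_all

lemma decreasing01_integral_bounds:
  assumes f: "decreasing01 f" and uv: "0 \<le> u" "u \<le> v" "v \<le> 1"
  shows "(v - u) * f v \<le> integral {u..v} f" "integral {u..v} f \<le> (v - u) * f u"
proof -
  note int = decreasing01_integrable(1)[OF f uv(1,3)]
  have "integral {u..v} (\<lambda>_. f v) \<le> integral {u..v} f"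
    using decreasing01D(2)[OF f] uv by (intro integral_le int) auto
  then show "(v - u) * f v \<le> integral {u..v} f" using uv by simp
  have "integral {u..v} f \<le> integral {u..v} (\<lambda>_. f u)"
    using decreasing01D(2)[OF f] uv by (intro integral_le int) auto
  then show "integral {u..v} f \<le> (v - u) * f u" using uv by simp
qed

definition cell :: "(real \<Rightarrow> real) \<Rightarrow> nat \<Rightarrow> nat \<Rightarrow> real" where
  "cell f n k = integral {real k / 2 ^ n..real (Suc k) / 2 ^ n} f"

lemma dyadic_le_1: "k < 2 ^ n \<Longrightarrow> real (Suc k) / 2 ^ n \<le> 1"
proof -
  assume "k < 2 ^ n"
  then have "real (Suc k) \<le> real (2 ^ n)" by (simp only: of_nat_le_iff Suc_le_eq)
  then show ?thesis by simp
qed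

lemma cell_bounds:
  assumes f: "decreasing01 f" and k: "k < 2 ^ n"
  shows "f (real (Suc k) / 2 ^ n) / 2 ^ n \<le> cell f n k" "cell f n k \<le> f (real k / 2 ^ n) / 2 ^ n"
proof -
  have "real (Suc k) / 2 ^ n - real k / 2 ^ n = 1 / 2 ^ n" by (simp add: diff_divide_distrib[symmetric])
  then show "f (real (Suc k) / 2 ^ n) / 2 ^ n \<le> cell f n k" "cell f n k \<le> f (real k / 2 ^ n) / 2 ^ n"
    using decreasing01_integral_bounds[OF f, of "real k / 2 ^ n" "real (Suc k) / 2 ^ n"] dyadic_le_1[OF k]
    by (simp_all add: cell_def divide_right_mono)
qed

lemma cell_split:
  assumes f: "decreasing01 f" and k: "k < 2 ^ n"
  shows "cell f n k = cell f (Suc n) (2 * k) + cell f (Suc n) (Suc (2 * k))"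
proof -
  have e: "real (2 * k) / 2 ^ Suc n = real k / 2 ^ n" "real (Suc (Suc (2 * k))) / 2 ^ Suc n = real (Suc k) / 2 ^ n"
    by (simp_all add: field_simps)
  have "integral {real k / 2 ^ n..real (Suc (2 * k)) / 2 ^ Suc n} f + integral {real (Suc (2 * k)) / 2 ^ Suc n..real (Suc k) / 2 ^ n} f
    = integral {real k / 2 ^ n..real (Suc k) / 2 ^ n} f"
    using decreasing01_integrable(1)[OF f, of "real k / 2 ^ n" "real (Suc k) / 2 ^ n"] dyadic_le_1[OF k]
    by (intro Henstock_Kurzweil_Integration.integral_combine) (simp_all add: field_simps)
  then show ?thesis unfolding cell_def e by simp
qed

text \<open>The L2 inner product of the projections of \<open>f\<close> and \<open>g\<close> onto
  functions that are constant on the dyadic intervals of length \<open>2 ^ -n\<close>.\<close>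

definition cell_product :: "nat \<Rightarrow> (real \<Rightarrow> real) \<Rightarrow> (real \<Rightarrow> real) \<Rightarrow> real" where
  "cell_product n f g = 2 ^ n * (\<Sum>k<2 ^ n. cell f n k * cell g n k)"

lemma integral_cells:
  fixes h :: "real \<Rightarrow> real"
  assumes h: "h integrable_on {0..1}" and "m \<le> 2 ^ n"
  shows "integral {0..real m / 2 ^ n} h = (\<Sum>k<m. integral {real k / 2 ^ n..real (Suc k) / 2 ^ n} h)"
  using assms(2)
proof (induction m)
  case (Suc m)
  have le: "real (Suc m) / 2 ^ n \<le> 1" using Suc.prems by (intro dyadic_le_1) auto
  have "integral {0..real m / 2 ^ n} h + integral {real m / 2 ^ n..real (Suc m) / 2 ^ n} h = integral {0..real (Suc m) / 2 ^ n} h"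
    using le by (intro Henstock_Kurzweil_Integration.integral_combine integrable_subinterval_real[OF h]) (auto simp: divide_right_mono)
  then show ?case using Suc by simp
qed simp

text \<open>On each dyadic interval, replacing \<open>g\<close> by its mean costs at most the drop
  of \<open>g\<close> there times the length; the drops telescope to at most 1.\<close>

lemma cell_product_approx:
  assumes f: "decreasing01 f" and g: "decreasing01 g"
  shows "\<bar>cell_product n f g - integral {0..1} (\<lambda>x. f x * g x)\<bar> \<le> 1 / 2 ^ n"
proof -
  define l where "l k = real k / 2 ^ n" for k
  have l1: "l (Suc k) \<le> 1" if "k < 2 ^ n" for k using dyadic_le_1[OF that] by (simp add: l_def)
  have l0: "0 \<le> l k" and lS: "l k \<le> l (Suc k)" and ld: "l (Suc k) - l k = 1 / 2 ^ n" for k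
    by (auto simp: l_def divide_right_mono diff_divide_distrib[symmetric])
  have cellb: "\<bar>2 ^ n * (cell f n k * cell g n k) - integral {l k..l (Suc k)} (\<lambda>x. f x * g x)\<bar> \<le> (g (l k) - g (l (Suc k))) / 2 ^ n"
    if k: "k < 2 ^ n" for k
  proof -
    \<comment> \<open>The mean of \<open>g\<close> over the interval.\<close>
    define \<gamma> where "\<gamma> = 2 ^ n * cell g n k"
    have \<gamma>: "g (l (Suc k)) \<le> \<gamma>" "\<gamma> \<le> g (l k)"
      using cell_bounds[OF g k] by (simp_all add: \<gamma>_def l_def field_simps)
    note fi = decreasing01_integrable(1)[OF f l0 l1[OF k]]
    note fgi = decreasing01_mult_integrable(2)[OF f g l0 l1[OF k]]
    have int: "(\<lambda>x. f x * \<gamma> - f x * g x) integrable_on {l k..l (Suc k)}"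
      by (intro integrable_diff integrable_on_mult_left fi fgi)
    have "2 ^ n * (cell f n k * cell g n k) - integral {l k..l (Suc k)} (\<lambda>x. f x * g x)
      = integral {l k..l (Suc k)} (\<lambda>x. f x * \<gamma> - f x * g x)"
      using integral_diff[OF integrable_on_mult_left[OF fi, of \<gamma>] fgi]
      by (simp add: \<gamma>_def cell_def l_def)
    also have "\<bar>\<dots>\<bar> \<le> integral {l k..l (Suc k)} (\<lambda>_. g (l k) - g (l (Suc k)))"
    proof -
      have "norm (f x * \<gamma> - f x * g x) \<le> g (l k) - g (l (Suc k))" if x: "x \<in> {l k..l (Suc k)}" for x
      proof -
        have x01: "0 \<le> x" "x \<le> 1" using x l0[of k] l1[OF k] by auto
        have "\<bar>\<gamma> - g x\<bar> \<le> g (l k) - g (l (Suc k))"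
          using \<gamma> decreasing01D(2)[OF g, of "l k" x] decreasing01D(2)[OF g, of x "l (Suc k)"] x l0[of k] l1[OF k] x01
          by (auto simp: abs_le_iff)
        moreover have "\<bar>f x * \<gamma> - f x * g x\<bar> \<le> 1 * \<bar>\<gamma> - g x\<bar>"
          unfolding right_diff_distrib[symmetric] abs_mult
          using decreasing01D(3,4)[OF f x01] by (intro mult_right_mono) auto
        ultimately show ?thesis by simp
      qed
      from integral_norm_bound_integral[OF int integrable_const_ivl this] show ?thesis using lS[of k] by simp
    qed
    also have "\<dots> = (g (l k) - g (l (Suc k))) / 2 ^ n" using lS[of k] ld[of k] by simp
    finally show ?thesis .
  qed
  have "integral {0..1} (\<lambda>x. f x * g x) = (\<Sum>k<2 ^ n. integral {l k..l (Suc k)} (\<lambda>x. f x * g x))"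
    using integral_cells[OF decreasing01_mult_integrable(2)[OF f g order_refl order_refl], of "2 ^ n" n] by (simp add: l_def)
  then have "\<bar>cell_product n f g - integral {0..1} (\<lambda>x. f x * g x)\<bar> =
    \<bar>\<Sum>k<2 ^ n. (2 ^ n * (cell f n k * cell g n k) - integral {l k..l (Suc k)} (\<lambda>x. f x * g x))\<bar>"
    by (simp add: cell_product_def sum_subtractf sum_distrib_left)
  also have "\<dots> \<le> (\<Sum>k<2 ^ n. \<bar>2 ^ n * (cell f n k * cell g n k) - integral {l k..l (Suc k)} (\<lambda>x. f x * g x)\<bar>)"
    by (rule sum_abs)
  also have "\<dots> \<le> (\<Sum>k<2 ^ n. (g (l k) - g (l (Suc k))) / 2 ^ n)" by (intro sum_mono cellb) auto
  also have "\<dots> = (g (l 0) - g (l (2 ^ n))) / 2 ^ n"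
    unfolding sum_divide_distrib[symmetric] by (subst sum_lessThan_telescope') simp
  also have "\<dots> \<le> 1 / 2 ^ n"
    using decreasing01D(3)[OF g, of 1] decreasing01D(4)[OF g, of 0] by (intro divide_right_mono) (auto simp: l_def)
  finally show ?thesis .
qed

lemma cell_product_tendsto:
  assumes f: "decreasing01 f" and g: "decreasing01 g"
  shows "(\<lambda>n. cell_product n f g) \<longlonglongrightarrow> integral {0..1} (\<lambda>x. f x * g x)"
proof (rule LIM_zero_cancel, rule Lim_null_comparison)
  show "\<forall>\<^sub>F n in sequentially. norm (cell_product n f g - integral {0..1} (\<lambda>x. f x * g x)) \<le> (1 / 2) ^ n"
    using cell_product_approx[OF f g] by (simp add: power_one_over)
  show "(\<lambda>n. (1 / 2 :: real) ^ n) \<longlonglongrightarrow> 0" by (intro LIMSEQ_realpow_zero) auto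
qed

text \<open>Haar coefficients: level \<open>0\<close> is the constant function, and level \<open>n + 1\<close> consists of the
  \<open>2 ^ n\<close> wavelets supported on dyadic intervals of length \<open>2 ^ -n\<close>.\<close>

definition haar :: "(real \<Rightarrow> real) \<Rightarrow> nat \<Rightarrow> nat \<Rightarrow> real" where
  "haar f n k = (case n of 0 \<Rightarrow> cell f 0 k
     | Suc n \<Rightarrow> sqrt (2 ^ n) * (cell f (Suc n) (2 * k) - cell f (Suc n) (Suc (2 * k))))"

lemma sum_even_odd: "(\<Sum>j<2 * N. h j) = (\<Sum>k<N. h (2 * k) + h (Suc (2 * k)) :: real)"
  by (induction N) auto

text \<open>Parseval's identity, exact at every finite level, so that covariances of truncated
  series are cell products. As \<open>0 - 1 = 0\<close> for naturals, \<open>2 ^ (m - 1)\<close>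
  correctly counts one coefficient at level 0.\<close>

lemma haar_parseval:
  assumes f: "decreasing01 f" and g: "decreasing01 g"
  shows "(\<Sum>m<Suc n. \<Sum>k<2 ^ (m - 1). haar f m k * haar g m k) = cell_product n f g"
proof (induction n)
  case 0
  then show ?case by (simp add: haar_def cell_product_def)
next
  case (Suc n)
  have "(\<Sum>k<2 ^ n. haar f (Suc n) k * haar g (Suc n) k) + cell_product n f g = cell_product (Suc n) f g"
  proof -
    have s: "sqrt (2 ^ n) * x * (sqrt (2 ^ n) * y) = 2 ^ n * (x * y)" for x y :: real
    proof -
      have "sqrt (2 ^ n) * x * (sqrt (2 ^ n) * y) = (sqrt (2 ^ n) * sqrt (2 ^ n)) * (x * y)"
        by (simp only: mult_ac)
      then show ?thesis by simp
    qed
    have e1: "haar f (Suc n) k * haar g (Suc n) k = 2 ^ n * ((cell f (Suc n) (2 * k) - cell f (Suc n) (Suc (2 * k)))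
      * (cell g (Suc n) (2 * k) - cell g (Suc n) (Suc (2 * k))))" for k
      unfolding haar_def nat.case by (rule s)
    have e2: "cell f n k * cell g n k = (cell f (Suc n) (2 * k) + cell f (Suc n) (Suc (2 * k)))
      * (cell g (Suc n) (2 * k) + cell g (Suc n) (Suc (2 * k)))" if "k < 2 ^ n" for k
      by (simp only: cell_split[OF f that] cell_split[OF g that])
    \<comment> \<open>With \<open>z = 2 ^ n\<close>: sums of neighbouring cells are the cells one
      level up, differences are the Haar coefficients, and together they give the cells of level
      \<open>n + 1\<close> with the doubled factor.\<close>
    have polar: "z * ((x - x') * (y - y')) + z * ((x + x') * (y + y')) = (2 * z) * (x * y + x' * y')" for x x' y y' z :: real
      by (simp add: algebra_simps)
    have "(\<Sum>k<2 ^ n. haar f (Suc n) k * haar g (Suc n) k) + cell_product n f g =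
      (\<Sum>k<2 ^ n. haar f (Suc n) k * haar g (Suc n) k + 2 ^ n * (cell f n k * cell g n k))"
      by (simp add: cell_product_def sum_distrib_left sum.distrib)
    also have "\<dots> = (\<Sum>k<2 ^ n. (2 * 2 ^ n) * (cell f (Suc n) (2 * k) * cell g (Suc n) (2 * k)
        + cell f (Suc n) (Suc (2 * k)) * cell g (Suc n) (Suc (2 * k))))"
      by (intro sum.cong refl) (simp only: lessThan_iff e1 e2 polar)
    also have "\<dots> = (2 * 2 ^ n) * (\<Sum>k<2 * 2 ^ n. cell f (Suc n) k * cell g (Suc n) k)"
      unfolding sum_even_odd by (rule sum_distrib_left[symmetric])
    also have "\<dots> = cell_product (Suc n) f g" by (simp add: cell_product_def)
    finally show ?thesis .
  qed
  then show ?case using Suc.IH by simp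
qed

text \<open>A coefficient is at most the drop of \<open>f\<close> over its support times the
  normalisation \<open>sqrt (2 ^ m)\<close> and the length \<open>1 / 2 ^ (m + 1)\<close>. The drops
  telescope, so even the sum of absolute values over a level decays geometrically; this is what
  makes the paths continuous.\<close>

lemma haar_abs_sum:
  assumes f: "decreasing01 f"
  shows "(\<Sum>k<2 ^ (n - 1). \<bar>haar f n k\<bar>) \<le> (1 / sqrt 2) ^ n"
proof (cases n)
  case 0
  have "0 \<le> cell f 0 0" "cell f 0 0 \<le> 1"
    using cell_bounds[OF f, of 0 0] decreasing01D(3)[OF f, of 1] decreasing01D(4)[OF f, of 0] by simp_all
  then show ?thesis using 0 by (simp add: haar_def)
next
  case (Suc m)
  have step: "\<bar>haar f n k\<bar> \<le> sqrt (2 ^ m) * ((f (real k / 2 ^ m) - f (real (Suc k) / 2 ^ m)) / 2 ^ Suc m)" if k: "k < 2 ^ m" for k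
  proof -
    have k2: "2 * k < 2 ^ Suc m" "Suc (2 * k) < 2 ^ Suc m" using k by auto
    have e: "real (2 * k) / 2 ^ Suc m = real k / 2 ^ m" "real (Suc (Suc (2 * k))) / 2 ^ Suc m = real (Suc k) / 2 ^ m"
      by (simp_all add: field_simps)
    have "\<bar>cell f (Suc m) (2 * k) - cell f (Suc m) (Suc (2 * k))\<bar> \<le> (f (real k / 2 ^ m) - f (real (Suc k) / 2 ^ m)) / 2 ^ Suc m"
      using cell_bounds[OF f k2(1)] cell_bounds[OF f k2(2)] unfolding e diff_divide_distrib
      by linarith
    moreover have "\<bar>haar f n k\<bar> = sqrt (2 ^ m) * \<bar>cell f (Suc m) (2 * k) - cell f (Suc m) (Suc (2 * k))\<bar>"
      using Suc by (simp add: haar_def abs_mult)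
    ultimately show ?thesis by (simp only:) (rule mult_left_mono, auto)
  qed
  have "(\<Sum>k<2 ^ (n - 1). \<bar>haar f n k\<bar>) \<le> (\<Sum>k<2 ^ m. sqrt (2 ^ m) * ((f (real k / 2 ^ m) - f (real (Suc k) / 2 ^ m)) / 2 ^ Suc m))"
    using Suc step by (auto intro!: sum_mono)
  also have "\<dots> = sqrt (2 ^ m) * ((f (real 0 / 2 ^ m) - f (real (2 ^ m) / 2 ^ m)) / 2 ^ Suc m)"
    unfolding sum_distrib_left[symmetric] sum_divide_distrib[symmetric]
    using sum_lessThan_telescope'[of "\<lambda>k. f (real k / 2 ^ m)" "2 ^ m"] by simp
  also have "\<dots> \<le> sqrt (2 ^ m) * (1 / 2 ^ Suc m)"
    using decreasing01D(3)[OF f, of 1] decreasing01D(4)[OF f, of 0]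
    by (intro mult_left_mono divide_right_mono) auto
  also have "\<dots> = (1 / sqrt 2) ^ m * (1 / 2)"
  proof -
    have "sqrt (2 ^ m) * sqrt (2 ^ m) = (2 :: real) ^ m" by simp
    then have "sqrt (2 ^ m) * (1 / 2 ^ Suc m) = 1 / sqrt (2 ^ m) * (1 / 2)" by (simp add: field_simps)
    then show ?thesis by (simp add: real_sqrt_power power_one_over)
  qed
  also have "\<dots> \<le> (1 / sqrt 2) ^ m * (1 / sqrt 2)"
    using real_sqrt_le_mono[of 2 4] by (intro mult_left_mono) (auto intro!: divide_left_mono)
  finally show ?thesis using Suc by simp
qed

text \<open>Convergence almost everywhere is the right hypothesis: the steps converge everywhere
  except at the jump of their limit.\<close>

lemma cell_continuous:
  assumes X: "\<And>j::nat. decreasing01 (F j)" and F0: "decreasing01 f"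
    and lim: "AE x in lborel. (\<lambda>j. F j x) \<longlonglongrightarrow> f x" and k: "k < 2 ^ n"
  shows "(\<lambda>j. cell (F j) n k) \<longlonglongrightarrow> cell f n k"
proof -
  define u v where "u = real k / 2 ^ n" and "v = real (Suc k) / 2 ^ n"
  have uv: "0 \<le> u" "v \<le> 1" using dyadic_le_1[OF k] by (simp_all add: u_def v_def)
  have "(\<lambda>j. LINT x:{u..v}|lborel. F j x) \<longlonglongrightarrow> (LINT x:{u..v}|lborel. f x)"
    unfolding set_lebesgue_integral_def
  proof (rule integral_dominated_convergence[where w = "indicator {u..v}"])
    show "integrable lborel (indicator {u..v} :: real \<Rightarrow> real)"
      by (intro integrable_real_indicator) (auto simp: emeasure_lborel_Icc_eq)
    show "AE x in lborel. (\<lambda>j. indicator {u..v} x *\<^sub>R F j x) \<longlonglongrightarrow> indicator {u..v} x *\<^sub>R f x"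
      using lim by eventually_elim (intro tendsto_intros)
    show "AE x in lborel. norm (indicator {u..v} x *\<^sub>R F j x) \<le> indicator {u..v} x" for j
      using decreasing01D(3,4)[OF X] uv by (intro AE_I2) (auto simp: indicator_def)
  qed (use decreasing01D(1)[OF X] decreasing01D(1)[OF F0] in measurable)
  then show ?thesis
    using decreasing01_integrable(2)[OF X uv] decreasing01_integrable(2)[OF F0 uv]
    by (simp add: cell_def u_def v_def)
qed

lemma haar_continuous:
  assumes X: "\<And>j::nat. decreasing01 (F j)" and F0: "decreasing01 f"
    and lim: "AE x in lborel. (\<lambda>j. F j x) \<longlonglongrightarrow> f x" and k: "k < 2 ^ (n - 1)"
  shows "(\<lambda>j. haar (F j) n k) \<longlonglongrightarrow> haar f n k"
proof (cases n)
  case 0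
  then show ?thesis using cell_continuous[OF X F0 lim, of k 0] k by (simp add: haar_def)
next
  case (Suc m)
  have "2 * k < 2 ^ n" "Suc (2 * k) < 2 ^ n" using k Suc by auto
  from cell_continuous[OF X F0 lim this(1)] cell_continuous[OF X F0 lim this(2)] show ?thesis
    unfolding haar_def Suc by (simp add: tendsto_intros)
qed

text \<open>The threshold \<open>s\<^sup>2\<close> makes \<open>(min s s')\<^sup>2\<close> the inner product of \<open>step01 s\<close> and \<open>step01 s'\<close>.\<close>

definition step01 :: "real \<Rightarrow> real \<Rightarrow> real" where
  "step01 s x = (if x \<le> s\<^sup>2 then 1 else 0)"

text \<open>The factor in the integrand of \<open>c\<close>. The guard \<open>x < t\<close> encodes
  the upper limit of that integral and, for \<open>t \<le> 1\<close>, keeps \<open>x\<close> away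
  from the pole at 1.\<close>

definition ramp01 :: "real \<Rightarrow> real \<Rightarrow> real" where
  "ramp01 t x = (if x < t then (t - x) / (1 - x) else 0)"

lemma decreasing01_step: "decreasing01 (step01 s)"
proof -
  have "step01 s \<in> borel_measurable borel" unfolding step01_def by measurable
  then show ?thesis by (auto simp: decreasing01_def step01_def monotone_on_def)
qed

lemma ramp01_mono:
  fixes t :: real
  assumes "t \<le> 1" "x \<le> y" "y < t"
  shows "(t - y) / (1 - y) \<le> (t - x) / (1 - x)"
proof -
  have "t * (y - x) \<le> 1 * (y - x)" using assms by (intro mult_right_mono) auto
  then have "(t - y) * (1 - x) \<le> (t - x) * (1 - y)" by (simp add: algebra_simps)
  then show ?thesis using assms by (simp add: divide_simps)
qed

lemma decreasing01_ramp: "t \<le> 1 \<Longrightarrow> decreasing01 (ramp01 t)"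
proof -
  assume t: "t \<le> 1"
  have "ramp01 t \<in> borel_measurable borel" unfolding ramp01_def by measurable
  moreover have "antimono_on {0..1} (ramp01 t)"
    using t ramp01_mono[OF t] by (auto simp: ramp01_def monotone_on_def)
  moreover have "ramp01 t x \<in> {0..1}" if "x \<in> {0..1}" for x
    using t that by (auto simp: ramp01_def divide_simps)
  ultimately show ?thesis by (auto simp: decreasing01_def)
qed

lemma step01_inner:
  assumes "s \<in> {0..1}" "s' \<in> {0..1}"
  shows "integral {0..1} (\<lambda>x. step01 s x * step01 s' x) = (min s s')\<^sup>2"
proof -
  define m where "m = (min s s')\<^sup>2"
  have m: "0 \<le> m" "m \<le> 1" using assms by (auto simp: m_def power_le_one min_def)
  have mm: "m = min (s\<^sup>2) (s'\<^sup>2)"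
    using assms by (auto simp: m_def min_def power_mono intro!: antisym)
  have "integral {0..1} (\<lambda>x. step01 s x * step01 s' x) = (LINT x:{0..1}|lborel. step01 s x * step01 s' x)"
    by (intro decreasing01_mult_integrable decreasing01_step) auto
  also have "\<dots> = (LINT x|lborel. indicator {0..m} x)"
    unfolding set_lebesgue_integral_def using m
    by (intro Bochner_Integration.integral_cong) (auto simp: indicator_def step01_def mm)
  also have "\<dots> = m" using m by simp
  finally show ?thesis by (simp add: m_def)
qed

lemma ramp01_inner:
  assumes "t \<in> {0..1}" "t' \<in> {0..1}"
  shows "integral {0..1} (\<lambda>x. ramp01 t x * ramp01 t' x) = c t t'"
proof -
  have "integral {0..1} (\<lambda>x. ramp01 t x * ramp01 t' x) = (LINT x:{0..1}|lborel. ramp01 t x * ramp01 t' x)"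
    using assms by (intro decreasing01_mult_integrable decreasing01_ramp) auto
  also have "\<dots> = c t t'"
    unfolding c_def set_lebesgue_integral_def
  proof (intro Bochner_Integration.integral_cong refl)
    fix x :: real
    show "indicat_real {0..1} x *\<^sub>R (ramp01 t x * ramp01 t' x) =
      indicat_real {0..min t t'} x *\<^sub>R ((t - x) * (t' - x) / (1 - x)\<^sup>2)"
      using assms by (auto simp: ramp01_def indicator_def power2_eq_square min_def split: if_splits)
  qed
  finally show ?thesis .
qed

lemma haar_step_continuous:
  assumes "k < 2 ^ (n - 1)" "X \<longlonglongrightarrow> s"
  shows "(\<lambda>j. haar (step01 (X j)) n k) \<longlonglongrightarrow> haar (step01 s) n k"
proof (rule haar_continuous[OF decreasing01_step decreasing01_step _ assms(1)])
  have lim2: "(\<lambda>j. (X j)\<^sup>2) \<longlonglongrightarrow> s\<^sup>2" using assms(2) by (intro tendsto_intros)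
  show "AE x in lborel. (\<lambda>j. step01 (X j) x) \<longlonglongrightarrow> step01 s x"
    using AE_lborel_singleton[of "s\<^sup>2"]
  proof eventually_elim
    case (elim x)
    then consider "x < s\<^sup>2" | "x > s\<^sup>2" by linarith
    then show ?case
    proof cases
      case 1
      show ?thesis
        using order_tendstoD(1)[OF lim2 1] 1
        by (intro tendsto_eventually) (auto simp: step01_def elim!: eventually_mono)
    next
      case 2
      show ?thesis
        using order_tendstoD(2)[OF lim2 2] 2
        by (intro tendsto_eventually) (auto simp: step01_def elim!: eventually_mono)
    qed
  qed
qed

lemma haar_ramp_continuous:
  assumes "k < 2 ^ (n - 1)" "X \<longlonglongrightarrow> t" "\<And>j. X j \<le> 1" "t \<le> 1"
  shows "(\<lambda>j. haar (ramp01 (X j)) n k) \<longlonglongrightarrow> haar (ramp01 t) n k"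
proof (rule haar_continuous[OF decreasing01_ramp decreasing01_ramp _ assms(1)])
  show "AE x in lborel. (\<lambda>j. ramp01 (X j) x) \<longlonglongrightarrow> ramp01 t x"
  proof (rule AE_I2)
    fix x :: real
    \<comment> \<open>In this form the ramp is visibly continuous in \<open>t\<close> for fixed
      \<open>x\<close>; at \<open>x = 1\<close> it is 0 because division by zero yields 0.\<close>
    have eq: "ramp01 t x = max 0 (t - x) / (1 - x)" for t by (simp add: ramp01_def max_def)
    show "(\<lambda>j. ramp01 (X j) x) \<longlonglongrightarrow> ramp01 t x"
    proof (cases "x = 1")
      case True
      then show ?thesis unfolding eq by simp
    next
      case False
      then show ?thesis
        unfolding eq by (intro tendsto_divide tendsto_max tendsto_diff tendsto_const assms(2)) simp
    qed
  qed
qed (use assms in auto)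

section \<open>Construction of the limit process\<close>

text \<open>The index type comes from the type of the measure in the existence claim of the theorem;
  \<open>noise\<close> embeds the countable family that drives the Haar series.\<close>

definition white_noise :: "(real \<times> real \<Rightarrow> real) measure" where
  "white_noise = PiM UNIV (\<lambda>_. std_normal_distribution)"

interpretation white_noise: prob_space white_noise
  unfolding white_noise_def by (intro prob_space_PiM std_normal.prob_space_axioms)

lemma white_noise_coordinate: "(\<lambda>\<omega>. \<omega> i) \<in> borel_measurable white_noise"
  unfolding white_noise_def using measurable_component_singleton[of i UNIV "\<lambda>_. std_normal_distribution"] by simp

lemma distr_white_noise: "distr white_noise borel (\<lambda>\<omega>. \<omega> i) = std_normal_distribution"
proof -
  have "distr white_noise std_normal_distribution (\<lambda>\<omega>. \<omega> i) = std_normal_distribution"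
    unfolding white_noise_def by (intro distr_PiM_component std_normal.prob_space_axioms) auto
  moreover have "distr white_noise std_normal_distribution (\<lambda>\<omega>. \<omega> i) = distr white_noise borel (\<lambda>\<omega>. \<omega> i)"
    by (rule distr_cong) auto
  ultimately show ?thesis by simp
qed

lemma white_noise_indep: "white_noise.indep_vars (\<lambda>_. borel) (\<lambda>i \<omega>. \<omega> i) UNIV"
proof (subst white_noise.indep_vars_iff_distr_eq_PiM')
  have sets: "sets (PiM UNIV (\<lambda>_. borel)) = sets white_noise"
    unfolding white_noise_def by (intro sets_PiM_cong) auto
  have "(\<lambda>x :: real \<times> real \<Rightarrow> real. \<lambda>i\<in>UNIV. x i) = (\<lambda>x. x)" by (simp add: fun_eq_iff)
  then have "distr white_noise (PiM UNIV (\<lambda>_. borel)) (\<lambda>x. \<lambda>i\<in>UNIV. x i) = white_noise"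
    using distr_id2[OF sets] by (simp only:)
  then show "distr white_noise (PiM UNIV (\<lambda>_. borel)) (\<lambda>x. \<lambda>i\<in>UNIV. x i) = PiM UNIV (\<lambda>i. distr white_noise borel (\<lambda>\<omega>. \<omega> i))"
    by (simp add: distr_white_noise) (simp add: white_noise_def)
qed (auto intro: white_noise_coordinate)

lemma white_noise_char:
  assumes "finite J"
  shows "(\<integral>\<omega>. iexp (t * (\<Sum>i\<in>J. a i * \<omega> i)) \<partial>white_noise) = exp (- (t\<^sup>2 * (\<Sum>i\<in>J. (a i)\<^sup>2)) / 2)"
proof -
  have rv: "(\<lambda>\<omega>. a i * \<omega> i) \<in> borel_measurable white_noise" for i using white_noise_coordinate[of i] by simp
  have ind: "white_noise.indep_vars (\<lambda>_. borel) (\<lambda>i \<omega>. a i * \<omega> i) J"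
    by (rule white_noise.indep_vars_compose2[OF white_noise.indep_vars_subset[OF white_noise_indep subset_UNIV]]) simp
  have one: "char (distr white_noise borel (\<lambda>\<omega>. a i * \<omega> i)) t = exp (- (t\<^sup>2 * (a i)\<^sup>2) / 2)" for i
  proof -
    have "char (distr white_noise borel (\<lambda>\<omega>. a i * \<omega> i)) t = (\<integral>\<omega>. iexp (t * (a i * \<omega> i)) \<partial>white_noise)"
      unfolding char_def using rv by (subst integral_distr) auto
    also have "\<dots> = (\<integral>z. iexp (t * (a i * z)) \<partial>distr white_noise borel (\<lambda>\<omega>. \<omega> i))"
      by (subst integral_distr[OF white_noise_coordinate]) auto
    finally show ?thesis using std_normal_iexp[of t 0 "a i"] by (simp add: distr_white_noise)
  qed
  have "(\<integral>\<omega>. iexp (t * (\<Sum>i\<in>J. a i * \<omega> i)) \<partial>white_noise) = char (distr white_noise borel (\<lambda>\<omega>. \<Sum>i\<in>J. a i * \<omega> i)) t"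
    unfolding char_def using rv by (subst integral_distr) auto
  also have "\<dots> = (\<Prod>i\<in>J. char (distr white_noise borel (\<lambda>\<omega>. a i * \<omega> i)) t)"
    by (rule white_noise.char_distr_sum[OF ind])
  also have "\<dots> = (\<Prod>i\<in>J. complex_of_real (exp (- (t\<^sup>2 * (a i)\<^sup>2) / 2)))" by (simp add: one)
  also have "\<dots> = complex_of_real (exp (\<Sum>i\<in>J. - (t\<^sup>2 * (a i)\<^sup>2) / 2))"
    using assms by (simp add: exp_sum)
  also have "(\<Sum>i\<in>J. - (t\<^sup>2 * (a i)\<^sup>2) / 2) = - (t\<^sup>2 * (\<Sum>i\<in>J. (a i)\<^sup>2)) / 2"
    by (simp add: sum_negf sum_divide_distrib sum_distrib_left)
  finally show ?thesis by simp
qed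

type_synonym haar_index = "nat \<times> nat \<times> nat \<times> nat"

definition noise :: "haar_index \<Rightarrow> (real \<times> real \<Rightarrow> real) \<Rightarrow> real" where
  "noise q \<omega> = \<omega> (real (to_nat q), 0)"

fun level :: "haar_index \<Rightarrow> nat" where
  "level (m, k, n, l) = m + n"

fun haar2 :: "haar_index \<Rightarrow> real \<times> real \<Rightarrow> real" where
  "haar2 (m, k, n, l) (s, t) = haar (step01 s) m k * haar (ramp01 t) n l"

definition box_index :: "nat set \<Rightarrow> nat set \<Rightarrow> haar_index set" where
  "box_index U V = (SIGMA m:U. SIGMA k:{..<2 ^ (m - 1)}. SIGMA n:V. {..<2 ^ (n - 1)})"

text \<open>Summing by the larger of the two levels makes the partial sums range over square boxes,
  on which sums of products of Haar coefficients factor into one-dimensional ones.\<close>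

definition shell :: "nat \<Rightarrow> haar_index set" where
  "shell N = box_index {..<Suc N} {..<Suc N} - box_index {..<N} {..<N}"

lemma finite_box_index [simp]: "finite U \<Longrightarrow> finite V \<Longrightarrow> finite (box_index U V)"
  unfolding box_index_def by (intro finite_SigmaI) auto

lemma finite_shell [simp]: "finite (shell N)"
  by (simp add: shell_def)

lemma sum_box_index:
  assumes "finite U" "finite V"
  shows "(\<Sum>q\<in>box_index U V. f q) = (\<Sum>m\<in>U. \<Sum>n\<in>V. \<Sum>k<2 ^ (m - 1). \<Sum>l<2 ^ (n - 1). f (m, k, n, l) :: real)"
proof -
  have "(\<Sum>q\<in>box_index U V. f q) = (\<Sum>m\<in>U. \<Sum>k<2 ^ (m - 1). \<Sum>n\<in>V. \<Sum>l<2 ^ (n - 1). f (m, k, n, l))"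
    unfolding box_index_def using assms
    by (simp add: sum.Sigma[symmetric] case_prod_unfold finite_SigmaI sum.Sigma)
  also have "\<dots> = (\<Sum>m\<in>U. \<Sum>n\<in>V. \<Sum>k<2 ^ (m - 1). \<Sum>l<2 ^ (n - 1). f (m, k, n, l))"
    by (intro sum.cong refl sum.swap)
  finally show ?thesis .
qed

lemma sum_shells: "(\<Sum>N<K. \<Sum>q\<in>shell N. f q) = (\<Sum>q\<in>box_index {..<K} {..<K}. f q :: real)"
proof (induction K)
  case 0
  then show ?case by (simp add: box_index_def)
next
  case (Suc K)
  have "box_index {..<K} {..<K} \<subseteq> box_index {..<Suc K} {..<Suc K}"
    by (auto simp: box_index_def)
  from sum.subset_diff[OF this, of f] show ?case using Suc.IH by (simp add: shell_def)
qed

text \<open>A shell is covered by two strips, in each of which one level equals \<open>N\<close> and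
  the other runs up to \<open>N\<close>, leaving a geometric sum. Applied with ratio 1/2 to expected
  noise norms and with ratio \<open>2 ^ (-1/4)\<close> to the layers of the series.\<close>

lemma shell_sum_le:
  assumes f: "\<And>q. 0 \<le> f q" and \<rho>: "0 \<le> \<rho>" "\<rho> < 1" and "A \<ge> 0"
    and b: "\<And>m n. (\<Sum>k<2 ^ (m - 1). \<Sum>l<2 ^ (n - 1). f (m, k, n, l)) \<le> A * \<rho> ^ (m + n)"
  shows "(\<Sum>q\<in>shell N. f q) \<le> (2 * A / (1 - \<rho>)) * (\<rho> ^ N :: real)"
proof -
  let ?S1 = "box_index {N} {..<Suc N}" and ?S2 = "box_index {..<Suc N} {N}"
  have geo: "(\<Sum>i<Suc N. \<rho> ^ i) \<le> 1 / (1 - \<rho>)"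
  proof -
    have "(\<Sum>i<Suc N. \<rho> ^ i) \<le> (\<Sum>i. \<rho> ^ i)"
      using \<rho> by (intro sum_le_suminf summable_geometric) auto
    then show ?thesis using \<rho> by (simp add: suminf_geometric)
  qed
  have "shell N \<subseteq> ?S1 \<union> ?S2" by (auto simp: shell_def box_index_def)
  then have "(\<Sum>q\<in>shell N. f q) \<le> (\<Sum>q\<in>?S1 \<union> ?S2. f q)" using f by (intro sum_mono2) auto
  also have "\<dots> \<le> (\<Sum>q\<in>?S1. f q) + (\<Sum>q\<in>?S2. f q)"
    using sum.union_inter[of ?S1 ?S2 f] sum_nonneg[of "?S1 \<inter> ?S2" f] f by simp
  also have "\<dots> \<le> (\<Sum>n<Suc N. A * \<rho> ^ (N + n)) + (\<Sum>m<Suc N. A * \<rho> ^ (m + N))"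
  proof (rule add_mono)
    have eq: "(\<Sum>q\<in>?S1. f q) = (\<Sum>n<Suc N. \<Sum>k<2 ^ (N - 1). \<Sum>l<2 ^ (n - 1). f (N, k, n, l))"
      by (subst sum_box_index) (simp_all del: sum.lessThan_Suc)
    show "(\<Sum>q\<in>?S1. f q) \<le> (\<Sum>n<Suc N. A * \<rho> ^ (N + n))" unfolding eq by (intro sum_mono b)
    have eq: "(\<Sum>q\<in>?S2. f q) = (\<Sum>m<Suc N. \<Sum>k<2 ^ (m - 1). \<Sum>l<2 ^ (N - 1). f (m, k, N, l))"
      by (subst sum_box_index) (simp_all del: sum.lessThan_Suc)
    show "(\<Sum>q\<in>?S2. f q) \<le> (\<Sum>m<Suc N. A * \<rho> ^ (m + N))" unfolding eq by (intro sum_mono b)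
  qed
  also have "\<dots> = 2 * A * \<rho> ^ N * (\<Sum>i<Suc N. \<rho> ^ i)"
  proof -
    have "(\<Sum>n<Suc N. A * \<rho> ^ (N + n)) = A * \<rho> ^ N * (\<Sum>i<Suc N. \<rho> ^ i)"
      unfolding sum_distrib_left by (intro sum.cong refl) (simp add: power_add)
    moreover have "(\<Sum>m<Suc N. A * \<rho> ^ (m + N)) = A * \<rho> ^ N * (\<Sum>i<Suc N. \<rho> ^ i)"
      unfolding sum_distrib_left by (intro sum.cong refl) (simp add: power_add)
    ultimately show ?thesis by (simp del: sum.lessThan_Suc)
  qed
  also have "\<dots> \<le> 2 * A * \<rho> ^ N * (1 / (1 - \<rho>))"
    using \<rho> \<open>A \<ge> 0\<close> by (intro mult_left_mono geo) auto
  finally show ?thesis by simp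
qed

lemma noise_borel [measurable]: "noise q \<in> borel_measurable white_noise"
  unfolding noise_def by (rule white_noise_coordinate)

text \<open>The exponents balance two demands. A pair of levels has at most \<open>2 ^ level\<close>
  coefficients, so dividing by \<open>4 ^ level\<close> makes the expectations summable. The
  resulting growth \<open>4 ^ (level / 8) = 2 ^ (level / 4)\<close> of a coefficient is still beaten
  by the decay \<open>2 ^ (- level / 2)\<close> of the Haar sums.\<close>

definition noise_norm :: "nat \<Rightarrow> (real \<times> real \<Rightarrow> real) \<Rightarrow> real" where
  "noise_norm N \<omega> = (\<Sum>q\<in>shell N. noise q \<omega> ^ 8 / 4 ^ level q)"

text \<open>On this event of probability one, the eighth power of each coefficient is \<open>O(4 ^ level)\<close>, which is
  beaten by the decay of the Haar coefficients; this makes the series below uniformly convergent.\<close>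

definition tame :: "(real \<times> real \<Rightarrow> real) \<Rightarrow> bool" where
  "tame \<omega> \<longleftrightarrow> (\<Sum>N. ennreal (noise_norm N \<omega>)) \<noteq> \<infinity>"

lemma noise_norm_nonneg: "0 \<le> noise_norm N \<omega>"
  unfolding noise_norm_def by (intro sum_nonneg divide_nonneg_nonneg) (auto simp: zero_le_even_power)

lemma tame_borel [measurable]: "Measurable.pred white_noise tame"
proof -
  have "(\<lambda>\<omega>. \<Sum>N. ennreal (noise_norm N \<omega>)) \<in> borel_measurable white_noise"
    unfolding noise_norm_def by measurable
  then show ?thesis unfolding tame_def by measurable
qed

lemma AE_tame: "AE \<omega> in white_noise. tame \<omega>"
  unfolding tame_def
proof (rule nn_integral_noteq_infinite)
  have nm: "noise_norm N \<in> borel_measurable white_noise" for N unfolding noise_norm_def by measurable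
  then show "(\<lambda>\<omega>. \<Sum>N. ennreal (noise_norm N \<omega>)) \<in> borel_measurable white_noise" by measurable
  define \<mu> where "\<mu> = (\<integral>z. z ^ 8 \<partial>std_normal_distribution)"
  have \<mu>0: "\<mu> \<ge> 0" unfolding \<mu>_def by (intro integral_nonneg_AE) (auto simp: zero_le_even_power)
  have int8: "integrable white_noise (\<lambda>\<omega>. noise q \<omega> ^ 8)" and E8: "(\<integral>\<omega>. noise q \<omega> ^ 8 \<partial>white_noise) = \<mu>" for q
  proof -
    have "integrable (distr white_noise borel (\<lambda>\<omega>. \<omega> (real (to_nat q), 0))) (\<lambda>z. z ^ 8)"
      unfolding distr_white_noise by (rule integrable_std_normal_power)
    then show "integrable white_noise (\<lambda>\<omega>. noise q \<omega> ^ 8)"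
      unfolding noise_def by (subst (asm) integrable_distr_eq[OF white_noise_coordinate]) auto
    show "(\<integral>\<omega>. noise q \<omega> ^ 8 \<partial>white_noise) = \<mu>"
      unfolding \<mu>_def distr_white_noise[of "(real (to_nat q), 0)", symmetric] noise_def
      by (subst integral_distr[OF white_noise_coordinate]) auto
  qed
  have bound: "(\<integral>\<omega>. noise_norm N \<omega> \<partial>white_noise) \<le> 4 * \<mu> * (1 / 2) ^ N" for N
  proof -
    have "(\<integral>\<omega>. noise_norm N \<omega> \<partial>white_noise) = (\<Sum>q\<in>shell N. \<mu> / 4 ^ level q)"
      unfolding noise_norm_def using int8 E8 by (subst Bochner_Integration.integral_sum) auto
    also have "\<dots> \<le> (2 * \<mu> / (1 - 1 / 2)) * (1 / 2) ^ N"
    proof (rule shell_sum_le)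
      fix m n :: nat
      have "(\<Sum>k<2 ^ (m - 1). \<Sum>l<2 ^ (n - 1). \<mu> / 4 ^ level (m, k, n, l)) = 2 ^ (m - 1) * 2 ^ (n - 1) * (\<mu> / 4 ^ (m + n))"
        by simp
      also have "\<dots> \<le> 2 ^ m * 2 ^ n * (\<mu> / 4 ^ (m + n))"
        using \<mu>0 by (intro mult_right_mono mult_mono power_increasing) auto
      also have "\<dots> = \<mu> * (1 / 2) ^ (m + n)"
      proof -
        have "(4 :: real) ^ j = 2 ^ j * 2 ^ j" for j by (simp add: power_mult_distrib[symmetric])
        then show ?thesis by (simp add: power_add power_one_over field_simps)
      qed
      finally show "(\<Sum>k<2 ^ (m - 1). \<Sum>l<2 ^ (n - 1). \<mu> / 4 ^ level (m, k, n, l)) \<le> \<mu> * (1 / 2) ^ (m + n)" .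
    qed (use \<mu>0 in auto)
    finally show ?thesis by simp
  qed
  have "(\<integral>\<^sup>+\<omega>. (\<Sum>N. ennreal (noise_norm N \<omega>)) \<partial>white_noise) = (\<Sum>N. \<integral>\<^sup>+\<omega>. ennreal (noise_norm N \<omega>) \<partial>white_noise)"
    using nm by (intro nn_integral_suminf) measurable
  also have "\<dots> = (\<Sum>N. ennreal (\<integral>\<omega>. noise_norm N \<omega> \<partial>white_noise))"
  proof (intro suminf_cong nn_integral_eq_integral)
    show "integrable white_noise (noise_norm N)" for N
      unfolding noise_norm_def using int8 by (intro Bochner_Integration.integrable_sum) auto
  qed (auto simp: noise_norm_nonneg)
  also have "\<dots> \<le> (\<Sum>N. ennreal (4 * \<mu> * (1 / 2) ^ N))"
    by (intro suminf_le ennreal_leI bound summableI)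
  also have "\<dots> = ennreal (\<Sum>N. 4 * \<mu> * (1 / 2) ^ N)"
    using \<mu>0 by (intro suminf_ennreal2 summable_mult summable_geometric) auto
  also have "\<dots> < \<infinity>" by simp
  finally show "(\<integral>\<^sup>+\<omega>. (\<Sum>N. ennreal (noise_norm N \<omega>)) \<partial>white_noise) \<noteq> \<infinity>" by simp
qed

abbreviation fourth_root2 :: real where "fourth_root2 \<equiv> sqrt (sqrt 2)"

lemma tame_bound:
  assumes "tame \<omega>"
  obtains A where "A \<ge> 0" "\<And>N q. q \<in> shell N \<Longrightarrow> \<bar>noise q \<omega>\<bar> \<le> A * fourth_root2 ^ level q"
proof
  define S where "S = (\<Sum>N. noise_norm N \<omega>)"
  \<comment> \<open>As \<open>A \<ge> 1\<close>, the chain \<open>S \<le> A \<le> A ^ 8\<close>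
    avoids taking an eighth root.\<close>
  define A where "A = max 1 S"
  show "A \<ge> 0" by (simp add: A_def)
  have summ: "summable (\<lambda>N. noise_norm N \<omega>)"
    using assms unfolding tame_def by (intro summable_suminf_not_top noise_norm_nonneg) auto
  fix N q assume q: "q \<in> shell N"
  have "noise q \<omega> ^ 8 / 4 ^ level q \<le> noise_norm N \<omega>"
    unfolding noise_norm_def using q
    by (intro member_le_sum[of q "shell N" "\<lambda>q. noise q \<omega> ^ 8 / 4 ^ level q"]) (auto simp: zero_le_even_power)
  also have "\<dots> \<le> S"
    unfolding S_def using sum_le_suminf[OF summ, of "{N}"] noise_norm_nonneg by simp
  also have "\<dots> \<le> A" by (simp add: A_def)
  also have "\<dots> \<le> A ^ 8" unfolding A_def by (rule self_le_power) auto
  finally have "\<bar>noise q \<omega>\<bar> ^ 8 \<le> A ^ 8 * 4 ^ level q" by (simp add: divide_le_eq power_even_abs)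
  also have "\<dots> = (A * fourth_root2 ^ level q) ^ 8"
  proof -
    have "x ^ 8 = ((x\<^sup>2)\<^sup>2)\<^sup>2" for x :: real by (simp flip: power_mult)
    from this[of fourth_root2] have "fourth_root2 ^ 8 = 4" by simp
    then have "(fourth_root2 ^ level q) ^ 8 = 4 ^ level q"
      by (metis power_mult mult.commute)
    then show ?thesis by (simp add: power_mult_distrib)
  qed
  finally show "\<bar>noise q \<omega>\<bar> \<le> A * fourth_root2 ^ level q"
    by (rule power_le_imp_le_base[of _ 7, simplified]) (simp add: \<open>A \<ge> 0\<close>)
qed

definition layer :: "nat \<Rightarrow> (real \<times> real \<Rightarrow> real) \<Rightarrow> real \<times> real \<Rightarrow> real" where
  "layer N \<omega> z = (\<Sum>q\<in>shell N. noise q \<omega> * haar2 q z)"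

lemma layer_bound:
  assumes "tame \<omega>"
  obtains C where "\<And>N z. z \<in> unit_square \<Longrightarrow> \<bar>layer N \<omega> z\<bar> \<le> C * (1 / fourth_root2) ^ N"
proof -
  obtain A where A: "A \<ge> 0" "\<And>N q. q \<in> shell N \<Longrightarrow> \<bar>noise q \<omega>\<bar> \<le> A * fourth_root2 ^ level q"
    using tame_bound[OF assms] by blast
  let ?\<rho> = "1 / fourth_root2"
  have \<rho>: "0 \<le> ?\<rho>" "?\<rho> < 1" by auto
  have "\<bar>layer N \<omega> (s, t)\<bar> \<le> (2 * A / (1 - ?\<rho>)) * ?\<rho> ^ N" if st: "s \<in> {0..1}" "t \<in> {0..1}" for N s t
  proof -
    have "\<bar>layer N \<omega> (s, t)\<bar> \<le> (\<Sum>q\<in>shell N. \<bar>noise q \<omega> * haar2 q (s, t)\<bar>)"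
      unfolding layer_def by (rule sum_abs)
    also have "\<dots> \<le> (\<Sum>q\<in>shell N. A * fourth_root2 ^ level q * \<bar>haar2 q (s, t)\<bar>)"
      unfolding abs_mult using A by (intro sum_mono mult_right_mono) auto
    also have "\<dots> \<le> (2 * A / (1 - ?\<rho>)) * ?\<rho> ^ N"
    proof (rule shell_sum_le[OF _ \<rho> A(1)])
      fix m n :: nat
      have "(\<Sum>k<2 ^ (m - 1). \<Sum>l<2 ^ (n - 1). A * fourth_root2 ^ level (m, k, n, l) * \<bar>haar2 (m, k, n, l) (s, t)\<bar>)
        = A * fourth_root2 ^ (m + n) * ((\<Sum>k<2 ^ (m - 1). \<bar>haar (step01 s) m k\<bar>) * (\<Sum>l<2 ^ (n - 1). \<bar>haar (ramp01 t) n l\<bar>))"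
        unfolding level.simps haar2.simps abs_mult by (subst sum_product) (simp only: sum_distrib_left)
      also have "\<dots> \<le> A * fourth_root2 ^ (m + n) * ((1 / sqrt 2) ^ m * (1 / sqrt 2) ^ n)"
        using A(1) st by (intro mult_left_mono mult_mono haar_abs_sum decreasing01_step decreasing01_ramp) (auto intro!: sum_nonneg)
      also have "\<dots> = A * (fourth_root2 * (1 / sqrt 2)) ^ (m + n)"
        by (simp only: power_add[symmetric] power_mult_distrib mult.assoc)
      also have "fourth_root2 * (1 / sqrt 2) = ?\<rho>"
        using real_sqrt_mult_self[of "sqrt 2"] by (simp add: field_simps)
      finally show "(\<Sum>k<2 ^ (m - 1). \<Sum>l<2 ^ (n - 1). A * fourth_root2 ^ level (m, k, n, l) * \<bar>haar2 (m, k, n, l) (s, t)\<bar>)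
        \<le> A * ?\<rho> ^ (m + n)" .
    qed (use A in auto)
    finally show ?thesis .
  qed
  then show ?thesis using that[of "2 * A / (1 - ?\<rho>)"] by auto
qed

lemma haar2_continuous:
  assumes "q \<in> shell N"
  shows "continuous_on unit_square (haar2 q)"
proof -
  obtain m k n l where q: "q = (m, k, n, l)" by (metis prod.exhaust)
  have kl: "k < 2 ^ (m - 1)" "l < 2 ^ (n - 1)" using assms by (auto simp: q shell_def box_index_def)
  show ?thesis unfolding continuous_on_sequentially
  proof (intro allI ballI impI, elim conjE)
    fix x :: "nat \<Rightarrow> real \<times> real" and z
    assume z: "z \<in> unit_square" "\<forall>j. x j \<in> unit_square" "x \<longlonglongrightarrow> z"
    have le: "snd (x j) \<le> 1" for j using z(2) by (auto simp: mem_Times_iff)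
    have "(\<lambda>j. haar (step01 (fst (x j))) m k * haar (ramp01 (snd (x j))) n l) \<longlonglongrightarrow> haar (step01 (fst z)) m k * haar (ramp01 (snd z)) n l"
      using z le by (intro tendsto_mult haar_step_continuous haar_ramp_continuous kl tendsto_fst tendsto_snd) (auto simp: mem_Times_iff)
    then show "(haar2 q \<circ> x) \<longlonglongrightarrow> haar2 q z"
      unfolding q comp_def by (cases z) (simp add: haar2.simps[of m k n l "fst (x j)" "snd (x j)" for j, simplified])
  qed
qed

text \<open>The factor \<open>1 / sqrt 2\<close> yields the 1/2 in the kernel. The value 0 off the
  event \<open>tame\<close> makes every path continuous, as the definition of the limit process
  demands, and not only almost every one.\<close>

definition gaussian_sheet :: "(real \<times> real \<Rightarrow> real) \<Rightarrow> real \<times> real \<Rightarrow> real" where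
  "gaussian_sheet \<omega> z = (if tame \<omega> then (\<Sum>N. layer N \<omega> z) / sqrt 2 else 0)"

lemma gaussian_sheet_limit:
  assumes "tame \<omega>"
  shows "uniform_limit unit_square (\<lambda>K z. \<Sum>N<K. layer N \<omega> z) (\<lambda>z. \<Sum>N. layer N \<omega> z) sequentially"
proof -
  obtain C where "\<And>N z. z \<in> unit_square \<Longrightarrow> \<bar>layer N \<omega> z\<bar> \<le> C * (1 / fourth_root2) ^ N"
    using layer_bound[OF assms] by blast
  then show ?thesis
    by (intro Weierstrass_m_test[where M = "\<lambda>N. C * (1 / fourth_root2) ^ N"] summable_mult summable_geometric) auto
qed

lemma gaussian_sheet_continuous: "continuous_on unit_square (gaussian_sheet \<omega>)"
proof (cases "tame \<omega>")
  case True
  have "continuous_on unit_square (\<lambda>z. \<Sum>N. layer N \<omega> z)"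
    using gaussian_sheet_limit[OF True]
    by (rule uniform_limit_theorem[rotated])
      (auto simp: layer_def intro!: always_eventually continuous_on_sum continuous_on_mult haar2_continuous)
  then show ?thesis unfolding gaussian_sheet_def using True by (auto intro!: continuous_intros)
next
  case False
  then show ?thesis unfolding gaussian_sheet_def by simp
qed

lemma gaussian_sheet_borel: "(\<lambda>\<omega>. gaussian_sheet \<omega> z) \<in> borel_measurable white_noise"
  unfolding gaussian_sheet_def layer_def by measurable

text \<open>On a square box the sum factors into two one-dimensional Parseval sums, for the steps
  and for the ramps.\<close>

lemma haar2_parseval:
  assumes "y \<in> unit_square" "z \<in> unit_square"
  shows "(\<lambda>K. \<Sum>q\<in>box_index {..<K} {..<K}. haar2 q y * haar2 q z) \<longlonglongrightarrow> 2 * limit_kernel y z"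
proof -
  obtain s t s' t' where yz: "y = (s, t)" "z = (s', t')" by (metis prod.exhaust)
  have st: "s \<in> {0..1}" "t \<in> {0..1}" "s' \<in> {0..1}" "t' \<in> {0..1}" using assms yz by auto
  have "(\<lambda>K. cell_product K (step01 s) (step01 s') * cell_product K (ramp01 t) (ramp01 t')) \<longlonglongrightarrow> (min s s')\<^sup>2 * c t t'"
    unfolding step01_inner[OF st(1,3), symmetric] ramp01_inner[OF st(2,4), symmetric]
    using st by (intro tendsto_mult cell_product_tendsto decreasing01_step decreasing01_ramp) auto
  moreover have "(\<Sum>q\<in>box_index {..<Suc K} {..<Suc K}. haar2 q y * haar2 q z) =
    cell_product K (step01 s) (step01 s') * cell_product K (ramp01 t) (ramp01 t')" for K
  proof -
    have "(\<Sum>q\<in>box_index {..<Suc K} {..<Suc K}. haar2 q y * haar2 q z) =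
      (\<Sum>m<Suc K. \<Sum>n<Suc K. (\<Sum>k<2 ^ (m - 1). haar (step01 s) m k * haar (step01 s') m k) * (\<Sum>l<2 ^ (n - 1). haar (ramp01 t) n l * haar (ramp01 t') n l))"
      unfolding yz by (subst sum_box_index[OF finite_lessThan finite_lessThan])
        (simp only: haar2.simps sum_product, intro sum.cong refl, simp only: mult_ac)
    also have "\<dots> = cell_product K (step01 s) (step01 s') * cell_product K (ramp01 t) (ramp01 t')"
      using st by (simp only: sum_product[symmetric] haar_parseval decreasing01_step decreasing01_ramp atLeastAtMost_iff)
    finally show ?thesis .
  qed
  ultimately have "(\<lambda>K. \<Sum>q\<in>box_index {..<Suc K} {..<Suc K}. haar2 q y * haar2 q z) \<longlonglongrightarrow> 2 * limit_kernel y z"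
    by (simp add: limit_kernel_def yz)
  then show ?thesis by (rule LIMSEQ_imp_Suc)
qed

text \<open>The partial sums over boxes are finite combinations of independent normal variables,
  whose variances converge by Parseval; dominated convergence carries the characteristic function to
  the limit. The kernel is seen to be positive semidefinite on the way, as a limit of sums of
  squares.\<close>

lemma gaussian_sheet_combination:
  fixes u :: "'x \<Rightarrow> real" and \<tau> :: "'x \<Rightarrow> real \<times> real" and x :: real
  assumes A: "finite A" "\<And>a. a \<in> A \<Longrightarrow> \<tau> a \<in> unit_square"
  defines "v \<equiv> \<Sum>a\<in>A. \<Sum>b\<in>A. u a * u b * limit_kernel (\<tau> a) (\<tau> b)"
  shows "v \<ge> 0" and "(\<integral>\<omega>. iexp (x * (\<Sum>a\<in>A. u a * gaussian_sheet \<omega> (\<tau> a))) \<partial>white_noise) = exp (- (x\<^sup>2 * v) / 2)"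
proof -
  define w where "w q = (\<Sum>a\<in>A. u a * haar2 q (\<tau> a)) / sqrt 2" for q
  define B where "B K = box_index {..<K} {..<K}" for K
  have wsq: "(\<Sum>q\<in>B K. (w q)\<^sup>2) = (\<Sum>a\<in>A. \<Sum>b\<in>A. u a * u b * ((\<Sum>q\<in>B K. haar2 q (\<tau> a) * haar2 q (\<tau> b)) / 2))" for K
  proof -
    have "(w q)\<^sup>2 = (\<Sum>a\<in>A. \<Sum>b\<in>A. u a * u b * (haar2 q (\<tau> a) * haar2 q (\<tau> b) / 2))" for q
      unfolding w_def power_divide square_sum by (simp add: sum_divide_distrib mult_ac)
    then have "(\<Sum>q\<in>B K. (w q)\<^sup>2) = (\<Sum>q\<in>B K. \<Sum>a\<in>A. \<Sum>b\<in>A. u a * u b * (haar2 q (\<tau> a) * haar2 q (\<tau> b) / 2))" by simp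
    also have "\<dots> = (\<Sum>a\<in>A. \<Sum>b\<in>A. \<Sum>q\<in>B K. u a * u b * (haar2 q (\<tau> a) * haar2 q (\<tau> b) / 2))"
      by (subst sum.swap) (intro sum.cong refl sum.swap)
    finally show ?thesis by (simp add: sum_distrib_left sum_divide_distrib)
  qed
  have wlim: "(\<lambda>K. \<Sum>q\<in>B K. (w q)\<^sup>2) \<longlonglongrightarrow> v"
  proof -
    have "(\<lambda>K. \<Sum>a\<in>A. \<Sum>b\<in>A. u a * u b * ((\<Sum>q\<in>B K. haar2 q (\<tau> a) * haar2 q (\<tau> b)) / 2)) \<longlonglongrightarrow>
      (\<Sum>a\<in>A. \<Sum>b\<in>A. u a * u b * (2 * limit_kernel (\<tau> a) (\<tau> b) / 2))"
      unfolding B_def using A by (intro tendsto_intros haar2_parseval) auto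
    then show ?thesis unfolding wsq v_def by simp
  qed
  show "v \<ge> 0" by (rule LIMSEQ_le_const[OF wlim]) (auto intro!: sum_nonneg)
  have "(\<lambda>K. \<integral>\<omega>. iexp (x * (\<Sum>q\<in>B K. w q * noise q \<omega>)) \<partial>white_noise) \<longlonglongrightarrow>
    (\<integral>\<omega>. iexp (x * (\<Sum>a\<in>A. u a * gaussian_sheet \<omega> (\<tau> a))) \<partial>white_noise)"
  proof (rule integral_dominated_convergence[where w = "\<lambda>_. 1"])
    show "AE \<omega> in white_noise. (\<lambda>K. iexp (x * (\<Sum>q\<in>B K. w q * noise q \<omega>))) \<longlonglongrightarrow> iexp (x * (\<Sum>a\<in>A. u a * gaussian_sheet \<omega> (\<tau> a)))"
      using AE_tame
    proof eventually_elim
      case (elim \<omega>)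
      have "(\<lambda>K. \<Sum>q\<in>B K. noise q \<omega> * haar2 q (\<tau> a)) \<longlonglongrightarrow> (\<Sum>N. layer N \<omega> (\<tau> a))" if "a \<in> A" for a
        using tendsto_uniform_limitI[OF gaussian_sheet_limit[OF elim] A(2)[OF that]]
        unfolding layer_def sum_shells B_def .
      then have "(\<lambda>K. \<Sum>a\<in>A. u a * ((\<Sum>q\<in>B K. noise q \<omega> * haar2 q (\<tau> a)) / sqrt 2)) \<longlonglongrightarrow> (\<Sum>a\<in>A. u a * ((\<Sum>N. layer N \<omega> (\<tau> a)) / sqrt 2))"
        by (intro tendsto_intros) auto
      also have "(\<lambda>K. \<Sum>a\<in>A. u a * ((\<Sum>q\<in>B K. noise q \<omega> * haar2 q (\<tau> a)) / sqrt 2)) = (\<lambda>K. \<Sum>q\<in>B K. w q * noise q \<omega>)"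
      proof
        fix K
        have "w q * noise q \<omega> = (\<Sum>a\<in>A. u a * (noise q \<omega> * haar2 q (\<tau> a) / sqrt 2))" for q
          unfolding w_def sum_divide_distrib sum_distrib_right by (intro sum.cong refl) simp
        then have "(\<Sum>q\<in>B K. w q * noise q \<omega>) = (\<Sum>q\<in>B K. \<Sum>a\<in>A. u a * (noise q \<omega> * haar2 q (\<tau> a) / sqrt 2))"
          by (simp only:)
        also have "\<dots> = (\<Sum>a\<in>A. \<Sum>q\<in>B K. u a * (noise q \<omega> * haar2 q (\<tau> a) / sqrt 2))" by (rule sum.swap)
        finally show "(\<Sum>a\<in>A. u a * ((\<Sum>q\<in>B K. noise q \<omega> * haar2 q (\<tau> a)) / sqrt 2)) = (\<Sum>q\<in>B K. w q * noise q \<omega>)"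
          by (simp only: sum_distrib_left sum_divide_distrib)
      qed
      also have "(\<Sum>a\<in>A. u a * ((\<Sum>N. layer N \<omega> (\<tau> a)) / sqrt 2)) = (\<Sum>a\<in>A. u a * gaussian_sheet \<omega> (\<tau> a))"
        using elim by (simp add: gaussian_sheet_def)
      finally show ?case by (intro tendsto_intros)
    qed
    show "(\<lambda>\<omega>. iexp (x * (\<Sum>a\<in>A. u a * gaussian_sheet \<omega> (\<tau> a)))) \<in> borel_measurable white_noise"
      using gaussian_sheet_borel by measurable
    show "(\<lambda>\<omega>. iexp (x * (\<Sum>q\<in>B K. w q * noise q \<omega>))) \<in> borel_measurable white_noise" for K
      by measurable
  qed auto
  moreover have "(\<integral>\<omega>. iexp (x * (\<Sum>q\<in>B K. w q * noise q \<omega>)) \<partial>white_noise) = exp (- (x\<^sup>2 * (\<Sum>q\<in>B K. (w q)\<^sup>2)) / 2)" for K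
  proof -
    \<comment> \<open>\<open>white_noise_char\<close> is indexed by coordinates; injectivity of
      \<open>to_nat\<close> allows \<open>inv_into\<close> to carry the coefficients over.\<close>
    define \<iota> :: "haar_index \<Rightarrow> real \<times> real" where "\<iota> q = (real (to_nat q), 0)" for q
    have inj: "inj_on \<iota> (B K)" by (auto simp: \<iota>_def inj_on_def)
    have fin: "finite (B K)" by (simp add: B_def)
    have sum: "(\<Sum>i\<in>\<iota> ` B K. h (inv_into (B K) \<iota> i) i) = (\<Sum>q\<in>B K. h q (\<iota> q))" for h :: "haar_index \<Rightarrow> real \<times> real \<Rightarrow> real"
      using inj by (subst sum.reindex) auto
    show ?thesis
      using white_noise_char[OF finite_imageI[OF fin, of \<iota>], of x "\<lambda>i. w (inv_into (B K) \<iota> i)"]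
      unfolding sum[of "\<lambda>q i. w q * \<omega> i" for \<omega>] sum[of "\<lambda>q i. (w q)\<^sup>2"]
      unfolding noise_def \<iota>_def .
  qed
  moreover have "(\<lambda>K. complex_of_real (exp (- (x\<^sup>2 * (\<Sum>q\<in>B K. (w q)\<^sup>2)) / 2))) \<longlonglongrightarrow> complex_of_real (exp (- (x\<^sup>2 * v) / 2))"
    by (intro tendsto_intros wlim) auto
  ultimately show "(\<integral>\<omega>. iexp (x * (\<Sum>a\<in>A. u a * gaussian_sheet \<omega> (\<tau> a))) \<partial>white_noise) = exp (- (x\<^sup>2 * v) / 2)"
    using LIMSEQ_unique by simp
qed

theorem gaussian_sheet:
  "centered_continuous_gaussian_process white_noise unit_square limit_kernel gaussian_sheet"
proof -
  have comb: "gaussian_rv white_noise (\<lambda>\<omega>. \<Sum>a\<in>A. u a * gaussian_sheet \<omega> (\<tau> a))"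
    "white_noise.expectation (\<lambda>\<omega>. \<Sum>a\<in>A. u a * gaussian_sheet \<omega> (\<tau> a)) = 0"
    "white_noise.expectation (\<lambda>\<omega>. (\<Sum>a\<in>A. u a * gaussian_sheet \<omega> (\<tau> a))\<^sup>2) = (\<Sum>a\<in>A. \<Sum>b\<in>A. u a * u b * limit_kernel (\<tau> a) (\<tau> b))"
    if "finite A" "\<And>a. a \<in> A \<Longrightarrow> \<tau> a \<in> unit_square" for A :: "'x set" and \<tau> u
  proof -
    have m: "(\<lambda>\<omega>. \<Sum>a\<in>A. u a * gaussian_sheet \<omega> (\<tau> a)) \<in> borel_measurable white_noise"
      using gaussian_sheet_borel by (intro borel_measurable_sum borel_measurable_times) auto
    note gs = gaussian_sheet_combination[where u = u and \<tau> = \<tau>, OF that]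
    note g = white_noise.gaussian_rvI_char[OF m gs(1) gs(2)]
    show "gaussian_rv white_noise (\<lambda>\<omega>. \<Sum>a\<in>A. u a * gaussian_sheet \<omega> (\<tau> a))"
      "white_noise.expectation (\<lambda>\<omega>. \<Sum>a\<in>A. u a * gaussian_sheet \<omega> (\<tau> a)) = 0"
      "white_noise.expectation (\<lambda>\<omega>. (\<Sum>a\<in>A. u a * gaussian_sheet \<omega> (\<tau> a))\<^sup>2) = (\<Sum>a\<in>A. \<Sum>b\<in>A. u a * u b * limit_kernel (\<tau> a) (\<tau> b))"
      by (rule g; assumption)+
  qed
  have single: "gaussian_rv white_noise (\<lambda>\<omega>. gaussian_sheet \<omega> z)" "white_noise.expectation (\<lambda>\<omega>. gaussian_sheet \<omega> z) = 0"
    "white_noise.expectation (\<lambda>\<omega>. (gaussian_sheet \<omega> z)\<^sup>2) = limit_kernel z z" if "z \<in> unit_square" for z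
    using comb[of "{()}" "\<lambda>_. z" "\<lambda>_. 1"] that by simp_all
  have sq: "integrable white_noise (\<lambda>\<omega>. (gaussian_sheet \<omega> z)\<^sup>2)" if "z \<in> unit_square" for z
    using white_noise.gaussian_rv_facts(1)[OF single(1)[OF that]] .
  have pair: "white_noise.expectation (\<lambda>\<omega>. gaussian_sheet \<omega> y * gaussian_sheet \<omega> z) = limit_kernel y z"
    if y: "y \<in> unit_square" and z: "z \<in> unit_square" for y z
  proof -
    have int: "integrable white_noise (\<lambda>\<omega>. gaussian_sheet \<omega> y * gaussian_sheet \<omega> z)"
      by (intro white_noise.square_integrable_mult gaussian_sheet_borel sq y z)
    have sym: "limit_kernel z y = limit_kernel y z"
      by (cases y; cases z) (simp add: limit_kernel_def c_def min.commute mult_ac)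
    \<comment> \<open>Polarisation. The index set \<open>bool\<close> instead of
      \<open>{y, z}\<close> keeps the two terms apart when \<open>y = z\<close>.\<close>
    have "white_noise.expectation (\<lambda>\<omega>. (gaussian_sheet \<omega> y + gaussian_sheet \<omega> z)\<^sup>2) = limit_kernel y y + 2 * limit_kernel y z + limit_kernel z z"
      using comb(3)[of "UNIV :: bool set" "\<lambda>b. if b then y else z" "\<lambda>_. 1"] y z
      by (simp add: UNIV_bool sym algebra_simps)
    moreover have "white_noise.expectation (\<lambda>\<omega>. (gaussian_sheet \<omega> y + gaussian_sheet \<omega> z)\<^sup>2) =
      limit_kernel y y + 2 * white_noise.expectation (\<lambda>\<omega>. gaussian_sheet \<omega> y * gaussian_sheet \<omega> z) + limit_kernel z z"
    proof -
      have "(gaussian_sheet \<omega> y + gaussian_sheet \<omega> z)\<^sup>2 = (gaussian_sheet \<omega> y)\<^sup>2 + 2 * (gaussian_sheet \<omega> y * gaussian_sheet \<omega> z) + (gaussian_sheet \<omega> z)\<^sup>2" for \<omega>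
        by (simp add: power2_eq_square algebra_simps)
      then show ?thesis using int sq[OF y] sq[OF z] single(3)[OF y] single(3)[OF z] by simp
    qed
    ultimately show ?thesis by simp
  qed
  show ?thesis
    unfolding centered_continuous_gaussian_process_def gaussian_process_def cov_def
    using comb(1)[of _ "\<lambda>z. z"] single(2) pair gaussian_sheet_continuous white_noise.prob_space_axioms
    by (auto simp: subset_iff)
qed

section \<open>Maximal inequalities\<close>

text \<open>When for the first \<open>k\<close> some sum over the ranks below \<open>k\<close>
  exceeds \<open>2 * e\<close>, the remaining tail is independent of this event and with probability
  at least 1/2 stays within \<open>e\<close> for all \<theta> at once; then the total exceeds
  \<open>e\<close>. Ties in \<open>rank\<close> let a whole column or row enter at once, and the
  finite set \<Theta> provides a maximum over many linear functionals.\<close>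

lemma (in prob_space) ottaviani:
  fixes Z :: "'i \<Rightarrow> 'a \<Rightarrow> real" and g :: "'h \<Rightarrow> 'i \<Rightarrow> real \<Rightarrow> real" and rank :: "'i \<Rightarrow> nat"
  assumes indep: "indep_vars (\<lambda>_. borel) Z I" and fin: "finite I" "finite \<Theta>"
    and g: "\<And>\<theta> x. \<theta> \<in> \<Theta> \<Longrightarrow> x \<in> I \<Longrightarrow> g \<theta> x \<in> borel_measurable borel"
    and tail: "\<And>k. k \<le> q \<Longrightarrow>
      prob {\<omega>\<in>space M. \<exists>\<theta>\<in>\<Theta>. \<bar>\<Sum>x\<in>{x\<in>I. k \<le> rank x}. g \<theta> x (Z x \<omega>)\<bar> > e} \<le> 1 / 2"
  shows "prob {\<omega>\<in>space M. \<exists>k\<le>q. \<exists>\<theta>\<in>\<Theta>. \<bar>\<Sum>x\<in>{x\<in>I. rank x < k}. g \<theta> x (Z x \<omega>)\<bar> > 2 * e}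
    \<le> 2 * prob {\<omega>\<in>space M. \<exists>\<theta>\<in>\<Theta>. \<bar>\<Sum>x\<in>I. g \<theta> x (Z x \<omega>)\<bar> > e}"
proof -
  define A where "A k = {x\<in>I. rank x < k}" for k
  define B where "B k = {x\<in>I. k \<le> rank x}" for k
  have AI: "A k \<subseteq> I" and BI: "B k \<subseteq> I" and AB: "A k \<inter> B k = {}" and un: "I = A k \<union> B k" for k
    by (auto simp: A_def B_def)
  have finA: "finite (A k)" and finB: "finite (B k)" for k
    using finite_subset[OF AI fin(1)] finite_subset[OF BI fin(1)] by blast+
  have Am: "A j \<subseteq> A k" if "j \<le> k" for j k using that by (auto simp: A_def)
  define big where "big S c y \<longleftrightarrow> (\<exists>\<theta>\<in>\<Theta>. \<bar>\<Sum>x\<in>S. g \<theta> x (y x)\<bar> > c)" for S c and y :: "'i \<Rightarrow> real"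
  have big_sets: "{y\<in>space (PiM K (\<lambda>_. borel)). big S c y} \<in> sets (PiM K (\<lambda>_. borel))"
    if "S \<subseteq> K" "K \<subseteq> I" for S K and c :: real
  proof -
    have coord: "(\<lambda>y. y x) \<in> borel_measurable (PiM K (\<lambda>_. borel :: real measure))" if "x \<in> S" for x
      using measurable_component_singleton[of x K "\<lambda>_. borel"] \<open>S \<subseteq> K\<close> that by auto
    have "(\<lambda>y. \<bar>\<Sum>x\<in>S. g \<theta> x (y x)\<bar>) \<in> borel_measurable (PiM K (\<lambda>_. borel))" if "\<theta> \<in> \<Theta>" for \<theta>
      using \<open>S \<subseteq> K\<close> \<open>K \<subseteq> I\<close> that
      by (intro borel_measurable_abs borel_measurable_sum measurable_compose[OF coord g]) auto
    then show ?thesis unfolding big_def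
      by (intro sets.sets_Collect_finite_Ex fin) (auto intro: borel_measurable_less)
  qed
  have rv: "Z x \<in> borel_measurable M" if "x \<in> I" for x
    using indep that by (auto simp: indep_vars_def)
  have big_ev: "{\<omega>\<in>space M. big S c (\<lambda>x. Z x \<omega>)} \<in> events" if "S \<subseteq> I" for S c
  proof -
    have "(\<lambda>\<omega>. \<bar>\<Sum>x\<in>S. g \<theta> x (Z x \<omega>)\<bar>) \<in> borel_measurable M" if "\<theta> \<in> \<Theta>" for \<theta>
      using \<open>S \<subseteq> I\<close> that
      by (intro borel_measurable_abs borel_measurable_sum measurable_compose[OF rv g]) auto
    then show ?thesis unfolding big_def
      by (intro sets.sets_Collect_finite_Ex fin) (auto intro: borel_measurable_less)
  qed
  define E where "E k = {\<omega>\<in>space M. big (A k) (2 * e) (\<lambda>x. Z x \<omega>)}" for k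
  \<comment> \<open>The first-passage events: disjoint in \<open>k\<close>, and determined by the
    variables of rank below \<open>k\<close>.\<close>
  define F where "F k = {\<omega>\<in>space M. big (A k) (2 * e) (\<lambda>x. Z x \<omega>) \<and> (\<forall>j<k. \<not> big (A j) (2 * e) (\<lambda>x. Z x \<omega>))}" for k
  define T where "T k = {\<omega>\<in>space M. \<not> big (B k) e (\<lambda>x. Z x \<omega>)}" for k
  define G where "G = {\<omega>\<in>space M. big I e (\<lambda>x. Z x \<omega>)}"
  have Eev: "E k \<in> events" for k unfolding E_def by (intro big_ev AI)
  have Fev: "F k \<in> events" for k
  proof -
    have "F k = E k - (\<Union>j<k. E j)" by (auto simp: F_def E_def)
    then show ?thesis using Eev by auto
  qed
  have Gev: "G \<in> events" unfolding G_def by (intro big_ev) auto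
  have Tev: "T k \<in> events" for k
  proof -
    have "T k = space M - {\<omega>\<in>space M. big (B k) e (\<lambda>x. Z x \<omega>)}" by (auto simp: T_def)
    then show ?thesis using big_ev[OF BI] by auto
  qed
  have Tprob: "prob (T k) \<ge> 1 / 2" if "k \<le> q" for k
  proof -
    have "T k = space M - {\<omega>\<in>space M. big (B k) e (\<lambda>x. Z x \<omega>)}" by (auto simp: T_def)
    then have "prob (T k) = 1 - prob {\<omega>\<in>space M. big (B k) e (\<lambda>x. Z x \<omega>)}"
      using prob_compl[OF big_ev[OF BI]] by simp
    then show ?thesis using tail[OF that] by (simp add: big_def B_def)
  qed
  have indepFT: "prob (F k \<inter> T k) = prob (F k) * prob (T k)" for k
  proof -
    let ?RA = "\<lambda>\<omega>. restrict (\<lambda>i. Z i \<omega>) (A k)" and ?RB = "\<lambda>\<omega>. restrict (\<lambda>i. Z i \<omega>) (B k)"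
    \<comment> \<open>First passage and tail event are written as sets in the two product spaces, so
      that independence of the disjoint blocks \<open>A k\<close> and \<open>B k\<close>
      applies.\<close>
    define SF where "SF = {y\<in>space (PiM (A k) (\<lambda>_. borel)). big (A k) (2 * e) y} -
      (\<Union>j<k. {y\<in>space (PiM (A k) (\<lambda>_. borel)). big (A j) (2 * e) y})"
    define ST where "ST = space (PiM (B k) (\<lambda>_. borel)) - {y\<in>space (PiM (B k) (\<lambda>_. borel)). big (B k) e y}"
    have "SF \<in> sets (PiM (A k) (\<lambda>_. borel))"
      unfolding SF_def by (intro sets.Diff sets.finite_UN big_sets AI Am) auto
    moreover have "ST \<in> sets (PiM (B k) (\<lambda>_. borel))"
      unfolding ST_def by (intro sets.Diff big_sets BI) auto
    moreover have cong: "big S b (restrict y K) = big S b y" if "S \<subseteq> K" for S K b y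
    proof -
      have "(\<Sum>x\<in>S. g \<theta> x (restrict y K x)) = (\<Sum>x\<in>S. g \<theta> x (y x))" for \<theta>
        using that by (intro sum.cong) auto
      then show ?thesis by (simp add: big_def)
    qed
    have "?RA -` SF \<inter> space M = F k"
      by (auto simp: SF_def F_def space_PiM cong[OF subset_refl] cong[OF Am])
    moreover have "?RB -` ST \<inter> space M = T k"
      by (auto simp: ST_def T_def space_PiM cong[OF subset_refl])
    ultimately have "prob ((\<lambda>x. (?RA x, ?RB x)) -` (SF \<times> ST) \<inter> space M) = prob (F k) * prob (T k)"
      using indep_varD[OF indep_var_restrict[OF indep AB AI BI], of SF k ST] by simp
    moreover have "(\<lambda>x. (?RA x, ?RB x)) -` (SF \<times> ST) \<inter> space M = F k \<inter> T k"
      using \<open>?RA -` SF \<inter> space M = F k\<close> \<open>?RB -` ST \<inter> space M = T k\<close> by blast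
    ultimately show ?thesis by simp
  qed
  have sub: "F k \<inter> T k \<subseteq> G" for k
  proof
    fix \<omega> assume \<omega>: "\<omega> \<in> F k \<inter> T k"
    then obtain \<theta> where \<theta>: "\<theta> \<in> \<Theta>" "\<bar>\<Sum>x\<in>A k. g \<theta> x (Z x \<omega>)\<bar> > 2 * e"
      by (auto simp: F_def big_def)
    have "\<bar>\<Sum>x\<in>B k. g \<theta> x (Z x \<omega>)\<bar> \<le> e" using \<omega> \<theta>(1) by (auto simp: T_def big_def)
    moreover have "(\<Sum>x\<in>I. g \<theta> x (Z x \<omega>)) = (\<Sum>x\<in>A k. g \<theta> x (Z x \<omega>)) + (\<Sum>x\<in>B k. g \<theta> x (Z x \<omega>))"
      by (subst un[of k]) (intro sum.union_disjoint finA finB AB)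
    ultimately have "\<bar>\<Sum>x\<in>I. g \<theta> x (Z x \<omega>)\<bar> > e" using \<theta>(2) by linarith
    then show "\<omega> \<in> G" using \<omega> \<theta>(1) by (auto simp: G_def big_def F_def)
  qed
  have disj: "disjoint_family_on F {..q}"
  proof -
    have "F j \<inter> F k = {}" if "j < k" for j k using that by (auto simp: F_def)
    then show ?thesis unfolding disjoint_family_on_def by (metis inf_commute linorder_neqE_nat)
  qed
  have first: "{\<omega>\<in>space M. \<exists>k\<le>q. big (A k) (2 * e) (\<lambda>x. Z x \<omega>)} = (\<Union>k\<le>q. F k)"
  proof
    show "{\<omega>\<in>space M. \<exists>k\<le>q. big (A k) (2 * e) (\<lambda>x. Z x \<omega>)} \<subseteq> (\<Union>k\<le>q. F k)"
    proof
      fix \<omega> assume "\<omega> \<in> {\<omega>\<in>space M. \<exists>k\<le>q. big (A k) (2 * e) (\<lambda>x. Z x \<omega>)}"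
      then obtain k where k: "\<omega> \<in> space M" "k \<le> q" "big (A k) (2 * e) (\<lambda>x. Z x \<omega>)" by auto
      define k0 where "k0 = (LEAST k. big (A k) (2 * e) (\<lambda>x. Z x \<omega>))"
      have "k0 \<le> k" unfolding k0_def using k(3) by (rule Least_le)
      moreover have "big (A k0) (2 * e) (\<lambda>x. Z x \<omega>)" unfolding k0_def using k(3) by (rule LeastI)
      moreover have "\<not> big (A j) (2 * e) (\<lambda>x. Z x \<omega>)" if "j < k0" for j
        using not_less_Least[of j "\<lambda>k. big (A k) (2 * e) (\<lambda>x. Z x \<omega>)"] that unfolding k0_def by blast
      ultimately show "\<omega> \<in> (\<Union>k\<le>q. F k)" using k by (auto simp: F_def intro!: bexI[of _ k0])
    qed
  qed (auto simp: F_def)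
  have "prob (\<Union>k\<le>q. F k) = (\<Sum>k\<le>q. prob (F k))"
    using Fev disj by (intro finite_measure_finite_Union) auto
  also have "\<dots> \<le> (\<Sum>k\<le>q. 2 * prob (F k \<inter> T k))"
  proof (rule sum_mono)
    fix k assume "k \<in> {..q}"
    then have "prob (F k) * (1 / 2) \<le> prob (F k) * prob (T k)" using Tprob by (intro mult_left_mono) auto
    then show "prob (F k) \<le> 2 * prob (F k \<inter> T k)" by (simp add: indepFT)
  qed
  also have "\<dots> = 2 * prob (\<Union>k\<le>q. F k \<inter> T k)"
  proof -
    have "disjoint_family_on (\<lambda>k. F k \<inter> T k) {..q}"
      using disj by (auto simp: disjoint_family_on_def)
    then have "prob (\<Union>k\<le>q. F k \<inter> T k) = (\<Sum>k\<le>q. prob (F k \<inter> T k))"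
      using Fev Tev by (intro finite_measure_finite_Union) auto
    then show ?thesis by (simp add: sum_distrib_left)
  qed
  also have "\<dots> \<le> 2 * prob G"
    using sub Gev by (intro mult_left_mono finite_measure_mono) auto
  finally show ?thesis unfolding first[symmetric] G_def big_def A_def by simp
qed


section \<open>Second moments and elementary sums\<close>

lemma (in prob_space) indep_centered_square:
  fixes h :: "'i \<Rightarrow> real \<Rightarrow> real"
  assumes indep: "indep_vars (\<lambda>_. borel) Z I" and A: "finite A" "A \<subseteq> I"
    and h: "\<And>x. x \<in> A \<Longrightarrow> h x \<in> borel_measurable borel"
    and int: "\<And>x. x \<in> A \<Longrightarrow> integrable M (\<lambda>\<omega>. (h x (Z x \<omega>))\<^sup>2)"
    and mean: "\<And>x. x \<in> A \<Longrightarrow> expectation (\<lambda>\<omega>. h x (Z x \<omega>)) = 0"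
  shows "expectation (\<lambda>\<omega>. (\<Sum>x\<in>A. h x (Z x \<omega>))\<^sup>2) = (\<Sum>x\<in>A. expectation (\<lambda>\<omega>. (h x (Z x \<omega>))\<^sup>2))"
    and "integrable M (\<lambda>\<omega>. (\<Sum>x\<in>A. h x (Z x \<omega>))\<^sup>2)"
proof -
  define X where "X x \<omega> = h x (Z x \<omega>)" for x \<omega>
  have rv: "X x \<in> borel_measurable M" if "x \<in> A" for x
    unfolding X_def using indep h[OF that] that A by (auto simp: indep_vars_def intro: measurable_compose)
  have sq: "integrable M (\<lambda>\<omega>. (X x \<omega>)\<^sup>2)" if "x \<in> A" for x unfolding X_def by (rule int[OF that])
  have intX: "integrable M (X x)" if "x \<in> A" for x
    using sq[OF that] rv[OF that] by (rule square_integrable_imp_integrable[rotated])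
  have ind: "indep_vars (\<lambda>_. borel) X A"
    unfolding X_def by (rule indep_vars_compose2[OF indep_vars_subset[OF indep A(2)]]) (use h in auto)
  have cross: "expectation (\<lambda>\<omega>. X x \<omega> * X y \<omega>) = 0" if "x \<in> A" "y \<in> A" "x \<noteq> y" for x y
  proof -
    have "expectation (\<lambda>\<omega>. \<Prod>i\<in>{x, y}. X i \<omega>) = (\<Prod>i\<in>{x, y}. expectation (X i))"
      using that intX by (intro indep_vars_lebesgue_integral indep_vars_subset[OF ind]) auto
    moreover have "expectation (X x) = 0" using mean[OF that(1)] by (simp add: X_def[abs_def])
    ultimately show ?thesis using that by simp
  qed
  show "integrable M (\<lambda>\<omega>. (\<Sum>x\<in>A. h x (Z x \<omega>))\<^sup>2)"
    using expectation_square_sum(2)[OF A(1), of X "\<lambda>_. 1"] rv sq by (simp add: X_def)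
  have "expectation (\<lambda>\<omega>. (\<Sum>x\<in>A. X x \<omega>)\<^sup>2) = (\<Sum>x\<in>A. \<Sum>y\<in>A. expectation (\<lambda>\<omega>. X x \<omega> * X y \<omega>))"
    using expectation_square_sum(1)[OF A(1), of X "\<lambda>_. 1"] rv sq by simp
  also have "\<dots> = (\<Sum>x\<in>A. expectation (\<lambda>\<omega>. (X x \<omega>)\<^sup>2))"
  proof (rule sum.cong[OF refl])
    fix x assume x: "x \<in> A"
    have "(\<Sum>y\<in>A. expectation (\<lambda>\<omega>. X x \<omega> * X y \<omega>)) = (\<Sum>y\<in>A. if y = x then expectation (\<lambda>\<omega>. (X x \<omega>)\<^sup>2) else 0)"
      using cross x by (intro sum.cong) (auto simp: power2_eq_square)
    then show "(\<Sum>y\<in>A. expectation (\<lambda>\<omega>. X x \<omega> * X y \<omega>)) = expectation (\<lambda>\<omega>. (X x \<omega>)\<^sup>2)"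
      using x A(1) by simp
  qed
  finally show "expectation (\<lambda>\<omega>. (\<Sum>x\<in>A. h x (Z x \<omega>))\<^sup>2) = (\<Sum>x\<in>A. expectation (\<lambda>\<omega>. (h x (Z x \<omega>))\<^sup>2))"
    by (simp add: X_def)
qed

lemma (in prob_space) markov_real:
  assumes int: "integrable M f" and nonneg: "\<And>\<omega>. \<omega> \<in> space M \<Longrightarrow> 0 \<le> f \<omega>" and "a > (0::real)"
    and A: "\<And>\<omega>. \<omega> \<in> A \<Longrightarrow> \<omega> \<in> space M \<and> a \<le> f \<omega>"
  shows "prob A \<le> expectation f / a"
proof -
  have "prob A \<le> prob {\<omega>\<in>space M. a \<le> f \<omega>}"
    using A borel_measurable_integrable[OF int] by (intro finite_measure_mono) auto
  also have "\<dots> \<le> expectation f / a"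
    using integral_Markov_inequality_measure[OF int, of "space M" a] nonneg \<open>a > 0\<close> by auto
  finally show ?thesis .
qed

text \<open>Comparison with the increments of \<open>2 * sqrt\<close>; subadditivity of the square
  root then removes the dependence on the start \<open>a\<close>.\<close>

lemma sum_inverse_sqrt_le:
  "(\<Sum>i=a..<a + d. 1 / sqrt (real (Suc i))) \<le> 2 * sqrt (real d)"
proof -
  have step: "1 / sqrt (real (Suc i)) \<le> 2 * (sqrt (real (Suc i)) - sqrt (real i))" for i
  proof -
    have "(sqrt (real (Suc i)) - sqrt (real i)) * (sqrt (real (Suc i)) + sqrt (real i)) = 1"
      by (simp add: algebra_simps)
    moreover have "sqrt (real (Suc i)) + sqrt (real i) \<le> 2 * sqrt (real (Suc i))" by simp
    moreover have "0 \<le> sqrt (real (Suc i)) - sqrt (real i)" by simp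
    ultimately have "1 \<le> (sqrt (real (Suc i)) - sqrt (real i)) * (2 * sqrt (real (Suc i)))"
      by (metis mult_left_mono)
    then have "1 \<le> 2 * (sqrt (real (Suc i)) - sqrt (real i)) * sqrt (real (Suc i))"
      by (simp only: mult_ac)
    then show ?thesis by (subst pos_divide_le_eq) auto
  qed
  have "(\<Sum>i=a..<a + d. 1 / sqrt (real (Suc i))) \<le> (\<Sum>i=a..<a + d. 2 * (sqrt (real (Suc i)) - sqrt (real i)))"
    by (intro sum_mono step)
  also have "\<dots> = 2 * (sqrt (real (a + d)) - sqrt (real a))"
    unfolding sum_distrib_left[symmetric] using sum_Suc_diff'[of a "a + d" "\<lambda>i. sqrt (real i)"] by simp
  also have "\<dots> \<le> 2 * sqrt (real d)"
    using sqrt_add_le_add_sqrt[of "real a" "real d"] by simp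
  finally show ?thesis .
qed

lemma sum_inverse_square_le:
  assumes "l \<le> n"
  shows "(\<Sum>i=1..l. 1 / (real (n - i + 1))\<^sup>2) \<le> 2 / real (n - l + 1)"
proof -
  define N where "N = n - l + 1"
  have step: "1 / (real (N + k))\<^sup>2 \<le> 2 * (1 / real (N + k) - 1 / real (N + Suc k))" for k
  proof -
    define y where "y = real (N + k)"
    have y: "y \<ge> 1" by (simp add: y_def N_def)
    have "2 * (1 / y - 1 / (y + 1)) = 2 / (y * (y + 1))"
    proof -
      have "y \<noteq> 0" "y + 1 \<noteq> 0" using y by auto
      then show ?thesis by (simp add: divide_simps)
    qed
    moreover have "1 / y\<^sup>2 \<le> 2 / (y * (y + 1))"
    proof -
      have "y * 1 \<le> y * y" using y by (intro mult_left_mono) auto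
      then have "y * (y + 1) \<le> 2 * y\<^sup>2" by (simp add: power2_eq_square algebra_simps)
      then have "2 / (2 * y\<^sup>2) \<le> 2 / (y * (y + 1))" using y by (intro divide_left_mono) auto
      then show ?thesis by simp
    qed
    ultimately show ?thesis by (simp add: y_def add.commute)
  qed
  have "(\<Sum>i=1..l. 1 / (real (n - i + 1))\<^sup>2) = (\<Sum>k<l. 1 / (real (N + k))\<^sup>2)"
    using assms by (intro sum.reindex_bij_witness[of _ "\<lambda>k. l - k" "\<lambda>i. l - i"]) (auto simp: N_def)
  also have "\<dots> \<le> (\<Sum>k<l. 2 * (1 / real (N + k) - 1 / real (N + Suc k)))" by (intro sum_mono step)
  also have "\<dots> = 2 * (1 / real N - 1 / real (N + l))"
    unfolding sum_distrib_left[symmetric] using sum_lessThan_telescope'[of "\<lambda>k. 1 / real (N + k)" l] by simp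
  also have "\<dots> \<le> 2 / real N" by simp
  finally show ?thesis by (simp add: N_def)
qed

text \<open>Isolates what the maximal inequalities use about the array: independence over the cells
  and the two rates for row variances. The cells keep an abstract index so that they can be ordered
  by rows or by columns.\<close>

locale row_field = prob_space M for M :: "'a measure" +
  fixes I :: "'i set" and Z :: "'i \<Rightarrow> 'a \<Rightarrow> real" and row :: "'i \<Rightarrow> nat"
    and \<xi> \<eta> :: "'i \<Rightarrow> real \<Rightarrow> real" and n :: nat and K :: real
  assumes indep: "indep_vars (\<lambda>_. borel) Z I" and finite_I: "finite I"
    and row: "\<And>x. x \<in> I \<Longrightarrow> row x \<in> {1..n}" and n_pos: "n \<ge> 1" and K_nonneg: "K \<ge> 0"
    and \<xi>_borel: "\<And>x. x \<in> I \<Longrightarrow> \<xi> x \<in> borel_measurable borel"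
    and \<eta>_borel: "\<And>x. x \<in> I \<Longrightarrow> \<eta> x \<in> borel_measurable borel"
    and \<xi>_int: "\<And>x. x \<in> I \<Longrightarrow> integrable M (\<lambda>\<omega>. (\<xi> x (Z x \<omega>))\<^sup>2)"
    and \<eta>_int: "\<And>x. x \<in> I \<Longrightarrow> integrable M (\<lambda>\<omega>. (\<eta> x (Z x \<omega>))\<^sup>2)"
    and \<xi>_mean: "\<And>x. x \<in> I \<Longrightarrow> expectation (\<lambda>\<omega>. \<xi> x (Z x \<omega>)) = 0"
    and \<eta>_mean: "\<And>x. x \<in> I \<Longrightarrow> expectation (\<lambda>\<omega>. \<eta> x (Z x \<omega>)) = 0"
    and \<xi>_row: "\<And>i. i \<in> {1..n} \<Longrightarrow>
      (\<Sum>x\<in>{x\<in>I. row x = i}. expectation (\<lambda>\<omega>. (\<xi> x (Z x \<omega>))\<^sup>2)) \<le> K / (real (n - i + 1))\<^sup>2"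
    and \<eta>_row: "\<And>i. i \<in> {1..n} \<Longrightarrow>
      (\<Sum>x\<in>{x\<in>I. row x = i}. expectation (\<lambda>\<omega>. (\<eta> x (Z x \<omega>))\<^sup>2)) \<le> K / real (n - i + 1)"
begin

text \<open>Truncated subtraction removes the first summand for rows beyond \<open>m\<close>; the
  second needs the explicit guard.\<close>

definition wt :: "nat \<Rightarrow> 'i \<Rightarrow> real \<Rightarrow> real" where
  "wt m x z = real (m - row x) * \<xi> x z + (if row x \<le> m then \<eta> x z else 0)"

definition W :: "'i set \<Rightarrow> nat \<Rightarrow> 'a \<Rightarrow> real" where
  "W A m \<omega> = (\<Sum>x\<in>A. wt m x (Z x \<omega>))"

definition S :: "'i set \<Rightarrow> nat \<Rightarrow> 'a \<Rightarrow> real" where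
  "S A l \<omega> = (\<Sum>x\<in>A. if row x \<le> l then \<xi> x (Z x \<omega>) else 0)"

definition T :: "'i set \<Rightarrow> nat \<Rightarrow> 'a \<Rightarrow> real" where
  "T A m \<omega> = (\<Sum>x\<in>A. if row x \<le> m then \<eta> x (Z x \<omega>) else 0)"

lemma Z_borel: "x \<in> I \<Longrightarrow> Z x \<in> borel_measurable M"
  using indep by (auto simp: indep_vars_def)

lemma wt_borel: "x \<in> I \<Longrightarrow> wt m x \<in> borel_measurable borel"
  unfolding wt_def using \<xi>_borel \<eta>_borel by (cases "row x \<le> m") auto

lemma \<xi>Z_borel: "x \<in> I \<Longrightarrow> (\<lambda>\<omega>. \<xi> x (Z x \<omega>)) \<in> borel_measurable M"
  by (rule measurable_compose[OF Z_borel \<xi>_borel])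

lemma \<eta>Z_borel: "x \<in> I \<Longrightarrow> (\<lambda>\<omega>. \<eta> x (Z x \<omega>)) \<in> borel_measurable M"
  by (rule measurable_compose[OF Z_borel \<eta>_borel])

lemma W_borel: "A \<subseteq> I \<Longrightarrow> W A m \<in> borel_measurable M"
  unfolding W_def by (intro borel_measurable_sum measurable_compose[OF Z_borel wt_borel]) auto

lemma T_borel: "A \<subseteq> I \<Longrightarrow> T A m \<in> borel_measurable M"
  unfolding T_def using \<eta>Z_borel by (intro borel_measurable_sum) (auto simp: subset_iff)

text \<open>Summation by parts: \<open>m - r\<close> counts the \<open>l < m\<close> with
  \<open>r \<le> l\<close>. This exhibits \<open>W\<close> as a discrete integral of
  \<open>S\<close> in the direction of t, up to the remainder \<open>T\<close>, and is the reason
  why second moments control its increments there.\<close>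

lemma W_eq: "W A m \<omega> = (\<Sum>l<m. S A l \<omega>) + T A m \<omega>"
proof -
  have "(\<Sum>l<m. if r \<le> l then z else 0) = real (m - r) * z" for r and z :: real
  proof -
    have "(\<Sum>l<m. if r \<le> l then z else 0) = (\<Sum>l\<in>{l\<in>{..<m}. r \<le> l}. z)"
      by (rule sum.inter_filter[symmetric]) simp
    also have "{l\<in>{..<m}. r \<le> l} = {r..<m}" by auto
    finally show ?thesis by simp
  qed
  then have "(\<Sum>l<m. S A l \<omega>) = (\<Sum>x\<in>A. real (m - row x) * \<xi> x (Z x \<omega>))"
    unfolding S_def by (subst sum.swap) simp
  then show ?thesis by (simp add: W_def wt_def T_def sum.distrib)
qed

lemma row_sum_le:
  assumes f: "\<And>x. x \<in> I \<Longrightarrow> 0 \<le> (f x :: real)" and A: "A \<subseteq> I" and "l \<le> n"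
    and b: "\<And>i. i \<in> {1..n} \<Longrightarrow> (\<Sum>x\<in>{x\<in>I. row x = i}. f x) \<le> b i"
  shows "(\<Sum>x\<in>A. if row x \<le> l then f x else 0) \<le> (\<Sum>i=1..l. b i)"
proof -
  have "(\<Sum>x\<in>A. if row x \<le> l then f x else 0) \<le> (\<Sum>x\<in>I. if row x \<le> l then f x else 0)"
    using f A finite_I by (intro sum_mono2) auto
  also have "\<dots> = (\<Sum>x\<in>{x\<in>I. row x \<le> l}. f x)"
    using finite_I by (rule sum.inter_filter[symmetric])
  also have "\<dots> = (\<Sum>i=1..l. \<Sum>x\<in>{x\<in>{x\<in>I. row x \<le> l}. row x = i}. f x)"
    using finite_I row by (intro sum.group[symmetric]) fastforce+
  also have "\<dots> = (\<Sum>i=1..l. \<Sum>x\<in>{x\<in>I. row x = i}. f x)"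
    by (intro sum.cong refl) auto
  also have "\<dots> \<le> (\<Sum>i=1..l. b i)"
    using \<open>l \<le> n\<close> by (intro sum_mono b) auto
  finally show ?thesis .
qed

lemma S_square:
  assumes "A \<subseteq> I" "l \<le> n"
  shows "expectation (\<lambda>\<omega>. (S A l \<omega>)\<^sup>2) \<le> 2 * K / real (n - l + 1)" and "integrable M (\<lambda>\<omega>. (S A l \<omega>)\<^sup>2)"
proof -
  define h where "h x z = (if row x \<le> l then \<xi> x z else 0)" for x z
  have fA: "finite A" using assms finite_I by (auto intro: finite_subset)
  have hb: "h x \<in> borel_measurable borel" if "x \<in> A" for x
    unfolding h_def using \<xi>_borel assms that by (cases "row x \<le> l") auto
  have hi: "integrable M (\<lambda>\<omega>. (h x (Z x \<omega>))\<^sup>2)" "expectation (\<lambda>\<omega>. h x (Z x \<omega>)) = 0" if "x \<in> A" for x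
    unfolding h_def using \<xi>_int \<xi>_mean assms that by (cases "row x \<le> l"; auto)+
  note sq = indep_centered_square[where h = h, OF indep fA assms(1) hb hi]
  have S: "S A l \<omega> = (\<Sum>x\<in>A. h x (Z x \<omega>))" for \<omega> by (simp add: S_def h_def)
  show "integrable M (\<lambda>\<omega>. (S A l \<omega>)\<^sup>2)" unfolding S by (rule sq(2))
  have "expectation (\<lambda>\<omega>. (S A l \<omega>)\<^sup>2) = (\<Sum>x\<in>A. if row x \<le> l then expectation (\<lambda>\<omega>. (\<xi> x (Z x \<omega>))\<^sup>2) else 0)"
    unfolding S by (subst sq(1), simp) (intro sum.cong, auto simp: h_def)
  also have "\<dots> \<le> (\<Sum>i=1..l. K / (real (n - i + 1))\<^sup>2)"
    by (rule row_sum_le[OF _ assms \<xi>_row]) auto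
  also have "\<dots> = K * (\<Sum>i=1..l. 1 / (real (n - i + 1))\<^sup>2)" by (simp add: sum_distrib_left)
  also have "\<dots> \<le> K * (2 / real (n - l + 1))"
    using K_nonneg assms(2) by (intro mult_left_mono sum_inverse_square_le)
  finally show "expectation (\<lambda>\<omega>. (S A l \<omega>)\<^sup>2) \<le> 2 * K / real (n - l + 1)" by (simp add: mult.commute)
qed

lemma T_square:
  assumes "A \<subseteq> I" "m \<le> n"
  shows "expectation (\<lambda>\<omega>. (T A m \<omega>)\<^sup>2) \<le> 2 * K * sqrt (real n)" and "integrable M (\<lambda>\<omega>. (T A m \<omega>)\<^sup>2)"
proof -
  define h where "h x z = (if row x \<le> m then \<eta> x z else 0)" for x z
  have fA: "finite A" using assms finite_I by (auto intro: finite_subset)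
  have hb: "h x \<in> borel_measurable borel" if "x \<in> A" for x
    unfolding h_def using \<eta>_borel assms that by (cases "row x \<le> m") auto
  have hi: "integrable M (\<lambda>\<omega>. (h x (Z x \<omega>))\<^sup>2)" "expectation (\<lambda>\<omega>. h x (Z x \<omega>)) = 0" if "x \<in> A" for x
    unfolding h_def using \<eta>_int \<eta>_mean assms that by (cases "row x \<le> m"; auto)+
  note sq = indep_centered_square[where h = h, OF indep fA assms(1) hb hi]
  have T: "T A m \<omega> = (\<Sum>x\<in>A. h x (Z x \<omega>))" for \<omega> by (simp add: T_def h_def)
  show "integrable M (\<lambda>\<omega>. (T A m \<omega>)\<^sup>2)" unfolding T by (rule sq(2))
  have "expectation (\<lambda>\<omega>. (T A m \<omega>)\<^sup>2) = (\<Sum>x\<in>A. if row x \<le> m then expectation (\<lambda>\<omega>. (\<eta> x (Z x \<omega>))\<^sup>2) else 0)"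
    unfolding T by (subst sq(1), simp) (intro sum.cong, auto simp: h_def)
  also have "\<dots> \<le> (\<Sum>i=1..m. K / real (n - i + 1))"
    by (rule row_sum_le[OF _ assms \<eta>_row]) auto
  also have "\<dots> \<le> (\<Sum>i=1..n. K / real (n - i + 1))"
    using assms K_nonneg by (intro sum_mono2) auto
  also have "\<dots> = (\<Sum>k<n. K * (1 / real (Suc k)))"
    by (intro sum.reindex_bij_witness[of _ "\<lambda>k. n - k" "\<lambda>i. n - i"]) auto
  \<comment> \<open>The harmonic sum is of logarithmic size; \<open>sqrt n\<close> suffices, since
    after division by \<open>n\<close> the variance only has to vanish.\<close>
  also have "\<dots> \<le> (\<Sum>k<n. K * (1 / sqrt (real (Suc k))))"
  proof (intro sum_mono mult_left_mono K_nonneg divide_left_mono)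
    show "sqrt (real (Suc k)) \<le> real (Suc k)" for k
      using real_sqrt_le_mono[of "real (Suc k)" "(real (Suc k))\<^sup>2"] by (simp add: power2_eq_square)
  qed auto
  also have "\<dots> = K * (\<Sum>k=0..<0 + n. 1 / sqrt (real (Suc k)))"
    by (simp add: sum_distrib_left lessThan_atLeast0)
  also have "\<dots> \<le> K * (2 * sqrt (real n))"
    by (intro mult_left_mono sum_inverse_sqrt_le K_nonneg)
  finally show "expectation (\<lambda>\<omega>. (T A m \<omega>)\<^sup>2) \<le> 2 * K * sqrt (real n)" by simp
qed

text \<open>The summands of \<open>T\<close> do not depend on \<open>m\<close>, so here Ottaviani's
  inequality can be applied with the rows as ranks. If the Chebyshev bound \<open>b\<close> exceeds
  1/2, the claimed bound exceeds 1 and nothing is to be shown.\<close>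

lemma T_maximal:
  assumes A: "A \<subseteq> I" and "e > 0"
  shows "prob {\<omega>\<in>space M. \<exists>m\<le>n. \<bar>T A m \<omega>\<bar> > 2 * (e * sqrt (real n))} \<le> 4 * K / (e\<^sup>2 * sqrt (real n))"
proof -
  define b where "b = 2 * K / (e\<^sup>2 * sqrt (real n))"
  have sn: "sqrt (real n) > 0" using n_pos by simp
  have cheb: "prob {\<omega>\<in>space M. \<bar>T B n \<omega>\<bar> > e * sqrt (real n)} \<le> b" if B: "B \<subseteq> I" for B
  proof -
    have pos: "(e * sqrt (real n))\<^sup>2 > 0" using \<open>e > 0\<close> sn by simp
    have "prob {\<omega>\<in>space M. \<bar>T B n \<omega>\<bar> > e * sqrt (real n)} \<le> expectation (\<lambda>\<omega>. (T B n \<omega>)\<^sup>2) / (e * sqrt (real n))\<^sup>2"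
    proof (rule markov_real[OF T_square(2)[OF B order_refl] _ pos])
      fix \<omega> assume "\<omega> \<in> {\<omega>\<in>space M. \<bar>T B n \<omega>\<bar> > e * sqrt (real n)}"
      then show "\<omega> \<in> space M \<and> (e * sqrt (real n))\<^sup>2 \<le> (T B n \<omega>)\<^sup>2"
        using \<open>e > 0\<close> sn by (auto simp flip: abs_le_square_iff simp: abs_mult)
    qed auto
    also have "\<dots> \<le> 2 * K * sqrt (real n) / (e * sqrt (real n))\<^sup>2"
      using T_square(1)[OF B order_refl] by (intro divide_right_mono) auto
    also have "\<dots> = b"
      using sn \<open>e > 0\<close> by (simp add: b_def power2_eq_square field_simps del: real_sqrt_mult_self)
    finally show ?thesis .
  qed
  have TI: "(\<Sum>x\<in>B. \<eta> x (Z x \<omega>)) = T B n \<omega>" if "B \<subseteq> I" for B \<omega>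
    unfolding T_def using row that by (intro sum.cong) auto
  have "prob {\<omega>\<in>space M. \<exists>m\<le>n. \<bar>T A m \<omega>\<bar> > 2 * (e * sqrt (real n))} \<le> 2 * b"
  proof (cases "b \<le> 1 / 2")
    case False
    have "prob {\<omega>\<in>space M. \<exists>m\<le>n. \<bar>T A m \<omega>\<bar> > 2 * (e * sqrt (real n))} \<le> 1" by simp
    then show ?thesis using False by linarith
  next
    case True
    \<comment> \<open>Ottaviani's inequality sums over \<open>row x < k\<close>, so
      \<open>m \<le> n\<close> corresponds to \<open>k = m + 1\<close>; the empty sum at
      \<open>k = 0\<close> never exceeds the threshold.\<close>
    have "prob {\<omega>\<in>space M. \<exists>k\<le>n + 1. \<exists>\<theta>\<in>{()}. \<bar>\<Sum>x\<in>{x\<in>A. row x < k}. \<eta> x (Z x \<omega>)\<bar> > 2 * (e * sqrt (real n))}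
      \<le> 2 * prob {\<omega>\<in>space M. \<exists>\<theta>\<in>{()}. \<bar>\<Sum>x\<in>A. \<eta> x (Z x \<omega>)\<bar> > e * sqrt (real n)}"
    proof (rule ottaviani[OF indep_vars_subset[OF indep A], where g = "\<lambda>_. \<eta>"])
      show "finite A" using A finite_I by (rule finite_subset)
      fix k
      have sub: "{x \<in> A. k \<le> row x} \<subseteq> I" using A by auto
      show "prob {\<omega>\<in>space M. \<exists>\<theta>\<in>{()}. \<bar>\<Sum>x\<in>{x\<in>A. k \<le> row x}. \<eta> x (Z x \<omega>)\<bar> > e * sqrt (real n)} \<le> 1 / 2"
        using cheb[OF sub] True by (simp add: TI[OF sub])
    qed (use \<eta>_borel A in auto)
    also have "{\<omega>\<in>space M. \<exists>k\<le>n + 1. \<exists>\<theta>\<in>{()}. \<bar>\<Sum>x\<in>{x\<in>A. row x < k}. \<eta> x (Z x \<omega>)\<bar> > 2 * (e * sqrt (real n))}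
      = {\<omega>\<in>space M. \<exists>m\<le>n. \<bar>T A m \<omega>\<bar> > 2 * (e * sqrt (real n))}"
    proof -
      have fA: "finite A" using A finite_I by (rule finite_subset)
      have eq: "(\<Sum>x\<in>{x\<in>A. row x < Suc m}. \<eta> x (Z x \<omega>)) = T A m \<omega>" for m \<omega>
        unfolding T_def using fA by (simp add: sum.inter_filter less_Suc_eq_le)
      have nz: "\<not> (2 * (e * sqrt (real n)) < \<bar>\<Sum>x\<in>{x\<in>A. row x < 0}. \<eta> x (Z x \<omega>)\<bar>)" for \<omega>
        using \<open>e > 0\<close> sn by (simp add: not_less)
      have "(\<exists>k\<le>n + 1. P k) = (\<exists>m\<le>n. P (Suc m))" if "\<not> P 0" for P :: "nat \<Rightarrow> bool"
        using that by (metis Suc_eq_plus1 Suc_le_mono not0_implies_Suc)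
      note this[of "\<lambda>k. 2 * (e * sqrt (real n)) < \<bar>\<Sum>x\<in>{x\<in>A. row x < k}. \<eta> x (Z x \<omega>)\<bar>" for \<omega>, OF nz]
      then show ?thesis unfolding bex_simps eq[symmetric] by auto
    qed
    also have "prob {\<omega>\<in>space M. \<exists>\<theta>\<in>{()}. \<bar>\<Sum>x\<in>A. \<eta> x (Z x \<omega>)\<bar> > e * sqrt (real n)} \<le> b"
      using cheb[OF A] by (simp add: TI[OF A])
    finally show ?thesis by simp
  qed
  then show ?thesis by (simp add: b_def)
qed

text \<open>The weights \<open>1 / sqrt (n - l + 1)\<close> are chosen such that their sum over a window of length \<open>d\<close> is
  \<open>O(sqrt d)\<close> and that the right-hand side, for increments of variance \<open>O(1 / (n - l + 1))\<close>, has
  expectation \<open>O(sqrt (d n))\<close>.\<close>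

lemma window_cauchy_schwarz:
  assumes "m' \<le> m" "m \<le> n" "m \<le> m' + d"
  shows "(\<Sum>l=m'..<m. \<bar>f l\<bar>)\<^sup>2 \<le> 2 * sqrt (real d) * (\<Sum>l<n. sqrt (real (n - l + 1)) * (f l)\<^sup>2)"
proof -
  define r where "r l = sqrt (real (n - l + 1))" for l
  have r: "r l > 0" for l by (simp add: r_def)
  have "(\<Sum>l=m'..<m. \<bar>f l\<bar>)\<^sup>2 = (\<Sum>l=m'..<m. sqrt (1 / r l) * (sqrt (r l) * \<bar>f l\<bar>))\<^sup>2"
  proof -
    have "sqrt (1 / r l) * (sqrt (r l) * \<bar>f l\<bar>) = \<bar>f l\<bar>" for l
      using r[of l] by (simp add: real_sqrt_divide)
    then show ?thesis by (simp only:)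
  qed
  also have "\<dots> \<le> (\<Sum>l=m'..<m. (sqrt (1 / r l))\<^sup>2) * (\<Sum>l=m'..<m. (sqrt (r l) * \<bar>f l\<bar>)\<^sup>2)"
    by (rule Cauchy_Schwarz_ineq_sum)
  also have "\<dots> = (\<Sum>l=m'..<m. 1 / r l) * (\<Sum>l=m'..<m. r l * (f l)\<^sup>2)"
    using r by (simp add: power_mult_distrib less_imp_le)
  also have "\<dots> \<le> (2 * sqrt (real d)) * (\<Sum>l<n. r l * (f l)\<^sup>2)"
  proof (rule mult_mono)
    have "(\<Sum>l=m'..<m. 1 / r l) = (\<Sum>i=(n - m + 1)..<(n - m + 1) + (m - m'). 1 / sqrt (real (Suc i)))"
      using assms unfolding r_def
      by (intro sum.reindex_bij_witness[of _ "\<lambda>i. n - i" "\<lambda>l. n - l"]) auto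
    also have "\<dots> \<le> 2 * sqrt (real (m - m'))" by (rule sum_inverse_sqrt_le)
    also have "\<dots> \<le> 2 * sqrt (real d)" using assms by simp
    finally show "(\<Sum>l=m'..<m. 1 / r l) \<le> 2 * sqrt (real d)" .
    show "(\<Sum>l=m'..<m. r l * (f l)\<^sup>2) \<le> (\<Sum>l<n. r l * (f l)\<^sup>2)"
      using assms r by (intro sum_mono2) (auto simp: less_imp_le)
    show "0 \<le> (\<Sum>l=m'..<m. r l * (f l)\<^sup>2)" using r by (intro sum_nonneg mult_nonneg_nonneg) (auto simp: less_imp_le)
  qed simp
  finally show ?thesis unfolding r_def .
qed

text \<open>The Cauchy-Schwarz bound \<open>V\<close> is the same for all windows, so a single
  Markov inequality covers the maximum over \<open>m\<close> and \<open>m'\<close> without a union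
  bound. Half of the threshold is granted to the sum of the \<open>S\<close>, a quarter to each of
  the two values of \<open>T\<close>; hence the constants 32 and 256.\<close>

lemma window_bound:
  assumes A: "A \<subseteq> I" and "e > 0"
  shows "prob {\<omega>\<in>space M. \<exists>m\<le>n. \<exists>m'\<le>m. m \<le> m' + d \<and> \<bar>W A m \<omega> - W A m' \<omega>\<bar> > e * sqrt (real n)}
    \<le> 256 * K * (sqrt (real d / real n) + 1 / sqrt (real n)) / e\<^sup>2"
proof -
  define V where "V \<omega> = 2 * sqrt (real d) * (\<Sum>l<n. sqrt (real (n - l + 1)) * (S A l \<omega>)\<^sup>2)" for \<omega>
  have sn: "sqrt (real n) > 0" "real n > 0" using n_pos by auto
  have intV: "integrable M V"
    unfolding V_def using S_square(2)[OF A] by (intro integrable_mult_right Bochner_Integration.integrable_sum) auto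
  have V0: "0 \<le> V \<omega>" for \<omega> unfolding V_def by (intro mult_nonneg_nonneg sum_nonneg) auto
  have "expectation V = 2 * sqrt (real d) * (\<Sum>l<n. sqrt (real (n - l + 1)) * expectation (\<lambda>\<omega>. (S A l \<omega>)\<^sup>2))"
    unfolding V_def using S_square(2)[OF A]
    by (simp add: Bochner_Integration.integral_sum)
  also have "\<dots> \<le> 2 * sqrt (real d) * (\<Sum>l<n. 2 * K * (1 / sqrt (real (n - l + 1))))"
  proof (intro mult_left_mono sum_mono)
    fix l assume "l \<in> {..<n}"
    then have "sqrt (real (n - l + 1)) * expectation (\<lambda>\<omega>. (S A l \<omega>)\<^sup>2) \<le> sqrt (real (n - l + 1)) * (2 * K / real (n - l + 1))"
      using S_square(1)[OF A, of l] by (intro mult_left_mono) auto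
    also have "\<dots> = 2 * K * (sqrt (real (n - l + 1)) / real (n - l + 1))" by simp
    also have "sqrt (real (n - l + 1)) / real (n - l + 1) = 1 / sqrt (real (n - l + 1))"
      using sqrt_divide_self_eq[of "real (n - l + 1)"] by (simp add: inverse_eq_divide)
    finally show "sqrt (real (n - l + 1)) * expectation (\<lambda>\<omega>. (S A l \<omega>)\<^sup>2) \<le> 2 * K * (1 / sqrt (real (n - l + 1)))" .
  qed auto
  also have "(\<Sum>l<n. 2 * K * (1 / sqrt (real (n - l + 1)))) = 2 * K * (\<Sum>l<n. 1 / sqrt (real (n - l + 1)))"
    by (simp add: sum_distrib_left)
  also have "(\<Sum>l<n. 1 / sqrt (real (n - l + 1))) = (\<Sum>i=1..<1 + n. 1 / sqrt (real (Suc i)))"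
    by (intro sum.reindex_bij_witness[of _ "\<lambda>i. n - i" "\<lambda>l. n - l"]) auto
  also have "2 * sqrt (real d) * (2 * K * \<dots>) \<le> 2 * sqrt (real d) * (2 * K * (2 * sqrt (real n)))"
    using K_nonneg by (intro mult_left_mono sum_inverse_sqrt_le) auto
  finally have EV: "expectation V \<le> 8 * K * (sqrt (real d) * sqrt (real n))" by (simp add: mult_ac)
  define E1 where "E1 = {\<omega>\<in>space M. (e * sqrt (real n) / 2)\<^sup>2 \<le> V \<omega>}"
  define E2 where "E2 = {\<omega>\<in>space M. \<exists>m\<le>n. \<bar>T A m \<omega>\<bar> > 2 * (e / 8 * sqrt (real n))}"
  have E1ev: "E1 \<in> events" unfolding E1_def using borel_measurable_integrable[OF intV] by measurable
  have E2ev: "E2 \<in> events"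
  proof -
    note T_borel[OF A, measurable]
    show ?thesis unfolding E2_def by measurable
  qed
  have pE1: "prob E1 \<le> 32 * K * sqrt (real d / real n) / e\<^sup>2"
  proof -
    have pos: "(e * sqrt (real n) / 2)\<^sup>2 > 0" using \<open>e > 0\<close> sn by simp
    have "prob E1 \<le> expectation V / (e * sqrt (real n) / 2)\<^sup>2"
      by (rule markov_real[OF intV V0 pos]) (auto simp: E1_def)
    also have "\<dots> \<le> 8 * K * (sqrt (real d) * sqrt (real n)) / (e * sqrt (real n) / 2)\<^sup>2"
      by (intro divide_right_mono EV) auto
    also have "\<dots> = 32 * K * (sqrt (real d) / sqrt (real n)) / e\<^sup>2"
      using sn \<open>e > 0\<close> by (simp add: power2_eq_square field_simps del: real_sqrt_mult_self)
    finally show ?thesis by (simp add: real_sqrt_divide)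
  qed
  have pE2: "prob E2 \<le> 256 * K / (e\<^sup>2 * sqrt (real n))"
    using T_maximal[OF A, of "e / 8"] \<open>e > 0\<close> unfolding E2_def by (simp add: power_divide)
  have sub: "{\<omega>\<in>space M. \<exists>m\<le>n. \<exists>m'\<le>m. m \<le> m' + d \<and> \<bar>W A m \<omega> - W A m' \<omega>\<bar> > e * sqrt (real n)} \<subseteq> E1 \<union> E2"
  proof (rule ccontr)
    assume "\<not> ?thesis"
    then obtain \<omega> m m' where \<omega>: "\<omega> \<in> space M" "m \<le> n" "m' \<le> m" "m \<le> m' + d"
      "\<bar>W A m \<omega> - W A m' \<omega>\<bar> > e * sqrt (real n)" "\<omega> \<notin> E1" "\<omega> \<notin> E2" by auto
    have T: "\<bar>T A k \<omega>\<bar> \<le> e * sqrt (real n) / 4" if "k \<le> n" for k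
      using \<omega>(1,7) that by (auto simp: E2_def not_less)
    have "(\<Sum>l<m. S A l \<omega>) = (\<Sum>l<m'. S A l \<omega>) + (\<Sum>l=m'..<m. S A l \<omega>)"
      using \<omega>(3) by (simp add: sum.atLeastLessThan_concat lessThan_atLeast0)
    then have "W A m \<omega> - W A m' \<omega> = (\<Sum>l=m'..<m. S A l \<omega>) + T A m \<omega> - T A m' \<omega>"
      unfolding W_eq by simp
    moreover have "\<bar>\<Sum>l=m'..<m. S A l \<omega>\<bar> \<le> (\<Sum>l=m'..<m. \<bar>S A l \<omega>\<bar>)" by (rule sum_abs)
    ultimately have "(\<Sum>l=m'..<m. \<bar>S A l \<omega>\<bar>) > e * sqrt (real n) / 2"
      using T[of m] T[of m'] \<omega>(2,3,5) by linarith
    moreover have "0 \<le> e * sqrt (real n) / 2" using \<open>e > 0\<close> by simp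
    ultimately have "(e * sqrt (real n) / 2)\<^sup>2 \<le> (\<Sum>l=m'..<m. \<bar>S A l \<omega>\<bar>)\<^sup>2"
      by (intro power_mono) auto
    also have "\<dots> \<le> V \<omega>" unfolding V_def using \<omega> by (intro window_cauchy_schwarz) auto
    finally show False using \<omega> by (simp add: E1_def)
  qed
  have "prob {\<omega>\<in>space M. \<exists>m\<le>n. \<exists>m'\<le>m. m \<le> m' + d \<and> \<bar>W A m \<omega> - W A m' \<omega>\<bar> > e * sqrt (real n)} \<le> prob (E1 \<union> E2)"
    using E1ev E2ev by (intro finite_measure_mono sub) auto
  also have "\<dots> \<le> prob E1 + prob E2" by (rule measure_Un_le[OF E1ev E2ev])
  also have "\<dots> \<le> 32 * K * sqrt (real d / real n) / e\<^sup>2 + 256 * K / (e\<^sup>2 * sqrt (real n))"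
    by (intro add_mono pE1 pE2)
  also have "\<dots> \<le> 256 * K * sqrt (real d / real n) / e\<^sup>2 + 256 * K / (e\<^sup>2 * sqrt (real n))"
    using K_nonneg by (intro add_right_mono divide_right_mono mult_right_mono) auto
  also have "\<dots> = 256 * K * (sqrt (real d / real n) + 1 / sqrt (real n)) / e\<^sup>2"
    using \<open>e > 0\<close> sn by (simp add: add_divide_distrib distrib_left)
  finally show ?thesis .
qed

text \<open>Ottaviani's inequality with columns as ranks and windows as \<Theta>. Since
  \<open>window_bound\<close> holds for every set of cells, it verifies the tail hypothesis and also
  bounds the total; again a bound above 1 is trivial.\<close>

lemma window_maximal:
  fixes col :: "'i \<Rightarrow> nat"
  assumes "e > 0"
  shows "prob {\<omega>\<in>space M. \<exists>k\<le>q. \<exists>m\<le>n. \<exists>m'\<le>m. m \<le> m' + d \<and>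
      \<bar>W {x\<in>I. col x < k} m \<omega> - W {x\<in>I. col x < k} m' \<omega>\<bar> > 2 * (e * sqrt (real n))}
    \<le> 512 * K * (sqrt (real d / real n) + 1 / sqrt (real n)) / e\<^sup>2"
proof -
  define b where "b = 256 * K * (sqrt (real d / real n) + 1 / sqrt (real n)) / e\<^sup>2"
  define \<Theta> where "\<Theta> = {(m, m'). m \<le> n \<and> m' \<le> m \<and> m \<le> m' + d}"
  have "\<Theta> \<subseteq> {..n} \<times> {..n}" by (auto simp: \<Theta>_def)
  then have fin\<Theta>: "finite \<Theta>" by (rule finite_subset) auto
  define g where "g \<theta> x z = wt (fst \<theta>) x z - wt (snd \<theta>) x z" for \<theta> x z
  have g: "(\<Sum>x\<in>B. g (m, m') x (Z x \<omega>)) = W B m \<omega> - W B m' \<omega>" for B m m' \<omega>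
    by (simp add: g_def W_def sum_subtractf)
  have ex\<Theta>: "(\<exists>\<theta>\<in>\<Theta>. P \<theta>) \<longleftrightarrow> (\<exists>m\<le>n. \<exists>m'\<le>m. m \<le> m' + d \<and> P (m, m'))" for P
    by (auto simp: \<Theta>_def)
  have "prob {\<omega>\<in>space M. \<exists>k\<le>q. \<exists>m\<le>n. \<exists>m'\<le>m. m \<le> m' + d \<and>
      \<bar>W {x\<in>I. col x < k} m \<omega> - W {x\<in>I. col x < k} m' \<omega>\<bar> > 2 * (e * sqrt (real n))} \<le> 2 * b"
  proof (cases "b \<le> 1 / 2")
    case False
    then have "1 \<le> 2 * b" by simp
    then show ?thesis using prob_le_1 order_trans by blast
  next
    case True
    have "prob {\<omega>\<in>space M. \<exists>k\<le>q. \<exists>\<theta>\<in>\<Theta>. \<bar>\<Sum>x\<in>{x\<in>I. col x < k}. g \<theta> x (Z x \<omega>)\<bar> > 2 * (e * sqrt (real n))}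
      \<le> 2 * prob {\<omega>\<in>space M. \<exists>\<theta>\<in>\<Theta>. \<bar>\<Sum>x\<in>I. g \<theta> x (Z x \<omega>)\<bar> > e * sqrt (real n)}"
    proof (rule ottaviani[OF indep finite_I fin\<Theta>])
      show "g \<theta> x \<in> borel_measurable borel" if "x \<in> I" for \<theta> x
        unfolding g_def using wt_borel[OF that] by (intro borel_measurable_diff)
      fix k
      have sub: "{x \<in> I. k \<le> col x} \<subseteq> I" by auto
      show "prob {\<omega>\<in>space M. \<exists>\<theta>\<in>\<Theta>. \<bar>\<Sum>x\<in>{x\<in>I. k \<le> col x}. g \<theta> x (Z x \<omega>)\<bar> > e * sqrt (real n)} \<le> 1 / 2"
        unfolding ex\<Theta> g using window_bound[OF sub \<open>e > 0\<close>, of d] True unfolding b_def by linarith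
    qed
    also have "\<dots> \<le> 2 * b"
      unfolding ex\<Theta> g b_def using window_bound[OF order_refl \<open>e > 0\<close>, of d] by linarith
    finally show ?thesis unfolding ex\<Theta> g .
  qed
  then show ?thesis by (simp add: b_def)
qed

lemma wt_moments:
  assumes "x \<in> I"
  shows "expectation (\<lambda>\<omega>. wt m x (Z x \<omega>)) = 0" and "integrable M (\<lambda>\<omega>. (wt m x (Z x \<omega>))\<^sup>2)"
proof -
  define a b where "a = real (m - row x)" and "b = (if row x \<le> m then 1 else 0 :: real)"
  have wt: "wt m x z = a * \<xi> x z + b * \<eta> x z" for z by (simp add: wt_def a_def b_def)
  have "integrable M (\<lambda>\<omega>. \<xi> x (Z x \<omega>))" "integrable M (\<lambda>\<omega>. \<eta> x (Z x \<omega>))"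
    using square_integrable_imp_integrable[OF \<xi>Z_borel \<xi>_int] square_integrable_imp_integrable[OF \<eta>Z_borel \<eta>_int] assms by auto
  then show "expectation (\<lambda>\<omega>. wt m x (Z x \<omega>)) = 0"
    unfolding wt using \<xi>_mean[OF assms] \<eta>_mean[OF assms] by simp
  have "(wt m x z)\<^sup>2 = a\<^sup>2 * (\<xi> x z)\<^sup>2 + 2 * a * b * (\<xi> x z * \<eta> x z) + b\<^sup>2 * (\<eta> x z)\<^sup>2" for z
    unfolding wt by (simp add: power2_eq_square algebra_simps)
  moreover have "integrable M (\<lambda>\<omega>. \<xi> x (Z x \<omega>) * \<eta> x (Z x \<omega>))"
    using assms by (intro square_integrable_mult \<xi>Z_borel \<eta>Z_borel \<xi>_int \<eta>_int)
  ultimately show "integrable M (\<lambda>\<omega>. (wt m x (Z x \<omega>))\<^sup>2)"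
    using \<xi>_int[OF assms] \<eta>_int[OF assms] by simp
qed

lemma W_square:
  assumes "A \<subseteq> I"
  shows "expectation (\<lambda>\<omega>. (W A m \<omega>)\<^sup>2) = (\<Sum>x\<in>A. expectation (\<lambda>\<omega>. (wt m x (Z x \<omega>))\<^sup>2))"
    and "integrable M (\<lambda>\<omega>. (W A m \<omega>)\<^sup>2)"
proof -
  have fA: "finite A" using assms finite_I by (rule finite_subset)
  note sq = indep_centered_square[where h = "wt m", OF indep fA assms wt_borel wt_moments(2) wt_moments(1)]
  show "expectation (\<lambda>\<omega>. (W A m \<omega>)\<^sup>2) = (\<Sum>x\<in>A. expectation (\<lambda>\<omega>. (wt m x (Z x \<omega>))\<^sup>2))"
    unfolding W_def by (rule sq) (use assms in auto)
  show "integrable M (\<lambda>\<omega>. (W A m \<omega>)\<^sup>2)"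
    unfolding W_def by (rule sq) (use assms in auto)
qed

text \<open>The variance of the block dominates that of each of its tails, so Chebyshev's inequality
  verifies Ottaviani's hypothesis. The probability for the whole block is left as it stands, to be
  estimated later by better moments.\<close>

lemma block_maximal:
  fixes col :: "'i \<Rightarrow> nat"
  assumes A: "A \<subseteq> I" and "a > 0" and small: "expectation (\<lambda>\<omega>. (W A m \<omega>)\<^sup>2) \<le> a\<^sup>2 / 2"
  shows "prob {\<omega>\<in>space M. \<exists>k\<le>q. \<bar>W {x\<in>A. col x < k} m \<omega>\<bar> > 2 * a}
    \<le> 2 * prob {\<omega>\<in>space M. \<bar>W A m \<omega>\<bar> > a}"
proof -
  have fA: "finite A" using A finite_I by (rule finite_subset)
  have "prob {\<omega>\<in>space M. \<exists>k\<le>q. \<exists>\<theta>\<in>{()}. \<bar>\<Sum>x\<in>{x\<in>A. col x < k}. wt m x (Z x \<omega>)\<bar> > 2 * a}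
      \<le> 2 * prob {\<omega>\<in>space M. \<exists>\<theta>\<in>{()}. \<bar>\<Sum>x\<in>A. wt m x (Z x \<omega>)\<bar> > a}"
  proof (rule ottaviani[OF indep_vars_subset[OF indep A] fA, where g = "\<lambda>_. wt m"])
    fix k
    have sub: "{x \<in> A. k \<le> col x} \<subseteq> I" using A by auto
    have "prob {\<omega>\<in>space M. \<bar>W {x \<in> A. k \<le> col x} m \<omega>\<bar> > a} \<le> expectation (\<lambda>\<omega>. (W {x \<in> A. k \<le> col x} m \<omega>)\<^sup>2) / a\<^sup>2"
    proof (rule markov_real[OF W_square(2)[OF sub]])
      fix \<omega> assume "\<omega> \<in> {\<omega>\<in>space M. \<bar>W {x \<in> A. k \<le> col x} m \<omega>\<bar> > a}"
      then show "\<omega> \<in> space M \<and> a\<^sup>2 \<le> (W {x \<in> A. k \<le> col x} m \<omega>)\<^sup>2"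
        using \<open>a > 0\<close> by (auto simp flip: abs_le_square_iff)
    qed (use \<open>a > 0\<close> in auto)
    also have "expectation (\<lambda>\<omega>. (W {x \<in> A. k \<le> col x} m \<omega>)\<^sup>2) \<le> expectation (\<lambda>\<omega>. (W A m \<omega>)\<^sup>2)"
      unfolding W_square(1)[OF sub] W_square(1)[OF A] using fA by (intro sum_mono2) auto
    finally have "prob {\<omega>\<in>space M. \<bar>W {x \<in> A. k \<le> col x} m \<omega>\<bar> > a} \<le> expectation (\<lambda>\<omega>. (W A m \<omega>)\<^sup>2) / a\<^sup>2"
      by (simp add: divide_right_mono)
    also have "\<dots> \<le> (a\<^sup>2 / 2) / a\<^sup>2" by (intro divide_right_mono small) auto
    also have "\<dots> = 1 / 2" using \<open>a > 0\<close> by simp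
    finally show "prob {\<omega>\<in>space M. \<exists>\<theta>\<in>{()}. \<bar>\<Sum>x\<in>{x\<in>A. k \<le> col x}. wt m x (Z x \<omega>)\<bar> > a} \<le> 1 / 2"
      by (simp add: W_def)
  qed (use wt_borel A in auto)
  then show ?thesis by (simp add: W_def)
qed

end

section \<open>Logarithmic moments of the beta distribution\<close>

text \<open>Termwise differentiation and uniqueness of derivatives identify the coefficients with
  any given chain of derivatives of the sum. It reads moments off a moment generating
  function.\<close>

lemma power_series_derivative_chain:
  fixes f :: "nat \<Rightarrow> real \<Rightarrow> real"
  assumes "\<delta> > 0" and sums: "\<And>x. \<bar>x\<bar> < \<delta> \<Longrightarrow> (\<lambda>k. a k * x ^ k) sums f 0 x"
    and der: "\<And>j x. j < n \<Longrightarrow> \<bar>x\<bar> < \<delta> \<Longrightarrow> (f j has_real_derivative f (Suc j) x) (at x)"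
    and "j \<le> n"
  shows "f j 0 = fact j * a j"
proof -
  have "j \<le> n \<Longrightarrow> (\<forall>x. \<bar>x\<bar> < \<delta> \<longrightarrow> (\<lambda>k. (diffs ^^ j) a k * x ^ k) sums f j x)"
  proof (induction j)
    case 0
    then show ?case using sums by simp
  next
    case (Suc j)
    then have IH: "(\<lambda>k. (diffs ^^ j) a k * x ^ k) sums f j x" if "\<bar>x\<bar> < \<delta>" for x using that by simp
    show ?case
    proof (intro allI impI)
      fix x :: real assume x: "\<bar>x\<bar> < \<delta>"
      have summ: "summable (\<lambda>k. (diffs ^^ j) a k * z ^ k)" if "norm z < \<delta>" for z
        using IH[of z] that by (simp add: sums_iff)
      have "((\<lambda>x. \<Sum>k. (diffs ^^ j) a k * x ^ k) has_real_derivative (\<Sum>k. diffs ((diffs ^^ j) a) k * x ^ k)) (at x)"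
        using x by (intro termdiffs_strong'[of \<delta>] summ) auto
      moreover have "((\<lambda>x. \<Sum>k. (diffs ^^ j) a k * x ^ k) has_real_derivative f (Suc j) x) (at x)"
      proof (rule has_field_derivative_transform_within_open)
        show "(f j has_real_derivative f (Suc j) x) (at x)" using der Suc.prems x by simp
        show "open {- \<delta><..<\<delta>}" "x \<in> {- \<delta><..<\<delta>}" using x by auto
        show "f j y = (\<Sum>k. (diffs ^^ j) a k * y ^ k)" if "y \<in> {- \<delta><..<\<delta>}" for y
          using IH[of y] that by (auto simp: sums_iff)
      qed
      ultimately have "(\<Sum>k. diffs ((diffs ^^ j) a) k * x ^ k) = f (Suc j) x" by (rule DERIV_unique)
      moreover have "summable (\<lambda>k. diffs ((diffs ^^ j) a) k * x ^ k)"
        using x by (intro termdiff_converges[of x \<delta>] summ) auto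
      ultimately show "(\<lambda>k. (diffs ^^ Suc j) a k * x ^ k) sums f (Suc j) x"
        by (simp add: sums_iff)
    qed
  qed
  then have "(\<lambda>k. (diffs ^^ j) a k * 0 ^ k) sums f j 0"
    using \<open>j \<le> n\<close> \<open>\<delta> > 0\<close> by (metis abs_zero)
  then have "(diffs ^^ j) a 0 = f j 0" by (rule powser_sums_zero_iff[THEN iffD1])
  moreover have "(diffs ^^ j) a k = (fact (k + j) / fact k) * a (k + j)" for k
  proof (induction j arbitrary: k)
    case (Suc j)
    have d: "diffs b k = real (Suc k) * b (Suc k)" for b :: "nat \<Rightarrow> real" by (simp add: diffs_def)
    have "(diffs ^^ Suc j) a k = real (Suc k) * (fact (Suc k + j) / fact (Suc k) * a (Suc k + j))"
      unfolding funpow.simps o_apply d Suc.IH ..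
    then show ?case by (simp add: divide_simps)
  qed simp
  ultimately show ?thesis by simp
qed

text \<open>Exponential integrability at both \<open>r\<close> and \<open>- r\<close> for some
  \<open>r\<close> beyond the modulus of \<open>x\<close> dominates the partial sums of the
  exponential series, so expectation and series may be exchanged.\<close>

lemma (in prob_space) exponential_moments:
  fixes X :: "'a \<Rightarrow> real" and \<delta> :: real
  assumes X: "X \<in> borel_measurable M"
    and e: "\<And>x. \<bar>x\<bar> < \<delta> \<Longrightarrow> integrable M (\<lambda>\<omega>. exp (x * X \<omega>))" and "\<bar>x\<bar> < \<delta>"
  shows "(\<lambda>k. expectation (\<lambda>\<omega>. X \<omega> ^ k) / fact k * x ^ k) sums expectation (\<lambda>\<omega>. exp (x * X \<omega>))"
    and "integrable M (\<lambda>\<omega>. X \<omega> ^ k)"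
proof -
  define r where "r = (\<bar>x\<bar> + \<delta>) / 2"
  have r: "\<bar>x\<bar> < r" "r < \<delta>" "r > 0" using assms(3) by (auto simp: r_def)
  have dom: "exp (r * \<bar>X \<omega>\<bar>) \<le> exp (r * X \<omega>) + exp (- r * X \<omega>)" for \<omega>
    by (cases "X \<omega> \<ge> 0") auto
  have intd: "integrable M (\<lambda>\<omega>. exp (r * \<bar>X \<omega>\<bar>))"
  proof (rule Bochner_Integration.integrable_bound)
    show "integrable M (\<lambda>\<omega>. exp (r * X \<omega>) + exp (- r * X \<omega>))"
      using e[of r] e[of "- r"] r by simp
    show "AE \<omega> in M. norm (exp (r * \<bar>X \<omega>\<bar>)) \<le> norm (exp (r * X \<omega>) + exp (- r * X \<omega>))"
      using dom by simp
  qed (use X in measurable)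
  have pw: "\<bar>y\<bar> ^ k \<le> fact k * exp \<bar>y\<bar>" for y :: real and k
  proof -
    have "\<bar>y\<bar> ^ k / fact k \<le> (\<Sum>i\<in>{k}. \<bar>y\<bar> ^ i / fact i)" by simp
    also have "\<dots> \<le> exp \<bar>y\<bar>"
      using exp_converges[of "\<bar>y\<bar>"] sum_le_suminf[of "\<lambda>k. \<bar>y\<bar> ^ k / fact k" "{k}"]
      by (simp add: sums_iff divide_inverse mult.commute)
    finally show ?thesis by (simp add: field_simps)
  qed
  show "integrable M (\<lambda>\<omega>. X \<omega> ^ k)" for k
  proof (rule Bochner_Integration.integrable_bound)
    show "integrable M (\<lambda>\<omega>. fact k / r ^ k * exp (r * \<bar>X \<omega>\<bar>))" using intd by (rule integrable_mult_right)
    show "AE \<omega> in M. norm (X \<omega> ^ k) \<le> norm (fact k / r ^ k * exp (r * \<bar>X \<omega>\<bar>))"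
    proof (rule AE_I2)
      fix \<omega>
      have "r ^ k * \<bar>X \<omega>\<bar> ^ k \<le> fact k * exp (r * \<bar>X \<omega>\<bar>)"
        using pw[of "r * X \<omega>" k] r by (simp add: abs_mult power_mult_distrib)
      then show "norm (X \<omega> ^ k) \<le> norm (fact k / r ^ k * exp (r * \<bar>X \<omega>\<bar>))"
        using r by (simp add: power_abs abs_mult field_simps)
    qed
  qed (use X in measurable)
  note intX = this
  have "(\<lambda>n. expectation (\<lambda>\<omega>. \<Sum>k<n. (x * X \<omega>) ^ k / fact k)) \<longlonglongrightarrow> expectation (\<lambda>\<omega>. exp (x * X \<omega>))"
  proof (rule integral_dominated_convergence[where w = "\<lambda>\<omega>. exp (r * \<bar>X \<omega>\<bar>)"])
    show "AE \<omega> in M. (\<lambda>n. \<Sum>k<n. (x * X \<omega>) ^ k / fact k) \<longlonglongrightarrow> exp (x * X \<omega>)"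
    proof (rule AE_I2)
      fix \<omega>
      show "(\<lambda>n. \<Sum>k<n. (x * X \<omega>) ^ k / fact k) \<longlonglongrightarrow> exp (x * X \<omega>)"
        using exp_converges[of "x * X \<omega>"] by (simp add: sums_def divide_inverse mult.commute)
    qed
    show "AE \<omega> in M. norm (\<Sum>k<n. (x * X \<omega>) ^ k / fact k) \<le> exp (r * \<bar>X \<omega>\<bar>)" for n
    proof (rule AE_I2)
      fix \<omega>
      have "norm (\<Sum>k<n. (x * X \<omega>) ^ k / fact k) \<le> (\<Sum>k<n. \<bar>x * X \<omega>\<bar> ^ k / fact k)"
        by (rule order_trans[OF norm_sum]) (simp add: power_abs)
      also have "\<dots> \<le> exp \<bar>x * X \<omega>\<bar>"
        using exp_converges[of "\<bar>x * X \<omega>\<bar>"] sum_le_suminf[of "\<lambda>k. \<bar>x * X \<omega>\<bar> ^ k / fact k" "{..<n}"]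
        by (simp add: sums_iff divide_inverse mult.commute)
      also have "\<dots> \<le> exp (r * \<bar>X \<omega>\<bar>)" using r by (simp add: abs_mult mult_right_mono)
      finally show "norm (\<Sum>k<n. (x * X \<omega>) ^ k / fact k) \<le> exp (r * \<bar>X \<omega>\<bar>)" .
    qed
    show "(\<lambda>\<omega>. exp (x * X \<omega>)) \<in> borel_measurable M" using X by measurable
    show "(\<lambda>\<omega>. \<Sum>k<n. (x * X \<omega>) ^ k / fact k) \<in> borel_measurable M" for n using X by measurable
  qed (rule intd)
  moreover have "expectation (\<lambda>\<omega>. \<Sum>k<n. (x * X \<omega>) ^ k / fact k) = (\<Sum>k<n. expectation (\<lambda>\<omega>. X \<omega> ^ k) / fact k * x ^ k)" for n
    using intX by (subst Bochner_Integration.integral_sum) (auto simp: power_mult_distrib mult_ac)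
  ultimately show "(\<lambda>k. expectation (\<lambda>\<omega>. X \<omega> ^ k) / fact k * x ^ k) sums expectation (\<lambda>\<omega>. exp (x * X \<omega>))"
    by (simp add: sums_def)
qed

text \<open>The functions \<open>L 1, \<dots>, L 4\<close> are the derivatives of the cumulant generating function \<open>L 0\<close>.\<close>

lemma (in prob_space) cumulants:
  fixes L :: "nat \<Rightarrow> real \<Rightarrow> real"
  assumes X: "X \<in> borel_measurable M" and "\<delta> > 0"
    and int: "\<And>x. \<bar>x\<bar> < \<delta> \<Longrightarrow> integrable M (\<lambda>\<omega>. exp (x * X \<omega>))"
    and mgf: "\<And>x. \<bar>x\<bar> < \<delta> \<Longrightarrow> expectation (\<lambda>\<omega>. exp (x * X \<omega>)) = exp (L 0 x)"
    and der: "\<And>j x. j < 4 \<Longrightarrow> \<bar>x\<bar> < \<delta> \<Longrightarrow> (L j has_real_derivative L (Suc j) x) (at x)"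
  shows "integrable M (\<lambda>\<omega>. X \<omega> ^ k)" and "integrable M (\<lambda>\<omega>. (X \<omega> - expectation X) ^ k)"
    and "variance X = L 2 0" and "expectation (\<lambda>\<omega>. (X \<omega> - expectation X) ^ 4) = L 4 0 + 3 * (L 2 0)\<^sup>2"
proof -
  show "integrable M (\<lambda>\<omega>. X \<omega> ^ k)" for k
    using exponential_moments(2)[OF X int, of \<delta> 0] \<open>\<delta> > 0\<close> by simp
  define \<mu> where "\<mu> = L 1 0"
  \<comment> \<open>\<open>L 1 0\<close> is the candidate for the mean; that it is the expectation
    follows afterwards from the first derivative of the centred generating function.\<close>
  define Y where "Y \<omega> = X \<omega> - \<mu>" for \<omega>
  have Y: "Y \<in> borel_measurable M" unfolding Y_def using X by simp
  have expY: "exp (x * Y \<omega>) = exp (- x * \<mu>) * exp (x * X \<omega>)" for x \<omega>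
    by (simp add: Y_def exp_add[symmetric] algebra_simps)
  have intY: "integrable M (\<lambda>\<omega>. exp (x * Y \<omega>))" if "\<bar>x\<bar> < \<delta>" for x
    unfolding expY using int[OF that] by simp
  have mgfY: "expectation (\<lambda>\<omega>. exp (x * Y \<omega>)) = exp (L 0 x - x * \<mu>)" if "\<bar>x\<bar> < \<delta>" for x
  proof -
    have "expectation (\<lambda>\<omega>. exp (x * Y \<omega>)) = exp (- x * \<mu>) * expectation (\<lambda>\<omega>. exp (x * X \<omega>))"
      unfolding expY by (rule integral_mult_right_zero)
    then show ?thesis unfolding mgf[OF that] exp_add[symmetric] by (simp add: algebra_simps)
  qed
  have intYk: "integrable M (\<lambda>\<omega>. Y \<omega> ^ k)" for k
    using exponential_moments(2)[OF Y intY, of \<delta> 0] \<open>\<delta> > 0\<close> by simp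
  define m where "m x = exp (L 0 x - x * \<mu>)" for x
  \<comment> \<open>The derivatives of \<open>m\<close> of orders 0 to 4: complete Bell polynomials
    in the derivatives of the exponent \<open>L 0 x - x * \<mu>\<close>, times \<open>m x\<close>.
    At 0 the first derivative of the exponent vanishes, which leaves
    \<open>L 4 0 + 3 * (L 2 0)\<^sup>2\<close> at order 4.\<close>
  define f where "f j x = (if j = 0 then m x
    else if j = 1 then (L 1 x - \<mu>) * m x
    else if j = 2 then (L 2 x + (L 1 x - \<mu>)\<^sup>2) * m x
    else if j = 3 then (L 3 x + 3 * (L 1 x - \<mu>) * L 2 x + (L 1 x - \<mu>) ^ 3) * m x
    else (L 4 x + 4 * (L 1 x - \<mu>) * L 3 x + 3 * (L 2 x)\<^sup>2 + 6 * (L 1 x - \<mu>)\<^sup>2 * L 2 x + (L 1 x - \<mu>) ^ 4) * m x)" for j :: nat and x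
  have d: "(L 0 has_real_derivative L 1 x) (at x)" "(L 1 has_real_derivative L 2 x) (at x)"
    "(L 2 has_real_derivative L 3 x) (at x)" "(L 3 has_real_derivative L 4 x) (at x)" if "\<bar>x\<bar> < \<delta>" for x
    using der[of 0 x] der[of 1 x] der[of 2 x] der[of 3 x] that by (simp_all add: numeral_eq_Suc)
  have dm: "(m has_real_derivative (L 1 x - \<mu>) * m x) (at x)" if "\<bar>x\<bar> < \<delta>" for x
    unfolding m_def using d[OF that] by (auto intro!: derivative_eq_intros)
  have fder: "(f j has_real_derivative f (Suc j) x) (at x)" if "j < 4" "\<bar>x\<bar> < \<delta>" for j x
  proof -
    have "j = 0 \<or> j = 1 \<or> j = 2 \<or> j = 3" using that(1) by arith
    then consider "j = 0" | "j = 1" | "j = 2" | "j = 3" by blast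
    then show ?thesis
    proof cases
      case 1
      then show ?thesis using dm[OF that(2)] by (simp add: f_def[abs_def])
    next
      case 2
      have "((\<lambda>x. (L 1 x - \<mu>) * m x) has_real_derivative f 2 x) (at x)"
        using d[OF that(2)] dm[OF that(2)] by (auto intro!: derivative_eq_intros simp: f_def power2_eq_square algebra_simps)
      then show ?thesis using 2 by (simp add: f_def[abs_def] numeral_eq_Suc)
    next
      case 3
      have "((\<lambda>x. (L 2 x + (L 1 x - \<mu>)\<^sup>2) * m x) has_real_derivative f 3 x) (at x)"
        using d[OF that(2)] dm[OF that(2)]
        by (auto intro!: derivative_eq_intros simp: f_def power2_eq_square power3_eq_cube algebra_simps)
      then show ?thesis using 3 by (simp add: f_def[abs_def] numeral_eq_Suc)
    next
      case 4
      have "((\<lambda>x. (L 3 x + 3 * (L 1 x - \<mu>) * L 2 x + (L 1 x - \<mu>) ^ 3) * m x) has_real_derivative f 4 x) (at x)"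
        using d[OF that(2)] dm[OF that(2)]
        by (auto intro!: derivative_eq_intros simp: f_def power2_eq_square power3_eq_cube power4_eq_xxxx algebra_simps)
      then show ?thesis using 4 by (simp add: f_def[abs_def] numeral_eq_Suc)
    qed
  qed
  have sums: "(\<lambda>k. expectation (\<lambda>\<omega>. Y \<omega> ^ k) / fact k * x ^ k) sums f 0 x" if "\<bar>x\<bar> < \<delta>" for x
    using exponential_moments(1)[OF Y intY that] mgfY[OF that] by (simp add: f_def m_def)
  have mom: "f j 0 = expectation (\<lambda>\<omega>. Y \<omega> ^ j)" if "j \<le> 4" for j
    using power_series_derivative_chain[OF \<open>\<delta> > 0\<close> sums fder that] by simp
  have m0: "m 0 = 1" using mom[of 0] by (simp add: f_def prob_space)
  have "expectation Y = 0" using mom[of 1] by (simp add: f_def \<mu>_def)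
  then have EX: "expectation X = \<mu>"
  proof -
    have "integrable M X" using exponential_moments(2)[OF X int, of \<delta> 0 1] \<open>\<delta> > 0\<close> by simp
    then show ?thesis using \<open>expectation Y = 0\<close> by (simp add: Y_def[abs_def] prob_space)
  qed
  show "integrable M (\<lambda>\<omega>. (X \<omega> - expectation X) ^ k)" for k
    unfolding EX using intYk by (simp add: Y_def)
  show "variance X = L 2 0" unfolding EX using mom[of 2] m0 by (simp add: f_def Y_def \<mu>_def)
  show "expectation (\<lambda>\<omega>. (X \<omega> - expectation X) ^ 4) = L 4 0 + 3 * (L 2 0)\<^sup>2"
    unfolding EX using mom[of 4] m0 by (simp add: f_def Y_def \<mu>_def)
qed


section \<open>Logarithms of beta variables\<close>

lemma beta_density_nonneg: "a > 0 \<Longrightarrow> b > 0 \<Longrightarrow> 0 \<le> beta_density a b x"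
  by (auto simp: beta_density_def Beta_def intro!: divide_nonneg_nonneg Gamma_real_nonneg mult_nonneg_nonneg)

lemma (in prob_space) beta_AE:
  assumes "distributed M lborel P (beta_density a b)"
  shows "AE \<omega> in M. 0 < P \<omega> \<and> P \<omega> < 1"
proof -
  have "AE x in distr M lborel P. 0 < x \<and> x < 1"
    unfolding distributed_distr_eq_density[OF assms]
    by (subst AE_density) (use assms in \<open>auto simp: beta_density_def distributed_def\<close>)
  then show ?thesis
    using assms by (subst (asm) AE_distr_iff) (auto simp: distributed_def)
qed

text \<open>Exponential tilting: the integrand is again an unnormalised beta density, with
  parameters \<open>a + u\<close> and \<open>b + v\<close>. The end points 0 and 1, where the
  formulas differ, form a null set.\<close>

lemma (in prob_space) beta_mgf:
  assumes P: "distributed M lborel P (beta_density a b)" and ab: "a > 0" "b > 0" "a + u > 0" "b + v > 0"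
  shows "integrable M (\<lambda>\<omega>. exp (u * ln (P \<omega>) + v * ln (1 - P \<omega>)))"
    and "expectation (\<lambda>\<omega>. exp (u * ln (P \<omega>) + v * ln (1 - P \<omega>))) = Beta (a + u) (b + v) / Beta a b"
proof -
  define g where "g x = exp (u * ln x + v * ln (1 - x))" for x :: real
  define q where "q x = x powr (a + u - 1) * (1 - x) powr (b + v - 1)" for x :: real
  have [measurable]: "g \<in> borel_measurable borel" unfolding g_def by measurable
  have eq: "beta_density a b x * g x = (1 / Beta a b) * (indicator {0..1} x * q x)" if "x \<noteq> 0" "x \<noteq> 1" for x
  proof (cases "0 < x \<and> x < 1")
    case True
    then have "x powr (a - 1) * exp (u * ln x) = x powr (a + u - 1)"
      "(1 - x) powr (b - 1) * exp (v * ln (1 - x)) = (1 - x) powr (b + v - 1)"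
      by (simp_all add: powr_def exp_add[symmetric] algebra_simps)
    moreover have "beta_density a b x * g x = (1 / Beta a b) * ((x powr (a - 1) * exp (u * ln x)) * ((1 - x) powr (b - 1) * exp (v * ln (1 - x))))"
      using True by (simp add: beta_density_def g_def exp_add)
    ultimately show ?thesis using True by (simp add: q_def)
  qed (use that in \<open>auto simp: beta_density_def\<close>)
  have ae: "AE x in lborel. beta_density a b x * g x = (1 / Beta a b) * (indicator {0..1} x * q x)"
    using AE_lborel_singleton[of 0] AE_lborel_singleton[of 1] by eventually_elim (rule eq)
  have iq: "integrable lborel (\<lambda>x. (1 / Beta a b) * (indicator {0..1} x * q x))"
    using integrable_Beta[of "a + u" "b + v"] ab unfolding q_def set_integrable_def by simp
  have Bq: "(\<integral>x. indicator {0..1} x * q x \<partial>lborel) = Beta (a + u) (b + v)"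
    using set_borel_integral_eq_integral(2)[OF integrable_Beta[of "a + u" "b + v"]] ab
      integral_unique[OF has_integral_Beta_real[of "a + u" "b + v"]]
    unfolding q_def set_lebesgue_integral_def by simp
  have mbd: "beta_density a b \<in> borel_measurable borel" unfolding beta_density_def by measurable
  have nn: "\<And>x. x \<in> space lborel \<Longrightarrow> 0 \<le> beta_density a b x" using ab beta_density_nonneg by blast
  have "integrable lborel (\<lambda>x. beta_density a b x * g x)"
    using mbd by (subst integrable_cong_AE[OF _ _ ae]) (use iq borel_measurable_integrable[OF iq] in auto)
  then show "integrable M (\<lambda>\<omega>. exp (u * ln (P \<omega>) + v * ln (1 - P \<omega>)))"
    using distributed_integrable[OF P, of g] nn by (simp add: g_def)
  have "expectation (\<lambda>\<omega>. g (P \<omega>)) = (\<integral>x. beta_density a b x * g x \<partial>lborel)"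
    using distributed_integral[OF P, of g] nn by simp
  also have "\<dots> = (\<integral>x. (1 / Beta a b) * (indicator {0..1} x * q x) \<partial>lborel)"
    using mbd borel_measurable_integrable[OF iq] by (intro integral_cong_AE ae) auto
  also have "\<dots> = Beta (a + u) (b + v) / Beta a b" using Bq by simp
  finally show "expectation (\<lambda>\<omega>. exp (u * ln (P \<omega>) + v * ln (1 - P \<omega>))) = Beta (a + u) (b + v) / Beta a b"
    by (simp add: g_def)
qed

text \<open>The case \<open>v = 1\<close> is for variables \<open>p\<close> in \<open>LL\<close>,
  the case \<open>v = 0\<close> for the lone \<open>ln p\<close> in \<open>DD\<close> and for the
  variables \<open>r\<close>.\<close>

lemma (in prob_space) beta_log_moments:
  assumes P: "distributed M lborel P (beta_density a b)" and ab: "a > 0" "b > 0"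
    and v: "v \<in> {0, 1}"
  defines "X \<equiv> \<lambda>\<omega>. ln (P \<omega>) + v * ln (1 - P \<omega>)"
  shows "X \<in> borel_measurable M" and "\<And>k. integrable M (\<lambda>\<omega>. X \<omega> ^ k)" and "\<And>k. integrable M (\<lambda>\<omega>. (X \<omega> - expectation X) ^ k)"
    and "variance X = Polygamma 1 a + v * Polygamma 1 b - (1 + v)\<^sup>2 * Polygamma 1 (a + b)"
    and "expectation (\<lambda>\<omega>. (X \<omega> - expectation X) ^ 4) =
      Polygamma 3 a + v * Polygamma 3 b - (1 + v) ^ 4 * Polygamma 3 (a + b) + 3 * (variance X)\<^sup>2"
proof -
  define \<delta> where "\<delta> = min a b"
  have "\<delta> > 0" using ab by (simp add: \<delta>_def)
  have Pm: "P \<in> borel_measurable M" using P by (simp add: distributed_def)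
  show Xm: "X \<in> borel_measurable M" unfolding X_def using Pm by measurable
  \<comment> \<open>\<open>L 0\<close> is the logarithm of the quotient of Beta functions from
    \<open>beta_mgf\<close>. The arguments have slopes 1, \<open>v\<close> and \<open>1 + v\<close>;
    powers of \<open>v\<close> collapse to \<open>v\<close> because it is 0 or 1.\<close>
  define L where "L j x = (if j = 0 then ln_Gamma (a + x) + ln_Gamma (b + v * x) - ln_Gamma (a + b + (1 + v) * x)
      - (ln_Gamma a + ln_Gamma b - ln_Gamma (a + b))
    else Polygamma (j - 1) (a + x) + v * Polygamma (j - 1) (b + v * x) - (1 + v) ^ j * Polygamma (j - 1) (a + b + (1 + v) * x))"
    for j :: nat and x :: real
  have pos: "a + x > 0" "b + v * x > 0" "a + b + (1 + v) * x > 0" if "\<bar>x\<bar> < \<delta>" for x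
    using that v ab by (auto simp: \<delta>_def abs_less_iff)
  have vp: "v ^ j = v" if "j > 0" for j :: nat using v that by auto
  have der: "(L j has_real_derivative L (Suc j) x) (at x)" if "\<bar>x\<bar> < \<delta>" for j x
  proof (cases "j = 0")
    case True
    have "((\<lambda>x. ln_Gamma (a + x) + ln_Gamma (b + v * x) - ln_Gamma (a + b + (1 + v) * x)
      - (ln_Gamma a + ln_Gamma b - ln_Gamma (a + b))) has_real_derivative
      Digamma (a + x) * (0 + 1) + Digamma (b + v * x) * (0 + v) - Digamma (a + b + (1 + v) * x) * (0 + (1 + v)) - 0) (at x)"
      using pos[OF that]
      by (intro DERIV_diff DERIV_add DERIV_const DERIV_chain2[OF has_field_derivative_ln_Gamma_real] DERIV_cmult DERIV_ident DERIV_cmult_Id)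
    then show ?thesis using True by (simp add: L_def[abs_def] mult.commute)
  next
    case False
    have nz: "y \<notin> \<int>\<^sub>\<le>\<^sub>0" if "y > 0" for y :: real using that by (auto elim!: nonpos_Ints_cases)
    have "((\<lambda>x. Polygamma (j - 1) (a + x) + v * Polygamma (j - 1) (b + v * x) - (1 + v) ^ j * Polygamma (j - 1) (a + b + (1 + v) * x))
      has_real_derivative Polygamma (Suc (j - 1)) (a + x) * (0 + 1) + v * (Polygamma (Suc (j - 1)) (b + v * x) * (0 + v))
        - (1 + v) ^ j * (Polygamma (Suc (j - 1)) (a + b + (1 + v) * x) * (0 + (1 + v)))) (at x)"
      using pos[OF that] nz
      by (intro DERIV_diff DERIV_add DERIV_const DERIV_chain2[OF has_field_derivative_Polygamma] DERIV_cmult DERIV_ident DERIV_cmult_Id) auto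
    moreover have "v * (v * z) = v * z" for z using v by auto
    ultimately show ?thesis using False by (simp add: L_def[abs_def] mult_ac)
  qed
  have ex: "x * X \<omega> = x * ln (P \<omega>) + (v * x) * ln (1 - P \<omega>)" for x \<omega>
    by (simp add: X_def algebra_simps)
  have int: "integrable M (\<lambda>\<omega>. exp (x * X \<omega>))" if "\<bar>x\<bar> < \<delta>" for x
    unfolding ex using pos[OF that] by (intro beta_mgf[OF P ab])
  have mgf: "expectation (\<lambda>\<omega>. exp (x * X \<omega>)) = exp (L 0 x)" if "\<bar>x\<bar> < \<delta>" for x
  proof -
    have "expectation (\<lambda>\<omega>. exp (x * X \<omega>)) = Beta (a + x) (b + v * x) / Beta a b"
      unfolding ex using pos[OF that] by (intro beta_mgf[OF P ab])
    also have "Beta (a + x) (b + v * x) / Beta a b = exp (L 0 x)"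
    proof -
      have "a + x + (b + v * x) = a + b + (1 + v) * x" by (simp add: algebra_simps)
      then have s: "Beta (a + x) (b + v * x) = Gamma (a + x) * Gamma (b + v * x) / Gamma (a + b + (1 + v) * x)"
        by (simp only: Beta_def)
      show ?thesis
      unfolding s unfolding Beta_def L_def using pos[OF that] ab
      by (simp add: exp_diff exp_add Gamma_real_pos_exp)
    qed
    finally show ?thesis .
  qed
  note cu = cumulants[where L = L, OF Xm \<open>\<delta> > 0\<close> int mgf der]
  show "integrable M (\<lambda>\<omega>. X \<omega> ^ k)" "integrable M (\<lambda>\<omega>. (X \<omega> - expectation X) ^ k)" for k
    by (rule cu; assumption)+
  show V: "variance X = Polygamma 1 a + v * Polygamma 1 b - (1 + v)\<^sup>2 * Polygamma 1 (a + b)"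
    using cu(3) by (simp add: L_def)
  show "expectation (\<lambda>\<omega>. (X \<omega> - expectation X) ^ 4) =
      Polygamma 3 a + v * Polygamma 3 b - (1 + v) ^ 4 * Polygamma 3 (a + b) + 3 * (variance X)\<^sup>2"
    using cu(4) cu(3) by (simp add: L_def)
qed

section \<open>Bounds for polygamma functions\<close>

lemma Polygamma_1_sums: "x > 0 \<Longrightarrow> (\<lambda>k. 1 / (x + real k)\<^sup>2) sums Polygamma 1 (x :: real)"
  using Polygamma_LIMSEQ[of x 1] by (simp add: numeral_eq_Suc inverse_eq_divide)

lemma Polygamma_3_sums: "x > 0 \<Longrightarrow> (\<lambda>k. 6 / (x + real k) ^ 4) sums Polygamma 3 (x :: real)"
  using sums_mult[OF Polygamma_LIMSEQ[of x 3], of 6] by (simp add: numeral_eq_Suc inverse_eq_divide fact_numeral)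

lemma reciprocal_telescope:
  assumes "x > 0" shows "(\<lambda>k. 1 / (x + real k) - 1 / (x + real (Suc k))) sums (1 / x)"
proof -
  have "(\<lambda>k. 1 / (x + real k)) \<longlonglongrightarrow> 0"
    using filterlim_tendsto_add_at_top[OF tendsto_const filterlim_real_sequentially, of x]
    by (intro tendsto_divide_0[OF tendsto_const] filterlim_at_top_imp_at_infinity)
  from telescope_sums'[OF this] show ?thesis by simp
qed

lemma reciprocal_step:
  fixes x :: real
  assumes "x > 0"
  shows "1 / (x + real k)\<^sup>2 - (1 / (x + real k) - 1 / (x + real (Suc k))) = 1 / ((x + real k)\<^sup>2 * (x + real k + 1))"
    and "(1 / (x + real k) - 1 / (x + real (Suc k))) - 1 / (x + real (Suc k))\<^sup>2 = 1 / ((x + real k) * (x + real k + 1)\<^sup>2)"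
proof -
  define y where "y = x + real k"
  have "y > 0" using assms by (simp add: y_def)
  then have "1 / y\<^sup>2 - (1 / y - 1 / (y + 1)) = 1 / (y\<^sup>2 * (y + 1))"
    and "(1 / y - 1 / (y + 1)) - 1 / (y + 1)\<^sup>2 = 1 / (y * (y + 1)\<^sup>2)"
    by (simp_all add: divide_simps) (simp_all add: power2_eq_square algebra_simps)
  moreover have "x + real (Suc k) = y + 1" by (simp add: y_def)
  ultimately show "1 / (x + real k)\<^sup>2 - (1 / (x + real k) - 1 / (x + real (Suc k))) = 1 / ((x + real k)\<^sup>2 * (x + real k + 1))"
    and "(1 / (x + real k) - 1 / (x + real (Suc k))) - 1 / (x + real (Suc k))\<^sup>2 = 1 / ((x + real k) * (x + real k + 1)\<^sup>2)"
    by (simp_all only: y_def)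
qed

text \<open>The variance of \<open>ln r\<close> is such a difference, in which the leading orders
  cancel, so bounds for the single values are too weak. Term by term, the series is compared with
  the telescoping one for \<open>1 / x\<close>; the error of each term decreases in the argument, so
  that the comparison survives the subtraction. For the upper bound the series is shifted by one, at
  the price of \<open>1 / x\<^sup>2\<close>.\<close>

lemma Polygamma_1_diff_bounds:
  fixes x y :: real
  assumes "0 < x" "x \<le> y"
  shows "1 / x - 1 / y \<le> Polygamma 1 x - Polygamma 1 y"
    and "Polygamma 1 x - Polygamma 1 y \<le> 1 / x - 1 / y + 1 / x\<^sup>2"
proof -
  have y: "0 < y" using assms by simp
  note t = sums_diff[OF reciprocal_telescope[OF assms(1)] reciprocal_telescope[OF y]]
  note s = sums_diff[OF Polygamma_1_sums[OF assms(1)] Polygamma_1_sums[OF y]]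
  have mono1: "1 / (v\<^sup>2 * (v + 1)) \<le> 1 / (u\<^sup>2 * (u + 1))" and mono2: "1 / (v * (v + 1)\<^sup>2) \<le> 1 / (u * (u + 1)\<^sup>2)"
    if "0 < u" "u \<le> v" for u v :: real
    using that by (intro divide_left_mono mult_mono power_mono; simp)+
  show "1 / x - 1 / y \<le> Polygamma 1 x - Polygamma 1 y"
  proof (rule sums_le[OF _ t s])
    fix k
    show "1 / (x + real k) - 1 / (x + real (Suc k)) - (1 / (y + real k) - 1 / (y + real (Suc k)))
      \<le> 1 / (x + real k)\<^sup>2 - 1 / (y + real k)\<^sup>2"
      using reciprocal_step(1)[of x k] reciprocal_step(1)[of y k] mono1[of "x + real k" "y + real k"] assms y by linarith
  qed
  have s': "(\<lambda>k. 1 / (x + real (Suc k))\<^sup>2 - 1 / (y + real (Suc k))\<^sup>2) sums (Polygamma 1 x - Polygamma 1 y - (1 / x\<^sup>2 - 1 / y\<^sup>2))"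
    using s by (subst sums_Suc_iff) simp
  have "Polygamma 1 x - Polygamma 1 y - (1 / x\<^sup>2 - 1 / y\<^sup>2) \<le> 1 / x - 1 / y"
  proof (rule sums_le[OF _ s' t])
    fix k
    show "1 / (x + real (Suc k))\<^sup>2 - 1 / (y + real (Suc k))\<^sup>2 \<le>
      1 / (x + real k) - 1 / (x + real (Suc k)) - (1 / (y + real k) - 1 / (y + real (Suc k)))"
      using reciprocal_step(2)[of x k] reciprocal_step(2)[of y k] mono2[of "x + real k" "y + real k"] assms y by linarith
  qed
  moreover have "0 \<le> 1 / y\<^sup>2" by simp
  ultimately show "Polygamma 1 x - Polygamma 1 y \<le> 1 / x - 1 / y + 1 / x\<^sup>2" by linarith
qed

lemma Polygamma_1_bounds:
  fixes x :: real
  assumes "0 < x"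
  shows "1 / x \<le> Polygamma 1 x" and "Polygamma 1 x \<le> 1 / x + 1 / x\<^sup>2"
proof -
  note t = reciprocal_telescope[OF assms] and s = Polygamma_1_sums[OF assms]
  show "1 / x \<le> Polygamma 1 x"
  proof (rule sums_le[OF _ t s])
    fix k
    have "0 \<le> 1 / ((x + real k)\<^sup>2 * (x + real k + 1))" using assms by simp
    then show "1 / (x + real k) - 1 / (x + real (Suc k)) \<le> 1 / (x + real k)\<^sup>2"
      using reciprocal_step(1)[of x k] assms by linarith
  qed
  have s': "(\<lambda>k. 1 / (x + real (Suc k))\<^sup>2) sums (Polygamma 1 x - 1 / x\<^sup>2)"
    using s by (subst sums_Suc_iff) simp
  have "Polygamma 1 x - 1 / x\<^sup>2 \<le> 1 / x"
  proof (rule sums_le[OF _ s' t])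
    fix k
    have "0 \<le> 1 / ((x + real k) * (x + real k + 1)\<^sup>2)" using assms by simp
    then show "1 / (x + real (Suc k))\<^sup>2 \<le> 1 / (x + real k) - 1 / (x + real (Suc k))"
      using reciprocal_step(2)[of x k] assms by linarith
  qed
  then show "Polygamma 1 x \<le> 1 / x + 1 / x\<^sup>2" by linarith
qed

lemma Polygamma_3_bound:
  fixes x :: real
  assumes "0 < x"
  shows "0 \<le> Polygamma 3 x" and "Polygamma 3 x \<le> 6 / x\<^sup>2 * (1 / x + 1 / x\<^sup>2)"
proof -
  note s = Polygamma_3_sums[OF assms]
  show "0 \<le> Polygamma 3 x" by (rule sums_le[OF _ sums_zero s]) simp
  have "Polygamma 3 x \<le> 6 / x\<^sup>2 * Polygamma 1 x"
  proof (rule sums_le[OF _ s sums_mult[OF Polygamma_1_sums[OF assms]]])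
    fix k
    have "x\<^sup>2 * (x + real k)\<^sup>2 \<le> (x + real k)\<^sup>2 * (x + real k)\<^sup>2"
      using assms by (intro mult_right_mono power_mono) auto
    then have "6 / ((x + real k)\<^sup>2 * (x + real k)\<^sup>2) \<le> 6 / (x\<^sup>2 * (x + real k)\<^sup>2)"
      using assms by (intro divide_left_mono) auto
    then show "6 / (x + real k) ^ 4 \<le> 6 / x\<^sup>2 * (1 / (x + real k)\<^sup>2)"
      by (simp add: power4_eq_xxxx power2_eq_square mult.assoc)
  qed
  also have "\<dots> \<le> 6 / x\<^sup>2 * (1 / x + 1 / x\<^sup>2)"
    using Polygamma_1_bounds[OF assms] by (intro mult_left_mono) auto
  finally show "Polygamma 3 x \<le> 6 / x\<^sup>2 * (1 / x + 1 / x\<^sup>2)" .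
qed

section \<open>A central limit theorem for triangular arrays\<close>

lemma exp_minus_quadratic:
  fixes y :: real
  assumes "y \<ge> 0"
  shows "\<bar>exp (- y) - (1 - y)\<bar> \<le> y\<^sup>2 / 2"
proof -
  have lower: "1 - y \<le> exp (- y)" using exp_ge_add_one_self[of "- y"] by simp
  have "(\<lambda>y. y\<^sup>2 / 2 - (exp (- y) - (1 - y))) 0 \<le> (\<lambda>y. y\<^sup>2 / 2 - (exp (- y) - (1 - y))) y"
    using assms
  proof (rule DERIV_nonneg_imp_nondecreasing)
    show "\<exists>D. ((\<lambda>y. y\<^sup>2 / 2 - (exp (- y) - (1 - y))) has_real_derivative D) (at z) \<and> 0 \<le> D" for z :: real
      using exp_ge_add_one_self[of "- z"]
      by (intro exI[of _ "z - (- exp (- z) + 1)"]) (auto intro!: derivative_eq_intros)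
  qed
  then show ?thesis using lower by simp
qed

lemma (in prob_space) square_expectation_le:
  fixes X :: "'a \<Rightarrow> real"
  assumes "integrable M X" "integrable M (\<lambda>\<omega>. (X \<omega>)\<^sup>2)"
  shows "(expectation X)\<^sup>2 \<le> expectation (\<lambda>\<omega>. (X \<omega>)\<^sup>2)"
  using variance_eq[OF assms] variance_positive[of X] by simp

text \<open>Each factor is expanded to second order and the products are compared factor by factor.
  The third moment in the remainder is interpolated as
  \<open>\<delta> * y\<^sup>2 + y ^ 4 / \<delta>\<close>, so that second and fourth moments suffice
  and \<delta> stays free.\<close>

lemma (in prob_space) char_lyapunov:
  fixes Y :: "'i \<Rightarrow> 'a \<Rightarrow> real"
  assumes I: "finite I" and indep: "indep_vars (\<lambda>_. borel) Y I"
    and int: "\<And>x. x \<in> I \<Longrightarrow> integrable M (\<lambda>\<omega>. (Y x \<omega>)\<^sup>2)" "\<And>x. x \<in> I \<Longrightarrow> integrable M (\<lambda>\<omega>. (Y x \<omega>) ^ 4)"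
    and mean: "\<And>x. x \<in> I \<Longrightarrow> expectation (Y x) = 0" and "\<delta> > 0"
  defines "V \<equiv> \<Sum>x\<in>I. expectation (\<lambda>\<omega>. (Y x \<omega>)\<^sup>2)" and "L \<equiv> \<Sum>x\<in>I. expectation (\<lambda>\<omega>. (Y x \<omega>) ^ 4)"
  shows "cmod ((\<integral>\<omega>. iexp (t * (\<Sum>x\<in>I. Y x \<omega>)) \<partial>M) - exp (- (t\<^sup>2 * V) / 2))
    \<le> \<bar>t\<bar> ^ 3 / 6 * (\<delta> * V + L / \<delta>) + t ^ 4 / 8 * L"
proof -
  have rv: "Y x \<in> borel_measurable M" if "x \<in> I" for x using indep that by (auto simp: indep_vars_def)
  have intY: "integrable M (Y x)" if "x \<in> I" for x
    using square_integrable_imp_integrable[OF rv int(1)] that by simp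
  define \<sigma>2 where "\<sigma>2 x = expectation (\<lambda>\<omega>. (Y x \<omega>)\<^sup>2)" for x
  define L4 where "L4 x = expectation (\<lambda>\<omega>. (Y x \<omega>) ^ 4)" for x
  define \<phi> where "\<phi> x = char (distr M borel (Y x)) t" for x
  have \<sigma>0: "\<sigma>2 x \<ge> 0" and L0: "L4 x \<ge> 0" for x
    unfolding \<sigma>2_def L4_def by (auto intro!: integral_nonneg_AE simp: zero_le_even_power)
  have \<sigma>4: "(\<sigma>2 x)\<^sup>2 \<le> L4 x" if "x \<in> I" for x
    using square_expectation_le[of "\<lambda>\<omega>. (Y x \<omega>)\<^sup>2"] int[OF that] by (simp add: \<sigma>2_def L4_def flip: power_mult)
  have one_term: "cmod (\<phi> x - exp (- (t\<^sup>2 * \<sigma>2 x) / 2)) \<le> \<bar>t\<bar> ^ 3 / 6 * (\<delta> * \<sigma>2 x + L4 x / \<delta>) + t ^ 4 / 8 * L4 x" if x: "x \<in> I" for x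
  proof -
    have "cmod (\<phi> x - (1 - t\<^sup>2 * \<sigma>2 x / 2)) \<le> t\<^sup>2 / 6 * expectation (\<lambda>\<omega>. min (6 * (Y x \<omega>)\<^sup>2) (\<bar>t\<bar> * \<bar>Y x \<omega>\<bar> ^ 3))"
      unfolding \<phi>_def using rv[OF x] intY[OF x] int(1)[OF x] mean[OF x]
      by (intro char_approx3') (auto simp: \<sigma>2_def)
    also have "expectation (\<lambda>\<omega>. min (6 * (Y x \<omega>)\<^sup>2) (\<bar>t\<bar> * \<bar>Y x \<omega>\<bar> ^ 3)) \<le> expectation (\<lambda>\<omega>. \<bar>t\<bar> * (\<delta> * (Y x \<omega>)\<^sup>2 + (Y x \<omega>) ^ 4 / \<delta>))"
    proof (rule integral_mono)
      show "integrable M (\<lambda>\<omega>. \<bar>t\<bar> * (\<delta> * (Y x \<omega>)\<^sup>2 + (Y x \<omega>) ^ 4 / \<delta>))" using int[OF x] by simp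
      show "integrable M (\<lambda>\<omega>. min (6 * (Y x \<omega>)\<^sup>2) (\<bar>t\<bar> * \<bar>Y x \<omega>\<bar> ^ 3))"
      proof (rule Bochner_Integration.integrable_bound)
        show "integrable M (\<lambda>\<omega>. 6 * (Y x \<omega>)\<^sup>2)" using int(1)[OF x] by simp
      qed (use rv[OF x] in \<open>auto intro!: AE_I2\<close>)
      fix \<omega>
      have "\<bar>Y x \<omega>\<bar> ^ 3 \<le> \<delta> * (Y x \<omega>)\<^sup>2 + (Y x \<omega>) ^ 4 / \<delta>"
      proof (cases "\<bar>Y x \<omega>\<bar> \<le> \<delta>")
        case True
        then have "\<bar>Y x \<omega>\<bar> * \<bar>Y x \<omega>\<bar>\<^sup>2 \<le> \<delta> * \<bar>Y x \<omega>\<bar>\<^sup>2" by (intro mult_right_mono) auto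
        moreover have "0 \<le> (Y x \<omega>) ^ 4 / \<delta>" using \<open>\<delta> > 0\<close> by (auto simp: zero_le_even_power)
        ultimately show ?thesis by (simp add: power3_eq_cube power2_eq_square mult.assoc)
      next
        case False
        then have "\<delta> * \<bar>Y x \<omega>\<bar> ^ 3 \<le> \<bar>Y x \<omega>\<bar> * \<bar>Y x \<omega>\<bar> ^ 3" by (intro mult_right_mono) auto
        also have "\<dots> = (Y x \<omega>) ^ 4" using power_even_abs[of 4 "Y x \<omega>"] by (simp add: eval_nat_numeral)
        finally have "\<bar>Y x \<omega>\<bar> ^ 3 \<le> (Y x \<omega>) ^ 4 / \<delta>" using \<open>\<delta> > 0\<close> by (simp add: field_simps)
        moreover have "0 \<le> \<delta> * (Y x \<omega>)\<^sup>2" using \<open>\<delta> > 0\<close> by simp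
        ultimately show ?thesis by linarith
      qed
      then have "\<bar>t\<bar> * \<bar>Y x \<omega>\<bar> ^ 3 \<le> \<bar>t\<bar> * (\<delta> * (Y x \<omega>)\<^sup>2 + (Y x \<omega>) ^ 4 / \<delta>)" by (intro mult_left_mono) auto
      then show "min (6 * (Y x \<omega>)\<^sup>2) (\<bar>t\<bar> * \<bar>Y x \<omega>\<bar> ^ 3) \<le> \<bar>t\<bar> * (\<delta> * (Y x \<omega>)\<^sup>2 + (Y x \<omega>) ^ 4 / \<delta>)" by simp
    qed
    also have "expectation (\<lambda>\<omega>. \<bar>t\<bar> * (\<delta> * (Y x \<omega>)\<^sup>2 + (Y x \<omega>) ^ 4 / \<delta>)) = \<bar>t\<bar> * (\<delta> * \<sigma>2 x + L4 x / \<delta>)"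
      using int[OF x] by (simp add: \<sigma>2_def L4_def)
    finally have 1: "cmod (\<phi> x - (1 - t\<^sup>2 * \<sigma>2 x / 2)) \<le> \<bar>t\<bar> ^ 3 / 6 * (\<delta> * \<sigma>2 x + L4 x / \<delta>)"
      by (simp add: mult_left_mono power2_eq_square power3_eq_cube abs_mult_self_eq mult.assoc[symmetric])
    have "\<bar>exp (- (t\<^sup>2 * \<sigma>2 x / 2)) - (1 - t\<^sup>2 * \<sigma>2 x / 2)\<bar> \<le> (t\<^sup>2 * \<sigma>2 x / 2)\<^sup>2 / 2"
      using \<sigma>0 by (intro exp_minus_quadratic) simp
    also have "\<dots> = t ^ 4 / 8 * (\<sigma>2 x)\<^sup>2" by (simp add: power_mult_distrib power_divide flip: power_mult)
    also have "\<dots> \<le> t ^ 4 / 8 * L4 x" using \<sigma>4[OF x] by (intro mult_left_mono) (auto simp: zero_le_even_power)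
    finally have "\<bar>(1 - t\<^sup>2 * \<sigma>2 x / 2) - exp (- (t\<^sup>2 * \<sigma>2 x / 2))\<bar> \<le> t ^ 4 / 8 * L4 x"
      by (simp only: abs_minus_commute)
    then have 2: "cmod (complex_of_real (1 - t\<^sup>2 * \<sigma>2 x / 2) - complex_of_real (exp (- (t\<^sup>2 * \<sigma>2 x / 2)))) \<le> t ^ 4 / 8 * L4 x"
      by (simp only: of_real_diff[symmetric] norm_of_real)
    have 1: "cmod (\<phi> x - complex_of_real (1 - t\<^sup>2 * \<sigma>2 x / 2)) \<le> \<bar>t\<bar> ^ 3 / 6 * (\<delta> * \<sigma>2 x + L4 x / \<delta>)"
      using 1 by simp
    from norm_diff_triangle_le[OF 1 2] show ?thesis by simp
  qed
  have "(\<integral>\<omega>. iexp (t * (\<Sum>x\<in>I. Y x \<omega>)) \<partial>M) = char (distr M borel (\<lambda>\<omega>. \<Sum>x\<in>I. Y x \<omega>)) t"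
    unfolding char_def using rv by (subst integral_distr) auto
  also have "\<dots> = (\<Prod>x\<in>I. \<phi> x)" unfolding \<phi>_def by (rule char_distr_sum[OF indep])
  finally have lhs: "(\<integral>\<omega>. iexp (t * (\<Sum>x\<in>I. Y x \<omega>)) \<partial>M) = (\<Prod>x\<in>I. \<phi> x)" .
  have rhs: "complex_of_real (exp (- (t\<^sup>2 * V) / 2)) = (\<Prod>x\<in>I. complex_of_real (exp (- (t\<^sup>2 * \<sigma>2 x) / 2)))"
  proof -
    have "- (t\<^sup>2 * V) / 2 = (\<Sum>x\<in>I. - (t\<^sup>2 * \<sigma>2 x) / 2)"
      by (simp add: V_def \<sigma>2_def sum_negf sum_divide_distrib sum_distrib_left)
    then show ?thesis using I by (simp add: exp_sum)
  qed
  have "cmod ((\<Prod>x\<in>I. \<phi> x) - (\<Prod>x\<in>I. complex_of_real (exp (- (t\<^sup>2 * \<sigma>2 x) / 2)))) \<le>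
    (\<Sum>x\<in>I. cmod (\<phi> x - complex_of_real (exp (- (t\<^sup>2 * \<sigma>2 x) / 2))))"
  proof (rule norm_prod_diff)
    show "cmod (\<phi> x) \<le> 1" if "x \<in> I" for x
      unfolding \<phi>_def by (rule real_distribution.cmod_char_le_1[OF real_distribution_distr[OF rv[OF that]]])
    show "cmod (complex_of_real (exp (- (t\<^sup>2 * \<sigma>2 x) / 2))) \<le> 1" for x using \<sigma>0[of x] by simp
  qed
  also have "\<dots> \<le> (\<Sum>x\<in>I. \<bar>t\<bar> ^ 3 / 6 * (\<delta> * \<sigma>2 x + L4 x / \<delta>) + t ^ 4 / 8 * L4 x)"
    by (intro sum_mono one_term)
  also have "\<dots> = \<bar>t\<bar> ^ 3 / 6 * (\<delta> * V + L / \<delta>) + t ^ 4 / 8 * L"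
    by (simp add: V_def L_def \<sigma>2_def L4_def sum.distrib sum_distrib_left sum_divide_distrib distrib_left)
  finally show ?thesis unfolding lhs rhs .
qed

text \<open>\<delta> is fixed before \<open>n\<close>: for every \<delta> the fourth moments
  disappear in the limit, and what remains is a multiple of \<open>\<delta> * v\<close>.\<close>

lemma lyapunov_clt:
  fixes Y :: "nat \<Rightarrow> 'i \<Rightarrow> 'a \<Rightarrow> real"
  assumes M: "\<And>n. prob_space (M n)"
    and I: "\<forall>\<^sub>F n in sequentially. finite (I n) \<and> prob_space.indep_vars (M n) (\<lambda>_. borel) (Y n) (I n) \<and>
      (\<forall>x\<in>I n. integrable (M n) (\<lambda>\<omega>. (Y n x \<omega>)\<^sup>2) \<and> integrable (M n) (\<lambda>\<omega>. (Y n x \<omega>) ^ 4) \<and> (\<integral>\<omega>. Y n x \<omega> \<partial>M n) = 0)"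
    and V: "(\<lambda>n. \<Sum>x\<in>I n. \<integral>\<omega>. (Y n x \<omega>)\<^sup>2 \<partial>M n) \<longlonglongrightarrow> v"
    and L: "(\<lambda>n. \<Sum>x\<in>I n. \<integral>\<omega>. (Y n x \<omega>) ^ 4 \<partial>M n) \<longlonglongrightarrow> 0"
  shows "(\<lambda>n. \<integral>\<omega>. iexp (t * (\<Sum>x\<in>I n. Y n x \<omega>)) \<partial>M n) \<longlonglongrightarrow> exp (- (t\<^sup>2 * v) / 2)"
proof -
  define Vn where "Vn n = (\<Sum>x\<in>I n. \<integral>\<omega>. (Y n x \<omega>)\<^sup>2 \<partial>M n)" for n
  define Ln where "Ln n = (\<Sum>x\<in>I n. \<integral>\<omega>. (Y n x \<omega>) ^ 4 \<partial>M n)" for n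
  define e where "e n = (\<integral>\<omega>. iexp (t * (\<Sum>x\<in>I n. Y n x \<omega>)) \<partial>M n) - exp (- (t\<^sup>2 * Vn n) / 2)" for n
  have "e \<longlonglongrightarrow> 0"
  proof (rule LIMSEQ_I)
    fix r :: real assume "r > 0"
    define B where "B = \<bar>t\<bar> ^ 3 / 6 * \<bar>v\<bar> + 1"
    have "B > 0" by (auto simp: B_def intro!: add_nonneg_pos)
    define \<delta> where "\<delta> = r / (2 * B)"
    have "\<delta> > 0" using \<open>r > 0\<close> \<open>B > 0\<close> by (simp add: \<delta>_def)
    have bound: "\<forall>\<^sub>F n in sequentially. cmod (e n) \<le> \<bar>t\<bar> ^ 3 / 6 * (\<delta> * Vn n + Ln n / \<delta>) + t ^ 4 / 8 * Ln n"
      using I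
    proof eventually_elim
      case (elim n)
      show ?case unfolding e_def Vn_def Ln_def
        using elim \<open>\<delta> > 0\<close> by (intro prob_space.char_lyapunov[OF M]) auto
    qed
    have "(\<lambda>n. \<bar>t\<bar> ^ 3 / 6 * (\<delta> * Vn n + Ln n / \<delta>) + t ^ 4 / 8 * Ln n) \<longlonglongrightarrow> \<bar>t\<bar> ^ 3 / 6 * (\<delta> * v + 0 / \<delta>) + t ^ 4 / 8 * 0"
      using V L \<open>\<delta> > 0\<close> unfolding Vn_def Ln_def by (intro tendsto_intros) auto
    moreover have "\<bar>t\<bar> ^ 3 / 6 * (\<delta> * v + 0 / \<delta>) + t ^ 4 / 8 * 0 < r"
    proof -
      have "\<bar>t\<bar> ^ 3 / 6 * (\<delta> * v) \<le> \<delta> * (\<bar>t\<bar> ^ 3 / 6 * \<bar>v\<bar>)"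
        using \<open>\<delta> > 0\<close> by (simp add: mult_left_mono mult.left_commute)
      also have "\<dots> \<le> \<delta> * B" using \<open>\<delta> > 0\<close> by (simp add: B_def)
      also have "\<dots> = r / 2" using \<open>B > 0\<close> by (simp add: \<delta>_def)
      finally have "\<bar>t\<bar> ^ 3 / 6 * (\<delta> * v) < r" using \<open>r > 0\<close> by linarith
      then show ?thesis by simp
    qed
    ultimately have "\<forall>\<^sub>F n in sequentially. \<bar>t\<bar> ^ 3 / 6 * (\<delta> * Vn n + Ln n / \<delta>) + t ^ 4 / 8 * Ln n < r"
      by (rule order_tendstoD(2))
    with bound have "\<forall>\<^sub>F n in sequentially. norm (e n - 0) < r"
      by eventually_elim simp
    then show "\<exists>n0. \<forall>n\<ge>n0. norm (e n - 0) < r" by (simp add: eventually_sequentially)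
  qed
  moreover have "(\<lambda>n. complex_of_real (exp (- (t\<^sup>2 * Vn n) / 2))) \<longlonglongrightarrow> complex_of_real (exp (- (t\<^sup>2 * v) / 2))"
    using V unfolding Vn_def by (intro tendsto_intros) auto
  ultimately have "(\<lambda>n. e n + complex_of_real (exp (- (t\<^sup>2 * Vn n) / 2))) \<longlonglongrightarrow> 0 + complex_of_real (exp (- (t\<^sup>2 * v) / 2))"
    by (rule tendsto_add)
  then show ?thesis by (simp add: e_def)
qed

text \<open>A form of Slutsky's lemma with an explicit L2 error, by which the variables
  \<open>p\<close> are discarded from the characteristic functions.\<close>

lemma (in prob_space) char_perturbation:
  assumes [measurable]: "X \<in> borel_measurable M" "Y \<in> borel_measurable M"
    and Y2: "integrable M (\<lambda>\<omega>. (Y \<omega>)\<^sup>2)"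
  shows "cmod ((\<integral>\<omega>. iexp (X \<omega> + Y \<omega>) \<partial>M) - (\<integral>\<omega>. iexp (X \<omega>) \<partial>M)) \<le> sqrt (expectation (\<lambda>\<omega>. (Y \<omega>)\<^sup>2))"
proof -
  have intY: "integrable M Y" by (rule square_integrable_imp_integrable[OF _ Y2]) simp
  have i: "integrable M (\<lambda>\<omega>. iexp (Z \<omega>))" if "Z \<in> borel_measurable M" for Z :: "'a \<Rightarrow> real"
    using measurable_compose[OF that borel_measurable_of_real] by (intro integrable_iexp) simp_all
  have iXY: "integrable M (\<lambda>\<omega>. iexp (X \<omega> + Y \<omega>))" and iX: "integrable M (\<lambda>\<omega>. iexp (X \<omega>))"
    by (intro i; measurable)+
  have "cmod ((\<integral>\<omega>. iexp (X \<omega> + Y \<omega>) \<partial>M) - (\<integral>\<omega>. iexp (X \<omega>) \<partial>M)) = cmod (\<integral>\<omega>. iexp (X \<omega> + Y \<omega>) - iexp (X \<omega>) \<partial>M)"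
    using iXY iX by simp
  also have "\<dots> \<le> expectation (\<lambda>\<omega>. cmod (iexp (X \<omega> + Y \<omega>) - iexp (X \<omega>)))"
    by (rule integral_norm_bound)
  also have "\<dots> \<le> expectation (\<lambda>\<omega>. \<bar>Y \<omega>\<bar>)"
  proof (rule integral_mono)
    show "integrable M (\<lambda>\<omega>. cmod (iexp (X \<omega> + Y \<omega>) - iexp (X \<omega>)))"
      using iXY iX by (intro integrable_norm Bochner_Integration.integrable_diff)
    show "integrable M (\<lambda>\<omega>. \<bar>Y \<omega>\<bar>)" using intY by simp
    fix \<omega>
    have "iexp (X \<omega> + Y \<omega>) - iexp (X \<omega>) = iexp (X \<omega>) * (iexp (Y \<omega>) - 1)"
      by (simp add: distrib_left exp_add right_diff_distrib)
    then have "cmod (iexp (X \<omega> + Y \<omega>) - iexp (X \<omega>)) = cmod (iexp (Y \<omega>) - 1)" by (simp add: norm_mult)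
    also have "\<dots> \<le> \<bar>Y \<omega>\<bar>" using iexp_approx1[of "Y \<omega>" 0] by simp
    finally show "cmod (iexp (X \<omega> + Y \<omega>) - iexp (X \<omega>)) \<le> \<bar>Y \<omega>\<bar>" .
  qed
  also have "\<dots> \<le> sqrt (expectation (\<lambda>\<omega>. (Y \<omega>)\<^sup>2))"
    using square_expectation_le[of "\<lambda>\<omega>. \<bar>Y \<omega>\<bar>"] intY Y2 by (intro real_le_rsqrt) simp
  finally show ?thesis .
qed

section \<open>Riemann sums\<close>

lemma sum_as_integral:
  fixes f :: "nat \<Rightarrow> real"
  assumes "n > 0"
  shows "(\<integral>x. indicator {0<..1} x * f (nat \<lceil>real n * x\<rceil>) \<partial>lborel) = (\<Sum>r=1..n. f r) / real n"
proof -
  have eq: "indicator {0<..1} x * f (nat \<lceil>real n * x\<rceil>) = (\<Sum>r=1..n. f r * indicator {(real r - 1) / real n<..real r / real n} x)" for x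
  proof (cases "x \<in> {0<..1}")
    case True
    define k where "k = nat \<lceil>real n * x\<rceil>"
    have nx: "0 < real n * x" "real n * x \<le> real n * 1" using True assms by (auto intro: mult_left_mono)
    then have k: "k \<in> {1..n}" unfolding k_def by (auto simp: ceiling_le_iff less_ceiling_iff nat_le_iff Suc_le_eq)
    have "x \<in> {(real r - 1) / real n<..real r / real n} \<longleftrightarrow> r = k" if "r \<in> {1..n}" for r
    proof -
      have "x \<in> {(real r - 1) / real n<..real r / real n} \<longleftrightarrow> real r - 1 < real n * x \<and> real n * x \<le> real r"
        using assms by (auto simp: field_simps)
      also have "\<dots> \<longleftrightarrow> \<lceil>real n * x\<rceil> = int r" using ceiling_eq_iff[of "real n * x" "int r"] by auto
      also have "\<dots> \<longleftrightarrow> r = k" unfolding k_def using nx by auto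
      finally show ?thesis .
    qed
    then have "(\<Sum>r=1..n. f r * indicator {(real r - 1) / real n<..real r / real n} x) = (\<Sum>r=1..n. if r = k then f r else 0)"
      by (intro sum.cong) (auto simp: indicator_def)
    then show ?thesis using k True by (simp add: k_def)
  next
    case False
    have "x \<notin> {(real r - 1) / real n<..real r / real n}" if "r \<in> {1..n}" for r
    proof
      assume "x \<in> {(real r - 1) / real n<..real r / real n}"
      moreover have "0 \<le> (real r - 1) / real n" "real r / real n \<le> 1" using that assms by auto
      ultimately show False using False by auto
    qed
    then have "(\<Sum>r=1..n. f r * indicator {(real r - 1) / real n<..real r / real n} x) = 0"
      by (intro sum.neutral) auto
    then show ?thesis using False by simp
  qed
  have "(\<integral>x. indicator {0<..1} x * f (nat \<lceil>real n * x\<rceil>) \<partial>lborel) =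
    (\<Sum>r=1..n. \<integral>x. f r * indicator {(real r - 1) / real n<..real r / real n} x \<partial>lborel)"
    unfolding eq by (intro Bochner_Integration.integral_sum integrable_mult_right integrable_real_indicator) (auto simp: emeasure_lborel_Ioc divide_right_mono)
  also have "\<dots> = (\<Sum>r=1..n. f r / real n)"
    using assms by (intro sum.cong refl) (simp add: diff_divide_distrib divide_right_mono)
  finally show ?thesis by (simp add: sum_divide_distrib)
qed

text \<open>As the integral of a step function, the average is accessible to dominated convergence.
  Pointwise limits inside the unit interval are enough, and no uniformity is asked near 1, where the
  parameters of the array degenerate.\<close>

lemma average_tendsto_integral:
  fixes F :: "nat \<Rightarrow> nat \<Rightarrow> real"
  assumes B: "\<And>n r. r \<in> {1..n} \<Longrightarrow> \<bar>F n r\<bar> \<le> B"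
    and g: "g \<in> borel_measurable borel"
    and lim: "AE x in lborel. 0 < x \<and> x < 1 \<longrightarrow> (\<lambda>n. F n (nat \<lceil>real n * x\<rceil>)) \<longlonglongrightarrow> g x"
  shows "(\<lambda>n. (\<Sum>r=1..n. F n r) / real n) \<longlonglongrightarrow> (\<integral>x. indicator {0<..<1} x * g x \<partial>lborel)"
proof -
  have B0: "0 \<le> B" using B[of 1 1] by auto
  \<comment> \<open>For \<open>n = 0\<close> the ceiling is 0, a value of \<open>F\<close> that is
    not covered by the bound.\<close>
  define G where "G n r = (if n = 0 then 0 else F n r)" for n r :: nat
  have nat_ceil: "nat \<lceil>real n * x\<rceil> \<in> {1..n}" if "0 < x" "x \<le> 1" "n > 0" for x :: real and n
  proof -
    have "0 < real n * x" "real n * x \<le> real n * 1" using that by (auto intro: mult_left_mono)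
    then show ?thesis by (auto simp: ceiling_le_iff less_ceiling_iff nat_le_iff Suc_le_eq)
  qed
  have int: "integrable lborel (indicator {0<..1} :: real \<Rightarrow> real)"
    by (rule integrable_real_indicator) simp_all
  have "(\<lambda>n. \<integral>x. indicator {0<..1} x * G n (nat \<lceil>real n * x\<rceil>) \<partial>lborel) \<longlonglongrightarrow> (\<integral>x. indicator {0<..<1} x * g x \<partial>lborel)"
  proof (rule integral_dominated_convergence[where w = "\<lambda>x. B * indicator {0<..1} x"])
    show "integrable lborel (\<lambda>x :: real. B * indicator {0<..1} x :: real)"
      using int by (rule integrable_mult_right)
    show "AE x in lborel. (\<lambda>n. indicator {0<..1} x * G n (nat \<lceil>real n * x\<rceil>)) \<longlonglongrightarrow> indicator {0<..<1} x * g x"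
      using lim AE_lborel_singleton[of 1]
    proof eventually_elim
      case (elim x)
      have ev: "\<forall>\<^sub>F n in sequentially. F n (nat \<lceil>real n * x\<rceil>) = G n (nat \<lceil>real n * x\<rceil>)"
        using eventually_gt_at_top[of 0] by eventually_elim (simp add: G_def)
      show ?case
      proof (cases "0 < x \<and> x < 1")
        case True
        with elim(1) have "(\<lambda>n. G n (nat \<lceil>real n * x\<rceil>)) \<longlonglongrightarrow> g x"
          using tendsto_cong[OF ev] by blast
        then show ?thesis using True by (simp add: indicator_def)
      next
        case False
        then show ?thesis using elim(2) by (auto simp: indicator_def)
      qed
    qed
    show "AE x in lborel. norm (indicator {0<..1} x * G n (nat \<lceil>real n * x\<rceil>)) \<le> B * indicator {0<..1} x" for n
      using nat_ceil[of _ n] B[of _ n] B0 by (intro AE_I2) (auto simp: indicator_def G_def)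
    show "(\<lambda>x. indicator {0<..<1} x * g x) \<in> borel_measurable lborel" using g by measurable
    show "(\<lambda>x. indicator {0<..1} x * G n (nat \<lceil>real n * x\<rceil>)) \<in> borel_measurable lborel" for n
      by measurable
  qed
  moreover have "\<forall>\<^sub>F n in sequentially. (\<integral>x. indicator {0<..1} x * G n (nat \<lceil>real n * x\<rceil>) \<partial>lborel) = (\<Sum>r=1..n. F n r) / real n"
    using eventually_gt_at_top[of 0] by eventually_elim (simp only: sum_as_integral, simp add: G_def)
  ultimately show ?thesis by (rule Lim_transform_eventually)
qed

section \<open>Moments of the array\<close>

lemma floor_le_nat: "t \<in> {0..1} \<Longrightarrow> nat \<lfloor>real b * t\<rfloor> \<le> b"
proof -
  assume "t \<in> {0..1}"
  then have "real b * t \<le> real b * 1" by (intro mult_left_mono) auto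
  then show ?thesis by (simp add: nat_le_iff floor_le_iff)
qed

text \<open>In the application \<open>a\<close> is \<open>par i\<close> and \<open>N\<close> is
  \<open>height i\<close>. Because \<open>j \<le> q \<le> q * N\<close>, subtracting
  \<open>j / 2\<close> costs at most a factor 2, and all inverse powers are of the order of those of
  \<open>q * N\<close>.\<close>

lemma beta_parameter_bounds:
  fixes a q N j :: real
  assumes "q \<ge> 1" "N \<ge> 1" "0 \<le> j" "j \<le> q" "a \<ge> q * N"
  defines "\<alpha> \<equiv> a - j / 2"
  shows "q * N / 2 \<le> \<alpha>" "0 < \<alpha>" "0 < a" "\<alpha> \<le> a"
    and "1 / \<alpha> \<le> 2 / (q * N)" "1 / \<alpha>\<^sup>2 \<le> 4 / (q\<^sup>2 * N\<^sup>2)" "1 / a \<le> 1 / (q * N)"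
    and "1 / \<alpha> + 1 / \<alpha>\<^sup>2 \<le> 6 / (q * N)"
proof -
  have qN: "q * N \<ge> 1" using mult_mono[of 1 q 1 N] assms by simp
  have "q * 1 \<le> q * N" using assms by (intro mult_left_mono) auto
  then have jq: "j \<le> q * N" using assms(4) by simp
  show \<alpha>: "q * N / 2 \<le> \<alpha>" using jq assms(5) by (simp add: \<alpha>_def)
  show "0 < \<alpha>" "0 < a" "\<alpha> \<le> a" using \<alpha> qN assms by (auto simp: \<alpha>_def)
  have "1 / \<alpha> \<le> 1 / (q * N / 2)" using \<alpha> qN by (intro divide_left_mono) auto
  then show i1: "1 / \<alpha> \<le> 2 / (q * N)" by simp
  have "(1 / \<alpha>)\<^sup>2 \<le> (2 / (q * N))\<^sup>2" using i1 \<open>0 < \<alpha>\<close> by (intro power_mono) auto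
  then show i2: "1 / \<alpha>\<^sup>2 \<le> 4 / (q\<^sup>2 * N\<^sup>2)" by (simp add: power_divide power_mult_distrib)
  show "1 / a \<le> 1 / (q * N)" using assms qN by (intro divide_left_mono) auto
  have "4 / (q\<^sup>2 * N\<^sup>2) \<le> 4 / (q * N)"
  proof (intro divide_left_mono)
    have "(q * N) * 1 \<le> (q * N) * (q * N)" using qN by (intro mult_left_mono) auto
    then show "q * N \<le> q\<^sup>2 * N\<^sup>2" by (simp add: power2_eq_square mult_ac)
  qed (use qN assms in auto)
  then have "1 / \<alpha> + 1 / \<alpha>\<^sup>2 \<le> 2 / (q * N) + 4 / (q * N)" by (intro add_mono i1 order_trans[OF i2])
  also have "\<dots> = 6 / (q * N)" by (simp add: add_divide_distrib[symmetric])
  finally show "1 / \<alpha> + 1 / \<alpha>\<^sup>2 \<le> 6 / (q * N)" .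
qed

text \<open>The first and the last bound are for \<open>ln r\<close>, the second for
  \<open>ln p + ln (1 - p)\<close>, the third for \<open>ln p\<close>. In the second one the leading
  terms combine to \<open>(a - \<alpha>)\<^sup>2 / (\<alpha> * a * (\<alpha> + a))\<close>: compared
  with \<open>ln r\<close>, a factor \<open>1 / N\<close> or \<open>1 / q\<close> is gained, and
  this is why the variables \<open>p\<close> leave no trace in the limit. For \<open>ln p\<close>
  alone nothing cancels.\<close>

lemma beta_variance_bounds:
  fixes a q N j :: real
  assumes A: "q \<ge> 1" "N \<ge> 1" "0 \<le> j" "j \<le> q" "a \<ge> q * N"
  defines "\<alpha> \<equiv> a - j / 2"
  shows "Polygamma 1 \<alpha> - Polygamma 1 a \<le> 5 / (q * N\<^sup>2)"
    and "Polygamma 1 \<alpha> + Polygamma 1 a - 4 * Polygamma 1 (\<alpha> + a) \<le> 1 / (2 * q * N ^ 3) + 5 / (q\<^sup>2 * N\<^sup>2)"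
    and "Polygamma 1 \<alpha> - Polygamma 1 (\<alpha> + a) \<le> 6 / (q * N)"
    and "Polygamma 3 \<alpha> - Polygamma 3 a + 3 * (Polygamma 1 \<alpha> - Polygamma 1 a)\<^sup>2 \<le> 220 / (q\<^sup>2 * N ^ 3)"
proof -
  note b = beta_parameter_bounds[OF A, folded \<alpha>_def]
  have pos: "q > 0" "N > 0" using A by auto
  have aqN: "q * N > 0" using pos by simp
  have diff: "1 / \<alpha> - 1 / a = (j / 2) * ((1 / \<alpha>) * (1 / a))"
    using b(2,3) by (simp add: \<alpha>_def field_simps)
  have diff': "1 / \<alpha> - 1 / a \<le> 1 / (q * N\<^sup>2)"
  proof -
    have "(j / 2) * ((1 / \<alpha>) * (1 / a)) \<le> (q / 2) * ((2 / (q * N)) * (1 / (q * N)))"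
      using b A pos by (intro mult_mono) auto
    also have "\<dots> = 1 / (q * N\<^sup>2)" using pos by (simp add: power2_eq_square field_simps)
    finally show ?thesis using diff by simp
  qed
  have q2: "4 / (q\<^sup>2 * N\<^sup>2) \<le> 4 / (q * N\<^sup>2)"
  proof -
    have "q * 1 \<le> q * q" using A by (intro mult_left_mono) auto
    then have "q * N\<^sup>2 \<le> q\<^sup>2 * N\<^sup>2" by (intro mult_right_mono) (auto simp: power2_eq_square)
    then show ?thesis using pos by (intro divide_left_mono) auto
  qed
  have "Polygamma 1 \<alpha> - Polygamma 1 a \<le> 1 / (q * N\<^sup>2) + 4 / (q * N\<^sup>2)"
    using Polygamma_1_diff_bounds(2)[OF b(2,4)] diff' b(6) q2 by linarith
  then show v: "Polygamma 1 \<alpha> - Polygamma 1 a \<le> 5 / (q * N\<^sup>2)"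
    by (simp add: add_divide_distrib[symmetric])
  have v0: "0 \<le> Polygamma 1 \<alpha> - Polygamma 1 a"
  proof -
    have "1 / a \<le> 1 / \<alpha>" using b(2,4) by (intro divide_left_mono) auto
    then show ?thesis using Polygamma_1_diff_bounds(1)[OF b(2,4)] by linarith
  qed
  show "Polygamma 1 \<alpha> + Polygamma 1 a - 4 * Polygamma 1 (\<alpha> + a) \<le> 1 / (2 * q * N ^ 3) + 5 / (q\<^sup>2 * N\<^sup>2)"
  proof -
    have "1 / \<alpha> + 1 / a - 4 / (\<alpha> + a) = (a - \<alpha>)\<^sup>2 / (\<alpha> * a * (\<alpha> + a))"
      using b(2,3) by (simp add: divide_simps) (simp add: power2_eq_square algebra_simps)
    also have "\<dots> = (j / 2)\<^sup>2 * ((1 / \<alpha>) * ((1 / a) * (1 / (\<alpha> + a))))" by (simp add: \<alpha>_def)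
    also have "\<dots> \<le> (q / 2)\<^sup>2 * ((2 / (q * N)) * ((1 / (q * N)) * (1 / (q * N))))"
    proof (intro mult_mono power_mono)
      have "1 / (\<alpha> + a) \<le> 1 / a" using b(2,3) by (intro divide_left_mono) auto
      then show "1 / (\<alpha> + a) \<le> 1 / (q * N)" using b(7) by linarith
    qed (use b A pos in auto)
    also have "\<dots> = 1 / (2 * q * N ^ 3)" using pos by (simp add: power2_eq_square power3_eq_cube field_simps)
    finally have main: "1 / \<alpha> + 1 / a - 4 / (\<alpha> + a) \<le> 1 / (2 * q * N ^ 3)" .
    have "(1 / a)\<^sup>2 \<le> (1 / (q * N))\<^sup>2" using b(3,7) by (intro power_mono) auto
    then have a2: "1 / a\<^sup>2 \<le> 1 / (q\<^sup>2 * N\<^sup>2)" by (simp add: power_divide power_mult_distrib)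
    have "1 / (q\<^sup>2 * N\<^sup>2) + 4 / (q\<^sup>2 * N\<^sup>2) = 5 / (q\<^sup>2 * N\<^sup>2)" by (simp add: add_divide_distrib[symmetric])
    then show ?thesis
      using main a2 b(6) Polygamma_1_bounds(2)[OF b(2)] Polygamma_1_bounds(2)[OF b(3)] Polygamma_1_bounds(1)[of "\<alpha> + a"] b(2,3)
      by simp
  qed
  have "0 \<le> Polygamma 1 (\<alpha> + a)"
    using Polygamma_1_bounds(1)[of "\<alpha> + a"] b(2,3) by (smt (verit) divide_nonneg_nonneg)
  then show "Polygamma 1 \<alpha> - Polygamma 1 (\<alpha> + a) \<le> 6 / (q * N)"
    using Polygamma_1_bounds(2)[OF b(2)] b(8) by linarith
  show "Polygamma 3 \<alpha> - Polygamma 3 a + 3 * (Polygamma 1 \<alpha> - Polygamma 1 a)\<^sup>2 \<le> 220 / (q\<^sup>2 * N ^ 3)"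
  proof -
    have "Polygamma 3 \<alpha> \<le> 6 * ((1 / \<alpha>\<^sup>2) * (1 / \<alpha> + 1 / \<alpha>\<^sup>2))"
      using Polygamma_3_bound(2)[OF b(2)] by simp
    also have "\<dots> \<le> 6 * ((4 / (q\<^sup>2 * N\<^sup>2)) * (6 / (q * N)))"
      using b pos by (intro mult_left_mono mult_mono) auto
    also have "\<dots> = 144 / (q ^ 3 * N ^ 3)" by (simp add: power2_eq_square power3_eq_cube mult_ac)
    also have "\<dots> \<le> 144 / (q\<^sup>2 * N ^ 3)"
    proof (intro divide_left_mono mult_right_mono)
      show "q\<^sup>2 \<le> q ^ 3" using A by (intro power_increasing) auto
    qed (use pos in auto)
    finally have p3: "Polygamma 3 \<alpha> \<le> 144 / (q\<^sup>2 * N ^ 3)" .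
    have "(Polygamma 1 \<alpha> - Polygamma 1 a)\<^sup>2 \<le> (5 / (q * N\<^sup>2))\<^sup>2" using v v0 by (intro power_mono) auto
    also have "\<dots> = 25 / (q\<^sup>2 * N ^ 4)" by (simp add: power_divide power_mult_distrib flip: power_mult)
    also have "\<dots> \<le> 25 / (q\<^sup>2 * N ^ 3)"
    proof (intro divide_left_mono mult_left_mono)
      show "N ^ 3 \<le> N ^ 4" using A by (intro power_increasing) auto
    qed (use pos in auto)
    finally have "(Polygamma 1 \<alpha> - Polygamma 1 a)\<^sup>2 \<le> 25 / (q\<^sup>2 * N ^ 3)" .
    moreover have "144 / (q\<^sup>2 * N ^ 3) + 3 * (25 / (q\<^sup>2 * N ^ 3)) \<le> 220 / (q\<^sup>2 * N ^ 3)"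
    proof -
      \<comment> \<open>The 144 comes from the tetragamma-type series, three times 25 from the
        squared variance; the sum 219 is rounded up.\<close>
      have "144 / (q\<^sup>2 * N ^ 3) + 3 * (25 / (q\<^sup>2 * N ^ 3)) = 219 / (q\<^sup>2 * N ^ 3)" by (simp add: add_divide_distrib[symmetric])
      also have "\<dots> \<le> 220 / (q\<^sup>2 * N ^ 3)" using pos by (intro divide_right_mono) auto
      finally show ?thesis .
    qed
    ultimately show ?thesis using p3 Polygamma_3_bound(1)[OF b(3)] by linarith
  qed
qed

lemma sum_even_odd_Icc:
  fixes g :: "nat \<Rightarrow> real"
  shows "(\<Sum>i=1..2 * n. g i) = (\<Sum>r=1..n. g (2 * r) + g (2 * r - 1))"
  by (induction n) (auto simp: algebra_simps)

locale beta_array = prob_space M for M :: "'a measure" +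
  fixes P R :: "nat \<Rightarrow> nat \<Rightarrow> 'a \<Rightarrow> real" and n q :: nat
  assumes n_pos: "n \<ge> 1" and q_pos: "q \<ge> 1"
    and indep_PR: "indep_vars (\<lambda>_. borel) (case_sum (\<lambda>(i, j). P i j) (\<lambda>(i, j). R i j))
        (({1..2 * n} \<times> {0..<q}) <+> ({1..2 * n} \<times> {1..<q}))"
    and P_beta: "\<And>i j. i \<in> {1..2 * n} \<Longrightarrow> j \<in> {0..<q} \<Longrightarrow>
        distributed M lborel (P i j)
          (beta_density ((real q + 1) / 2 * (2 * real n - real i + 2) - real j / 2)
                        ((real q + 1) / 2 * (2 * real n - real i + 2)))"
    and R_beta: "\<And>i j. i \<in> {1..2 * n} \<Longrightarrow> j \<in> {1..<q} \<Longrightarrow>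
        distributed M lborel (R i j)
          (beta_density ((real q + 1) / 2 * (2 * real n - real i + 2) - real j / 2) (real j / 2))"
begin

definition I :: "(nat \<times> nat + nat \<times> nat) set" where
  "I = ({1..2 * n} \<times> {0..<q}) <+> ({1..2 * n} \<times> {1..<q})"

definition Z :: "nat \<times> nat + nat \<times> nat \<Rightarrow> 'a \<Rightarrow> real" where
  "Z = case_sum (\<lambda>(i, j). P i j) (\<lambda>(i, j). R i j)"

definition idx :: "nat \<times> nat + nat \<times> nat \<Rightarrow> nat" where "idx = case_sum fst fst"
definition col :: "nat \<times> nat + nat \<times> nat \<Rightarrow> nat" where "col = case_sum snd snd"
definition row :: "nat \<times> nat + nat \<times> nat \<Rightarrow> nat" where "row x = (idx x + 1) div 2"

text \<open>In \<open>H\<close>, a cell in row \<open>r \<le> m\<close> contributes \<open>(m - r) LL + DD\<close>. The summand \<open>Inl\<close> carries the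
  variables \<open>p\<close>, the summand \<open>Inr\<close> the variables \<open>r\<close>.\<close>

definition LL :: "nat \<times> nat + nat \<times> nat \<Rightarrow> real \<Rightarrow> real" where
  "LL x z = (case x of Inl _ \<Rightarrow> ln z + ln (1 - z) | Inr _ \<Rightarrow> ln z)"

text \<open>At an odd index \<open>2 * r - 1\<close> all exponents are \<open>m - r + 1\<close>, one
  more than \<open>m - r\<close>. At an even index only the factor \<open>p\<close> carries the
  additional 1.\<close>

definition DD :: "nat \<times> nat + nat \<times> nat \<Rightarrow> real \<Rightarrow> real" where
  "DD x z = (if odd (idx x) then LL x z else case x of Inl _ \<Rightarrow> ln z | Inr _ \<Rightarrow> 0)"

definition \<xi> :: "nat \<times> nat + nat \<times> nat \<Rightarrow> real \<Rightarrow> real" where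
  "\<xi> x z = LL x z - expectation (\<lambda>\<omega>. LL x (Z x \<omega>))"

definition \<eta> :: "nat \<times> nat + nat \<times> nat \<Rightarrow> real \<Rightarrow> real" where
  "\<eta> x z = DD x z - expectation (\<lambda>\<omega>. DD x (Z x \<omega>))"

definition height :: "nat \<Rightarrow> real" where
  "height i = real (n - (i + 1) div 2 + 1)"

definition par :: "nat \<Rightarrow> real" where
  "par i = (real q + 1) / 2 * (2 * real n - real i + 2)"

lemma par_eq: "i \<in> {1..2 * n} \<Longrightarrow> par i = (real q + 1) * (height i + of_bool (odd i) / 2)"
proof -
  assume i: "i \<in> {1..2 * n}"
  define r where "r = (i + 1) div 2"
  have r: "i = (if odd i then 2 * r - 1 else 2 * r)" "1 \<le> r" "r \<le> n"
    using i by (auto simp: r_def elim!: oddE evenE)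
  have h: "height i = real n - real r + 1" using r by (simp add: height_def r_def of_nat_diff)
  have ri: "real i = 2 * real r - of_bool (odd i)" using r by (auto simp: of_nat_diff)
  show ?thesis unfolding par_def h ri by (simp add: field_simps)
qed

lemma height_ge_1: "height i \<ge> 1" by (simp add: height_def)

lemma par_ge: "i \<in> {1..2 * n} \<Longrightarrow> par i \<ge> real q * height i"
proof -
  assume i: "i \<in> {1..2 * n}"
  have "real q * height i \<le> (real q + 1) * (height i + of_bool (odd i) / 2)"
    using height_ge_1[of i] by (intro mult_mono) auto
  then show ?thesis using par_eq[OF i] by simp
qed

lemma cases_I:
  assumes "x \<in> I"
  obtains (P) i j where "x = Inl (i, j)" "i \<in> {1..2 * n}" "j \<in> {0..<q}" "Z x = P i j"
    | (R) i j where "x = Inr (i, j)" "i \<in> {1..2 * n}" "j \<in> {1..<q}" "Z x = R i j"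
  using assms by (auto simp: I_def Z_def)

lemma P_moments:
  assumes i: "i \<in> {1..2 * n}" and j: "j \<in> {0..<q}" and v: "v \<in> {0, 1}"
  defines "X \<equiv> \<lambda>\<omega>. ln (P i j \<omega>) + v * ln (1 - P i j \<omega>)"
  shows "X \<in> borel_measurable M" "integrable M X" "integrable M (\<lambda>\<omega>. (X \<omega> - expectation X)\<^sup>2)"
    "variance X \<le> (if v = 0 then 6 / (real q * height i) else 1 / (2 * real q * height i ^ 3) + 5 / ((real q)\<^sup>2 * (height i)\<^sup>2))"
proof -
  have bd: "distributed M lborel (P i j) (beta_density (par i - real j / 2) (par i))"
    using P_beta[OF i j] by (simp add: par_def)
  have jq: "0 \<le> real j" "real j \<le> real q" "1 \<le> real q" using j q_pos by auto
  note b = beta_parameter_bounds[OF jq(3) height_ge_1 jq(1,2) par_ge[OF i]]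
  note bv = beta_variance_bounds[OF jq(3) height_ge_1 jq(1,2) par_ge[OF i]]
  note m = beta_log_moments[OF bd b(2,3) v]
  show "X \<in> borel_measurable M" unfolding X_def by (rule m(1))
  show "integrable M X" unfolding X_def using m(2)[of 1] by simp
  show "integrable M (\<lambda>\<omega>. (X \<omega> - expectation X)\<^sup>2)" unfolding X_def by (rule m(3))
  have "variance X = Polygamma 1 (par i - real j / 2) + v * Polygamma 1 (par i) - (1 + v)\<^sup>2 * Polygamma 1 (par i - real j / 2 + par i)"
    unfolding X_def by (rule m(4))
  then show "variance X \<le> (if v = 0 then 6 / (real q * height i) else 1 / (2 * real q * height i ^ 3) + 5 / ((real q)\<^sup>2 * (height i)\<^sup>2))"
    using v bv(2,3) by auto
qed

lemma R_moments:
  assumes i: "i \<in> {1..2 * n}" and j: "j \<in> {1..<q}"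
  defines "X \<equiv> \<lambda>\<omega>. ln (R i j \<omega>)"
  shows "X \<in> borel_measurable M" "integrable M X" "integrable M (\<lambda>\<omega>. (X \<omega> - expectation X) ^ k)"
    "variance X = Polygamma 1 (par i - real j / 2) - Polygamma 1 (par i)"
    "variance X \<le> 5 / (real q * (height i)\<^sup>2)"
    "expectation (\<lambda>\<omega>. (X \<omega> - expectation X) ^ 4) \<le> 220 / ((real q)\<^sup>2 * height i ^ 3)"
proof -
  have bd: "distributed M lborel (R i j) (beta_density (par i - real j / 2) (real j / 2))"
    using R_beta[OF i j] by (simp add: par_def)
  have jq: "0 \<le> real j" "real j \<le> real q" "1 \<le> real q" and j2: "0 < real j / 2" using j q_pos by auto
  note b = beta_parameter_bounds[OF jq(3) height_ge_1 jq(1,2) par_ge[OF i]]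
  note bv = beta_variance_bounds[OF jq(3) height_ge_1 jq(1,2) par_ge[OF i]]
  have X: "X = (\<lambda>\<omega>. ln (R i j \<omega>) + 0 * ln (1 - R i j \<omega>))" by (simp add: X_def)
  note m = beta_log_moments[OF bd b(2) j2 insertI1]
  show "X \<in> borel_measurable M" unfolding X by (rule m(1))
  show "integrable M X" unfolding X using m(2)[of 1] by simp
  show "integrable M (\<lambda>\<omega>. (X \<omega> - expectation X) ^ k)" unfolding X by (rule m(3))
  have "variance X = Polygamma 1 (par i - real j / 2) + 0 * Polygamma 1 (real j / 2) - (1 + 0)\<^sup>2 * Polygamma 1 (par i - real j / 2 + real j / 2)"
    unfolding X by (rule m(4))
  then show V: "variance X = Polygamma 1 (par i - real j / 2) - Polygamma 1 (par i)" by simp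
  show "variance X \<le> 5 / (real q * (height i)\<^sup>2)" unfolding V by (rule bv(1))
  have "expectation (\<lambda>\<omega>. (X \<omega> - expectation X) ^ 4) = Polygamma 3 (par i - real j / 2) + 0 * Polygamma 3 (real j / 2)
    - (1 + 0) ^ 4 * Polygamma 3 (par i - real j / 2 + real j / 2) + 3 * (variance X)\<^sup>2"
    unfolding X by (rule m(5))
  then show "expectation (\<lambda>\<omega>. (X \<omega> - expectation X) ^ 4) \<le> 220 / ((real q)\<^sup>2 * height i ^ 3)"
    using bv(4) unfolding V by simp
qed

lemma Z_beta_AE: "AE \<omega> in M. \<forall>x\<in>I. 0 < Z x \<omega> \<and> Z x \<omega> < 1"
proof -
  have "finite I" by (simp add: I_def)
  moreover have "AE \<omega> in M. 0 < Z x \<omega> \<and> Z x \<omega> < 1" if "x \<in> I" for x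
    using that by (cases rule: cases_I) (use beta_AE[OF P_beta] beta_AE[OF R_beta] in auto)
  ultimately show ?thesis by (intro AE_finite_allI) auto
qed

text \<open>Both kinds of cells are brought to the common rate that \<open>row_field\<close> asks
  for. For the variables \<open>p\<close> this gives away the gain in the second bound of
  \<open>beta_variance_bounds\<close>, which \<open>P_part_variance\<close> exploits
  instead.\<close>

lemma cell_moments:
  assumes x: "x \<in> I"
  shows "integrable M (\<lambda>\<omega>. LL x (Z x \<omega>))" "integrable M (\<lambda>\<omega>. DD x (Z x \<omega>))"
    "integrable M (\<lambda>\<omega>. (\<xi> x (Z x \<omega>))\<^sup>2)" "integrable M (\<lambda>\<omega>. (\<eta> x (Z x \<omega>))\<^sup>2)"
    "expectation (\<lambda>\<omega>. (\<xi> x (Z x \<omega>))\<^sup>2) \<le> 6 / (real q * (height (idx x))\<^sup>2)"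
    "expectation (\<lambda>\<omega>. (\<eta> x (Z x \<omega>))\<^sup>2) \<le> 6 / (real q * height (idx x))"
proof -
  let ?h = "height (idx x)"
  have h1: "?h \<ge> 1" by (rule height_ge_1)
  have q1: "real q \<ge> 1" using q_pos by simp
  have le: "6 / (real q * ?h\<^sup>2) \<le> 6 / (real q * ?h)"
    using h1 q1 by (intro divide_left_mono mult_left_mono) (auto simp: self_le_power)
  have Lfacts: "integrable M (\<lambda>\<omega>. LL x (Z x \<omega>)) \<and> integrable M (\<lambda>\<omega>. (\<xi> x (Z x \<omega>))\<^sup>2) \<and>
    expectation (\<lambda>\<omega>. (\<xi> x (Z x \<omega>))\<^sup>2) \<le> 6 / (real q * ?h\<^sup>2)"
    using x
  proof (cases rule: cases_I)
    case (P i j)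
    have "1 / (2 * real q * ?h ^ 3) + 5 / ((real q)\<^sup>2 * ?h\<^sup>2) \<le> 1 / (real q * ?h\<^sup>2) + 5 / (real q * ?h\<^sup>2)"
    proof (rule add_mono)
      have "?h\<^sup>2 \<le> ?h ^ 3" using h1 by (intro power_increasing) auto
      then have "real q * ?h\<^sup>2 \<le> 2 * real q * ?h ^ 3" using q1 by (intro mult_mono) auto
      then show "1 / (2 * real q * ?h ^ 3) \<le> 1 / (real q * ?h\<^sup>2)" using h1 q1 by (intro divide_left_mono) auto
      have "real q * ?h\<^sup>2 \<le> (real q)\<^sup>2 * ?h\<^sup>2" using q1 by (intro mult_right_mono) (auto simp: self_le_power)
      then show "5 / ((real q)\<^sup>2 * ?h\<^sup>2) \<le> 5 / (real q * ?h\<^sup>2)" using h1 q1 by (intro divide_left_mono) auto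
    qed
    also have "\<dots> = 6 / (real q * ?h\<^sup>2)" by (simp add: add_divide_distrib[symmetric])
    finally show ?thesis
      using P_moments[OF P(2,3), of 1] P by (simp add: \<xi>_def LL_def idx_def)
  next
    case (R i j)
    have "5 / (real q * ?h\<^sup>2) \<le> 6 / (real q * ?h\<^sup>2)" by (intro divide_right_mono) auto
    then show ?thesis
      using R_moments(2,5)[OF R(2,3)] R_moments(3)[OF R(2,3), of 2] R by (simp add: \<xi>_def LL_def idx_def)
  qed
  show "integrable M (\<lambda>\<omega>. LL x (Z x \<omega>))" using Lfacts by blast
  show "integrable M (\<lambda>\<omega>. (\<xi> x (Z x \<omega>))\<^sup>2)" using Lfacts by blast
  show "expectation (\<lambda>\<omega>. (\<xi> x (Z x \<omega>))\<^sup>2) \<le> 6 / (real q * ?h\<^sup>2)" using Lfacts by blast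
  have Dfacts: "integrable M (\<lambda>\<omega>. DD x (Z x \<omega>)) \<and> integrable M (\<lambda>\<omega>. (\<eta> x (Z x \<omega>))\<^sup>2) \<and>
    expectation (\<lambda>\<omega>. (\<eta> x (Z x \<omega>))\<^sup>2) \<le> 6 / (real q * ?h)"
  proof (cases "odd (idx x)")
    case True
    then have "DD x = LL x" "\<eta> x = \<xi> x" by (auto simp: fun_eq_iff DD_def \<eta>_def \<xi>_def)
    then show ?thesis using Lfacts le by auto
  next
    case False
    from x show ?thesis
    proof (cases rule: cases_I)
      case (P i j)
      then show ?thesis using P_moments[OF P(2,3), of 0] False by (simp add: \<eta>_def DD_def idx_def)
    next
      case (R i j)
      then show ?thesis using False q1 h1 by (simp add: \<eta>_def DD_def idx_def)
    qed
  qed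
  show "integrable M (\<lambda>\<omega>. DD x (Z x \<omega>))" using Dfacts by blast
  show "integrable M (\<lambda>\<omega>. (\<eta> x (Z x \<omega>))\<^sup>2)" using Dfacts by blast
  show "expectation (\<lambda>\<omega>. (\<eta> x (Z x \<omega>))\<^sup>2) \<le> 6 / (real q * ?h)" using Dfacts by blast
qed

lemma finite_I': "finite I" by (simp add: I_def)

lemma row_range: "x \<in> I \<Longrightarrow> row x \<in> {1..n}"
  by (auto simp: I_def row_def idx_def)

lemma height_idx: "height (idx x) = real (n - row x + 1)"
  by (simp add: height_def row_def)

lemma row_card: "card {x\<in>I. row x = i} \<le> 4 * q"
proof -
  have "{x\<in>I. row x = i} \<subseteq> ({2 * i - 1, 2 * i} \<times> {0..<q}) <+> ({2 * i - 1, 2 * i} \<times> {0..<q})"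
    by (auto simp: I_def row_def idx_def; presburger)
  then have "card {x\<in>I. row x = i} \<le> card (({2 * i - 1, 2 * i} \<times> {0..<q}) <+> ({2 * i - 1, 2 * i} \<times> {0..<q}))"
    by (intro card_mono) auto
  also have "\<dots> = 2 * (card {2 * i - 1, 2 * i} * q)" by (simp add: card_Plus card_cartesian_product)
  also have "\<dots> \<le> 2 * (2 * q)" by (intro mult_le_mono) (auto simp: card_insert_if)
  finally show ?thesis by simp
qed

lemma row_sum_bound:
  assumes "\<And>x. x \<in> I \<Longrightarrow> row x = i \<Longrightarrow> f x \<le> 6 / (real q * b)" and "b > 0"
  shows "(\<Sum>x\<in>{x\<in>I. row x = i}. f x) \<le> 24 / b"
proof -
  have "(\<Sum>x\<in>{x\<in>I. row x = i}. f x) \<le> (\<Sum>x\<in>{x\<in>I. row x = i}. 6 / (real q * b))"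
    using assms by (intro sum_mono) auto
  also have "\<dots> = real (card {x\<in>I. row x = i}) * (6 / (real q * b))" by simp
  also have "\<dots> \<le> real (4 * q) * (6 / (real q * b))"
    using row_card[of i] assms(2) by (intro mult_right_mono) (simp_all only: of_nat_le_iff, auto)
  also have "\<dots> = 24 / b" using q_pos by simp
  finally show ?thesis .
qed

text \<open>A row has at most \<open>4 * q\<close> cells, each with variance at most
  \<open>6 / q\<close> times the rate; hence 24.\<close>

sublocale row_field M I Z row \<xi> \<eta> n 24
proof
  show "indep_vars (\<lambda>_. borel) Z I" unfolding Z_def I_def by (rule indep_PR)
  show "\<xi> x \<in> borel_measurable borel" for x
    unfolding \<xi>_def LL_def by (cases x) auto
  show "\<eta> x \<in> borel_measurable borel" for x
    unfolding \<eta>_def DD_def LL_def by (cases x; cases "odd (idx x)") auto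
  show "expectation (\<lambda>\<omega>. \<xi> x (Z x \<omega>)) = 0" if "x \<in> I" for x
    unfolding \<xi>_def using cell_moments(1)[OF that] by (simp add: prob_space)
  show "expectation (\<lambda>\<omega>. \<eta> x (Z x \<omega>)) = 0" if "x \<in> I" for x
    unfolding \<eta>_def using cell_moments(2)[OF that] by (simp add: prob_space)
  show "(\<Sum>x\<in>{x\<in>I. row x = i}. expectation (\<lambda>\<omega>. (\<xi> x (Z x \<omega>))\<^sup>2)) \<le> 24 / (real (n - i + 1))\<^sup>2" for i
    using cell_moments(5) by (intro row_sum_bound) (auto simp: height_idx)
  show "(\<Sum>x\<in>{x\<in>I. row x = i}. expectation (\<lambda>\<omega>. (\<eta> x (Z x \<omega>))\<^sup>2)) \<le> 24 / real (n - i + 1)" for i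
    using cell_moments(6) by (intro row_sum_bound) (auto simp: height_idx)
qed (use n_pos finite_I' row_range cell_moments in auto)

end

section \<open>The process as a sum over cells\<close>

context beta_array
begin

definition cellterm :: "nat \<Rightarrow> nat \<times> nat + nat \<times> nat \<Rightarrow> 'a \<Rightarrow> real" where
  "cellterm m x \<omega> = real (m - row x) * LL x (Z x \<omega>) + (if row x \<le> m then DD x (Z x \<omega>) else 0)"

definition H0 :: "nat \<Rightarrow> nat \<Rightarrow> 'a \<Rightarrow> real" where
  "H0 k m \<omega> = (\<Sum>x\<in>{x\<in>I. col x < k}. cellterm m x \<omega>)"

abbreviation Hr :: "real \<Rightarrow> real \<Rightarrow> 'a \<Rightarrow> real" where
  "Hr s t \<omega> \<equiv> H n q (\<lambda>i j. P i j \<omega>) (\<lambda>i j. R i j \<omega>) s t"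

lemma Inl_I: "i \<in> {1..2 * n} \<Longrightarrow> j < q \<Longrightarrow> Inl (i, j) \<in> I"
  and Inr_I: "i \<in> {1..2 * n} \<Longrightarrow> j \<in> {1..<q} \<Longrightarrow> Inr (i, j) \<in> I"
  by (auto simp: I_def)

lemma H0_sum:
  assumes "m \<le> n" "k \<le> q"
  shows "H0 k m \<omega> = (\<Sum>i=1..m.
      (\<Sum>j=1..<k. cellterm m (Inr (2 * i, j)) \<omega> + cellterm m (Inr (2 * i - 1, j)) \<omega>)
    + (\<Sum>j=0..<k. cellterm m (Inl (2 * i, j)) \<omega>) + (\<Sum>j=0..<k. cellterm m (Inl (2 * i - 1, j)) \<omega>))"
proof -
  have set: "{x\<in>I. col x < k} = ({1..2 * n} \<times> {0..<k}) <+> ({1..2 * n} \<times> {1..<k})"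
    using assms by (auto simp: I_def col_def)
  define g where "g i = (\<Sum>j=0..<k. cellterm m (Inl (i, j)) \<omega>) + (\<Sum>j=1..<k. cellterm m (Inr (i, j)) \<omega>)" for i
  have "H0 k m \<omega> = (\<Sum>x\<in>{1..2 * n} \<times> {0..<k}. cellterm m (Inl x) \<omega>) + (\<Sum>x\<in>{1..2 * n} \<times> {1..<k}. cellterm m (Inr x) \<omega>)"
    unfolding H0_def set by (subst sum.Plus) auto
  also have "\<dots> = (\<Sum>i=1..2 * n. g i)"
    by (simp add: g_def sum.distrib sum.cartesian_product case_prod_unfold)
  also have "\<dots> = (\<Sum>r=1..n. g (2 * r) + g (2 * r - 1))" by (rule sum_even_odd_Icc)
  also have "\<dots> = (\<Sum>r=1..m. g (2 * r) + g (2 * r - 1))"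
  proof (rule sum.mono_neutral_right)
    show "\<forall>r\<in>{1..n} - {1..m}. g (2 * r) + g (2 * r - 1) = 0"
      by (auto simp: g_def cellterm_def row_def idx_def)
  qed (use assms in auto)
  finally show ?thesis by (simp add: g_def sum.distrib algebra_simps)
qed

text \<open>The logarithm of a product splits only for positive factors, hence the assumption that
  all variables lie strictly inside the unit interval; it holds almost surely.\<close>

lemma H_eq_H0:
  assumes pos: "\<forall>x\<in>I. 0 < Z x \<omega> \<and> Z x \<omega> < 1" and st: "s \<in> {0..1}" "t \<in> {0..1}"
  shows "Hr s t \<omega> = H0 (nat \<lfloor>real q * s\<rfloor>) (nat \<lfloor>real n * t\<rfloor>) \<omega>"
proof -
  define m where "m = nat \<lfloor>real n * t\<rfloor>"
  define k where "k = nat \<lfloor>real q * s\<rfloor>"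
  have mn: "m \<le> n" and kq: "k \<le> q" using st floor_le_nat by (auto simp: m_def k_def)
  have Ppos: "0 < P i j \<omega>" "P i j \<omega> < 1" if "i \<in> {1..2 * n}" "j < k" for i j
    using bspec[OF pos Inl_I[OF that(1), of j]] that kq by (auto simp: Z_def)
  have Rpos: "0 < R i j \<omega>" if "i \<in> {1..2 * n}" "j \<in> {1..<k}" for i j
    using bspec[OF pos Inr_I[OF that(1), of j]] that kq by (auto simp: Z_def)
  have "Hr s t \<omega> = (\<Sum>i = 1..m.
        (\<Sum>j = 1..<k. ln (R (2 * i) j \<omega> ^ (m - i)) + ln (R (2 * i - 1) j \<omega> ^ (m - i + 1)))
      + (\<Sum>j = 0..<k. ln (P (2 * i) j \<omega> ^ (m - i + 1) * (1 - P (2 * i) j \<omega>) ^ (m - i)))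
      + (\<Sum>j = 0..<k. ln (P (2 * i - 1) j \<omega> ^ (m - i + 1) * (1 - P (2 * i - 1) j \<omega>) ^ (m - i + 1))))"
    by (simp add: H_def Let_def m_def k_def)
  also have "\<dots> = H0 k m \<omega>"
    unfolding H0_sum[OF mn kq]
  proof (intro sum.cong refl arg_cong2[where f = "(+)"])
    fix i assume "i \<in> {1..m}"
    then have i: "i \<le> m" "2 * i \<in> {1..2 * n}" "2 * i - 1 \<in> {1..2 * n}" "odd (2 * i - 1)" "(2 * i - 1 + 1) div 2 = i"
      using mn by auto
    show "ln (R (2 * i) j \<omega> ^ (m - i)) = cellterm m (Inr (2 * i, j)) \<omega>" if "j \<in> {1..<k}" for j
      using Rpos[OF i(2) that] i by (simp add: cellterm_def row_def idx_def LL_def DD_def Z_def ln_realpow)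
    show "ln (R (2 * i - 1) j \<omega> ^ (m - i + 1)) = cellterm m (Inr (2 * i - 1, j)) \<omega>" if "j \<in> {1..<k}" for j
    proof -
      have "ln (R (2 * i - 1) j \<omega> ^ (m - i + 1)) = real (m - i + 1) * ln (R (2 * i - 1) j \<omega>)"
        by (rule ln_realpow)
      then show ?thesis using i by (simp add: cellterm_def row_def idx_def LL_def DD_def Z_def algebra_simps)
    qed
    show "ln (P (2 * i) j \<omega> ^ (m - i + 1) * (1 - P (2 * i) j \<omega>) ^ (m - i)) = cellterm m (Inl (2 * i, j)) \<omega>" if "j \<in> {0..<k}" for j
    proof -
      have p: "0 < P (2 * i) j \<omega>" "P (2 * i) j \<omega> < 1" using Ppos[OF i(2)] that by auto
      have "ln (P (2 * i) j \<omega> ^ (m - i + 1) * (1 - P (2 * i) j \<omega>) ^ (m - i))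
        = real (m - i + 1) * ln (P (2 * i) j \<omega>) + real (m - i) * ln (1 - P (2 * i) j \<omega>)"
        using p by (subst ln_mult_pos) (auto simp del: power_Suc simp: ln_realpow)
      then show ?thesis using i by (simp add: cellterm_def row_def idx_def LL_def DD_def Z_def algebra_simps)
    qed
    show "ln (P (2 * i - 1) j \<omega> ^ (m - i + 1) * (1 - P (2 * i - 1) j \<omega>) ^ (m - i + 1)) = cellterm m (Inl (2 * i - 1, j)) \<omega>" if "j \<in> {0..<k}" for j
    proof -
      have p: "0 < P (2 * i - 1) j \<omega>" "P (2 * i - 1) j \<omega> < 1" using Ppos[OF i(3)] that by auto
      have "ln (P (2 * i - 1) j \<omega> ^ (m - i + 1) * (1 - P (2 * i - 1) j \<omega>) ^ (m - i + 1))
        = real (m - i + 1) * ln (P (2 * i - 1) j \<omega>) + real (m - i + 1) * ln (1 - P (2 * i - 1) j \<omega>)"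
        using p by (subst ln_mult_pos) (auto simp del: power_Suc simp: ln_realpow)
      then show ?thesis using i by (simp add: cellterm_def row_def idx_def LL_def DD_def Z_def algebra_simps)
    qed
  qed
  finally show ?thesis by (simp add: m_def k_def)
qed

text \<open>Proved for \<open>H\<close> itself and not through \<open>H0\<close>: the two agree only
  almost surely, and \<open>M\<close> is not assumed to be complete.\<close>

lemma Hr_borel:
  assumes st: "s \<in> {0..1}" "t \<in> {0..1}"
  shows "Hr s t \<in> borel_measurable M"
proof -
  define m where "m = nat \<lfloor>real n * t\<rfloor>"
  define k where "k = nat \<lfloor>real q * s\<rfloor>"
  have mn: "m \<le> n" and kq: "k \<le> q" using st floor_le_nat by (auto simp: m_def k_def)
  have Pm: "P i j \<in> borel_measurable M" if "i \<in> {1..2 * n}" "j \<in> {0..<k}" for i j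
    using Z_borel[OF Inl_I[OF that(1), of j]] that kq by (auto simp: Z_def)
  have Rm: "R i j \<in> borel_measurable M" if "i \<in> {1..2 * n}" "j \<in> {1..<k}" for i j
    using Z_borel[OF Inr_I[OF that(1), of j]] that kq by (auto simp: Z_def)
  have lnR: "(\<lambda>\<omega>. ln (R i j \<omega> ^ a)) \<in> borel_measurable M" if "i \<in> {1..2 * n}" "j \<in> {1..<k}" for i j a
    using Rm[OF that] by measurable
  have lnP: "(\<lambda>\<omega>. ln (P i j \<omega> ^ a * (1 - P i j \<omega>) ^ b)) \<in> borel_measurable M" if "i \<in> {1..2 * n}" "j \<in> {0..<k}" for i j a b
    using Pm[OF that] by measurable
  have "Hr s t = (\<lambda>\<omega>. \<Sum>i = 1..m.
        (\<Sum>j = 1..<k. ln (R (2 * i) j \<omega> ^ (m - i)) + ln (R (2 * i - 1) j \<omega> ^ (m - i + 1)))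
      + (\<Sum>j = 0..<k. ln (P (2 * i) j \<omega> ^ (m - i + 1) * (1 - P (2 * i) j \<omega>) ^ (m - i)))
      + (\<Sum>j = 0..<k. ln (P (2 * i - 1) j \<omega> ^ (m - i + 1) * (1 - P (2 * i - 1) j \<omega>) ^ (m - i + 1))))"
    by (simp add: H_def Let_def m_def k_def)
  also have "\<dots> \<in> borel_measurable M"
    using mn by (intro borel_measurable_sum borel_measurable_add lnR lnP) auto
  finally show ?thesis .
qed

lemma W_eq_H0:
  "W {x\<in>I. col x < k} m \<omega> = H0 k m \<omega> - expectation (H0 k m)"
proof -
  have fin: "finite {x\<in>I. col x < k}" using finite_I by simp
  have int: "integrable M (cellterm m x)" if "x \<in> I" for x
    unfolding cellterm_def using cell_moments(1,2)[OF that] by (cases "row x \<le> m") auto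
  have E: "expectation (cellterm m x) = real (m - row x) * expectation (\<lambda>\<omega>. LL x (Z x \<omega>))
      + (if row x \<le> m then expectation (\<lambda>\<omega>. DD x (Z x \<omega>)) else 0)" if "x \<in> I" for x
    unfolding cellterm_def using cell_moments(1,2)[OF that] by (cases "row x \<le> m") auto
  have "expectation (H0 k m) = (\<Sum>x\<in>{x\<in>I. col x < k}. expectation (cellterm m x))"
    unfolding H0_def using int by (intro Bochner_Integration.integral_sum) auto
  then have "H0 k m \<omega> - expectation (H0 k m) = (\<Sum>x\<in>{x\<in>I. col x < k}. cellterm m x \<omega> - expectation (cellterm m x))"
    by (simp add: H0_def sum_subtractf)
  also have "\<dots> = W {x\<in>I. col x < k} m \<omega>"
    unfolding W_def
  proof (intro sum.cong refl)
    fix x assume "x \<in> {x\<in>I. col x < k}"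
    then show "cellterm m x \<omega> - expectation (cellterm m x) = wt m x (Z x \<omega>)"
      using E[of x] by (simp add: wt_def \<xi>_def \<eta>_def cellterm_def algebra_simps)
  qed
  finally show ?thesis by simp
qed

text \<open>One null set serves all \<open>s\<close> and \<open>t\<close>, because it concerns the
  variables and not the parameters. Suprema over the square can therefore be computed with
  \<open>W\<close>.\<close>

lemma AE_Hr_centered:
  "AE \<omega> in M. \<forall>s\<in>{0..1}. \<forall>t\<in>{0..1}.
     Hr s t \<omega> - expectation (Hr s t) = W {x\<in>I. col x < nat \<lfloor>real q * s\<rfloor>} (nat \<lfloor>real n * t\<rfloor>) \<omega>"
proof -
  have H0m: "H0 k m \<in> borel_measurable M" for k m
    unfolding H0_def cellterm_def
    using cell_moments(1,2) by (intro borel_measurable_sum borel_measurable_add) (auto intro: borel_measurable_integrable)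
  have E: "expectation (Hr s t) = expectation (H0 (nat \<lfloor>real q * s\<rfloor>) (nat \<lfloor>real n * t\<rfloor>))" if "s \<in> {0..1}" "t \<in> {0..1}" for s t
    using Z_beta_AE H_eq_H0[OF _ that] by (intro integral_cong_AE Hr_borel[OF that] H0m) (auto elim!: eventually_mono)
  show ?thesis
    using Z_beta_AE
  proof eventually_elim
    case (elim \<omega>)
    then show ?case using E H_eq_H0[OF elim] by (simp add: W_eq_H0)
  qed
qed

lemma wt_square_le:
  assumes x: "x \<in> I" and "m \<le> n"
  shows "expectation (\<lambda>\<omega>. (wt m x (Z x \<omega>))\<^sup>2) \<le>
    2 * (height (idx x))\<^sup>2 * expectation (\<lambda>\<omega>. (\<xi> x (Z x \<omega>))\<^sup>2) + 2 * expectation (\<lambda>\<omega>. (\<eta> x (Z x \<omega>))\<^sup>2)"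
proof -
  have mr: "real (m - row x) \<le> height (idx x)" using assms by (simp add: height_idx)
  have "expectation (\<lambda>\<omega>. (wt m x (Z x \<omega>))\<^sup>2) \<le>
    expectation (\<lambda>\<omega>. 2 * (height (idx x))\<^sup>2 * (\<xi> x (Z x \<omega>))\<^sup>2 + 2 * (\<eta> x (Z x \<omega>))\<^sup>2)"
  proof (rule integral_mono)
    show "integrable M (\<lambda>\<omega>. (wt m x (Z x \<omega>))\<^sup>2)" by (rule wt_moments(2)[OF x])
    show "integrable M (\<lambda>\<omega>. 2 * (height (idx x))\<^sup>2 * (\<xi> x (Z x \<omega>))\<^sup>2 + 2 * (\<eta> x (Z x \<omega>))\<^sup>2)"
      using cell_moments(3,4)[OF x] by simp
    fix \<omega>
    define b where "b = (if row x \<le> m then \<eta> x (Z x \<omega>) else 0)"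
    have "(real (m - row x) * \<xi> x (Z x \<omega>) + b)\<^sup>2 \<le> 2 * (real (m - row x) * \<xi> x (Z x \<omega>))\<^sup>2 + 2 * b\<^sup>2"
      using sum_squares_bound[of "real (m - row x) * \<xi> x (Z x \<omega>)" b] by (simp add: power2_sum)
    also have "\<dots> \<le> 2 * (height (idx x))\<^sup>2 * (\<xi> x (Z x \<omega>))\<^sup>2 + 2 * (\<eta> x (Z x \<omega>))\<^sup>2"
    proof (rule add_mono)
      have "(real (m - row x))\<^sup>2 * (\<xi> x (Z x \<omega>))\<^sup>2 \<le> (height (idx x))\<^sup>2 * (\<xi> x (Z x \<omega>))\<^sup>2"
        using mr by (intro mult_right_mono power_mono) auto
      then show "2 * (real (m - row x) * \<xi> x (Z x \<omega>))\<^sup>2 \<le> 2 * (height (idx x))\<^sup>2 * (\<xi> x (Z x \<omega>))\<^sup>2"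
        by (simp add: power_mult_distrib)
      show "2 * b\<^sup>2 \<le> 2 * (\<eta> x (Z x \<omega>))\<^sup>2" by (simp add: b_def)
    qed
    finally show "(wt m x (Z x \<omega>))\<^sup>2 \<le> 2 * (height (idx x))\<^sup>2 * (\<xi> x (Z x \<omega>))\<^sup>2 + 2 * (\<eta> x (Z x \<omega>))\<^sup>2"
      by (simp add: wt_def b_def)
  qed
  also have "\<dots> = 2 * (height (idx x))\<^sup>2 * expectation (\<lambda>\<omega>. (\<xi> x (Z x \<omega>))\<^sup>2) + 2 * expectation (\<lambda>\<omega>. (\<eta> x (Z x \<omega>))\<^sup>2)"
    using cell_moments(3,4)[OF x] by simp
  finally show ?thesis .
qed

text \<open>Bounded second moments of the scaled process, as required by
  \<open>fdd_convergence\<close>.\<close>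

lemma total_variance:
  assumes "A \<subseteq> I" "m \<le> n"
  shows "(\<Sum>x\<in>A. expectation (\<lambda>\<omega>. (wt m x (Z x \<omega>))\<^sup>2)) \<le> 96 * real n"
proof -
  have "(\<Sum>x\<in>A. expectation (\<lambda>\<omega>. (wt m x (Z x \<omega>))\<^sup>2)) \<le> (\<Sum>x\<in>I. expectation (\<lambda>\<omega>. (wt m x (Z x \<omega>))\<^sup>2))"
    using assms finite_I by (intro sum_mono2) auto
  also have "\<dots> \<le> (\<Sum>x\<in>I. 24 / real q)"
  proof (rule sum_mono)
    fix x assume x: "x \<in> I"
    let ?h = "height (idx x)"
    have h: "?h \<ge> 1" by (rule height_ge_1)
    have "2 * ?h\<^sup>2 * expectation (\<lambda>\<omega>. (\<xi> x (Z x \<omega>))\<^sup>2) \<le> 2 * ?h\<^sup>2 * (6 / (real q * ?h\<^sup>2))"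
      by (intro mult_left_mono cell_moments(5)[OF x]) auto
    also have "\<dots> = 12 / real q" using h by simp
    finally have 1: "2 * ?h\<^sup>2 * expectation (\<lambda>\<omega>. (\<xi> x (Z x \<omega>))\<^sup>2) \<le> 12 / real q" .
    have "6 / (real q * ?h) \<le> 6 / (real q * 1)"
      using h q_pos by (intro divide_left_mono mult_left_mono) auto
    then have "2 * expectation (\<lambda>\<omega>. (\<eta> x (Z x \<omega>))\<^sup>2) \<le> 12 / real q"
      using cell_moments(6)[OF x] by simp
    with 1 have "expectation (\<lambda>\<omega>. (wt m x (Z x \<omega>))\<^sup>2) \<le> 12 / real q + 12 / real q"
      using wt_square_le[OF x assms(2)] by linarith
    then show "expectation (\<lambda>\<omega>. (wt m x (Z x \<omega>))\<^sup>2) \<le> 24 / real q" by simp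
  qed
  also have "\<dots> = real (card I) * (24 / real q)" by simp
  also have "\<dots> \<le> real (4 * n * q) * (24 / real q)"
  proof (intro mult_right_mono)
    have "card I = 2 * n * q + 2 * n * (q - 1)"
      by (simp add: I_def card_Plus card_cartesian_product)
    also have "\<dots> \<le> 2 * n * q + 2 * n * q" by (intro add_left_mono mult_le_mono) auto
    finally have "card I \<le> 4 * n * q" by simp
    then show "real (card I) \<le> real (4 * n * q)" by (simp only: of_nat_le_iff)
  qed auto
  also have "\<dots> = 96 * real n" using q_pos by simp
  finally show ?thesis .
qed

text \<open>The squared weight of \<xi> is of order \<open>N\<^sup>2\<close> at height
  \<open>N\<close>, so the sharp bound for \<open>ln p + ln (1 - p)\<close> leaves
  \<open>1 / (q * N) + 10 / q\<^sup>2\<close> per cell. Over \<open>q\<close> columns and all rows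
  this is a harmonic sum, again estimated by \<open>sqrt n\<close>, and a multiple of
  \<open>n / q\<close>; both are \<open>o(n)\<close> as \<open>n\<close> and \<open>q\<close>
  grow.\<close>

lemma P_part_variance:
  assumes "m \<le> n"
  shows "(\<Sum>x\<in>{1..2 * n} \<times> {0..<q}. expectation (\<lambda>\<omega>. (wt m (Inl x) (Z (Inl x) \<omega>))\<^sup>2)) \<le> 52 * sqrt (real n) + 20 * real n / real q"
proof -
  have q1: "real q \<ge> 1" using q_pos by simp
  have cellb: "expectation (\<lambda>\<omega>. (wt m (Inl (i, j)) (Z (Inl (i, j)) \<omega>))\<^sup>2) \<le> 13 / (real q * height i) + 10 / (real q)\<^sup>2"
    if i: "i \<in> {1..2 * n}" and j: "j \<in> {0..<q}" for i j
  proof -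
    have x: "Inl (i, j) \<in> I" using i j by (auto simp: I_def)
    have h: "height i \<ge> 1" by (rule height_ge_1)
    have "expectation (\<lambda>\<omega>. (\<xi> (Inl (i, j)) (Z (Inl (i, j)) \<omega>))\<^sup>2) \<le> 1 / (2 * real q * height i ^ 3) + 5 / ((real q)\<^sup>2 * (height i)\<^sup>2)"
      using P_moments(4)[OF i j, of 1] by (simp add: \<xi>_def LL_def Z_def)
    then have "2 * (height i)\<^sup>2 * expectation (\<lambda>\<omega>. (\<xi> (Inl (i, j)) (Z (Inl (i, j)) \<omega>))\<^sup>2)
      \<le> 2 * (height i)\<^sup>2 * (1 / (2 * real q * height i ^ 3) + 5 / ((real q)\<^sup>2 * (height i)\<^sup>2))"
      by (intro mult_left_mono) auto
    also have "\<dots> = 1 / (real q * height i) + 10 / (real q)\<^sup>2"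
      using h q1 by (simp add: field_simps power2_eq_square power3_eq_cube)
    finally have 1: "2 * (height i)\<^sup>2 * expectation (\<lambda>\<omega>. (\<xi> (Inl (i, j)) (Z (Inl (i, j)) \<omega>))\<^sup>2) \<le> 1 / (real q * height i) + 10 / (real q)\<^sup>2" .
    have 2: "2 * expectation (\<lambda>\<omega>. (\<eta> (Inl (i, j)) (Z (Inl (i, j)) \<omega>))\<^sup>2) \<le> 12 / (real q * height i)"
      using cell_moments(6)[OF x] by (simp add: idx_def)
    have "expectation (\<lambda>\<omega>. (wt m (Inl (i, j)) (Z (Inl (i, j)) \<omega>))\<^sup>2) \<le>
      2 * (height i)\<^sup>2 * expectation (\<lambda>\<omega>. (\<xi> (Inl (i, j)) (Z (Inl (i, j)) \<omega>))\<^sup>2) + 2 * expectation (\<lambda>\<omega>. (\<eta> (Inl (i, j)) (Z (Inl (i, j)) \<omega>))\<^sup>2)"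
      using wt_square_le[OF x assms] by (simp add: idx_def)
    also have "\<dots> \<le> (1 / (real q * height i) + 10 / (real q)\<^sup>2) + 12 / (real q * height i)"
      by (rule add_mono[OF 1 2])
    also have "\<dots> = 13 / (real q * height i) + 10 / (real q)\<^sup>2"
      using add_divide_distrib[of 1 12 "real q * height i"] by simp
    finally show ?thesis .
  qed
  have "(\<Sum>x\<in>{1..2 * n} \<times> {0..<q}. expectation (\<lambda>\<omega>. (wt m (Inl x) (Z (Inl x) \<omega>))\<^sup>2)) =
    (\<Sum>i=1..2 * n. \<Sum>j=0..<q. expectation (\<lambda>\<omega>. (wt m (Inl (i, j)) (Z (Inl (i, j)) \<omega>))\<^sup>2))"
    by (simp add: sum.cartesian_product case_prod_unfold)
  also have "\<dots> \<le> (\<Sum>i=1..2 * n. \<Sum>j=0..<q. 13 / (real q * height i) + 10 / (real q)\<^sup>2)"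
    by (intro sum_mono cellb)
  also have "\<dots> = (\<Sum>i=1..2 * n. 13 / height i + 10 / real q)"
    using q1 by (intro sum.cong refl) (simp add: field_simps power2_eq_square)
  also have "\<dots> = (\<Sum>r=1..n. 26 / real (n - r + 1) + 20 / real q)"
    unfolding sum_even_odd_Icc
  proof (intro sum.cong refl)
    fix r assume "r \<in> {1..n}"
    then have "height (2 * r) = real (n - r + 1)" "height (2 * r - 1) = real (n - r + 1)" by (auto simp: height_def)
    then show "13 / height (2 * r) + 10 / real q + (13 / height (2 * r - 1) + 10 / real q) = 26 / real (n - r + 1) + 20 / real q"
      by (simp add: add_divide_distrib[symmetric])
  qed
  also have "\<dots> = 26 * (\<Sum>r=1..n. 1 / real (n - r + 1)) + 20 * real n / real q"
    by (simp add: sum.distrib sum_distrib_left)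
  also have "(\<Sum>r=1..n. 1 / real (n - r + 1)) = (\<Sum>k=0..<0 + n. 1 / real (Suc k))"
    by (intro sum.reindex_bij_witness[of _ "\<lambda>k. n - k" "\<lambda>i. n - i"]) auto
  also have "(\<Sum>k=0..<0 + n. 1 / real (Suc k)) \<le> (\<Sum>k=0..<0 + n. 1 / sqrt (real (Suc k)))"
  proof (intro sum_mono divide_left_mono)
    show "sqrt (real (Suc k)) \<le> real (Suc k)" for k
      using real_sqrt_le_mono[of "real (Suc k)" "(real (Suc k))\<^sup>2"] by (simp add: power2_eq_square)
  qed auto
  also have "\<dots> \<le> 2 * sqrt (real n)" by (rule sum_inverse_sqrt_le)
  finally show ?thesis by simp
qed

text \<open>For a cell with a variable \<open>r\<close> the part \<eta> is a multiple of \<xi>, so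
  its weight collapses to this scalar factor. A linear combination of fields is then a weighted sum
  of one noise variable per cell.\<close>

definition coef :: "nat \<Rightarrow> nat \<Rightarrow> real" where
  "coef m i = (if (i + 1) div 2 \<le> m then real (m - (i + 1) div 2) + of_bool (odd i) else 0)"

lemma wt_R: "wt m (Inr (i, j)) z = coef m i * \<xi> (Inr (i, j)) z"
proof -
  have "\<eta> (Inr (i, j)) z = of_bool (odd i) * \<xi> (Inr (i, j)) z"
    by (simp add: \<eta>_def \<xi>_def DD_def idx_def)
  then show ?thesis by (simp add: wt_def coef_def row_def idx_def algebra_simps)
qed

lemma coef_bounds: "m \<le> n \<Longrightarrow> 0 \<le> coef m i" "m \<le> n \<Longrightarrow> coef m i \<le> height i"
  by (auto simp: coef_def height_def)

definition vR :: "nat \<Rightarrow> nat \<Rightarrow> real" where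
  "vR i j = Polygamma 1 (par i - real j / 2) - Polygamma 1 (par i)"

lemma R_cell:
  assumes "i \<in> {1..2 * n}" "j \<in> {1..<q}"
  shows "Inr (i, j) \<in> I" "expectation (\<lambda>\<omega>. (\<xi> (Inr (i, j)) (Z (Inr (i, j)) \<omega>))\<^sup>2) = vR i j"
    "integrable M (\<lambda>\<omega>. (\<xi> (Inr (i, j)) (Z (Inr (i, j)) \<omega>)) ^ k)"
    "expectation (\<lambda>\<omega>. (\<xi> (Inr (i, j)) (Z (Inr (i, j)) \<omega>)) ^ 4) \<le> 220 / ((real q)\<^sup>2 * height i ^ 3)"
    "vR i j \<le> 5 / (real q * (height i)\<^sup>2)"
proof -
  show "Inr (i, j) \<in> I" using assms by (auto simp: I_def)
  show "expectation (\<lambda>\<omega>. (\<xi> (Inr (i, j)) (Z (Inr (i, j)) \<omega>))\<^sup>2) = vR i j"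
    using R_moments(4)[OF assms] by (simp add: \<xi>_def LL_def Z_def vR_def)
  show "integrable M (\<lambda>\<omega>. (\<xi> (Inr (i, j)) (Z (Inr (i, j)) \<omega>)) ^ k)"
    using R_moments(3)[OF assms] by (simp add: \<xi>_def LL_def Z_def)
  show "expectation (\<lambda>\<omega>. (\<xi> (Inr (i, j)) (Z (Inr (i, j)) \<omega>)) ^ 4) \<le> 220 / ((real q)\<^sup>2 * height i ^ 3)"
    using R_moments(6)[OF assms] by (simp add: \<xi>_def LL_def Z_def)
  show "vR i j \<le> 5 / (real q * (height i)\<^sup>2)"
    using R_moments(4,5)[OF assms] by (simp add: vR_def)
qed

definition WW :: "nat \<Rightarrow> nat \<Rightarrow> 'a \<Rightarrow> real" where
  "WW k m \<omega> = W {x\<in>I. col x < k} m \<omega>"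

lemma WW_borel [measurable]: "WW k m \<in> borel_measurable M"
  unfolding WW_def[abs_def] by (rule W_borel) auto

lemma WW_square:
  assumes "m \<le> n"
  shows "integrable M (\<lambda>\<omega>. (WW k m \<omega>)\<^sup>2)" "expectation (\<lambda>\<omega>. (WW k m \<omega>)\<^sup>2) \<le> 96 * real n"
  unfolding WW_def using W_square[of "{x\<in>I. col x < k}" m] total_variance[of "{x\<in>I. col x < k}" m] assms by auto

definition R_index :: "(nat \<times> nat) set" where "R_index = {1..2 * n} \<times> {1..<q}"

definition R_noise :: "nat \<times> nat \<Rightarrow> 'a \<Rightarrow> real" where
  "R_noise x \<omega> = \<xi> (Inr x) (Z (Inr x) \<omega>)"

text \<open>\<open>min k q\<close> keeps the index set inside \<open>I\<close> for every
  \<open>k\<close>.\<close>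

definition P_noise :: "nat \<Rightarrow> nat \<Rightarrow> 'a \<Rightarrow> real" where
  "P_noise k m \<omega> = W (Inl ` ({1..2 * n} \<times> {0..<min k q})) m \<omega>"

text \<open>Separates the part that survives in the limit from the one that is small in L2. The
  condition \<open>j < k\<close> sits in the coefficient, so that all \<open>k\<close> and
  \<open>m\<close> share one index set.\<close>

lemma WW_split: "WW k m \<omega> = (\<Sum>(i, j)\<in>R_index. (if j < k then coef m i else 0) * R_noise (i, j) \<omega>) + P_noise k m \<omega>"
proof -
  have set: "{x\<in>I. col x < k} = Inl ` ({1..2 * n} \<times> {0..<min k q}) \<union> Inr ` {x\<in>R_index. snd x < k}"
    by (auto simp: I_def R_index_def col_def)
  have "WW k m \<omega> = P_noise k m \<omega> + (\<Sum>x\<in>Inr ` {x\<in>R_index. snd x < k}. wt m x (Z x \<omega>))"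
    unfolding WW_def P_noise_def W_def set by (rule sum.union_disjoint) (auto simp: R_index_def)
  also have "(\<Sum>x\<in>Inr ` {x\<in>R_index. snd x < k}. wt m x (Z x \<omega>)) = (\<Sum>x\<in>{x\<in>R_index. snd x < k}. coef m (fst x) * R_noise x \<omega>)"
  proof (subst sum.reindex)
    show "inj_on Inr {x\<in>R_index. snd x < k}" by (simp add: inj_on_def)
    have "wt m (Inr x) z = coef m (fst x) * \<xi> (Inr x) z" for x z
      using wt_R[of m "fst x" "snd x"] by simp
    then show "(\<Sum>x\<in>{x\<in>R_index. snd x < k}. ((\<lambda>x. wt m x (Z x \<omega>)) \<circ> Inr) x) = (\<Sum>x\<in>{x\<in>R_index. snd x < k}. coef m (fst x) * R_noise x \<omega>)"
      by (simp add: R_noise_def)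
  qed
  also have "\<dots> = (\<Sum>x\<in>R_index. if snd x < k then coef m (fst x) * R_noise x \<omega> else 0)"
    by (rule sum.inter_filter) (simp add: R_index_def)
  also have "\<dots> = (\<Sum>(i, j)\<in>R_index. (if j < k then coef m i else 0) * R_noise (i, j) \<omega>)"
    by (intro sum.cong) auto
  finally show ?thesis by simp
qed

lemma P_noise_facts:
  assumes "m \<le> n"
  shows "P_noise k m \<in> borel_measurable M" "integrable M (\<lambda>\<omega>. (P_noise k m \<omega>)\<^sup>2)"
    "expectation (\<lambda>\<omega>. (P_noise k m \<omega>)\<^sup>2) \<le> 52 * sqrt (real n) + 20 * real n / real q"
proof -
  have sub: "Inl ` ({1..2 * n} \<times> {0..<min k q}) \<subseteq> I" by (auto simp: I_def)
  show "P_noise k m \<in> borel_measurable M" unfolding P_noise_def[abs_def] by (rule W_borel[OF sub])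
  show "integrable M (\<lambda>\<omega>. (P_noise k m \<omega>)\<^sup>2)" unfolding P_noise_def by (rule W_square(2)[OF sub])
  have "expectation (\<lambda>\<omega>. (P_noise k m \<omega>)\<^sup>2) = (\<Sum>x\<in>{1..2 * n} \<times> {0..<min k q}. expectation (\<lambda>\<omega>. (wt m (Inl x) (Z (Inl x) \<omega>))\<^sup>2))"
    unfolding P_noise_def W_square(1)[OF sub] by (subst sum.reindex) auto
  also have "\<dots> \<le> (\<Sum>x\<in>{1..2 * n} \<times> {0..<q}. expectation (\<lambda>\<omega>. (wt m (Inl x) (Z (Inl x) \<omega>))\<^sup>2))"
    by (intro sum_mono2) auto
  also have "\<dots> \<le> 52 * sqrt (real n) + 20 * real n / real q" by (rule P_part_variance[OF assms])
  finally show "expectation (\<lambda>\<omega>. (P_noise k m \<omega>)\<^sup>2) \<le> 52 * sqrt (real n) + 20 * real n / real q" .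
qed

text \<open>The change of index along \<open>Inr\<close> is made by grouping the variables into the
  disjoint blocks \<open>{Inr x}\<close>.\<close>

lemma R_noise_indep: "indep_vars (\<lambda>_. borel) (\<lambda>x \<omega>. b x * R_noise x \<omega>) R_index"
proof -
  have r: "indep_vars (\<lambda>x. PiM {Inr x} (\<lambda>_. borel)) (\<lambda>x \<omega>. restrict (\<lambda>y. Z y \<omega>) {Inr x}) R_index"
    by (rule indep_vars_restrict[OF indep]) (auto simp: I_def R_index_def disjoint_family_on_def)
  have m: "(\<lambda>y. b x * \<xi> (Inr x) (y (Inr x))) \<in> borel_measurable (PiM {Inr x} (\<lambda>_. borel))" if "x \<in> R_index" for x
  proof -
    have x: "\<xi> (Inr x) \<in> borel_measurable borel" using that by (intro \<xi>_borel) (auto simp: I_def R_index_def)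
    have y: "(\<lambda>y. y (Inr x)) \<in> borel_measurable (PiM {Inr x} (\<lambda>_. borel :: real measure))"
      by (rule measurable_component_singleton) simp
    show ?thesis
      by (rule borel_measurable_times[OF borel_measurable_const measurable_compose[OF y x]])
  qed
  have "indep_vars (\<lambda>_. borel) (\<lambda>x \<omega>. b x * \<xi> (Inr x) (restrict (\<lambda>y. Z y \<omega>) {Inr x} (Inr x))) R_index"
    by (rule indep_vars_compose2[OF r, of "\<lambda>x y. b x * \<xi> (Inr x) (y (Inr x))" "\<lambda>_. borel"]) (rule m)
  then show ?thesis by (simp add: R_noise_def)
qed

lemma R_noise_facts:
  assumes "x \<in> R_index"
  shows "integrable M (\<lambda>\<omega>. (R_noise x \<omega>) ^ k)" "expectation (R_noise x) = 0"
    "expectation (\<lambda>\<omega>. (R_noise x \<omega>)\<^sup>2) = vR (fst x) (snd x)"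
    "expectation (\<lambda>\<omega>. (R_noise x \<omega>) ^ 4) \<le> 220 / ((real q)\<^sup>2 * height (fst x) ^ 3)"
proof -
  obtain i j where x: "x = (i, j)" "i \<in> {1..2 * n}" "j \<in> {1..<q}" using assms by (auto simp: R_index_def)
  note r = R_cell[OF x(2,3)]
  show "integrable M (\<lambda>\<omega>. (R_noise x \<omega>) ^ k)" "expectation (\<lambda>\<omega>. (R_noise x \<omega>)\<^sup>2) = vR (fst x) (snd x)"
    "expectation (\<lambda>\<omega>. (R_noise x \<omega>) ^ 4) \<le> 220 / ((real q)\<^sup>2 * height (fst x) ^ 3)"
    using r by (simp_all add: R_noise_def x)
  show "expectation (R_noise x) = 0"
    unfolding R_noise_def[abs_def] using \<xi>_mean[OF r(1)] by (simp add: x)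
qed

text \<open>With coefficients of order \<open>N / sqrt n\<close>, a cell at height \<open>N\<close>
  contributes \<open>N ^ 4 / n\<^sup>2\<close> times \<open>1 / (q\<^sup>2 * N ^ 3)\<close>, at most
  \<open>1 / (n * q\<^sup>2)\<close>; there are fewer than \<open>2 * n * q\<close> cells.
  Lyapunov's condition thus holds because the number of columns tends to infinity.\<close>

lemma R_fourth_moments:
  assumes g: "\<And>i j. (i, j) \<in> R_index \<Longrightarrow> \<bar>g (i, j)\<bar> \<le> U * height i / sqrt (real n)" and "U \<ge> 0"
  shows "(\<Sum>x\<in>R_index. expectation (\<lambda>\<omega>. (g x * R_noise x \<omega>) ^ 4)) \<le> 440 * U ^ 4 / real q"
proof -
  have q1: "real q \<ge> 1" using q_pos by simp
  have n1: "real n \<ge> 1" using n_pos by simp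
  have "(\<Sum>x\<in>R_index. expectation (\<lambda>\<omega>. (g x * R_noise x \<omega>) ^ 4)) \<le> (\<Sum>x\<in>R_index. 220 * U ^ 4 / (real n * (real q)\<^sup>2))"
  proof (rule sum_mono)
    fix x assume x: "x \<in> R_index"
    obtain i j where ij: "x = (i, j)" by (cases x)
    have h: "height i \<ge> 1" "height i \<le> real n" using x ij height_ge_1 by (auto simp: height_def R_index_def)
    have "sqrt (real n) ^ 4 = (real n)\<^sup>2" using real_sqrt_pow2[of "real n"]
      by (metis mult_2 numeral_Bit0 of_nat_0_le_iff power_add power2_eq_square)
    then have g4: "(g x) ^ 4 \<le> (U * height i) ^ 4 / (real n)\<^sup>2"
      using power_mono[OF g[of i j] , of 4] x ij by (simp add: power_even_abs power_divide)
    have "expectation (\<lambda>\<omega>. (g x * R_noise x \<omega>) ^ 4) = (g x) ^ 4 * expectation (\<lambda>\<omega>. (R_noise x \<omega>) ^ 4)"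
      by (simp add: power_mult_distrib)
    also have "\<dots> \<le> ((U * height i) ^ 4 / (real n)\<^sup>2) * (220 / ((real q)\<^sup>2 * height i ^ 3))"
      using g4 R_noise_facts(4)[OF x] ij \<open>U \<ge> 0\<close> h
      by (intro mult_mono integral_nonneg_AE divide_nonneg_nonneg) (auto simp: zero_le_even_power)
    also have "\<dots> = 220 * U ^ 4 * height i / ((real n)\<^sup>2 * (real q)\<^sup>2)"
      using h by (simp add: power_mult_distrib power4_eq_xxxx power3_eq_cube field_simps)
    also have "\<dots> \<le> 220 * U ^ 4 * real n / ((real n)\<^sup>2 * (real q)\<^sup>2)"
      using h \<open>U \<ge> 0\<close> by (intro divide_right_mono mult_left_mono) auto
    also have "\<dots> = 220 * U ^ 4 / (real n * (real q)\<^sup>2)" using n1 by (simp add: power2_eq_square)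
    finally show "expectation (\<lambda>\<omega>. (g x * R_noise x \<omega>) ^ 4) \<le> 220 * U ^ 4 / (real n * (real q)\<^sup>2)" .
  qed
  also have "\<dots> = real (card R_index) * (220 * U ^ 4 / (real n * (real q)\<^sup>2))" by simp
  also have "\<dots> \<le> real (2 * n * q) * (220 * U ^ 4 / (real n * (real q)\<^sup>2))"
  proof (intro mult_right_mono)
    have "card R_index \<le> 2 * n * q" by (simp add: R_index_def card_cartesian_product)
    then show "real (card R_index) \<le> real (2 * n * q)" by (simp only: of_nat_le_iff)
  qed (use \<open>U \<ge> 0\<close> in auto)
  also have "\<dots> = 440 * U ^ 4 / real q" using q1 n1 by (simp add: power2_eq_square field_simps)
  finally show ?thesis .
qed

lemma vR_nonneg: "i \<in> {1..2 * n} \<Longrightarrow> j \<in> {1..<q} \<Longrightarrow> 0 \<le> vR i j"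
  using R_cell(2)[of i j] by (metis integral_nonneg_AE AE_I2 zero_le_power2)

text \<open>Freezing the first beta parameter at its extreme values \<open>par i\<close> and
  \<open>par i - q / 2\<close> leaves the sum of the \<open>j / 2\<close>, that is
  \<open>k * (k - 1) / 4\<close>: the origin of s^2 in the kernel. The additional \<open>k\<close>
  in the upper bound is the error of the trigamma bound, 1 per column.\<close>

lemma vR_sum_bounds:
  assumes i: "i \<in> {1..2 * n}" and k: "k \<le> q"
  shows "real k * (real k - 1) / 4 / (par i)\<^sup>2 \<le> (\<Sum>j=1..<k. vR i j)"
    "(\<Sum>j=1..<k. vR i j) \<le> (real k * (real k - 1) / 4 + real k) / (par i - real q / 2)\<^sup>2"
proof -
  have h: "height i \<ge> 1" by (rule height_ge_1)
  have gauss: "(\<Sum>j=1..<k. real j / 2) = real k * (real k - 1) / 4"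
    by (induction k) (auto simp: algebra_simps)
  have q1: "real q \<ge> 1" using q_pos by simp
  define a where "a = par i"
  define b where "b = a - real q / 2"
  have b: "b > 0"
    using beta_parameter_bounds(2)[OF q1 h _ order_refl par_ge[OF i]] by (simp add: a_def b_def)
  have a: "a \<ge> b" "a > 0" using b by (auto simp: b_def)
  have each: "real j / 2 / a\<^sup>2 \<le> vR i j" "vR i j \<le> (real j / 2 + 1) / b\<^sup>2" if j: "j \<in> {1..<k}" for j
  proof -
    define \<alpha> where "\<alpha> = a - real j / 2"
    have \<alpha>: "b \<le> \<alpha>" "\<alpha> \<le> a" "\<alpha> > 0" using j k b by (auto simp: \<alpha>_def b_def)
    have d: "1 / \<alpha> - 1 / a = real j / 2 / (\<alpha> * a)" using \<alpha> a by (simp add: \<alpha>_def field_simps)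
    have v: "vR i j = Polygamma 1 \<alpha> - Polygamma 1 a" by (simp add: vR_def \<alpha>_def a_def)
    have "real j / 2 / a\<^sup>2 \<le> real j / 2 / (\<alpha> * a)"
      unfolding power2_eq_square using \<alpha> a by (intro divide_left_mono mult_right_mono) auto
    then show "real j / 2 / a\<^sup>2 \<le> vR i j"
      unfolding v d[symmetric] using Polygamma_1_diff_bounds(1)[OF \<alpha>(3,2)] by (rule order_trans)
    have "vR i j \<le> real j / 2 / (\<alpha> * a) + 1 / \<alpha>\<^sup>2"
      unfolding v d[symmetric] by (rule Polygamma_1_diff_bounds(2)[OF \<alpha>(3,2)])
    also have "\<dots> \<le> real j / 2 / b\<^sup>2 + 1 / b\<^sup>2"
      using \<alpha> a b unfolding power2_eq_square by (intro add_mono divide_left_mono mult_mono mult_pos_pos) auto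
    finally show "vR i j \<le> (real j / 2 + 1) / b\<^sup>2" by (simp add: add_divide_distrib)
  qed
  have "real k * (real k - 1) / 4 / a\<^sup>2 = (\<Sum>j=1..<k. real j / 2 / a\<^sup>2)"
    by (simp only: gauss[symmetric] sum_divide_distrib)
  also have "\<dots> \<le> (\<Sum>j=1..<k. vR i j)" by (intro sum_mono each)
  finally show "real k * (real k - 1) / 4 / (par i)\<^sup>2 \<le> (\<Sum>j=1..<k. vR i j)" by (simp add: a_def)
  have "(\<Sum>j=1..<k. vR i j) \<le> (\<Sum>j=1..<k. (real j / 2 + 1) / b\<^sup>2)" by (intro sum_mono each)
  also have "\<dots> = (\<Sum>j=1..<k. real j / 2 + 1) / b\<^sup>2" by (rule sum_divide_distrib[symmetric])
  also have "\<dots> = (real k * (real k - 1) / 4 + real (k - 1)) / b\<^sup>2"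
    unfolding sum.distrib gauss by simp
  also have "\<dots> \<le> (real k * (real k - 1) / 4 + real k) / b\<^sup>2"
    by (intro divide_right_mono add_left_mono) auto
  finally show "(\<Sum>j=1..<k. vR i j) \<le> (real k * (real k - 1) / 4 + real k) / (par i - real q / 2)\<^sup>2"
    by (simp add: a_def b_def)
qed

end

section \<open>Tightness\<close>

text \<open>Rounds down to a lattice. A coordinate equal to 1 is left in place, so there are
  \<open>(K + 1) * (L + 1)\<close> grid points in the square.\<close>

definition grid :: "nat \<Rightarrow> nat \<Rightarrow> real \<times> real \<Rightarrow> real \<times> real" where
  "grid K L z = (real (nat \<lfloor>real K * fst z\<rfloor>) / real K, real (nat \<lfloor>real L * snd z\<rfloor>) / real L)"

lemma nat_floor_div_bounds:
  assumes "K \<ge> 1" "s \<ge> 0"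
  shows "real (nat \<lfloor>real K * s\<rfloor>) / real K \<le> s" "s < (real (nat \<lfloor>real K * s\<rfloor>) + 1) / real K"
proof -
  have "real K * s \<ge> 0" "real K > 0" using assms by auto
  then have "real (nat \<lfloor>real K * s\<rfloor>) \<le> real K * s" "real K * s < real (nat \<lfloor>real K * s\<rfloor>) + 1" by linarith+
  then show "real (nat \<lfloor>real K * s\<rfloor>) / real K \<le> s" "s < (real (nat \<lfloor>real K * s\<rfloor>) + 1) / real K"
    using \<open>real K > 0\<close> by (simp_all add: pos_divide_le_eq pos_less_divide_eq mult.commute)
qed

lemma grid_in_square:
  assumes "K \<ge> 1" "L \<ge> 1" "z \<in> unit_square"
  shows "grid K L z \<in> unit_square"
proof -
  obtain s t where z: "z = (s, t)" "s \<in> {0..1}" "t \<in> {0..1}" using assms by auto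
  show ?thesis
    using nat_floor_div_bounds(1)[OF assms(1), of s] nat_floor_div_bounds(1)[OF assms(2), of t] z by (simp add: grid_def)
qed

lemma grid_image: "K \<ge> 1 \<Longrightarrow> L \<ge> 1 \<Longrightarrow> grid K L ` unit_square \<subseteq> unit_square"
  by (intro image_subsetI grid_in_square)

lemma grid_finite: "finite (grid K L ` unit_square)"
proof (rule finite_subset)
  show "grid K L ` unit_square \<subseteq> (\<lambda>(a, b). (real a / real K, real b / real L)) ` ({..K} \<times> {..L})"
  proof
    fix y assume "y \<in> grid K L ` unit_square"
    then obtain s t where z: "y = grid K L (s, t)" "s \<in> {0..1}" "t \<in> {0..1}" by auto
    show "y \<in> (\<lambda>(a, b). (real a / real K, real b / real L)) ` ({..K} \<times> {..L})"
      using z floor_le_nat[OF z(2), of K] floor_le_nat[OF z(3), of L]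
      by (intro image_eqI[of _ _ "(nat \<lfloor>real K * s\<rfloor>, nat \<lfloor>real L * t\<rfloor>)"]) (auto simp: grid_def)
  qed
qed simp

lemma dist_grid_le:
  assumes "K \<ge> 1" "L \<ge> 1" "z \<in> unit_square"
  shows "dist (grid K L z) z \<le> 1 / real K + 1 / real L"
proof -
  obtain s t where z: "z = (s, t)" "s \<in> {0..1}" "t \<in> {0..1}" using assms by auto
  have "\<bar>real (nat \<lfloor>real K * s\<rfloor>) / real K - s\<bar> \<le> 1 / real K"
    using nat_floor_div_bounds[OF assms(1), of s] z by (simp add: abs_le_iff add_divide_distrib)
  moreover have "\<bar>real (nat \<lfloor>real L * t\<rfloor>) / real L - t\<bar> \<le> 1 / real L"
    using nat_floor_div_bounds[OF assms(2), of t] z by (simp add: abs_le_iff add_divide_distrib)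
  moreover have "dist (grid K L z) z \<le> \<bar>real (nat \<lfloor>real K * s\<rfloor>) / real K - s\<bar> + \<bar>real (nat \<lfloor>real L * t\<rfloor>) / real L - t\<bar>"
    unfolding grid_def z dist_Pair_Pair dist_real_def fst_conv snd_conv
    by (rule order_trans[OF sqrt_sum_squares_le_sum_abs]) simp
  ultimately show ?thesis by linarith
qed

lemma continuous_grid_approx:
  fixes f :: "real \<times> real \<Rightarrow> real"
  assumes "continuous_on unit_square f" "e > 0"
  shows "\<exists>m\<ge>1. \<forall>K\<ge>m. \<forall>L\<ge>m. \<forall>z\<in>unit_square. \<bar>f (grid K L z) - f z\<bar> \<le> e"
proof -
  have "uniformly_continuous_on unit_square f"
    using assms(1) by (intro compact_uniformly_continuous compact_Times) auto
  then obtain d where d: "d > 0" "\<And>x y. x \<in> unit_square \<Longrightarrow> y \<in> unit_square \<Longrightarrow> dist y x < d \<Longrightarrow> dist (f y) (f x) < e"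
    unfolding uniformly_continuous_on_def using assms(2) by metis
  obtain m :: nat where m: "real m > 2 / d" using reals_Archimedean2 by blast
  have m0: "real m > 0" using m d by (meson divide_pos_pos less_trans zero_less_numeral)
  show ?thesis
  proof (intro exI[of _ m] conjI allI impI ballI)
    show "m \<ge> 1" using m0 by simp
    fix K L z assume KL: "m \<le> K" "m \<le> L" and z: "z \<in> unit_square"
    have K1: "K \<ge> 1" "L \<ge> 1" using KL m0 by auto
    have "1 / real K \<le> 1 / real m" "1 / real L \<le> 1 / real m" using KL m0 by (auto intro!: divide_left_mono)
    moreover have "2 / real m < d" using m m0 d by (simp add: divide_less_eq mult.commute)
    ultimately have "1 / real K + 1 / real L < d" by simp
    then have "dist (f (grid K L z)) (f z) < e"
      using dist_grid_le[OF K1 z] by (intro d z grid_in_square K1) auto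
    then show "\<bar>f (grid K L z) - f z\<bar> \<le> e" by (simp add: dist_real_def)
  qed
qed

text \<open>Uniform continuity on the compact square makes the path a uniform limit of its
  discretisations, which are measurable.\<close>

lemma continuous_process_measurable:
  assumes G: "\<And>z. z \<in> unit_square \<Longrightarrow> (\<lambda>\<omega>. G \<omega> z) \<in> borel_measurable N"
    and cont: "\<And>\<omega>. \<omega> \<in> space N \<Longrightarrow> continuous_on unit_square (G \<omega>)"
  shows "(\<lambda>\<omega>. restrict (G \<omega>) unit_square) \<in> measurable N (metric_borel (l_infinity unit_square))"
proof (rule measurable_metric_limit)
  define F where "F j \<omega> = restrict (\<lambda>z. G \<omega> (grid (Suc j) (Suc j) z)) unit_square" for j \<omega>
  have ne: "unit_square \<noteq> {}" by auto
  show F: "F j \<in> measurable N (metric_borel (l_infinity unit_square))" for j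
    unfolding F_def[abs_def] by (intro measurable_discretised grid_finite grid_image G ne) simp_all
  show in_space: "restrict (G \<omega>) unit_square \<in> mspace (l_infinity unit_square)" if "\<omega> \<in> space N" for \<omega>
  proof -
    have "compact (G \<omega> ` unit_square)"
      using cont[OF that] by (intro compact_continuous_image compact_Times) auto
    then show ?thesis by (auto simp: mspace_l_infinity image_restrict_eq intro: compact_imp_bounded)
  qed
  show "(\<lambda>j. mdist (l_infinity unit_square) (F j \<omega>) (restrict (G \<omega>) unit_square)) \<longlonglongrightarrow> 0" if w: "\<omega> \<in> space N" for \<omega>
  proof (rule LIMSEQ_I)
    fix r :: real assume "r > 0"
    then obtain m where m: "m \<ge> 1" "\<And>K L z. K \<ge> m \<Longrightarrow> L \<ge> m \<Longrightarrow> z \<in> unit_square \<Longrightarrow> \<bar>G \<omega> (grid K L z) - G \<omega> z\<bar> \<le> r / 2"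
      using continuous_grid_approx[OF cont[OF w], of "r / 2"] by auto
    have "mdist (l_infinity unit_square) (F j \<omega>) (restrict (G \<omega>) unit_square) \<le> r / 2" if "j \<ge> m" for j
    proof (subst mdist_l_infinity_le[OF _ in_space[OF w] ne])
      show "F j \<omega> \<in> mspace (l_infinity unit_square)" using measurable_space[OF F w] by simp
      show "\<forall>t\<in>unit_square. \<bar>F j \<omega> t - restrict (G \<omega>) unit_square t\<bar> \<le> r / 2"
        using m(2)[of "Suc j" "Suc j"] that by (simp add: F_def)
    qed
    moreover have "0 \<le> mdist (l_infinity unit_square) (F j \<omega>) (restrict (G \<omega>) unit_square)" for j by simp
    ultimately show "\<exists>no. \<forall>n\<ge>no. norm (mdist (l_infinity unit_square) (F n \<omega>) (restrict (G \<omega>) unit_square) - 0) < r"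
      using \<open>r > 0\<close> by (intro exI[of _ m]) (smt (verit) real_norm_def field_sum_of_halves)
  qed
qed

text \<open>An argument in the manner of Egorov. To have measurable events, the event
  \<open>B m\<close> compares only grid points with each other, finitely many pairs for each triple
  of grids of fineness beyond \<open>m\<close>. These events increase to the whole space because
  every path is uniformly continuous.\<close>

lemma (in prob_space) continuous_process_grid_approx:
  assumes G: "\<And>z. z \<in> unit_square \<Longrightarrow> (\<lambda>\<omega>. G \<omega> z) \<in> borel_measurable M"
    and cont: "\<And>\<omega>. \<omega> \<in> space M \<Longrightarrow> continuous_on unit_square (G \<omega>)" and "e > 0"
  shows "\<exists>m\<ge>1. \<forall>K\<ge>m. \<forall>L\<ge>m. \<exists>A\<in>events. prob A \<ge> 1 - e \<and>
    (\<forall>\<omega>\<in>A. \<forall>z\<in>unit_square. \<bar>G \<omega> z - G \<omega> (grid K L z)\<bar> \<le> e)"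
proof -
  define V where "V K L j = (\<lambda>z. (grid K L z, grid j j z)) ` unit_square" for K L j
  have V: "finite (V K L j)" for K L j
    by (rule finite_subset[of _ "grid K L ` unit_square \<times> grid j j ` unit_square"]) (auto simp: V_def grid_finite)
  define B where "B m = {\<omega>\<in>space M. \<forall>K L j. \<forall>v\<in>V (Suc m + K) (Suc m + L) (Suc m + j). \<bar>G \<omega> (fst v) - G \<omega> (snd v)\<bar> \<le> e}" for m
  have B: "B m \<in> events" for m
    unfolding B_def
  proof (intro sets.sets_Collect_countable_All sets.sets_Collect_finite_All V)
    fix K L j v assume "v \<in> V (Suc m + K) (Suc m + L) (Suc m + j)"
    then have "fst v \<in> unit_square" "snd v \<in> unit_square"
      using grid_in_square[of "Suc m + K" "Suc m + L"] grid_in_square[of "Suc m + j" "Suc m + j"] unfolding V_def by force+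
    note G[OF this(1), measurable] G[OF this(2), measurable]
    show "{\<omega>\<in>space M. \<bar>G \<omega> (fst v) - G \<omega> (snd v)\<bar> \<le> e} \<in> events" by measurable
  qed
  have "incseq B"
  proof (rule incseq_SucI, rule subsetI)
    fix m \<omega> assume w: "\<omega> \<in> B m"
    have "\<bar>G \<omega> (fst v) - G \<omega> (snd v)\<bar> \<le> e" if "v \<in> V (Suc (Suc m) + K) (Suc (Suc m) + L) (Suc (Suc m) + j)" for K L j v
      using w that unfolding B_def mem_Collect_eq
      by (elim conjE allE[of _ "Suc K"] allE[of _ "Suc L"] allE[of _ "Suc j"]) auto
    then show "\<omega> \<in> B (Suc m)" using w by (auto simp: B_def)
  qed
  moreover have "(\<Union>m. B m) = space M"
  proof (intro equalityI subsetI)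
    fix \<omega> assume w: "\<omega> \<in> space M"
    obtain m where m: "m \<ge> 1" "\<And>K L z. K \<ge> m \<Longrightarrow> L \<ge> m \<Longrightarrow> z \<in> unit_square \<Longrightarrow> \<bar>G \<omega> (grid K L z) - G \<omega> z\<bar> \<le> e / 2"
      using continuous_grid_approx[OF cont[OF w], of "e / 2"] \<open>e > 0\<close> by auto
    have "\<bar>G \<omega> (grid K L z) - G \<omega> (grid j j z)\<bar> \<le> e" if "K \<ge> m" "L \<ge> m" "j \<ge> m" "z \<in> unit_square" for K L j z
      using m(2)[OF that(1,2,4)] m(2)[OF that(3,3,4)] by linarith
    then have "\<omega> \<in> B m" using w by (auto simp: B_def V_def)
    then show "\<omega> \<in> (\<Union>m. B m)" by blast
  qed (auto simp: B_def)
  ultimately have "(\<lambda>m. prob (B m)) \<longlonglongrightarrow> 1"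
    using finite_Lim_measure_incseq[of B] B by (auto simp: prob_space)
  then have "\<forall>\<^sub>F m in sequentially. prob (B m) > 1 - e"
    using \<open>e > 0\<close> by (intro order_tendstoD(1)) auto
  then obtain m where m: "prob (B m) > 1 - e" by (auto simp: eventually_sequentially)
  show ?thesis
  proof (intro exI[of _ "Suc m"] conjI allI impI bexI[of _ "B m"] B ballI)
    fix K L \<omega> z assume KL: "Suc m \<le> K" "Suc m \<le> L" and w: "\<omega> \<in> B m" and z: "z \<in> unit_square"
    have ws: "\<omega> \<in> space M" using w by (simp add: B_def)
    have le: "\<bar>G \<omega> (grid K L z) - G \<omega> (grid (Suc m + j) (Suc m + j) z)\<bar> \<le> e" for j
    proof -
      have "(grid K L z, grid (Suc m + j) (Suc m + j) z) \<in> V (Suc m + (K - Suc m)) (Suc m + (L - Suc m)) (Suc m + j)"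
        using KL z by (auto simp: V_def)
      then show ?thesis using w unfolding B_def by force
    qed
    \<comment> \<open>The point \<open>z\<close> itself is reached by continuity, along a third and
      ever finer grid.\<close>
    show "\<bar>G \<omega> z - G \<omega> (grid K L z)\<bar> \<le> e"
    proof (rule field_le_epsilon)
      fix r :: real assume "r > 0"
      then obtain l where l: "\<And>K L z. K \<ge> l \<Longrightarrow> L \<ge> l \<Longrightarrow> z \<in> unit_square \<Longrightarrow> \<bar>G \<omega> (grid K L z) - G \<omega> z\<bar> \<le> r"
        using continuous_grid_approx[OF cont[OF ws], of r] by blast
      from l[of "Suc m + l" "Suc m + l" z] z le[of l] show "\<bar>G \<omega> z - G \<omega> (grid K L z)\<bar> \<le> e + r" by linarith
    qed
  qed (use m in auto)
qed

section \<open>Fourth moments of independent sums\<close>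

lemma (in prob_space) integrable_power_le_4:
  fixes X :: "'a \<Rightarrow> real"
  assumes [measurable]: "X \<in> borel_measurable M" and "integrable M (\<lambda>\<omega>. X \<omega> ^ 4)" "k \<le> 4"
  shows "integrable M (\<lambda>\<omega>. X \<omega> ^ k)"
proof (rule Bochner_Integration.integrable_bound)
  show "integrable M (\<lambda>\<omega>. 1 + X \<omega> ^ 4)" using assms by simp
  have "\<bar>x\<bar> ^ k \<le> 1 + x ^ 4" for x :: real
  proof (cases "\<bar>x\<bar> \<le> 1")
    case True
    then have "\<bar>x\<bar> ^ k \<le> 1" by (simp add: power_le_one)
    then show ?thesis by (simp add: add_increasing2)
  next
    case False
    then have "\<bar>x\<bar> ^ k \<le> \<bar>x\<bar> ^ 4" using \<open>k \<le> 4\<close> by (intro power_increasing) auto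
    then show ?thesis by (simp add: power_even_abs)
  qed
  then show "AE \<omega> in M. norm (X \<omega> ^ k) \<le> norm (1 + X \<omega> ^ 4)"
    by (intro AE_I2) (simp add: power_abs)
qed simp

text \<open>In the expansion of the fourth power, terms with a first power vanish by independence
  and centring, and the mixed term \<open>6 * v * V\<close> is absorbed by
  \<open>3 * (v + V)\<^sup>2\<close>. The claims are proved together since the induction step uses
  all of them.\<close>

lemma (in prob_space) indep_sum_fourth_moment:
  fixes X :: "'i \<Rightarrow> 'a \<Rightarrow> real"
  assumes "finite A" "indep_vars (\<lambda>_. borel) X A"
    and "\<And>x. x \<in> A \<Longrightarrow> integrable M (\<lambda>\<omega>. X x \<omega> ^ 4)" "\<And>x. x \<in> A \<Longrightarrow> expectation (X x) = 0"
  shows "integrable M (\<lambda>\<omega>. (\<Sum>x\<in>A. X x \<omega>) ^ 4) \<and> expectation (\<lambda>\<omega>. \<Sum>x\<in>A. X x \<omega>) = 0 \<and>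
    expectation (\<lambda>\<omega>. (\<Sum>x\<in>A. X x \<omega>)\<^sup>2) = (\<Sum>x\<in>A. expectation (\<lambda>\<omega>. (X x \<omega>)\<^sup>2)) \<and>
    expectation (\<lambda>\<omega>. (\<Sum>x\<in>A. X x \<omega>) ^ 4) \<le> (\<Sum>x\<in>A. expectation (\<lambda>\<omega>. X x \<omega> ^ 4)) + 3 * (\<Sum>x\<in>A. expectation (\<lambda>\<omega>. (X x \<omega>)\<^sup>2))\<^sup>2"
  using assms
proof (induction A rule: finite_induct)
  case empty
  then show ?case by simp
next
  case (insert i A)
  define S where "S \<omega> = (\<Sum>x\<in>A. X x \<omega>)" for \<omega>
  define V where "V = (\<Sum>x\<in>A. expectation (\<lambda>\<omega>. (X x \<omega>)\<^sup>2))"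
  have IH: "integrable M (\<lambda>\<omega>. S \<omega> ^ 4)" "expectation S = 0" "expectation (\<lambda>\<omega>. (S \<omega>)\<^sup>2) = V"
    "expectation (\<lambda>\<omega>. S \<omega> ^ 4) \<le> (\<Sum>x\<in>A. expectation (\<lambda>\<omega>. X x \<omega> ^ 4)) + 3 * V\<^sup>2"
    using insert.IH[OF indep_vars_subset[OF insert.prems(1)]] insert.prems by (auto simp: S_def[abs_def] V_def)
  have meas: "X x \<in> borel_measurable M" if "x \<in> insert i A" for x
    using insert.prems(1) that unfolding indep_vars_def by auto
  have mS: "S \<in> borel_measurable M" unfolding S_def[abs_def] using meas by (intro borel_measurable_sum) auto
  have mX: "X i \<in> borel_measurable M" using meas by simp
  have ind: "indep_var borel (X i) borel S"
    unfolding S_def[abs_def] by (rule indep_vars_sum[OF insert.hyps(1,2) insert.prems(1)])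
  have intX: "integrable M (\<lambda>\<omega>. X i \<omega> ^ k)" if "k \<le> 4" for k
    by (rule integrable_power_le_4[OF mX _ that]) (rule insert.prems(2), simp)
  have intS: "integrable M (\<lambda>\<omega>. S \<omega> ^ k)" if "k \<le> 4" for k
    by (rule integrable_power_le_4[OF mS IH(1) that])
  have prod: "integrable M (\<lambda>\<omega>. X i \<omega> ^ k * S \<omega> ^ l)"
    "expectation (\<lambda>\<omega>. X i \<omega> ^ k * S \<omega> ^ l) = expectation (\<lambda>\<omega>. X i \<omega> ^ k) * expectation (\<lambda>\<omega>. S \<omega> ^ l)"
    if "k \<le> 4" "l \<le> 4" for k l
  proof -
    have "indep_var borel ((\<lambda>x. x ^ k) \<circ> X i) borel ((\<lambda>x. x ^ l) \<circ> S)"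
      by (rule indep_var_compose[OF ind]) auto
    then have "indep_var borel (\<lambda>\<omega>. X i \<omega> ^ k) borel (\<lambda>\<omega>. S \<omega> ^ l)" by (simp add: o_def)
    from indep_var_integrable[OF this intX[OF that(1)] intS[OF that(2)]]
      indep_var_lebesgue_integral[OF this intX[OF that(1)] intS[OF that(2)]]
    show "integrable M (\<lambda>\<omega>. X i \<omega> ^ k * S \<omega> ^ l)"
      "expectation (\<lambda>\<omega>. X i \<omega> ^ k * S \<omega> ^ l) = expectation (\<lambda>\<omega>. X i \<omega> ^ k) * expectation (\<lambda>\<omega>. S \<omega> ^ l)" by auto
  qed
  have X0: "expectation (X i) = 0" using insert.prems(3) by simp
  have sum: "(\<Sum>x\<in>insert i A. X x \<omega>) = X i \<omega> + S \<omega>" for \<omega> using insert.hyps by (simp add: S_def)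
  \<comment> \<open>The exponents 0 and 1 are written out so that every term has the shape required
    by \<open>prod\<close>.\<close>
  have e4: "(X i \<omega> + S \<omega>) ^ 4 = X i \<omega> ^ 4 * S \<omega> ^ 0 + 4 * (X i \<omega> ^ 3 * S \<omega> ^ 1) + 6 * (X i \<omega> ^ 2 * S \<omega> ^ 2) + 4 * (X i \<omega> ^ 1 * S \<omega> ^ 3) + X i \<omega> ^ 0 * S \<omega> ^ 4" for \<omega>
    by (simp add: power4_eq_xxxx power3_eq_cube power2_eq_square algebra_simps)
  have e2: "(X i \<omega> + S \<omega>) ^ 2 = X i \<omega> ^ 2 * S \<omega> ^ 0 + 2 * (X i \<omega> ^ 1 * S \<omega> ^ 1) + X i \<omega> ^ 0 * S \<omega> ^ 2" for \<omega>
    by (simp add: power2_eq_square algebra_simps)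
  have i4: "integrable M (\<lambda>\<omega>. (X i \<omega> + S \<omega>) ^ 4)"
    unfolding e4 by (intro Bochner_Integration.integrable_add integrable_mult_right prod) auto
  have E4: "expectation (\<lambda>\<omega>. (X i \<omega> + S \<omega>) ^ 4) =
      expectation (\<lambda>\<omega>. X i \<omega> ^ 4) + 6 * (expectation (\<lambda>\<omega>. (X i \<omega>)\<^sup>2) * V) + expectation (\<lambda>\<omega>. S \<omega> ^ 4)"
  proof -
    have "expectation (\<lambda>\<omega>. (X i \<omega> + S \<omega>) ^ 4) =
      expectation (\<lambda>\<omega>. X i \<omega> ^ 4 * S \<omega> ^ 0) + 4 * expectation (\<lambda>\<omega>. X i \<omega> ^ 3 * S \<omega> ^ 1) + 6 * expectation (\<lambda>\<omega>. X i \<omega> ^ 2 * S \<omega> ^ 2)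
      + 4 * expectation (\<lambda>\<omega>. X i \<omega> ^ 1 * S \<omega> ^ 3) + expectation (\<lambda>\<omega>. X i \<omega> ^ 0 * S \<omega> ^ 4)"
      unfolding e4 by (simp only: Bochner_Integration.integral_add Bochner_Integration.integrable_add integrable_mult_right prod(1) integral_mult_right_zero order_refl numeral_le_iff one_le_numeral zero_le semiring_norm)
    then show ?thesis
      using IH(2,3) X0 prod(2)[of 3 1] prod(2)[of 1 3] prod(2)[of 2 2] by simp
  qed
  have E2: "expectation (\<lambda>\<omega>. (X i \<omega> + S \<omega>) ^ 2) = expectation (\<lambda>\<omega>. (X i \<omega>)\<^sup>2) + V"
  proof -
    have "expectation (\<lambda>\<omega>. (X i \<omega> + S \<omega>) ^ 2) =
      expectation (\<lambda>\<omega>. X i \<omega> ^ 2 * S \<omega> ^ 0) + 2 * expectation (\<lambda>\<omega>. X i \<omega> ^ 1 * S \<omega> ^ 1) + expectation (\<lambda>\<omega>. X i \<omega> ^ 0 * S \<omega> ^ 2)"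
      unfolding e2 by (simp only: Bochner_Integration.integral_add Bochner_Integration.integrable_add integrable_mult_right prod(1) integral_mult_right_zero order_refl numeral_le_iff one_le_numeral zero_le semiring_norm)
    then show ?thesis using IH(2,3) X0 prod(2)[of 1 1] by simp
  qed
  have E1: "expectation (\<lambda>\<omega>. X i \<omega> + S \<omega>) = 0"
    using intX[of 1] intS[of 1] X0 IH(2) by simp
  define v where "v = expectation (\<lambda>\<omega>. (X i \<omega>)\<^sup>2)"
  have "3 * V\<^sup>2 + 6 * (v * V) \<le> 3 * (v + V)\<^sup>2" by (simp add: power2_eq_square algebra_simps)
  then have "expectation (\<lambda>\<omega>. (X i \<omega> + S \<omega>) ^ 4) \<le> expectation (\<lambda>\<omega>. X i \<omega> ^ 4) + (\<Sum>x\<in>A. expectation (\<lambda>\<omega>. X x \<omega> ^ 4)) + 3 * (v + V)\<^sup>2"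
    unfolding E4 v_def[symmetric] using IH(4) by linarith
  then show ?case
    unfolding sum using i4 E1 E2 insert.hyps by (simp add: V_def v_def)
qed


section \<open>Oscillation of the field over the cells of a grid\<close>

context beta_array
begin

lemma W_block:
  assumes "k \<le> l"
  shows "W {x\<in>I. k \<le> col x \<and> col x < l} m \<omega> = WW l m \<omega> - WW k m \<omega>"
proof -
  have "{x\<in>I. col x < l} = {x\<in>I. col x < k} \<union> {x\<in>I. k \<le> col x \<and> col x < l}" using assms by auto
  then have "WW l m \<omega> = WW k m \<omega> + W {x\<in>I. k \<le> col x \<and> col x < l} m \<omega>"
    unfolding WW_def W_def by (simp only:) (rule sum.union_disjoint, use finite_I in auto)
  then show ?thesis by simp
qed

text \<open>\<open>X\<close> collects the variables \<open>r\<close>, whose fourth moments are under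
  control; \<open>Y\<close> collects the variables \<open>p\<close>, for which the second moment is
  already negligible. The value of \<open>v\<close> comes from \<open>2 * n * (l - k)\<close> cells
  with scaled variance at most \<open>5 / (q * n)\<close> each.\<close>

lemma block_decomposition:
  assumes k: "k \<le> l" "l \<le> q" and m: "m \<le> n"
  defines "v \<equiv> 10 * real (l - k) / real q" and "\<epsilon> \<equiv> 52 / sqrt (real n) + 20 / real q"
  obtains X Y where "\<And>\<omega>. WW l m \<omega> - WW k m \<omega> = sqrt (real n) * (X \<omega> + Y \<omega>)"
    "X \<in> borel_measurable M" "Y \<in> borel_measurable M"
    "integrable M (\<lambda>\<omega>. X \<omega> ^ 4)" "integrable M (\<lambda>\<omega>. (X \<omega>)\<^sup>2)" "integrable M (\<lambda>\<omega>. (Y \<omega>)\<^sup>2)"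
    "expectation (\<lambda>\<omega>. X \<omega> ^ 4) \<le> 440 / real q + 3 * v\<^sup>2" "expectation (\<lambda>\<omega>. (X \<omega>)\<^sup>2) \<le> v"
    "expectation (\<lambda>\<omega>. (Y \<omega>)\<^sup>2) \<le> 4 * \<epsilon>"
proof -
  have n0: "real n > 0" and q0: "real q > 0" using n_pos q_pos by auto
  define g where "g x = (if k \<le> snd x \<and> snd x < l then coef m (fst x) else 0) / sqrt (real n)" for x :: "nat \<times> nat"
  define X where "X \<omega> = (\<Sum>x\<in>R_index. g x * R_noise x \<omega>)" for \<omega>
  define Y where "Y \<omega> = (P_noise l m \<omega> - P_noise k m \<omega>) / sqrt (real n)" for \<omega>
  have fin: "finite R_index" by (simp add: R_index_def)
  have "(\<Sum>(i, j)\<in>R_index. (if j < l then coef m i else 0) * R_noise (i, j) \<omega>) - (\<Sum>(i, j)\<in>R_index. (if j < k then coef m i else 0) * R_noise (i, j) \<omega>)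
      = sqrt (real n) * X \<omega>" for \<omega>
    unfolding X_def sum_distrib_left sum_subtractf[symmetric]
    by (intro sum.cong refl) (use k n0 in \<open>auto simp: g_def\<close>)
  moreover have "P_noise l m \<omega> - P_noise k m \<omega> = sqrt (real n) * Y \<omega>" for \<omega> using n0 by (simp add: Y_def)
  ultimately have 1: "WW l m \<omega> - WW k m \<omega> = sqrt (real n) * (X \<omega> + Y \<omega>)" for \<omega>
    unfolding WW_split distrib_left by (simp add: algebra_simps)
  have gle: "\<bar>g (i, j)\<bar> \<le> 1 * height i / sqrt (real n)" for i j
    using coef_bounds[OF m, of i] height_ge_1[of i] by (auto simp: g_def divide_right_mono)
  have mR: "R_noise x \<in> borel_measurable M" if "x \<in> R_index" for x
    using R_noise_indep[of "\<lambda>_. 1"] that unfolding indep_vars_def by auto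
  have 2: "X \<in> borel_measurable M" unfolding X_def[abs_def] using mR by (intro borel_measurable_sum borel_measurable_times) auto
  note P = P_noise_facts[OF m]
  have 3: "Y \<in> borel_measurable M" unfolding Y_def[abs_def]
    by (intro borel_measurable_divide borel_measurable_diff P) simp
  have moments: "integrable M (\<lambda>\<omega>. X \<omega> ^ 4) \<and> expectation X = 0 \<and>
    expectation (\<lambda>\<omega>. (X \<omega>)\<^sup>2) = (\<Sum>x\<in>R_index. expectation (\<lambda>\<omega>. (g x * R_noise x \<omega>)\<^sup>2)) \<and>
    expectation (\<lambda>\<omega>. X \<omega> ^ 4) \<le> (\<Sum>x\<in>R_index. expectation (\<lambda>\<omega>. (g x * R_noise x \<omega>) ^ 4)) + 3 * (\<Sum>x\<in>R_index. expectation (\<lambda>\<omega>. (g x * R_noise x \<omega>)\<^sup>2))\<^sup>2"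
    unfolding X_def[abs_def]
    by (rule indep_sum_fourth_moment[OF fin R_noise_indep]) (simp_all add: power_mult_distrib R_noise_facts)
  have i2: "integrable M (\<lambda>\<omega>. (X \<omega>)\<^sup>2)"
    by (rule integrable_power_le_4[OF 2]) (use moments in auto)
  have cell: "(g x)\<^sup>2 * vR (fst x) (snd x) \<le> (if k \<le> snd x \<and> snd x < l then 5 / (real q * real n) else 0)" if x: "x \<in> R_index" for x
  proof (cases "k \<le> snd x \<and> snd x < l")
    case True
    obtain i j where ij: "x = (i, j)" "i \<in> {1..2 * n}" "j \<in> {1..<q}" using x by (auto simp: R_index_def)
    have h: "height i \<ge> 1" by (rule height_ge_1)
    have "(g x)\<^sup>2 \<le> (height i / sqrt (real n))\<^sup>2"
      using gle[of i j] unfolding ij by (intro abs_le_square_iff[THEN iffD1]) (use h in auto)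
    then have "(g x)\<^sup>2 \<le> (height i)\<^sup>2 / real n" by (simp add: power_divide)
    then have "(g x)\<^sup>2 * vR i j \<le> ((height i)\<^sup>2 / real n) * (5 / (real q * (height i)\<^sup>2))"
      using R_cell(5)[OF ij(2,3)] vR_nonneg[OF ij(2,3)] by (intro mult_mono) auto
    also have "\<dots> = 5 / (real q * real n)" using h by simp
    finally show ?thesis using True ij by simp
  qed (auto simp: g_def)
  have var: "(\<Sum>x\<in>R_index. expectation (\<lambda>\<omega>. (g x * R_noise x \<omega>)\<^sup>2)) \<le> v"
  proof -
    have "(\<Sum>x\<in>R_index. expectation (\<lambda>\<omega>. (g x * R_noise x \<omega>)\<^sup>2)) = (\<Sum>x\<in>R_index. (g x)\<^sup>2 * vR (fst x) (snd x))"
      by (intro sum.cong refl) (simp add: power_mult_distrib R_noise_facts(3))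
    also have "\<dots> \<le> (\<Sum>x\<in>R_index. if k \<le> snd x \<and> snd x < l then 5 / (real q * real n) else 0)"
      by (intro sum_mono cell)
    also have "\<dots> = (\<Sum>x\<in>{x\<in>R_index. k \<le> snd x \<and> snd x < l}. 5 / (real q * real n))"
      by (rule sum.inter_filter[OF fin, symmetric])
    also have "\<dots> \<le> (\<Sum>x\<in>{1..2 * n} \<times> {k..<l}. 5 / (real q * real n))"
      by (intro sum_mono2) (auto simp: R_index_def)
    also have "\<dots> = real (2 * n * (l - k)) * (5 / (real q * real n))"
      by (simp only: sum_constant card_cartesian_product card_atLeastAtMost card_atLeastLessThan) simp
    also have "\<dots> = v" using n0 q0 by (simp add: v_def)
    finally show ?thesis .
  qed
  have var0: "0 \<le> (\<Sum>x\<in>R_index. expectation (\<lambda>\<omega>. (g x * R_noise x \<omega>)\<^sup>2))"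
    by (intro sum_nonneg integral_nonneg_AE) auto
  have 4: "expectation (\<lambda>\<omega>. X \<omega> ^ 4) \<le> 440 / real q + 3 * v\<^sup>2"
  proof -
    have "(\<Sum>x\<in>R_index. expectation (\<lambda>\<omega>. (g x * R_noise x \<omega>) ^ 4)) \<le> 440 * 1 ^ 4 / real q"
      by (rule R_fourth_moments) (use gle in auto)
    moreover have "(\<Sum>x\<in>R_index. expectation (\<lambda>\<omega>. (g x * R_noise x \<omega>)\<^sup>2))\<^sup>2 \<le> v\<^sup>2"
      by (rule power_mono[OF var var0])
    ultimately show ?thesis using moments by (simp only: power_one mult_1_right) linarith
  qed
  have Ysq: "(Y \<omega>)\<^sup>2 \<le> (2 * (P_noise l m \<omega>)\<^sup>2 + 2 * (P_noise k m \<omega>)\<^sup>2) / real n" for \<omega>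
  proof -
    have "(a - b)\<^sup>2 \<le> 2 * a\<^sup>2 + 2 * b\<^sup>2" for a b :: real
      using zero_le_power2[of "a + b"] by (simp add: power2_eq_square algebra_simps)
    then show ?thesis by (simp add: Y_def power_divide divide_right_mono)
  qed
  have iB: "integrable M (\<lambda>\<omega>. (2 * (P_noise l m \<omega>)\<^sup>2 + 2 * (P_noise k m \<omega>)\<^sup>2) / real n)"
    using P(2)[of l] P(2)[of k] by simp
  have iY: "integrable M (\<lambda>\<omega>. (Y \<omega>)\<^sup>2)"
    using 3 by (intro Bochner_Integration.integrable_bound[OF iB]) (auto intro!: AE_I2 order_trans[OF Ysq])
  have 5: "expectation (\<lambda>\<omega>. (Y \<omega>)\<^sup>2) \<le> 4 * \<epsilon>"
  proof -
    have "expectation (\<lambda>\<omega>. (Y \<omega>)\<^sup>2) \<le> expectation (\<lambda>\<omega>. (2 * (P_noise l m \<omega>)\<^sup>2 + 2 * (P_noise k m \<omega>)\<^sup>2) / real n)"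
      by (intro integral_mono iY iB Ysq)
    also have "\<dots> = (2 * expectation (\<lambda>\<omega>. (P_noise l m \<omega>)\<^sup>2) + 2 * expectation (\<lambda>\<omega>. (P_noise k m \<omega>)\<^sup>2)) / real n"
      using P(2)[of l] P(2)[of k] by simp
    also have "\<dots> \<le> (2 * (52 * sqrt (real n) + 20 * real n / real q) + 2 * (52 * sqrt (real n) + 20 * real n / real q)) / real n"
      by (intro divide_right_mono add_mono mult_left_mono P(3)) auto
    also have "\<dots> = 4 * \<epsilon>"
    proof -
      define w where "w = sqrt (real n)"
      have w: "w > 0" "real n = w * w" using n0 by (simp_all add: w_def)
      show ?thesis unfolding \<epsilon>_def w_def[symmetric] w(2) using w(1) q0 by (simp add: field_simps)
    qed
    finally show ?thesis .
  qed
  show thesis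
    by (rule that[OF 1 2 3 _ i2 iY 4 _ 5]) (use moments var in auto)
qed

text \<open>The fourth moment makes the first term quadratic in the width of the block, so that the sum over all
  blocks of columns becomes small.\<close>

lemma block_oscillation:
  assumes k: "k \<le> l" "l \<le> q" and m: "m \<le> n" and a: "a > 0"
  defines "v \<equiv> 10 * real (l - k) / real q" and "\<epsilon> \<equiv> 52 / sqrt (real n) + 20 / real q"
  assumes small: "2 * v + 8 * \<epsilon> \<le> a\<^sup>2 / 2"
  shows "prob {\<omega>\<in>space M. \<exists>r\<le>q. k \<le> r \<and> r \<le> l \<and> \<bar>WW r m \<omega> - WW k m \<omega>\<bar> > 2 * (a * sqrt (real n))}
    \<le> 32 * (440 / real q + 3 * v\<^sup>2) / a ^ 4 + 32 * \<epsilon> / a\<^sup>2"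
proof -
  define A where "A = {x\<in>I. k \<le> col x \<and> col x < l}"
  have n0: "real n > 0" using n_pos by simp
  obtain X Y where XY: "\<And>\<omega>. WW l m \<omega> - WW k m \<omega> = sqrt (real n) * (X \<omega> + Y \<omega>)"
    "X \<in> borel_measurable M" "Y \<in> borel_measurable M"
    "integrable M (\<lambda>\<omega>. X \<omega> ^ 4)" "integrable M (\<lambda>\<omega>. (X \<omega>)\<^sup>2)" "integrable M (\<lambda>\<omega>. (Y \<omega>)\<^sup>2)"
    "expectation (\<lambda>\<omega>. X \<omega> ^ 4) \<le> 440 / real q + 3 * v\<^sup>2" "expectation (\<lambda>\<omega>. (X \<omega>)\<^sup>2) \<le> v"
    "expectation (\<lambda>\<omega>. (Y \<omega>)\<^sup>2) \<le> 4 * \<epsilon>"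
    using block_decomposition[OF k m] unfolding v_def[symmetric] \<epsilon>_def[symmetric] by metis
  note XY(2,3)[measurable]
  have WA: "W A m \<omega> = sqrt (real n) * (X \<omega> + Y \<omega>)" for \<omega>
    unfolding A_def W_block[OF k(1)] by (rule XY)
  have sub: "A \<subseteq> I" by (auto simp: A_def)
  have sq: "(X \<omega> + Y \<omega>)\<^sup>2 \<le> 2 * (X \<omega>)\<^sup>2 + 2 * (Y \<omega>)\<^sup>2" for \<omega>
    using zero_le_power2[of "X \<omega> - Y \<omega>"] by (simp add: power2_eq_square algebra_simps)
  have iB: "integrable M (\<lambda>\<omega>. 2 * (X \<omega>)\<^sup>2 + 2 * (Y \<omega>)\<^sup>2)" using XY(5,6) by simp
  have "expectation (\<lambda>\<omega>. (W A m \<omega>)\<^sup>2) = real n * expectation (\<lambda>\<omega>. (X \<omega> + Y \<omega>)\<^sup>2)"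
    unfolding WA by (simp add: power_mult_distrib)
  also have "\<dots> \<le> real n * expectation (\<lambda>\<omega>. 2 * (X \<omega>)\<^sup>2 + 2 * (Y \<omega>)\<^sup>2)"
  proof (intro mult_left_mono integral_mono iB sq)
    show "integrable M (\<lambda>\<omega>. (X \<omega> + Y \<omega>)\<^sup>2)"
      by (intro Bochner_Integration.integrable_bound[OF iB]) (auto intro!: AE_I2 order_trans[OF sq])
  qed simp
  also have "\<dots> = real n * (2 * expectation (\<lambda>\<omega>. (X \<omega>)\<^sup>2) + 2 * expectation (\<lambda>\<omega>. (Y \<omega>)\<^sup>2))" using XY(5,6) by simp
  also have "\<dots> \<le> real n * (a\<^sup>2 / 2)" by (rule mult_left_mono) (use XY(8,9) small in linarith, simp)
  also have "\<dots> = (a * sqrt (real n))\<^sup>2 / 2" by (simp add: power_mult_distrib)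
  finally have small': "expectation (\<lambda>\<omega>. (W A m \<omega>)\<^sup>2) \<le> (a * sqrt (real n))\<^sup>2 / 2" .
  have "prob {\<omega>\<in>space M. \<exists>r\<le>q. k \<le> r \<and> r \<le> l \<and> \<bar>WW r m \<omega> - WW k m \<omega>\<bar> > 2 * (a * sqrt (real n))}
    \<le> prob {\<omega>\<in>space M. \<exists>r\<le>q. \<bar>W {x\<in>A. col x < r} m \<omega>\<bar> > 2 * (a * sqrt (real n))}"
  proof (rule finite_measure_mono)
    have "W {x\<in>A. col x < r} m \<omega> = WW r m \<omega> - WW k m \<omega>" if "k \<le> r" "r \<le> l" for r \<omega>
    proof -
      have "{x\<in>A. col x < r} = {x\<in>I. k \<le> col x \<and> col x < r}" using that by (auto simp: A_def)
      then show ?thesis by (simp add: W_block that)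
    qed
    then show "{\<omega>\<in>space M. \<exists>r\<le>q. k \<le> r \<and> r \<le> l \<and> \<bar>WW r m \<omega> - WW k m \<omega>\<bar> > 2 * (a * sqrt (real n))}
      \<subseteq> {\<omega>\<in>space M. \<exists>r\<le>q. \<bar>W {x\<in>A. col x < r} m \<omega>\<bar> > 2 * (a * sqrt (real n))}" by auto
    have "W {x\<in>A. col x < r} m \<in> borel_measurable M" for r
      by (rule W_borel) (auto simp: A_def)
    note this[measurable]
    show "{\<omega>\<in>space M. \<exists>r\<le>q. \<bar>W {x\<in>A. col x < r} m \<omega>\<bar> > 2 * (a * sqrt (real n))} \<in> events" by measurable
  qed
  also have "\<dots> \<le> 2 * prob {\<omega>\<in>space M. \<bar>W A m \<omega>\<bar> > a * sqrt (real n)}"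
    by (rule block_maximal[OF sub _ small']) (use a n0 in simp)
  \<comment> \<open>One of the two parts exceeds \<open>a / 2\<close>: the fourth moment is used for
    \<open>X\<close>, the second for \<open>Y\<close>. With the factor 2 from Ottaviani's inequality
    this gives the constants 2 * 16 and 2 * 4 * 4.\<close>
  also have "prob {\<omega>\<in>space M. \<bar>W A m \<omega>\<bar> > a * sqrt (real n)}
      \<le> prob ({\<omega>\<in>space M. (a / 2) ^ 4 \<le> X \<omega> ^ 4} \<union> {\<omega>\<in>space M. (a / 2)\<^sup>2 \<le> (Y \<omega>)\<^sup>2})"
  proof (rule finite_measure_mono)
    show "{\<omega>\<in>space M. \<bar>W A m \<omega>\<bar> > a * sqrt (real n)} \<subseteq> {\<omega>\<in>space M. (a / 2) ^ 4 \<le> X \<omega> ^ 4} \<union> {\<omega>\<in>space M. (a / 2)\<^sup>2 \<le> (Y \<omega>)\<^sup>2}"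
    proof
      fix \<omega> assume w: "\<omega> \<in> {\<omega>\<in>space M. \<bar>W A m \<omega>\<bar> > a * sqrt (real n)}"
      then have "a * sqrt (real n) < \<bar>X \<omega> + Y \<omega>\<bar> * sqrt (real n)" by (simp add: WA abs_mult mult.commute)
      then have "a < \<bar>X \<omega> + Y \<omega>\<bar>" using n0 by simp
      then have "a / 2 \<le> \<bar>X \<omega>\<bar> \<or> a / 2 \<le> \<bar>Y \<omega>\<bar>" by linarith
      then have "(a / 2) ^ 4 \<le> \<bar>X \<omega>\<bar> ^ 4 \<or> (a / 2)\<^sup>2 \<le> \<bar>Y \<omega>\<bar>\<^sup>2"
      proof (elim disj_forward)
        show "(a / 2) ^ 4 \<le> \<bar>X \<omega>\<bar> ^ 4" if "a / 2 \<le> \<bar>X \<omega>\<bar>" using that by (rule power_mono) (use a in simp)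
        show "(a / 2)\<^sup>2 \<le> \<bar>Y \<omega>\<bar>\<^sup>2" if "a / 2 \<le> \<bar>Y \<omega>\<bar>" using that by (rule power_mono) (use a in simp)
      qed
      then show "\<omega> \<in> {\<omega>\<in>space M. (a / 2) ^ 4 \<le> X \<omega> ^ 4} \<union> {\<omega>\<in>space M. (a / 2)\<^sup>2 \<le> (Y \<omega>)\<^sup>2}"
        using w by (auto simp: power_even_abs)
    qed
  qed measurable
  also have "\<dots> \<le> prob {\<omega>\<in>space M. (a / 2) ^ 4 \<le> X \<omega> ^ 4} + prob {\<omega>\<in>space M. (a / 2)\<^sup>2 \<le> (Y \<omega>)\<^sup>2}"
    by (rule measure_Un_le) measurable
  also have "\<dots> \<le> (440 / real q + 3 * v\<^sup>2) / (a / 2) ^ 4 + 4 * \<epsilon> / (a / 2)\<^sup>2"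
  proof (intro add_mono)
    have "prob {\<omega>\<in>space M. (a / 2) ^ 4 \<le> X \<omega> ^ 4} \<le> expectation (\<lambda>\<omega>. X \<omega> ^ 4) / (a / 2) ^ 4"
      using a by (intro integral_Markov_inequality_measure[where A = "{}"] XY(4)) auto
    also have "\<dots> \<le> (440 / real q + 3 * v\<^sup>2) / (a / 2) ^ 4" by (intro divide_right_mono XY(7)) simp
    finally show "prob {\<omega>\<in>space M. (a / 2) ^ 4 \<le> X \<omega> ^ 4} \<le> (440 / real q + 3 * v\<^sup>2) / (a / 2) ^ 4" .
    have "prob {\<omega>\<in>space M. (a / 2)\<^sup>2 \<le> (Y \<omega>)\<^sup>2} \<le> expectation (\<lambda>\<omega>. (Y \<omega>)\<^sup>2) / (a / 2)\<^sup>2"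
      using a by (intro integral_Markov_inequality_measure[where A = "{}"] XY(6)) auto
    also have "\<dots> \<le> 4 * \<epsilon> / (a / 2)\<^sup>2" by (intro divide_right_mono XY(9)) simp
    finally show "prob {\<omega>\<in>space M. (a / 2)\<^sup>2 \<le> (Y \<omega>)\<^sup>2} \<le> 4 * \<epsilon> / (a / 2)\<^sup>2" .
  qed
  finally show ?thesis by (simp add: power_divide mult_ac)
qed

text \<open>From \<open>z\<close> the coordinate t is moved first, at an arbitrary column number,
  which \<open>window_maximal\<close> allows; then s is moved at a grid value of t. In this order
  the direction of s has to be controlled only at the \<open>L + 1\<close> grid values, by a union
  bound over \<open>K * Suc L\<close> blocks.\<close>

lemma grid_oscillation:
  assumes K: "K \<ge> 1" and L: "L \<ge> 1" and a: "a > 0"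
  defines "v \<equiv> 10 * (1 / real K + 1 / real q)" and "\<epsilon> \<equiv> 52 / sqrt (real n) + 20 / real q"
  assumes small: "2 * v + 8 * \<epsilon> \<le> a\<^sup>2 / 2"
  obtains B where "B \<in> events"
    "prob B \<le> 512 * 24 * (sqrt (1 / real L + 1 / real n) + 1 / sqrt (real n)) / a\<^sup>2
      + real (K * Suc L) * (32 * (440 / real q + 3 * v\<^sup>2) / a ^ 4 + 32 * \<epsilon> / a\<^sup>2)"
    "\<And>\<omega> z. \<omega> \<in> space M - B \<Longrightarrow> z \<in> unit_square \<Longrightarrow>
      \<bar>WW (nat \<lfloor>real q * fst z\<rfloor>) (nat \<lfloor>real n * snd z\<rfloor>) \<omega>
        - WW (nat \<lfloor>real q * fst (grid K L z)\<rfloor>) (nat \<lfloor>real n * snd (grid K L z)\<rfloor>) \<omega>\<bar> \<le> 4 * (a * sqrt (real n))"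
proof -
  have n0: "real n > 0" and q0: "real q > 0" and K0: "real K > 0" and L0: "real L > 0" using n_pos q_pos K L by auto
  define kg where "kg b = nat \<lfloor>real q * (real b / real K)\<rfloor>" for b
  define mg where "mg b = nat \<lfloor>real n * (real b / real L)\<rfloor>" for b
  \<comment> \<open>A grid cell spans about \<open>n / L\<close> values of \<open>m\<close>; the 1
    allows for rounding.\<close>
  define d where "d = n div L + 1"
  define B1 where "B1 = {\<omega>\<in>space M. \<exists>k\<le>q. \<exists>m\<le>n. \<exists>m'\<le>m. m \<le> m' + d \<and> \<bar>WW k m \<omega> - WW k m' \<omega>\<bar> > 2 * (a * sqrt (real n))}"
  define B2 where "B2 b l = {\<omega>\<in>space M. \<exists>r\<le>q. kg b \<le> r \<and> r \<le> kg (Suc b) \<and> \<bar>WW r (mg l) \<omega> - WW (kg b) (mg l) \<omega>\<bar> > 2 * (a * sqrt (real n))}" for b l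
  define \<beta> where "\<beta> = 32 * (440 / real q + 3 * v\<^sup>2) / a ^ 4 + 32 * \<epsilon> / a\<^sup>2"
  have kg_le: "kg b \<le> q" if "b \<le> K" for b
    unfolding kg_def by (rule floor_le_nat) (use that K0 in simp)
  have mg_le: "mg b \<le> n" if "b \<le> L" for b
    unfolding mg_def by (rule floor_le_nat) (use that L0 in simp)
  have kg_mono: "kg b \<le> kg (Suc b)" for b
    unfolding kg_def by (intro nat_mono floor_mono mult_left_mono divide_right_mono) auto
  have kg_diff: "10 * real (kg (Suc b) - kg b) / real q \<le> v" for b
  proof -
    have "real q * (real b / real K) \<ge> 0" "real q * (real (Suc b) / real K) \<ge> 0" by simp_all
    then have "real (kg (Suc b)) \<le> real q * (real (Suc b) / real K)" "real (kg b) \<ge> real q * (real b / real K) - 1"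
      unfolding kg_def by linarith+
    moreover have "real q * (real (Suc b) / real K) = real q * (real b / real K) + real q * (1 / real K)"
      by (simp add: add_divide_distrib distrib_left)
    moreover have "real (kg (Suc b) - kg b) = real (kg (Suc b)) - real (kg b)" using kg_mono[of b] by (simp add: of_nat_diff)
    ultimately have "real (kg (Suc b) - kg b) \<le> real q * (1 / real K) + 1" by linarith
    then have "10 * real (kg (Suc b) - kg b) / real q \<le> 10 * (real q * (1 / real K) + 1) / real q"
      by (intro divide_right_mono) auto
    also have "\<dots> = v" using q0 K0 by (simp add: v_def field_simps)
    finally show ?thesis .
  qed
  have B1: "B1 \<in> events" unfolding B1_def by measurable
  have B2: "B2 b l \<in> events" for b l unfolding B2_def by measurable
  have P1: "prob B1 \<le> 512 * 24 * (sqrt (1 / real L + 1 / real n) + 1 / sqrt (real n)) / a\<^sup>2"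
  proof -
    have "real d / real n \<le> 1 / real L + 1 / real n"
    proof -
      have "real (n div L) \<le> real n / real L" by (rule of_nat_div_le_of_nat)
      then have "real d / real n \<le> (real n / real L + 1) / real n" unfolding d_def by (intro divide_right_mono) auto
      also have "\<dots> = 1 / real L + 1 / real n" using n0 by (simp add: add_divide_distrib)
      finally show ?thesis .
    qed
    then have "512 * 24 * (sqrt (real d / real n) + 1 / sqrt (real n)) / a\<^sup>2
        \<le> 512 * 24 * (sqrt (1 / real L + 1 / real n) + 1 / sqrt (real n)) / a\<^sup>2"
      by (intro divide_right_mono mult_left_mono add_right_mono real_sqrt_le_mono) auto
    moreover have "prob B1 \<le> 512 * 24 * (sqrt (real d / real n) + 1 / sqrt (real n)) / a\<^sup>2"
      unfolding B1_def WW_def by (rule window_maximal[OF a])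
    ultimately show ?thesis by linarith
  qed
  have P2: "prob (B2 b l) \<le> \<beta>" if "b < K" "l \<le> L" for b l
  proof -
    define v' where "v' = 10 * real (kg (Suc b) - kg b) / real q"
    have v': "v' \<le> v" "0 \<le> v'" using kg_diff by (simp_all add: v'_def)
    have "prob (B2 b l) \<le> 32 * (440 / real q + 3 * v'\<^sup>2) / a ^ 4 + 32 * \<epsilon> / a\<^sup>2"
      unfolding B2_def v'_def \<epsilon>_def
      by (rule block_oscillation[OF kg_mono kg_le mg_le a])
        (use that small v' in \<open>auto simp: v'_def \<epsilon>_def\<close>)
    also have "\<dots> \<le> \<beta>" unfolding \<beta>_def using v' a
      by (intro add_right_mono divide_right_mono mult_left_mono add_left_mono power_mono) auto
    finally show ?thesis .
  qed
  define B where "B = B1 \<union> (\<Union>bl\<in>{..<K} \<times> {..L}. B2 (fst bl) (snd bl))"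
  have PB: "prob B \<le> 512 * 24 * (sqrt (1 / real L + 1 / real n) + 1 / sqrt (real n)) / a\<^sup>2 + real (K * Suc L) * \<beta>"
  proof -
    have "prob B \<le> prob B1 + prob (\<Union>bl\<in>{..<K} \<times> {..L}. B2 (fst bl) (snd bl))"
      unfolding B_def by (rule measure_Un_le) (use B1 B2 in auto)
    also have "prob (\<Union>bl\<in>{..<K} \<times> {..L}. B2 (fst bl) (snd bl)) \<le> (\<Sum>bl\<in>{..<K} \<times> {..L}. prob (B2 (fst bl) (snd bl)))"
      by (rule measure_UNION_le) (use B2 in auto)
    also have "\<dots> \<le> (\<Sum>bl\<in>{..<K} \<times> {..L}. \<beta>)" by (intro sum_mono P2) auto
    also have "\<dots> = real (K * Suc L) * \<beta>" by (simp only: sum_constant card_cartesian_product card_lessThan card_atMost)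
    finally show ?thesis using P1 by linarith
  qed
  show thesis
  proof (rule that)
    show "B \<in> events" unfolding B_def using B1 B2 by (intro sets.Un sets.finite_UN) auto
    show "prob B \<le> 512 * 24 * (sqrt (1 / real L + 1 / real n) + 1 / sqrt (real n)) / a\<^sup>2
      + real (K * Suc L) * (32 * (440 / real q + 3 * v\<^sup>2) / a ^ 4 + 32 * \<epsilon> / a\<^sup>2)"
      using PB unfolding \<beta>_def .
    fix \<omega> z assume w: "\<omega> \<in> space M - B" and "z \<in> unit_square"
    then obtain s t where z: "z = (s, t)" "s \<in> {0..1}" "t \<in> {0..1}" by auto
    define b where "b = nat \<lfloor>real K * s\<rfloor>"
    define l where "l = nat \<lfloor>real L * t\<rfloor>"
    define k where "k = nat \<lfloor>real q * s\<rfloor>"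
    define m where "m = nat \<lfloor>real n * t\<rfloor>"
    have bK: "b \<le> K" and lL: "l \<le> L" and kq: "k \<le> q" and mn: "m \<le> n"
      unfolding b_def l_def k_def m_def using z floor_le_nat by auto
    have s: "real b / real K \<le> s" "s < (real b + 1) / real K"
      unfolding b_def using nat_floor_div_bounds[OF K] z by auto
    have t: "real l / real L \<le> t" "t < (real l + 1) / real L"
      unfolding l_def using nat_floor_div_bounds[OF L] z by auto
    have mgm: "mg l \<le> m" unfolding mg_def m_def by (intro nat_mono floor_mono mult_left_mono t) auto
    have md: "m \<le> mg l + d"
    proof -
      have "real n * t \<ge> 0" "real n * (real l / real L) \<ge> 0" using z by auto
      then have "real m \<le> real n * t" "real (mg l) > real n * (real l / real L) - 1"
        unfolding m_def mg_def by linarith+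
      moreover have "real n * t < real n * (real l / real L) + real n / real L"
        using mult_strict_left_mono[OF t(2) n0] by (simp add: add_divide_distrib distrib_left)
      ultimately have "real m - real (mg l) - 1 < real n / real L" by linarith
      then have "(real m - real (mg l) - 1) * real L < real n" using L0 by (simp add: pos_less_divide_eq)
      moreover have "real (m - mg l - 1) = real m - real (mg l) - 1" if "\<not> m \<le> mg l"
        using that by (simp add: of_nat_diff)
      ultimately have "real ((m - mg l - 1) * L) < real n \<or> m \<le> mg l"
        unfolding of_nat_mult by metis
      then have "m - mg l - 1 \<le> n div L"
        using L by (auto simp: less_eq_div_iff_mult_less_eq simp del: of_nat_mult)
      then show ?thesis by (simp add: d_def)
    qed
    have "\<omega> \<notin> B1" "\<omega> \<in> space M" using w by (auto simp: B_def)
    then have "\<not> \<bar>WW k m \<omega> - WW k (mg l) \<omega>\<bar> > 2 * (a * sqrt (real n))"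
      unfolding B1_def using kq mn mgm md by blast
    then have t_step: "\<bar>WW k m \<omega> - WW k (mg l) \<omega>\<bar> \<le> 2 * (a * sqrt (real n))" by simp
    have s_step: "\<bar>WW k (mg l) \<omega> - WW (kg b) (mg l) \<omega>\<bar> \<le> 2 * (a * sqrt (real n))"
    \<comment> \<open>The point s = 1 is its own grid point, and no block lies beyond it.\<close>
    proof (cases "b = K")
      case True
      then have "s = 1" using s K0 z by simp
      then have "k = kg b" using True K0 by (simp add: k_def kg_def)
      then show ?thesis using a by simp
    next
      case False
      then have bK': "b < K" using bK by simp
      have "kg b \<le> k" unfolding kg_def k_def by (intro nat_mono floor_mono mult_left_mono s) auto
      moreover have "k \<le> kg (Suc b)" unfolding kg_def k_def
        using s(2) by (intro nat_mono floor_mono mult_left_mono) (auto simp: add.commute)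
      moreover have "\<omega> \<notin> B2 b l" "\<omega> \<in> space M" using w bK' lL by (auto simp: B_def)
      ultimately have "\<not> \<bar>WW k (mg l) \<omega> - WW (kg b) (mg l) \<omega>\<bar> > 2 * (a * sqrt (real n))"
        unfolding B2_def using kq by blast
      then show ?thesis by simp
    qed
    have "\<bar>WW k m \<omega> - WW (kg b) (mg l) \<omega>\<bar> \<le> 4 * (a * sqrt (real n))" using t_step s_step by linarith
    then show "\<bar>WW (nat \<lfloor>real q * fst z\<rfloor>) (nat \<lfloor>real n * snd z\<rfloor>) \<omega>
        - WW (nat \<lfloor>real q * fst (grid K L z)\<rfloor>) (nat \<lfloor>real n * snd (grid K L z)\<rfloor>) \<omega>\<bar> \<le> 4 * (a * sqrt (real n))"
      by (simp add: z k_def m_def b_def l_def kg_def mg_def grid_def)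
  qed
qed

end

section \<open>Convergence of finite-dimensional distributions of the array\<close>

lemma nat_floor_over_tendsto:
  assumes f: "filterlim f at_top sequentially" and s: "s \<ge> 0"
  shows "(\<lambda>n. real (nat \<lfloor>real (f n) * s\<rfloor>) / real (f n)) \<longlonglongrightarrow> s"
proof (rule tendsto_sandwich)
  have f0: "\<forall>\<^sub>F n in sequentially. f n > 0" by (rule eventually_compose_filterlim[OF eventually_gt_at_top f])
  have l: "\<forall>\<^sub>F n in sequentially. s - 1 / real (f n) \<le> real (nat \<lfloor>real (f n) * s\<rfloor>) / real (f n) \<and> real (nat \<lfloor>real (f n) * s\<rfloor>) / real (f n) \<le> s"
    using f0
  proof eventually_elim
    case (elim n)
    have "real (f n) * s \<ge> 0" using s by simp
    then have *: "real (nat \<lfloor>real (f n) * s\<rfloor>) = of_int \<lfloor>real (f n) * s\<rfloor>" by simp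
    have "real (f n) * s - 1 \<le> of_int \<lfloor>real (f n) * s\<rfloor>" "of_int \<lfloor>real (f n) * s\<rfloor> \<le> real (f n) * s" by linarith+
    then have "(real (f n) * s - 1) / real (f n) \<le> of_int \<lfloor>real (f n) * s\<rfloor> / real (f n)"
      "of_int \<lfloor>real (f n) * s\<rfloor> / real (f n) \<le> real (f n) * s / real (f n)" by (simp_all only: divide_right_mono of_nat_0_le_iff)
    then show ?case unfolding * using elim by (simp add: diff_divide_distrib)
  qed
  then show "\<forall>\<^sub>F n in sequentially. s - 1 / real (f n) \<le> real (nat \<lfloor>real (f n) * s\<rfloor>) / real (f n)"
    "\<forall>\<^sub>F n in sequentially. real (nat \<lfloor>real (f n) * s\<rfloor>) / real (f n) \<le> s"
    by (auto elim: eventually_mono)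
  have "(\<lambda>n. 1 / real (f n)) \<longlonglongrightarrow> 0"
    using filterlim_compose[OF lim_1_over_n f] by simp
  from tendsto_diff[OF tendsto_const this] show "(\<lambda>n. s - 1 / real (f n)) \<longlonglongrightarrow> s" by simp
qed simp

lemma nat_ceiling_over_tendsto:
  assumes x: "(x::real) \<ge> 0"
  shows "(\<lambda>n. real (nat \<lceil>real n * x\<rceil>) / real n) \<longlonglongrightarrow> x"
proof (rule tendsto_sandwich)
  have l: "\<forall>\<^sub>F n in sequentially. x \<le> real (nat \<lceil>real n * x\<rceil>) / real n \<and> real (nat \<lceil>real n * x\<rceil>) / real n \<le> x + 1 / real n"
    using eventually_gt_at_top[of 0]
  proof eventually_elim
    case (elim n)
    have "real n * x \<ge> 0" using x by simp
    then have *: "real (nat \<lceil>real n * x\<rceil>) = of_int \<lceil>real n * x\<rceil>" by simp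
    have "of_int \<lceil>real n * x\<rceil> \<le> real n * x + 1" "of_int \<lceil>real n * x\<rceil> \<ge> real n * x" by linarith+
    then have "of_int \<lceil>real n * x\<rceil> / real n \<le> (real n * x + 1) / real n"
      "real n * x / real n \<le> of_int \<lceil>real n * x\<rceil> / real n" by (simp_all only: divide_right_mono of_nat_0_le_iff)
    then show ?case unfolding * using elim by (simp add: add_divide_distrib)
  qed
  then show "\<forall>\<^sub>F n in sequentially. x \<le> real (nat \<lceil>real n * x\<rceil>) / real n"
    "\<forall>\<^sub>F n in sequentially. real (nat \<lceil>real n * x\<rceil>) / real n \<le> x + 1 / real n"
    by (auto elim: eventually_mono)
  from tendsto_add[OF tendsto_const lim_1_over_n, of x] show "(\<lambda>n. x + 1 / real n) \<longlonglongrightarrow> x" by simp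
qed simp

section \<open>Linear combinations of the field\<close>

context beta_array
begin

text \<open>The coefficient of a noise variable in a linear combination of fields, as needed for the
  Cramer-Wold device.\<close>

definition linear_coef :: "nat \<Rightarrow> (nat \<Rightarrow> real) \<Rightarrow> (nat \<Rightarrow> nat) \<Rightarrow> (nat \<Rightarrow> nat) \<Rightarrow> nat \<times> nat \<Rightarrow> real" where
  "linear_coef d u k m x = (\<Sum>a<d. u a * (if snd x < k a then coef (m a) (fst x) else 0))"

lemma linear_split:
  "(\<Sum>a<d. u a * WW (k a) (m a) \<omega>) =
    (\<Sum>x\<in>R_index. linear_coef d u k m x * R_noise x \<omega>) + (\<Sum>a<d. u a * P_noise (k a) (m a) \<omega>)"
proof -
  have "(\<Sum>a<d. u a * WW (k a) (m a) \<omega>) =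
    (\<Sum>a<d. \<Sum>x\<in>R_index. u a * (if snd x < k a then coef (m a) (fst x) else 0) * R_noise x \<omega>) + (\<Sum>a<d. u a * P_noise (k a) (m a) \<omega>)"
    by (simp add: WW_split sum.distrib distrib_left sum_distrib_left case_prod_unfold mult.assoc)
  also have "(\<Sum>a<d. \<Sum>x\<in>R_index. u a * (if snd x < k a then coef (m a) (fst x) else 0) * R_noise x \<omega>)
    = (\<Sum>x\<in>R_index. linear_coef d u k m x * R_noise x \<omega>)"
    by (subst sum.swap) (simp add: linear_coef_def sum_distrib_right)
  finally show ?thesis .
qed

lemma linear_coef_bound:
  assumes "\<And>a. a < d \<Longrightarrow> m a \<le> n"
  shows "\<bar>linear_coef d u k m x\<bar> \<le> (\<Sum>a<d. \<bar>u a\<bar>) * height (fst x)"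
proof -
  have "\<bar>linear_coef d u k m x\<bar> \<le> (\<Sum>a<d. \<bar>u a * (if snd x < k a then coef (m a) (fst x) else 0)\<bar>)"
    unfolding linear_coef_def by (rule sum_abs)
  also have "\<dots> \<le> (\<Sum>a<d. \<bar>u a\<bar> * height (fst x))"
  proof (rule sum_mono)
    fix a assume "a \<in> {..<d}"
    then have "0 \<le> coef (m a) (fst x)" "coef (m a) (fst x) \<le> height (fst x)" "0 \<le> height (fst x)"
      using assms[of a] coef_bounds height_ge_1[of "fst x"] by auto
    then show "\<bar>u a * (if snd x < k a then coef (m a) (fst x) else 0)\<bar> \<le> \<bar>u a\<bar> * height (fst x)"
      by (simp add: abs_mult mult_left_mono)
  qed
  finally show ?thesis by (simp add: sum_distrib_right)
qed

lemma linear_coef_variance: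
  assumes "\<And>a. a < d \<Longrightarrow> k a \<le> q"
  shows "(\<Sum>x\<in>R_index. (linear_coef d u k m x)\<^sup>2 * vR (fst x) (snd x)) =
    (\<Sum>a<d. \<Sum>b<d. u a * u b * (\<Sum>i=1..2 * n. coef (m a) i * coef (m b) i * (\<Sum>j=1..<min (k a) (k b). vR i j)))"
proof -
  have inner: "(\<Sum>x\<in>R_index. (if snd x < k a then coef (m a) (fst x) else 0) * (if snd x < k b then coef (m b) (fst x) else 0) * vR (fst x) (snd x))
    = (\<Sum>i=1..2 * n. coef (m a) i * coef (m b) i * (\<Sum>j=1..<min (k a) (k b). vR i j))" if "a < d" "b < d" for a b
  proof -
    have "(\<Sum>x\<in>R_index. (if snd x < k a then coef (m a) (fst x) else 0) * (if snd x < k b then coef (m b) (fst x) else 0) * vR (fst x) (snd x))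
      = (\<Sum>i=1..2 * n. \<Sum>j=1..<q. if j < min (k a) (k b) then coef (m a) i * coef (m b) i * vR i j else 0)"
      unfolding R_index_def sum.cartesian_product by (intro sum.cong) auto
    also have "\<dots> = (\<Sum>i=1..2 * n. \<Sum>j\<in>{j\<in>{1..<q}. j < min (k a) (k b)}. coef (m a) i * coef (m b) i * vR i j)"
      by (intro sum.cong refl sum.inter_filter[symmetric]) simp
    also have "{j\<in>{1..<q}. j < min (k a) (k b)} = {1..<min (k a) (k b)}"
      using assms[OF that(1)] by auto
    finally show ?thesis by (simp only: sum_distrib_left)
  qed
  have "(\<Sum>x\<in>R_index. (linear_coef d u k m x)\<^sup>2 * vR (fst x) (snd x)) =
    (\<Sum>x\<in>R_index. \<Sum>a<d. \<Sum>b<d. u a * u b * ((if snd x < k a then coef (m a) (fst x) else 0) * (if snd x < k b then coef (m b) (fst x) else 0) * vR (fst x) (snd x)))"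
    unfolding linear_coef_def square_sum sum_distrib_right by (intro sum.cong refl) (simp only: mult_ac)
  also have "\<dots> = (\<Sum>a<d. \<Sum>x\<in>R_index. \<Sum>b<d. u a * u b * ((if snd x < k a then coef (m a) (fst x) else 0) * (if snd x < k b then coef (m b) (fst x) else 0) * vR (fst x) (snd x)))"
    by (rule sum.swap)
  also have "\<dots> = (\<Sum>a<d. \<Sum>b<d. \<Sum>x\<in>R_index. u a * u b * ((if snd x < k a then coef (m a) (fst x) else 0) * (if snd x < k b then coef (m b) (fst x) else 0) * vR (fst x) (snd x)))"
    by (intro sum.cong refl sum.swap)
  also have "\<dots> = (\<Sum>a<d. \<Sum>b<d. u a * u b * (\<Sum>i=1..2 * n. coef (m a) i * coef (m b) i * (\<Sum>j=1..<min (k a) (k b). vR i j)))"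
    unfolding sum_distrib_left[symmetric] by (intro sum.cong refl arg_cong2[where f = "(*)"] inner) auto
  finally show ?thesis .
qed

text \<open>Reduces the characteristic function to the variables \<open>r\<close>; the error is the
  L2 norm of the combined part of the variables \<open>p\<close>, bounded by Cauchy-Schwarz over the
  \<open>d\<close> terms.\<close>

lemma linear_char:
  assumes m: "\<And>a. a < d \<Longrightarrow> m a \<le> n"
  shows "cmod ((\<integral>\<omega>. iexp (\<Sum>a<d. u a * (WW (k a) (m a) \<omega> / sqrt (real n))) \<partial>M)
      - (\<integral>\<omega>. iexp (\<Sum>x\<in>R_index. linear_coef d u k m x / sqrt (real n) * R_noise x \<omega>) \<partial>M))
    \<le> sqrt ((\<Sum>a<d. (u a)\<^sup>2) * real d * (52 / sqrt (real n) + 20 / real q))"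
proof -
  define X where "X \<omega> = (\<Sum>x\<in>R_index. linear_coef d u k m x / sqrt (real n) * R_noise x \<omega>)" for \<omega>
  define Y where "Y \<omega> = (\<Sum>a<d. u a * (P_noise (k a) (m a) \<omega> / sqrt (real n)))" for \<omega>
  have n0: "real n > 0" using n_pos by simp
  have split: "(\<Sum>a<d. u a * (WW (k a) (m a) \<omega> / sqrt (real n))) = X \<omega> + Y \<omega>" for \<omega>
    using linear_split[of u k m \<omega> d] by (simp add: X_def Y_def flip: sum_divide_distrib add_divide_distrib)
  have "R_noise x \<in> borel_measurable M" if "x \<in> R_index" for x
    using R_noise_indep[of "\<lambda>_. 1"] that unfolding indep_vars_def by auto
  then have X: "X \<in> borel_measurable M" unfolding X_def[abs_def] by (intro borel_measurable_sum borel_measurable_times) auto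
  have Pm: "P_noise (k a) (m a) \<in> borel_measurable M" "integrable M (\<lambda>\<omega>. (P_noise (k a) (m a) \<omega>)\<^sup>2)"
      "expectation (\<lambda>\<omega>. (P_noise (k a) (m a) \<omega>)\<^sup>2) \<le> 52 * sqrt (real n) + 20 * real n / real q" if "a < d" for a
    using P_noise_facts[OF m[OF that], of "k a"] by auto
  have Y: "Y \<in> borel_measurable M" unfolding Y_def[abs_def]
    using Pm by (intro borel_measurable_sum borel_measurable_times borel_measurable_divide) auto
  have Y2: "(Y \<omega>)\<^sup>2 \<le> (\<Sum>a<d. (u a)\<^sup>2) * (\<Sum>a<d. (P_noise (k a) (m a) \<omega>)\<^sup>2 / real n)" for \<omega>
    using Cauchy_Schwarz_ineq_sum[of u "\<lambda>a. P_noise (k a) (m a) \<omega> / sqrt (real n)" "{..<d}"]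
    by (simp add: Y_def power_divide)
  have int: "integrable M (\<lambda>\<omega>. (\<Sum>a<d. (u a)\<^sup>2) * (\<Sum>a<d. (P_noise (k a) (m a) \<omega>)\<^sup>2 / real n))"
    using Pm by (intro integrable_mult_right Bochner_Integration.integrable_sum integrable_divide) auto
  have intY: "integrable M (\<lambda>\<omega>. (Y \<omega>)\<^sup>2)"
    using Y by (intro Bochner_Integration.integrable_bound[OF int]) (auto intro!: AE_I2 order_trans[OF Y2])
  have "expectation (\<lambda>\<omega>. (Y \<omega>)\<^sup>2) \<le> expectation (\<lambda>\<omega>. (\<Sum>a<d. (u a)\<^sup>2) * (\<Sum>a<d. (P_noise (k a) (m a) \<omega>)\<^sup>2 / real n))"
    by (intro integral_mono intY int Y2)
  also have "\<dots> = (\<Sum>a<d. (u a)\<^sup>2) * (\<Sum>a<d. expectation (\<lambda>\<omega>. (P_noise (k a) (m a) \<omega>)\<^sup>2) / real n)"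
    using Pm by (subst integral_mult_right_zero, subst Bochner_Integration.integral_sum) auto
  also have "\<dots> \<le> (\<Sum>a<d. (u a)\<^sup>2) * (\<Sum>a<d. (52 * sqrt (real n) + 20 * real n / real q) / real n)"
    using Pm by (intro mult_left_mono sum_mono divide_right_mono sum_nonneg) auto
  also have "(52 * sqrt (real n) + 20 * real n / real q) / real n = 52 / sqrt (real n) + 20 / real q"
  proof -
    define w where "w = sqrt (real n)"
    have w: "w > 0" "real n = w * w" using n0 by (simp_all add: w_def)
    have q: "real q > 0" using q_pos by simp
    show ?thesis unfolding w_def[symmetric] w(2) using w(1) q by (simp add: field_simps)
  qed
  finally have "expectation (\<lambda>\<omega>. (Y \<omega>)\<^sup>2) \<le> (\<Sum>a<d. (u a)\<^sup>2) * real d * (52 / sqrt (real n) + 20 / real q)"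
    by (simp add: mult.assoc)
  then show ?thesis unfolding split X_def[symmetric]
    by (intro order_trans[OF char_perturbation[OF X Y intY]] real_sqrt_le_mono)
qed

end

section \<open>Limits of the covariances\<close>

locale beta_arrays =
  fixes M :: "nat \<Rightarrow> 'a measure" and P R :: "nat \<Rightarrow> nat \<Rightarrow> nat \<Rightarrow> 'a \<Rightarrow> real" and p :: "nat \<Rightarrow> nat"
  assumes arr: "\<And>n. n \<ge> 1 \<Longrightarrow> beta_array (M n) (P n) (R n) n (p n)"
    and prob: "\<And>n. prob_space (M n)"
    and p_pos: "\<And>n. p n > 0" and p_lim: "filterlim p at_top sequentially"
begin

abbreviation "coefA \<equiv> beta_array.coef"
abbreviation "vRA n \<equiv> beta_array.vR n (p n)"
abbreviation "parA n \<equiv> beta_array.par n (p n)"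
abbreviation "kk n s \<equiv> nat \<lfloor>real (p n) * s\<rfloor>"
abbreviation "mm n t \<equiv> nat \<lfloor>real n * t\<rfloor>"
abbreviation "field n \<equiv> beta_array.WW (M n) (P n) (R n) n (p n)"

lemma inverse_p_tendsto: "(\<lambda>n. 1 / real (p n)) \<longlonglongrightarrow> 0"
  using filterlim_compose[OF lim_1_over_n p_lim] by simp

lemma p_eventually: "\<forall>\<^sub>F n in sequentially. p n > 0"
  by (rule eventually_compose_filterlim[OF eventually_gt_at_top p_lim])

text \<open>\<open>i n\<close> stands for either of the two indices in the row at relative position
  \<open>x\<close>; its parity changes the coefficient by at most 1, which disappears after division
  by \<open>n\<close>.\<close>

lemma coef_tendsto:
  assumes t: "t \<ge> 0" and x: "0 < x" and i: "\<forall>\<^sub>F n in sequentially. (i n + 1) div 2 = nat \<lceil>real n * x\<rceil>"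
  shows "(\<lambda>n. coefA (mm n t) (i n) / real n) \<longlonglongrightarrow> max 0 (t - x)"
proof (rule tendsto_sandwich)
  define g where "g n = max 0 (real (mm n t) / real n - real (nat \<lceil>real n * x\<rceil>) / real n)" for n
  have g: "g \<longlonglongrightarrow> max 0 (t - x)"
    unfolding g_def using t x
    by (intro tendsto_intros nat_floor_over_tendsto nat_ceiling_over_tendsto filterlim_ident) auto
  show "g \<longlonglongrightarrow> max 0 (t - x)" by (rule g)
  from tendsto_add[OF g lim_1_over_n] show "(\<lambda>n. g n + 1 / real n) \<longlonglongrightarrow> max 0 (t - x)" by simp
  have "\<forall>\<^sub>F n in sequentially. g n \<le> coefA (mm n t) (i n) / real n \<and> coefA (mm n t) (i n) / real n \<le> g n + 1 / real n"
    using i eventually_gt_at_top[of 0]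
  proof eventually_elim
    case (elim n)
    interpret beta_array "M n" "P n" "R n" n "p n" by (rule arr) (use elim in simp)
    have "g n = max 0 (real (mm n t) - real (nat \<lceil>real n * x\<rceil>)) / real n"
      using elim(2) by (simp add: g_def max_divide_distrib_right diff_divide_distrib)
    moreover have "max 0 (real m - real r) \<le> coef m (i n)" "coef m (i n) \<le> max 0 (real m - real r) + 1"
      if "(i n + 1) div 2 = r" for m r
      unfolding coef_def that by (auto simp: of_nat_diff)
    note this[OF elim(1), of "mm n t"]
    ultimately show ?case using elim(2) by (simp add: divide_right_mono flip: add_divide_distrib)
  qed
  then show "\<forall>\<^sub>F n in sequentially. g n \<le> coefA (mm n t) (i n) / real n"
    "\<forall>\<^sub>F n in sequentially. coefA (mm n t) (i n) / real n \<le> g n + 1 / real n"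
    by (auto elim: eventually_mono)
qed

lemma par_tendsto:
  assumes x: "0 < x" "x < 1" and i: "\<forall>\<^sub>F n in sequentially. (i n + 1) div 2 = nat \<lceil>real n * x\<rceil> \<and> i n \<in> {1..2 * n}"
  shows "(\<lambda>n. parA n (i n) / (real (p n) * real n)) \<longlonglongrightarrow> 1 - x"
proof (rule tendsto_cong[THEN iffD1])
  define b where "b n = (of_bool (odd (i n)) / 2 :: real)" for n
  have bn: "(\<lambda>n. b n * (1 / real n)) \<longlonglongrightarrow> 0"
  proof (rule tendsto_rabs_zero_cancel, rule tendsto_sandwich[OF _ _ tendsto_const lim_1_over_n])
    show "\<forall>\<^sub>F n in sequentially. \<bar>b n * (1 / real n)\<bar> \<le> 1 / real n"
      by (intro always_eventually allI) (simp add: b_def abs_mult divide_simps)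
  qed simp
  have "(\<lambda>n. (1 + 1 / real (p n)) * (1 - real (nat \<lceil>real n * x\<rceil>) / real n + 1 / real n + b n * (1 / real n))) \<longlonglongrightarrow> (1 + 0) * (1 - x + 0 + 0)"
    using x by (intro tendsto_mult[OF tendsto_add[OF tendsto_const inverse_p_tendsto] tendsto_add[OF tendsto_add[OF tendsto_diff[OF tendsto_const nat_ceiling_over_tendsto] lim_1_over_n] bn]]) auto
  then show "(\<lambda>n. (1 + 1 / real (p n)) * (1 - real (nat \<lceil>real n * x\<rceil>) / real n + 1 / real n + b n * (1 / real n))) \<longlonglongrightarrow> 1 - x"
    by simp
  show "\<forall>\<^sub>F n in sequentially. (1 + 1 / real (p n)) * (1 - real (nat \<lceil>real n * x\<rceil>) / real n + 1 / real n + b n * (1 / real n)) = parA n (i n) / (real (p n) * real n)"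
    using i p_eventually eventually_gt_at_top[of 0]
  proof eventually_elim
    case (elim n)
    interpret beta_array "M n" "P n" "R n" n "p n" by (rule arr) (use elim in simp)
    have "i n \<le> 2 * n" using elim(1) by simp
    then have "(i n + 1) div 2 \<le> n" by presburger
    then have "height (i n) = real n - real ((i n + 1) div 2) + 1"
      by (simp add: height_def of_nat_diff)
    then have h: "height (i n) = real n - real (nat \<lceil>real n * x\<rceil>) + 1"
      using elim(1) by (simp only:)
    show ?case unfolding par_eq[OF elim(1)[THEN conjunct2]] h b_def using elim by (simp add: field_simps)
  qed
qed

lemma variance_sum_tendsto:
  assumes x: "0 < x" "x < 1" and i: "\<forall>\<^sub>F n in sequentially. (i n + 1) div 2 = nat \<lceil>real n * x\<rceil> \<and> i n \<in> {1..2 * n}"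
    and s: "s \<in> {0..1}"
  shows "(\<lambda>n. (real n)\<^sup>2 * (\<Sum>j=1..<kk n s. vRA n (i n) j)) \<longlonglongrightarrow> s\<^sup>2 / 4 / (1 - x)\<^sup>2"
proof (rule tendsto_sandwich)
  define y where "y n = real (kk n s) / real (p n)" for n
  define z where "z n = parA n (i n) / (real (p n) * real n)" for n
  have y: "y \<longlonglongrightarrow> s" unfolding y_def using s p_lim by (intro nat_floor_over_tendsto) auto
  have z: "z \<longlonglongrightarrow> 1 - x" unfolding z_def by (rule par_tendsto[OF x i])
  \<comment> \<open>\<open>l\<close> and \<open>u\<close> are the bounds of
    \<open>vR_sum_bounds\<close>, multiplied by \<open>n\<^sup>2\<close> and rewritten in the
    convergent ratios \<open>y\<close> and \<open>z\<close>.\<close>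
  define l where "l n = y n * (y n - 1 / real (p n)) / 4 / (z n)\<^sup>2" for n
  define u where "u n = (y n * (y n - 1 / real (p n)) / 4 + y n * (1 / real (p n))) / (z n - 1 / 2 * (1 / real n))\<^sup>2" for n
  have "l \<longlonglongrightarrow> s * (s - 0) / 4 / (1 - x)\<^sup>2" unfolding l_def[abs_def]
    using x by (intro tendsto_intros y z inverse_p_tendsto) auto
  then show "l \<longlonglongrightarrow> s\<^sup>2 / 4 / (1 - x)\<^sup>2" by (simp add: power2_eq_square)
  have "u \<longlonglongrightarrow> (s * (s - 0) / 4 + s * 0) / (1 - x - 1 / 2 * 0)\<^sup>2" unfolding u_def[abs_def]
    using x by (intro tendsto_intros y z inverse_p_tendsto lim_1_over_n) auto
  then show "u \<longlonglongrightarrow> s\<^sup>2 / 4 / (1 - x)\<^sup>2" by (simp add: power2_eq_square)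
  have "\<forall>\<^sub>F n in sequentially. l n \<le> (real n)\<^sup>2 * (\<Sum>j=1..<kk n s. vRA n (i n) j) \<and> (real n)\<^sup>2 * (\<Sum>j=1..<kk n s. vRA n (i n) j) \<le> u n"
    using i p_eventually eventually_gt_at_top[of 0]
  proof eventually_elim
    case (elim n)
    interpret beta_array "M n" "P n" "R n" n "p n" by (rule arr) (use elim in simp)
    have k: "kk n s \<le> p n" by (rule floor_le_nat[OF s])
    note b = vR_sum_bounds[OF elim(1)[THEN conjunct2] k]
    have pn: "real (p n) * real n \<noteq> 0" using elim by simp
    have leq: "l n = (real n)\<^sup>2 * (real (kk n s) * (real (kk n s) - 1) / 4 / (par (i n))\<^sup>2)"
      using elim by (simp add: l_def y_def z_def power_divide power_mult_distrib power2_eq_square diff_divide_distrib[symmetric])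
    have ueq: "u n = (real n)\<^sup>2 * ((real (kk n s) * (real (kk n s) - 1) / 4 + real (kk n s)) / (par (i n) - real (p n) / 2)\<^sup>2)"
    proof -
      have "z n - 1 / 2 * (1 / real n) = (par (i n) - real (p n) / 2) / (real (p n) * real n)"
        using elim by (simp add: z_def diff_divide_distrib)
      moreover have "y n * (y n - 1 / real (p n)) / 4 + y n * (1 / real (p n)) = (real (kk n s) * (real (kk n s) - 1) / 4 + real (kk n s)) / (real (p n))\<^sup>2"
        using elim by (simp add: y_def power2_eq_square field_simps)
      ultimately show ?thesis using elim by (simp add: u_def power_divide power_mult_distrib)
    qed
    show ?case unfolding leq ueq by (intro conjI mult_left_mono b) auto
  qed
  then show "\<forall>\<^sub>F n in sequentially. l n \<le> (real n)\<^sup>2 * (\<Sum>j=1..<kk n s. vRA n (i n) j)"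
    "\<forall>\<^sub>F n in sequentially. (real n)\<^sup>2 * (\<Sum>j=1..<kk n s. vRA n (i n) j) \<le> u n"
    by (auto elim: eventually_mono)
qed

lemma cell_covariance_tendsto:
  assumes x: "0 < x" "x < 1" and i: "\<forall>\<^sub>F n in sequentially. (i n + 1) div 2 = nat \<lceil>real n * x\<rceil> \<and> i n \<in> {1..2 * n}"
    and s: "s \<in> {0..1}" and t: "t \<in> {0..1}" "t' \<in> {0..1}"
  shows "(\<lambda>n. coefA (mm n t) (i n) * coefA (mm n t') (i n) * (\<Sum>j=1..<kk n s. vRA n (i n) j))
    \<longlonglongrightarrow> s\<^sup>2 / 4 * (ramp01 t x * ramp01 t' x)"
proof (rule tendsto_cong[THEN iffD1])
  have i': "\<forall>\<^sub>F n in sequentially. (i n + 1) div 2 = nat \<lceil>real n * x\<rceil>" using i by (auto elim: eventually_mono)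
  have eq: "max 0 (t - x) * max 0 (t' - x) * (s\<^sup>2 / 4 / (1 - x)\<^sup>2) = s\<^sup>2 / 4 * (ramp01 t x * ramp01 t' x)"
    using x by (simp add: ramp01_def max_def power2_eq_square divide_simps)
  have "(\<lambda>n. (coefA (mm n t) (i n) / real n) * (coefA (mm n t') (i n) / real n) * ((real n)\<^sup>2 * (\<Sum>j=1..<kk n s. vRA n (i n) j)))
    \<longlonglongrightarrow> max 0 (t - x) * max 0 (t' - x) * (s\<^sup>2 / 4 / (1 - x)\<^sup>2)"
    using t x s i by (intro tendsto_mult coef_tendsto variance_sum_tendsto i') auto
  then show "(\<lambda>n. (coefA (mm n t) (i n) / real n) * (coefA (mm n t') (i n) / real n) * ((real n)\<^sup>2 * (\<Sum>j=1..<kk n s. vRA n (i n) j)))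
    \<longlonglongrightarrow> s\<^sup>2 / 4 * (ramp01 t x * ramp01 t' x)"
    unfolding eq .
  show "\<forall>\<^sub>F n in sequentially. (coefA (mm n t) (i n) / real n) * (coefA (mm n t') (i n) / real n) * ((real n)\<^sup>2 * (\<Sum>j=1..<kk n s. vRA n (i n) j))
    = coefA (mm n t) (i n) * coefA (mm n t') (i n) * (\<Sum>j=1..<kk n s. vRA n (i n) j)"
    using eventually_gt_at_top[of 0] by eventually_elim (simp add: power2_eq_square)
qed

text \<open>The covariance of the scaled parts with variables \<open>r\<close> at \<open>y\<close>
  and \<open>z\<close>. By independence only common columns contribute, whence the minimum.\<close>

definition RC :: "nat \<Rightarrow> real \<times> real \<Rightarrow> real \<times> real \<Rightarrow> real" where
  "RC n y z = (\<Sum>i=1..2 * n. coefA (mm n (snd y)) i * coefA (mm n (snd z)) i *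
     (\<Sum>j=1..<kk n (min (fst y) (fst z)). vRA n i j)) / real n"

text \<open>The two indices of a row contribute \<open>s\<^sup>2 / 4\<close> each, which makes the
  1/2 in the kernel. The dominating constant 10 is twice 5: a coefficient is at most the height, and
  the variances of an index sum to at most 5 divided by the squared height. It is uniform up to the
  last row, where the variances are largest.\<close>

lemma RC_tendsto:
  assumes y: "y \<in> unit_square" and z: "z \<in> unit_square"
  shows "(\<lambda>n. RC n y z) \<longlonglongrightarrow> limit_kernel y z"
proof -
  obtain s1 t1 s2 t2 where yz: "y = (s1, t1)" "z = (s2, t2)" by (cases y, cases z)
  define s where "s = min s1 s2"
  have st: "s \<in> {0..1}" "t1 \<in> {0..1}" "t2 \<in> {0..1}" using y z by (auto simp: yz s_def)
  define h where "h n i = coefA (mm n t1) i * coefA (mm n t2) i * (\<Sum>j=1..<kk n s. vRA n i j)" for n i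
  define F where "F n r = h n (2 * r) + h n (2 * r - 1)" for n r
  have "(\<lambda>n. (\<Sum>r=1..n. F n r) / real n) \<longlonglongrightarrow> (\<integral>x. indicator {0<..<1} x * (s\<^sup>2 / 2 * (ramp01 t1 x * ramp01 t2 x)) \<partial>lborel)"
  proof (rule average_tendsto_integral[where B = 10])
    fix n r :: nat assume r: "r \<in> {1..n}"
    interpret beta_array "M n" "P n" "R n" n "p n" by (rule arr) (use r in simp)
    have m: "mm n t1 \<le> n" "mm n t2 \<le> n" "kk n s \<le> p n" using st by (auto intro: floor_le_nat)
    have "\<bar>h n i\<bar> \<le> 5" if i: "i \<in> {1..2 * n}" for i
    proof -
      have hi: "height i \<ge> 1" by (rule height_ge_1)
      have "(\<Sum>j=1..<kk n s. vR i j) \<le> (\<Sum>j=1..<kk n s. 5 / (real (p n) * (height i)\<^sup>2))"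
        using m by (intro sum_mono R_cell(5)[OF i]) auto
      also have "\<dots> \<le> real (p n) * (5 / (real (p n) * (height i)\<^sup>2))"
        unfolding sum_constant by (intro mult_right_mono) (use m in auto)
      also have "\<dots> = 5 / (height i)\<^sup>2" using q_pos by simp
      finally have a: "(\<Sum>j=1..<kk n s. vR i j) \<le> 5 / (height i)\<^sup>2" .
      have b: "(\<Sum>j=1..<kk n s. vR i j) \<ge> 0" using m by (intro sum_nonneg vR_nonneg[OF i]) auto
      have c': "coefA (mm n t1) i * coefA (mm n t2) i \<le> height i * height i" "0 \<le> coefA (mm n t1) i * coefA (mm n t2) i"
        using coef_bounds m hi by (auto intro!: mult_mono)
      have "h n i \<le> (height i * height i) * (5 / (height i)\<^sup>2)"
        unfolding h_def by (rule mult_mono[OF c'(1) a]) (use b c' in auto)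
      also have "\<dots> = 5" using hi by (simp add: power2_eq_square)
      finally show ?thesis using mult_nonneg_nonneg[OF c'(2) b] by (simp only: h_def abs_of_nonneg)
    qed
    moreover have "2 * r \<in> {1..2 * n}" "2 * r - 1 \<in> {1..2 * n}" using r by auto
    ultimately have "\<bar>h n (2 * r)\<bar> \<le> 5" "\<bar>h n (2 * r - 1)\<bar> \<le> 5" by blast+
    then show "\<bar>F n r\<bar> \<le> 10" unfolding F_def by linarith
  next
    show "(\<lambda>x. s\<^sup>2 / 2 * (ramp01 t1 x * ramp01 t2 x)) \<in> borel_measurable borel"
      unfolding ramp01_def by measurable
    show "AE x in lborel. 0 < x \<and> x < 1 \<longrightarrow> (\<lambda>n. F n (nat \<lceil>real n * x\<rceil>)) \<longlonglongrightarrow> s\<^sup>2 / 2 * (ramp01 t1 x * ramp01 t2 x)"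
    proof (intro AE_I2 impI)
      fix x :: real assume x: "0 < x \<and> x < 1"
      have r: "nat \<lceil>real n * x\<rceil> \<in> {1..n}" if "n \<ge> 1" for n
      proof -
        have "0 < real n * x" "real n * x \<le> real n * 1" using that x by (auto intro: mult_left_mono)
        then show ?thesis by (auto simp: nat_le_iff ceiling_le_iff Suc_le_eq)
      qed
      have "(\<lambda>n. h n (2 * nat \<lceil>real n * x\<rceil>)) \<longlonglongrightarrow> s\<^sup>2 / 4 * (ramp01 t1 x * ramp01 t2 x)"
        unfolding h_def using x st r
        by (intro cell_covariance_tendsto) (auto intro!: eventually_sequentiallyI[of 1])
      moreover have "(\<lambda>n. h n (2 * nat \<lceil>real n * x\<rceil> - 1)) \<longlonglongrightarrow> s\<^sup>2 / 4 * (ramp01 t1 x * ramp01 t2 x)"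
        unfolding h_def
      proof (intro cell_covariance_tendsto eventually_sequentiallyI[of 1])
        fix n :: nat assume "1 \<le> n"
        have "(2 * y - 1 + 1) div 2 = y \<and> 2 * y - 1 \<in> {1..2 * n}" if "y \<in> {1..n}" for y :: nat using that by auto
        from this[OF r[OF \<open>1 \<le> n\<close>]] show "(2 * nat \<lceil>real n * x\<rceil> - 1 + 1) div 2 = nat \<lceil>real n * x\<rceil> \<and> 2 * nat \<lceil>real n * x\<rceil> - 1 \<in> {1..2 * n}" .
      qed (use x st in auto)
      ultimately have "(\<lambda>n. F n (nat \<lceil>real n * x\<rceil>)) \<longlonglongrightarrow> s\<^sup>2 / 4 * (ramp01 t1 x * ramp01 t2 x) + s\<^sup>2 / 4 * (ramp01 t1 x * ramp01 t2 x)"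
        unfolding F_def by (rule tendsto_add)
      then show "(\<lambda>n. F n (nat \<lceil>real n * x\<rceil>)) \<longlonglongrightarrow> s\<^sup>2 / 2 * (ramp01 t1 x * ramp01 t2 x)" by (simp add: mult_ac)
    qed
  qed
  also have "(\<lambda>n. (\<Sum>r=1..n. F n r) / real n) = (\<lambda>n. RC n y z)"
    unfolding F_def sum_even_odd_Icc[symmetric] by (simp only: RC_def h_def[abs_def] yz s_def fst_conv snd_conv)
  also have "(\<integral>x. indicator {0<..<1} x * (s\<^sup>2 / 2 * (ramp01 t1 x * ramp01 t2 x)) \<partial>lborel) = limit_kernel y z"
  proof -
    have "(\<integral>x. indicator {0<..<1} x * (s\<^sup>2 / 2 * (ramp01 t1 x * ramp01 t2 x)) \<partial>lborel)
      = s\<^sup>2 / 2 * (\<integral>x. indicator {0<..<1} x * (ramp01 t1 x * ramp01 t2 x) \<partial>lborel)"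
      by (simp add: mult.left_commute flip: integral_mult_right_zero)
    also have "(\<integral>x. indicator {0<..<1} x * (ramp01 t1 x * ramp01 t2 x) \<partial>lborel) = (LINT x:{0..1}|lborel. ramp01 t1 x * ramp01 t2 x)"
      unfolding set_lebesgue_integral_def
    proof (rule integral_cong_AE)
      have "AE x in lborel. x \<noteq> 0" "AE x in lborel. x \<noteq> (1::real)" by (rule AE_lborel_singleton)+
      then show "AE x in lborel. indicator {0<..<1} x * (ramp01 t1 x * ramp01 t2 x) = indicat_real {0..1} x *\<^sub>R (ramp01 t1 x * ramp01 t2 x)"
        by eventually_elim (auto simp: indicator_def)
    qed (unfold ramp01_def, measurable)
    also have "\<dots> = integral {0..1} (\<lambda>x. ramp01 t1 x * ramp01 t2 x)"
      using st by (intro decreasing01_mult_integrable(3)[symmetric] decreasing01_ramp) auto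
    also have "\<dots> = c t1 t2" by (rule ramp01_inner[OF st(2,3)])
    finally show ?thesis by (simp add: limit_kernel_def yz s_def)
  qed
  finally show ?thesis .
qed

lemma min_kk: "kk n (min s s') = min (kk n s) (kk n s')"
  by (rule min_of_mono[symmetric, unfolded mono_def]) (auto intro!: nat_mono floor_mono mult_left_mono)

lemma inverse_tendsto:
  "(\<lambda>n. x / sqrt (real n)) \<longlonglongrightarrow> 0" "(\<lambda>n. x / real (p n)) \<longlonglongrightarrow> 0"
proof -
  have "filterlim (\<lambda>n. sqrt (real n)) at_top sequentially"
    by (rule filterlim_compose[OF sqrt_at_top filterlim_real_sequentially])
  then show "(\<lambda>n. x / sqrt (real n)) \<longlonglongrightarrow> 0" by (intro real_tendsto_divide_at_top[OF tendsto_const])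
  show "(\<lambda>n. x / real (p n)) \<longlonglongrightarrow> 0"
    using tendsto_mult[OF tendsto_const inverse_p_tendsto, of x] by simp
qed

lemma sqrt_error_tendsto: "(\<lambda>n. sqrt (C * (52 / sqrt (real n) + 20 / real (p n)))) \<longlonglongrightarrow> 0"
proof -
  have "(\<lambda>n. sqrt (C * (52 / sqrt (real n) + 20 / real (p n)))) \<longlonglongrightarrow> sqrt (C * (0 + 0))"
    by (intro tendsto_intros inverse_tendsto)
  then show ?thesis by simp
qed

lemma char_tendsto:
  fixes d :: nat and \<tau> :: "nat \<Rightarrow> real \<times> real"
  assumes \<tau>: "\<And>a. a < d \<Longrightarrow> \<tau> a \<in> unit_square"
  shows "(\<lambda>n. \<integral>\<omega>. iexp (\<Sum>a<d. u a * (field n (kk n (fst (\<tau> a))) (mm n (snd (\<tau> a))) \<omega> / sqrt (real n))) \<partial>M n)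
    \<longlonglongrightarrow> exp (- (\<Sum>a<d. \<Sum>b<d. u a * u b * limit_kernel (\<tau> a) (\<tau> b)) / 2)"
proof -
  define k where "k n a = kk n (fst (\<tau> a))" for n a
  define m where "m n a = mm n (snd (\<tau> a))" for n a
  have k: "k n a \<le> p n" and m: "m n a \<le> n" if "a < d" for n a
    using \<tau>[OF that] floor_le_nat by (auto simp: k_def m_def)
  define J where "J n = beta_array.R_index n (p n)" for n
  define Y where "Y n x \<omega> = beta_array.linear_coef d u (k n) (m n) x / sqrt (real n) * beta_array.R_noise (M n) (P n) (R n) x \<omega>" for n x \<omega>
  define V where "V n = (\<Sum>a<d. \<Sum>b<d. u a * u b * RC n (\<tau> a) (\<tau> b))" for n
  define U where "U = (\<Sum>a<d. \<bar>u a\<bar>)"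
  have U: "U \<ge> 0" by (auto simp: U_def intro: sum_nonneg)
  have facts: "finite (J n) \<and> prob_space.indep_vars (M n) (\<lambda>_. borel) (Y n) (J n) \<and>
      (\<forall>x\<in>J n. integrable (M n) (\<lambda>\<omega>. (Y n x \<omega>)\<^sup>2) \<and> integrable (M n) (\<lambda>\<omega>. (Y n x \<omega>) ^ 4) \<and> (\<integral>\<omega>. Y n x \<omega> \<partial>M n) = 0) \<and>
      (\<Sum>x\<in>J n. \<integral>\<omega>. (Y n x \<omega>)\<^sup>2 \<partial>M n) = V n \<and>
      (\<Sum>x\<in>J n. \<integral>\<omega>. (Y n x \<omega>) ^ 4 \<partial>M n) \<le> 440 * U ^ 4 / real (p n) \<and>
      cmod ((\<integral>\<omega>. iexp (\<Sum>a<d. u a * (field n (k n a) (m n a) \<omega> / sqrt (real n))) \<partial>M n) - (\<integral>\<omega>. iexp (1 * (\<Sum>x\<in>J n. Y n x \<omega>)) \<partial>M n))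
       \<le> sqrt ((\<Sum>a<d. (u a)\<^sup>2) * real d * (52 / sqrt (real n) + 20 / real (p n)))" if n: "n \<ge> 1" for n
  proof -
    interpret beta_array "M n" "P n" "R n" n "p n" by (rule arr[OF n])
    have J: "J n = R_index" by (simp add: J_def)
    have Yx: "Y n x = (\<lambda>\<omega>. linear_coef d u (k n) (m n) x / sqrt (real n) * R_noise x \<omega>)" for x by (simp add: Y_def fun_eq_iff)
    have n0: "real n > 0" using n by simp
    have 1: "finite R_index" by (simp add: R_index_def)
    have 2: "indep_vars (\<lambda>_. borel) (Y n) R_index"
      using R_noise_indep[of "\<lambda>x. linear_coef d u (k n) (m n) x / sqrt (real n)"] by (simp add: Y_def[abs_def])
    have 3: "integrable (M n) (\<lambda>\<omega>. (Y n x \<omega>) ^ l)" "expectation (Y n x) = 0"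
      "expectation (\<lambda>\<omega>. (Y n x \<omega>)\<^sup>2) = (linear_coef d u (k n) (m n) x)\<^sup>2 * vR (fst x) (snd x) / real n" if "x \<in> R_index" for x l
      using R_noise_facts[OF that] by (simp_all add: Yx power_mult_distrib power_divide)
    have "(\<Sum>x\<in>R_index. expectation (\<lambda>\<omega>. (Y n x \<omega>)\<^sup>2)) = (\<Sum>x\<in>R_index. (linear_coef d u (k n) (m n) x)\<^sup>2 * vR (fst x) (snd x)) / real n"
      by (simp add: 3(3) sum_divide_distrib)
    also have "\<dots> = V n"
      by (subst linear_coef_variance[of d "k n" u "m n"], erule k)
        (simp only: V_def RC_def min_kk k_def m_def times_divide_eq_right sum_divide_distrib[symmetric])
    finally have 4: "(\<Sum>x\<in>R_index. expectation (\<lambda>\<omega>. (Y n x \<omega>)\<^sup>2)) = V n" .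
    have 5: "(\<Sum>x\<in>R_index. expectation (\<lambda>\<omega>. (Y n x \<omega>) ^ 4)) \<le> 440 * U ^ 4 / real (p n)"
      unfolding Yx
    proof (rule R_fourth_moments[OF _ U])
      show "\<bar>linear_coef d u (k n) (m n) (i, j) / sqrt (real n)\<bar> \<le> U * height i / sqrt (real n)" for i j
        using linear_coef_bound[of d "m n" u "k n" "(i, j)", OF m] by (simp add: U_def divide_right_mono)
    qed
    have 6: "cmod ((\<integral>\<omega>. iexp (\<Sum>a<d. u a * (WW (k n a) (m n a) \<omega> / sqrt (real n))) \<partial>M n) - (\<integral>\<omega>. iexp (1 * (\<Sum>x\<in>R_index. Y n x \<omega>)) \<partial>M n))
       \<le> sqrt ((\<Sum>a<d. (u a)\<^sup>2) * real d * (52 / sqrt (real n) + 20 / real (p n)))"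
      using linear_char[of d "m n" u "k n", OF m] by (simp add: Yx)
    show ?thesis unfolding J using 1 2 3 4 5 6 by blast
  qed
  have V: "V \<longlonglongrightarrow> (\<Sum>a<d. \<Sum>b<d. u a * u b * limit_kernel (\<tau> a) (\<tau> b))"
    unfolding V_def[abs_def] using \<tau> by (intro tendsto_sum tendsto_mult tendsto_const RC_tendsto) auto
  have ev: "\<forall>\<^sub>F n in sequentially. n \<ge> (1::nat)" by (rule eventually_ge_at_top)
  \<comment> \<open>The theorem is used at \<open>t = 1\<close>, since all scaling is contained in
    \<open>u\<close>.\<close>
  have lim: "(\<lambda>n. \<integral>\<omega>. iexp (1 * (\<Sum>x\<in>J n. Y n x \<omega>)) \<partial>M n) \<longlonglongrightarrow> exp (- (1\<^sup>2 * (\<Sum>a<d. \<Sum>b<d. u a * u b * limit_kernel (\<tau> a) (\<tau> b))) / 2)"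
  proof (rule lyapunov_clt[OF prob])
    show "\<forall>\<^sub>F n in sequentially. finite (J n) \<and> prob_space.indep_vars (M n) (\<lambda>_. borel) (Y n) (J n) \<and>
      (\<forall>x\<in>J n. integrable (M n) (\<lambda>\<omega>. (Y n x \<omega>)\<^sup>2) \<and> integrable (M n) (\<lambda>\<omega>. (Y n x \<omega>) ^ 4) \<and> (\<integral>\<omega>. Y n x \<omega> \<partial>M n) = 0)"
      using ev by eventually_elim (use facts in blast)
    show "(\<lambda>n. \<Sum>x\<in>J n. \<integral>\<omega>. (Y n x \<omega>)\<^sup>2 \<partial>M n) \<longlonglongrightarrow> (\<Sum>a<d. \<Sum>b<d. u a * u b * limit_kernel (\<tau> a) (\<tau> b))"
      by (rule Lim_transform_eventually[OF V]) (use ev in eventually_elim, use facts in metis)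
    show "(\<lambda>n. \<Sum>x\<in>J n. \<integral>\<omega>. (Y n x \<omega>) ^ 4 \<partial>M n) \<longlonglongrightarrow> 0"
    proof (rule tendsto_sandwich)
      show "\<forall>\<^sub>F n in sequentially. 0 \<le> (\<Sum>x\<in>J n. \<integral>\<omega>. (Y n x \<omega>) ^ 4 \<partial>M n)"
        by (intro always_eventually allI sum_nonneg integral_nonneg_AE) auto
      show "\<forall>\<^sub>F n in sequentially. (\<Sum>x\<in>J n. \<integral>\<omega>. (Y n x \<omega>) ^ 4 \<partial>M n) \<le> 440 * U ^ 4 / real (p n)"
        using ev by eventually_elim (use facts in blast)
      show "(\<lambda>n. 440 * U ^ 4 / real (p n)) \<longlonglongrightarrow> 0"
        using tendsto_mult[OF tendsto_const inverse_p_tendsto, of "440 * U ^ 4"] by simp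
    qed simp
  qed
  have err: "(\<lambda>n. (\<integral>\<omega>. iexp (\<Sum>a<d. u a * (field n (k n a) (m n a) \<omega> / sqrt (real n))) \<partial>M n) - (\<integral>\<omega>. iexp (1 * (\<Sum>x\<in>J n. Y n x \<omega>)) \<partial>M n)) \<longlonglongrightarrow> 0"
    by (rule Lim_null_comparison[OF _ sqrt_error_tendsto]) (use ev in eventually_elim, use facts in blast)
  from tendsto_add[OF err lim] show ?thesis by (simp add: k_def m_def)
qed

end

section \<open>The limit theorem\<close>

text \<open>For \<open>n = 0\<close> the process vanishes, whereas the grid needs at least one step.\<close>

lemma H_eq_grid:
  assumes "q \<ge> 1" "z \<in> unit_square"
  shows "H n q P R (fst z) (snd z) = H n q P R (fst (grid q (max 1 n) z)) (snd (grid q (max 1 n) z))"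
proof -
  have "nat \<lfloor>real n * (real (nat \<lfloor>real (max 1 n) * t\<rfloor>) / real (max 1 n))\<rfloor> = nat \<lfloor>real n * t\<rfloor>" if "t \<ge> 0" for t
    using that by (cases n) auto
  moreover have "nat \<lfloor>real q * (real (nat \<lfloor>real q * s\<rfloor>) / real q)\<rfloor> = nat \<lfloor>real q * s\<rfloor>" for s
    using assms by simp
  ultimately show ?thesis using assms(2) by (auto simp: H_def grid_def)
qed

text \<open>The points of a sequence may coincide, whereas \<open>gaussian_process\<close> speaks
  about sets of points; \<open>w\<close> merges the coefficients of equal points.\<close>

lemma gaussian_char_indexed:
  fixes \<tau> :: "nat \<Rightarrow> 't::topological_space"
  assumes G: "centered_continuous_gaussian_process N T K G" and \<tau>: "\<And>a. a < d \<Longrightarrow> \<tau> a \<in> T"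
  shows "(\<integral>\<omega>. iexp (\<Sum>a<d. u a * G \<omega> (\<tau> a)) \<partial>N) = exp (- (\<Sum>a<d. \<Sum>b<d. u a * u b * K (\<tau> a) (\<tau> b)) / 2)"
proof -
  define J where "J = \<tau> ` {..<d}"
  define w where "w y = (\<Sum>a\<in>{a\<in>{..<d}. \<tau> a = y}. u a)" for y
  have group: "(\<Sum>a<d. u a * f (\<tau> a)) = (\<Sum>y\<in>J. w y * f y)" for f :: "'t \<Rightarrow> real"
  proof -
    have "(\<Sum>a<d. u a * f (\<tau> a)) = (\<Sum>y\<in>J. \<Sum>a\<in>{a\<in>{..<d}. \<tau> a = y}. u a * f (\<tau> a))"
      unfolding J_def by (rule sum.image_gen) simp
    also have "\<dots> = (\<Sum>y\<in>J. w y * f y)"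
      unfolding w_def sum_distrib_right by (intro sum.cong) auto
    finally show ?thesis .
  qed
  have "(\<Sum>a<d. \<Sum>b<d. u a * u b * K (\<tau> a) (\<tau> b)) = (\<Sum>a<d. u a * (\<Sum>b<d. u b * K (\<tau> a) (\<tau> b)))"
    by (simp add: sum_distrib_left mult.assoc)
  also have "\<dots> = (\<Sum>y\<in>J. \<Sum>z\<in>J. w y * w z * K y z)"
    unfolding group[of "K _"] unfolding group[of "\<lambda>t. \<Sum>y\<in>J. w y * K t y"] by (simp add: sum_distrib_left mult.assoc)
  finally show ?thesis
    unfolding group using centered_gaussian_process_facts(3)[OF G, of J w] \<tau> by (auto simp: J_def)
qed

context beta_arrays
begin

definition Ht :: "nat \<Rightarrow> 'a \<Rightarrow> real \<times> real \<Rightarrow> real" where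
  "Ht n \<omega> = (\<lambda>(s, t)\<in>unit_square.
     (H n (p n) (\<lambda>i j. P n i j \<omega>) (\<lambda>i j. R n i j \<omega>) s t
       - (\<integral>\<omega>'. H n (p n) (\<lambda>i j. P n i j \<omega>') (\<lambda>i j. R n i j \<omega>') s t \<partial>M n)) / sqrt (real n))"

abbreviation "fieldz n z \<omega> \<equiv> field n (kk n (fst z)) (mm n (snd z)) \<omega> / sqrt (real n)"

lemma Ht_AE:
  assumes "n \<ge> 1"
  shows "AE \<omega> in M n. \<forall>z\<in>unit_square. Ht n \<omega> z = fieldz n z \<omega>"
proof -
  interpret beta_array "M n" "P n" "R n" n "p n" by (rule arr[OF assms])
  show ?thesis using AE_Hr_centered
  proof eventually_elim
    case (elim \<omega>)
    show ?case
    proof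
      fix z :: "real \<times> real" assume "z \<in> unit_square"
      then obtain s t where z: "z = (s, t)" "s \<in> {0..1}" "t \<in> {0..1}" by auto
      have "Hr s t \<omega> - expectation (Hr s t) = WW (kk n s) (mm n t) \<omega>"
        using elim z(2,3) unfolding WW_def by blast
      then show "Ht n \<omega> z = fieldz n z \<omega>" using z by (simp add: Ht_def)
    qed
  qed
qed

lemma Ht_borel:
  assumes "z \<in> unit_square"
  shows "(\<lambda>\<omega>. Ht n \<omega> z) \<in> borel_measurable (M n)"
proof -
  obtain s t where z: "z = (s, t)" "s \<in> {0..1}" "t \<in> {0..1}" using assms by auto
  have "(\<lambda>\<omega>. H n (p n) (\<lambda>i j. P n i j \<omega>) (\<lambda>i j. R n i j \<omega>) s t) \<in> borel_measurable (M n)"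
  proof (cases "n \<ge> 1")
    case True
    interpret beta_array "M n" "P n" "R n" n "p n" by (rule arr[OF True])
    show ?thesis by (rule Hr_borel[OF z(2,3)])
  next
    case False
    then have "n = 0" by simp
    then have "(\<lambda>\<omega>. H n (p n) (\<lambda>i j. P n i j \<omega>) (\<lambda>i j. R n i j \<omega>) s t) = (\<lambda>\<omega>. 0)" by (simp add: H_def)
    then show ?thesis by simp
  qed
  note this[measurable]
  show ?thesis unfolding Ht_def using z by simp
qed

text \<open>\<open>H\<close> depends on \<open>z\<close> only through the two floors, everywhere and
  not only almost surely, so \<open>Ht n\<close> equals its own discretisation on a finite
  grid.\<close>

lemma Ht_measurable: "Ht n \<in> measurable (M n) (metric_borel (l_infinity unit_square))"
proof -
  have p1: "p n \<ge> 1" using p_pos[of n] by simp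
  have im: "grid (p n) (max 1 n) ` unit_square \<subseteq> unit_square" by (intro grid_image p1) simp
  have "Ht n \<omega> = restrict (\<lambda>z. Ht n \<omega> (grid (p n) (max 1 n) z)) unit_square" for \<omega>
  proof
    fix z
    show "Ht n \<omega> z = restrict (\<lambda>z. Ht n \<omega> (grid (p n) (max 1 n) z)) unit_square z"
    proof (cases "z \<in> unit_square")
      case True
      have eq: "H n (p n) P' R' (fst z) (snd z) = H n (p n) P' R' (fst (grid (p n) (max 1 n) z)) (snd (grid (p n) (max 1 n) z))" for P' R'
        by (rule H_eq_grid[OF p1 True])
      have Htz: "Ht n \<omega> y = (H n (p n) (\<lambda>i j. P n i j \<omega>) (\<lambda>i j. R n i j \<omega>) (fst y) (snd y)
         - (\<integral>\<omega>'. H n (p n) (\<lambda>i j. P n i j \<omega>') (\<lambda>i j. R n i j \<omega>') (fst y) (snd y) \<partial>M n)) / sqrt (real n)" if "y \<in> unit_square" for y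
        using that by (auto simp: Ht_def)
      have "grid (p n) (max 1 n) z \<in> unit_square" using im True by blast
      then show ?thesis unfolding restrict_apply if_P[OF True] Htz[OF True] by (subst Htz) (simp_all only: eq)
    qed (simp add: Ht_def del: mem_Sigma_iff)
  qed
  then have "Ht n = (\<lambda>\<omega>. restrict (\<lambda>z. Ht n \<omega> (grid (p n) (max 1 n) z)) unit_square)" by (rule ext)
  also have "\<dots> \<in> measurable (M n) (metric_borel (l_infinity unit_square))"
    by (rule measurable_discretised[OF grid_finite im _ Ht_borel]) auto
  finally show ?thesis .
qed

lemma field_borel: "n \<ge> 1 \<Longrightarrow> field n k m \<in> borel_measurable (M n)"
  by (rule beta_array.WW_borel[OF arr])

lemma Ht_square:
  assumes "n \<ge> 1" "z \<in> unit_square"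
  shows "integrable (M n) (\<lambda>\<omega>. (Ht n \<omega> z)\<^sup>2)" "(\<integral>\<omega>. (Ht n \<omega> z)\<^sup>2 \<partial>M n) \<le> 96"
proof -
  interpret beta_array "M n" "P n" "R n" n "p n" by (rule arr[OF assms(1)])
  define k m where "k = kk n (fst z)" and "m = mm n (snd z)"
  have mn: "m \<le> n" unfolding m_def by (rule floor_le_nat) (use assms(2) in auto)
  have ae: "AE \<omega> in M n. (Ht n \<omega> z)\<^sup>2 = (WW k m \<omega>)\<^sup>2 / real n"
    using Ht_AE[OF assms(1)]
  proof eventually_elim
    case (elim \<omega>)
    then show ?case using bspec[OF elim assms(2)] by (simp add: power_divide k_def m_def)
  qed
  have m1: "(\<lambda>\<omega>. (Ht n \<omega> z)\<^sup>2) \<in> borel_measurable (M n)" using Ht_borel[OF assms(2)] by measurable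
  have m2: "(\<lambda>\<omega>. (WW k m \<omega>)\<^sup>2 / real n) \<in> borel_measurable (M n)" by measurable
  show "integrable (M n) (\<lambda>\<omega>. (Ht n \<omega> z)\<^sup>2)"
    using integrable_cong_AE[OF m1 m2 ae] WW_square(1)[OF mn] by simp
  have "(\<integral>\<omega>. (Ht n \<omega> z)\<^sup>2 \<partial>M n) = expectation (\<lambda>\<omega>. (WW k m \<omega>)\<^sup>2) / real n"
    using integral_cong_AE[OF m1 m2 ae] by simp
  also have "\<dots> \<le> 96 * real n / real n" by (intro divide_right_mono WW_square(2)[OF mn]) simp
  finally show "(\<integral>\<omega>. (Ht n \<omega> z)\<^sup>2 \<partial>M n) \<le> 96" using assms(1) by simp
qed

lemma Ht_fdd:
  fixes \<tau> :: "nat \<Rightarrow> real \<times> real" and N :: "'b measure"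
  assumes G: "centered_continuous_gaussian_process N unit_square limit_kernel G" and \<tau>: "\<And>k. \<tau> k \<in> unit_square"
    and lip: "\<And>x y :: nat \<Rightarrow> real. \<bar>g x - g y\<bar> \<le> L * (\<Sum>k<d. \<bar>x k - y k\<bar>)" and bdd: "\<And>x. \<bar>g x\<bar> \<le> B"
  shows "(\<lambda>n. \<integral>\<omega>. g (\<lambda>k. Ht n \<omega> (\<tau> k)) \<partial>M n) \<longlonglongrightarrow> (\<integral>\<omega>. g (\<lambda>k. G \<omega> (\<tau> k)) \<partial>N)"
proof (rule fdd_convergence[where X = "\<lambda>n \<omega> k. Ht n \<omega> (\<tau> k)" and Y = "\<lambda>\<omega> k. G \<omega> (\<tau> k)" and K = 96, OF prob _ _ _ _ _ _ lip bdd])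
  show "prob_space N" using G by (simp add: centered_continuous_gaussian_process_def)
  show "(\<lambda>\<omega>. Ht n \<omega> (\<tau> i)) \<in> borel_measurable (M n)" for n i by (rule Ht_borel[OF \<tau>])
  show "(\<lambda>\<omega>. G \<omega> (\<tau> i)) \<in> borel_measurable N" for i by (rule centered_gaussian_process_facts(1)[OF G \<tau>])
  show "integrable N (\<lambda>\<omega>. (G \<omega> (\<tau> i))\<^sup>2)" for i by (rule centered_gaussian_process_facts(2)[OF G \<tau>])
  show "\<forall>\<^sub>F n in sequentially. \<forall>i<d. integrable (M n) (\<lambda>\<omega>. (Ht n \<omega> (\<tau> i))\<^sup>2) \<and> (\<integral>\<omega>. (Ht n \<omega> (\<tau> i))\<^sup>2 \<partial>M n) \<le> 96"
    by (intro eventually_sequentiallyI[of 1] allI impI conjI Ht_square \<tau>)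
  show "(\<lambda>n. \<integral>\<omega>. iexp (\<Sum>i<d. u i * Ht n \<omega> (\<tau> i)) \<partial>M n) \<longlonglongrightarrow> (\<integral>\<omega>. iexp (\<Sum>i<d. u i * G \<omega> (\<tau> i)) \<partial>N)" for u
  proof (rule Lim_transform_eventually)
    show "(\<lambda>n. \<integral>\<omega>. iexp (\<Sum>i<d. u i * fieldz n (\<tau> i) \<omega>) \<partial>M n) \<longlonglongrightarrow> (\<integral>\<omega>. iexp (\<Sum>i<d. u i * G \<omega> (\<tau> i)) \<partial>N)"
      unfolding gaussian_char_indexed[OF G \<tau>] by (rule char_tendsto[OF \<tau>])
    show "\<forall>\<^sub>F n in sequentially. (\<integral>\<omega>. iexp (\<Sum>i<d. u i * fieldz n (\<tau> i) \<omega>) \<partial>M n) = (\<integral>\<omega>. iexp (\<Sum>i<d. u i * Ht n \<omega> (\<tau> i)) \<partial>M n)"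
    proof (rule eventually_sequentiallyI[of 1])
      fix n :: nat assume n: "1 \<le> n"
      have f: "(\<lambda>\<omega>. \<Sum>i<d. u i * fieldz n (\<tau> i) \<omega>) \<in> borel_measurable (M n)"
        by (intro borel_measurable_sum borel_measurable_times borel_measurable_divide borel_measurable_const field_borel n)
      have h: "(\<lambda>\<omega>. \<Sum>i<d. u i * Ht n \<omega> (\<tau> i)) \<in> borel_measurable (M n)"
        by (intro borel_measurable_sum borel_measurable_times borel_measurable_const Ht_borel \<tau>)
      note f[measurable] h[measurable]
      show "(\<integral>\<omega>. iexp (\<Sum>i<d. u i * fieldz n (\<tau> i) \<omega>) \<partial>M n) = (\<integral>\<omega>. iexp (\<Sum>i<d. u i * Ht n \<omega> (\<tau> i)) \<partial>M n)"
      proof (rule integral_cong_AE)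
        show "AE \<omega> in M n. iexp (\<Sum>i<d. u i * fieldz n (\<tau> i) \<omega>) = iexp (\<Sum>i<d. u i * Ht n \<omega> (\<tau> i))"
          using Ht_AE[OF n]
        proof eventually_elim
          case (elim \<omega>)
          have "(\<Sum>i<d. u i * fieldz n (\<tau> i) \<omega>) = (\<Sum>i<d. u i * Ht n \<omega> (\<tau> i))"
            by (intro sum.cong refl arg_cong2[where f = "(*)"] bspec[OF elim, symmetric] \<tau>)
          then show ?case by simp
        qed
      qed measurable
    qed
  qed
qed

definition osc_bound :: "nat \<Rightarrow> nat \<Rightarrow> real \<Rightarrow> nat \<Rightarrow> real" where
  "osc_bound K L a n = 512 * 24 * (sqrt (1 / real L + 1 / real n) + 1 / sqrt (real n)) / a\<^sup>2
      + real (K * Suc L) * (32 * (440 / real (p n) + 3 * (10 * (1 / real K + 1 / real (p n)))\<^sup>2) / a ^ 4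
        + 32 * (52 / sqrt (real n) + 20 / real (p n)) / a\<^sup>2)"

lemma osc_bound_tendsto:
  "osc_bound K L a \<longlonglongrightarrow> 12288 * sqrt (1 / real L) / a\<^sup>2 + real (K * Suc L) * (32 * (3 * (10 / real K)\<^sup>2) / a ^ 4)"
\<comment> \<open>For \<open>a = 0\<close> all quotients are 0 by convention, on both sides.\<close>
proof (cases "a = 0")
  case True
  then show ?thesis by (simp add: osc_bound_def[abs_def])
next
  case False
  have "osc_bound K L a \<longlonglongrightarrow> 512 * 24 * (sqrt (1 / real L + 0) + 0) / a\<^sup>2
      + real (K * Suc L) * (32 * (0 + 3 * (10 * (1 / real K + 0))\<^sup>2) / a ^ 4 + 32 * (0 + 0) / a\<^sup>2)"
    unfolding osc_bound_def[abs_def] using False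
    by (intro tendsto_intros inverse_tendsto lim_1_over_n) auto
  then show ?thesis by simp
qed

text \<open>The order of the choices matters: \<open>L\<close> makes the window term small;
  \<open>K\<close> is then taken large depending on \<open>L\<close>, since the
  \<open>K * Suc L\<close> block terms are of order \<open>1 / K\<^sup>2\<close> each;
  \<open>n\<close> comes last. The lower bound \<open>m\<close> leaves room for the limit process,
  and \<open>a = e / 4\<close> undoes the factor 4 of \<open>grid_oscillation\<close>.\<close>

lemma Ht_grid_approx:
  assumes "e > 0"
  shows "\<exists>K\<ge>m. \<exists>L\<ge>m. 1 \<le> K \<and> 1 \<le> L \<and> (\<forall>\<^sub>F n in sequentially. \<exists>A\<in>sets (M n). measure (M n) A \<ge> 1 - e \<and>
         (\<forall>\<omega>\<in>A. \<forall>z\<in>unit_square. \<bar>Ht n \<omega> z - Ht n \<omega> (grid K L z)\<bar> \<le> e))"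
proof -
  define a where "a = e / 4"
  have a: "a > 0" using assms by (simp add: a_def)
  have "(\<lambda>L. 12288 * sqrt (1 / real L) / a\<^sup>2) \<longlonglongrightarrow> 12288 * sqrt 0 / a\<^sup>2"
    using a by (intro tendsto_intros lim_1_over_n) auto
  then have "\<forall>\<^sub>F L in sequentially. 12288 * sqrt (1 / real L) / a\<^sup>2 < e / 2"
    using assms by (intro order_tendstoD(2)) auto
  then have "\<forall>\<^sub>F L in sequentially. 12288 * sqrt (1 / real L) / a\<^sup>2 < e / 2 \<and> L \<ge> max m 1"
    using eventually_ge_at_top by (rule eventually_conj)
  then obtain L where L: "12288 * sqrt (1 / real L) / a\<^sup>2 < e / 2" "L \<ge> max m 1"
    by (auto simp: eventually_sequentially)
  have "(\<lambda>K. 9600 * real (Suc L) / a ^ 4 * (1 / real K)) \<longlonglongrightarrow> 9600 * real (Suc L) / a ^ 4 * 0"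
    by (intro tendsto_intros lim_1_over_n)
  then have K1: "\<forall>\<^sub>F K in sequentially. 9600 * real (Suc L) / a ^ 4 * (1 / real K) < e / 2"
    using assms by (intro order_tendstoD(2)) auto
  have "(\<lambda>K. 20 * (1 / real K)) \<longlonglongrightarrow> 20 * 0" by (intro tendsto_intros lim_1_over_n)
  then have K2: "\<forall>\<^sub>F K in sequentially. 20 * (1 / real K) < a\<^sup>2 / 2"
    using a by (intro order_tendstoD(2)) auto
  have "\<forall>\<^sub>F K in sequentially. 9600 * real (Suc L) / a ^ 4 * (1 / real K) < e / 2 \<and> 20 * (1 / real K) < a\<^sup>2 / 2 \<and> K \<ge> max m 1"
    using K1 K2 eventually_ge_at_top[of "max m 1"] by eventually_elim simp
  then obtain K where K: "9600 * real (Suc L) / a ^ 4 * (1 / real K) < e / 2" "20 * (1 / real K) < a\<^sup>2 / 2" "K \<ge> max m 1"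
    by (auto simp: eventually_sequentially)
  have KL: "K \<ge> 1" "L \<ge> 1" "K \<ge> m" "L \<ge> m" using K L by auto
  have "x * l * (32 * (3 * (10 / x)\<^sup>2) / b) = 9600 * l / b * (1 / x)" if "x \<noteq> 0" for x l b :: real
    using that by (simp add: power2_eq_square mult.commute)
  then have "real (K * Suc L) * (32 * (3 * (10 / real K)\<^sup>2) / a ^ 4) = 9600 * real (Suc L) / a ^ 4 * (1 / real K)"
    unfolding of_nat_mult using KL by simp
  then have "12288 * sqrt (1 / real L) / a\<^sup>2 + real (K * Suc L) * (32 * (3 * (10 / real K)\<^sup>2) / a ^ 4) < e"
    using K(1) L(1) by linarith
  then have ev1: "\<forall>\<^sub>F n in sequentially. osc_bound K L a n < e"
    by (rule order_tendstoD(2)[OF osc_bound_tendsto])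
  have "(\<lambda>n. 2 * (10 * (1 / real K + 1 / real (p n))) + 8 * (52 / sqrt (real n) + 20 / real (p n)))
     \<longlonglongrightarrow> 2 * (10 * (1 / real K + 0)) + 8 * (0 + 0)"
    by (intro tendsto_intros inverse_tendsto)
  then have ev2: "\<forall>\<^sub>F n in sequentially. 2 * (10 * (1 / real K + 1 / real (p n))) + 8 * (52 / sqrt (real n) + 20 / real (p n)) < a\<^sup>2 / 2"
    using K(2) by (intro order_tendstoD(2)) auto
  have "\<forall>\<^sub>F n in sequentially. \<exists>A\<in>sets (M n). measure (M n) A \<ge> 1 - e \<and>
         (\<forall>\<omega>\<in>A. \<forall>z\<in>unit_square. \<bar>Ht n \<omega> z - Ht n \<omega> (grid K L z)\<bar> \<le> e)"
    using ev1 ev2 eventually_ge_at_top[of 1]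
  proof eventually_elim
    case (elim n)
    interpret beta_array "M n" "P n" "R n" n "p n" by (rule arr[OF elim(3)])
    obtain B where B: "B \<in> events" "prob B \<le> osc_bound K L a n"
      "\<And>\<omega> z. \<omega> \<in> space (M n) - B \<Longrightarrow> z \<in> unit_square \<Longrightarrow>
      \<bar>WW (kk n (fst z)) (mm n (snd z)) \<omega> - WW (kk n (fst (grid K L z))) (mm n (snd (grid K L z))) \<omega>\<bar> \<le> 4 * (a * sqrt (real n))"
      using grid_oscillation[OF KL(1,2) a less_imp_le[OF elim(2)]] unfolding osc_bound_def by metis
    obtain N where N: "N \<in> null_sets (M n)" "{\<omega>\<in>space (M n). \<not> (\<forall>z\<in>unit_square. Ht n \<omega> z = fieldz n z \<omega>)} \<subseteq> N"
      using Ht_AE[OF elim(3)] unfolding eventually_ae_filter by blast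
    define A where "A = space (M n) - B - N"
    have "A \<in> events" using B(1) N(1) by (auto simp: A_def)
    moreover have "prob A \<ge> 1 - e"
    proof -
      have "prob A = prob (space (M n) - B)" unfolding A_def by (rule measure_Diff_null_set[OF _ N(1)]) (use B(1) in auto)
      also have "\<dots> = 1 - prob B" by (rule prob_compl[OF B(1)])
      finally show ?thesis using B(2) elim(1) by linarith
    qed
    moreover have "\<bar>Ht n \<omega> z - Ht n \<omega> (grid K L z)\<bar> \<le> e" if w: "\<omega> \<in> A" and z: "z \<in> unit_square" for \<omega> z
    proof -
      have ws: "\<omega> \<in> space (M n) - B" and all: "\<forall>z\<in>unit_square. Ht n \<omega> z = fieldz n z \<omega>"
        using w N(2) by (auto simp: A_def simp del: mem_Sigma_iff)
      have gz: "grid K L z \<in> unit_square" by (rule grid_in_square[OF KL(1,2) z])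
      have s0: "sqrt (real n) > 0" using elim(3) by simp
      have "\<bar>Ht n \<omega> z - Ht n \<omega> (grid K L z)\<bar> =
        \<bar>WW (kk n (fst z)) (mm n (snd z)) \<omega> - WW (kk n (fst (grid K L z))) (mm n (snd (grid K L z))) \<omega>\<bar> / sqrt (real n)"
        unfolding bspec[OF all z] bspec[OF all gz] diff_divide_distrib[symmetric] abs_divide using s0 by simp
      also have "\<dots> \<le> 4 * (a * sqrt (real n)) / sqrt (real n)" by (intro divide_right_mono B(3)[OF ws z]) simp
      also have "\<dots> = e" using s0 by (simp add: a_def)
      finally show ?thesis .
    qed
    ultimately show ?case by blast
  qed
  then show ?thesis using KL by blast
qed

text \<open>Process and limit must be discretised by the same grid: the limit accepts every
  sufficiently fine one, and the process supplies one beyond any prescribed fineness.\<close>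

theorem Ht_converges:
  fixes N :: "'b measure"
  assumes G: "centered_continuous_gaussian_process N unit_square limit_kernel G"
  shows "converges_weakly (l_infinity unit_square) M Ht N (\<lambda>\<omega>. restrict (G \<omega>) unit_square)"
proof (rule converges_weakly_l_infinityI[OF prob _ _ Ht_measurable _ Ht_borel])
  interpret N: prob_space N using G by (simp add: centered_continuous_gaussian_process_def)
  have cont: "continuous_on unit_square (G \<omega>)" if "\<omega> \<in> space N" for \<omega>
    using G that by (simp add: centered_continuous_gaussian_process_def)
  have Gm: "(\<lambda>\<omega>. G \<omega> z) \<in> borel_measurable N" if "z \<in> unit_square" for z
    by (rule centered_gaussian_process_facts(1)[OF G that])
  show "prob_space N" by (rule N.prob_space_axioms)
  show "unit_square \<noteq> {}" by auto
  show "(\<lambda>\<omega>. restrict (G \<omega>) unit_square) \<in> measurable N (metric_borel (l_infinity unit_square))"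
    by (rule continuous_process_measurable[OF Gm cont])
  show "(\<lambda>\<omega>. restrict (G \<omega>) unit_square z) \<in> borel_measurable N" if "z \<in> unit_square" for z
    using Gm[OF that] that by (simp del: mem_Sigma_iff)
  show "(\<lambda>n. \<integral>\<omega>. g (\<lambda>k. Ht n \<omega> (\<tau> k)) \<partial>M n) \<longlonglongrightarrow> (\<integral>\<omega>. g (\<lambda>k. restrict (G \<omega>) unit_square (\<tau> k)) \<partial>N)"
    if "\<And>k::nat. \<tau> k \<in> unit_square" "\<And>x y :: nat \<Rightarrow> real. \<bar>g x - g y\<bar> \<le> L * (\<Sum>k<d. \<bar>x k - y k\<bar>)" "\<And>x. \<bar>g x\<bar> \<le> B"
    for \<tau> g L B and d :: nat
    using Ht_fdd[OF G that] that(1) by (simp del: mem_Sigma_iff)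
  fix e :: real assume e: "e > 0"
  have "\<exists>m\<ge>1. \<forall>K\<ge>m. \<forall>L\<ge>m. \<exists>A\<in>N.events. N.prob A \<ge> 1 - e \<and>
    (\<forall>\<omega>\<in>A. \<forall>z\<in>unit_square. \<bar>G \<omega> z - G \<omega> (grid K L z)\<bar> \<le> e)"
    by (rule N.continuous_process_grid_approx) (fact Gm cont e)+
  then obtain m where m: "\<forall>K\<ge>m. \<forall>L\<ge>m. \<exists>A\<in>N.events. N.prob A \<ge> 1 - e \<and>
    (\<forall>\<omega>\<in>A. \<forall>z\<in>unit_square. \<bar>G \<omega> z - G \<omega> (grid K L z)\<bar> \<le> e)"
    by (elim exE conjE) (rule that)
  obtain K L where KL: "K \<ge> m" "L \<ge> m" "1 \<le> K" "1 \<le> L" and X: "\<forall>\<^sub>F n in sequentially. \<exists>A\<in>sets (M n). measure (M n) A \<ge> 1 - e \<and>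
         (\<forall>\<omega>\<in>A. \<forall>z\<in>unit_square. \<bar>Ht n \<omega> z - Ht n \<omega> (grid K L z)\<bar> \<le> e)"
    using Ht_grid_approx[OF e, of m] by (elim exE conjE) (rule that)
  obtain A where A: "A \<in> N.events" "N.prob A \<ge> 1 - e" "\<forall>\<omega>\<in>A. \<forall>z\<in>unit_square. \<bar>G \<omega> z - G \<omega> (grid K L z)\<bar> \<le> e"
    using m[rule_format, OF KL(1,2)] by (elim bexE conjE) (rule that)
  have "\<forall>\<omega>\<in>A. \<forall>z\<in>unit_square. \<bar>restrict (G \<omega>) unit_square z - restrict (G \<omega>) unit_square (grid K L z)\<bar> \<le> e"
    using A(3) grid_in_square[OF KL(3,4)] by (simp del: mem_Sigma_iff)
  then show "\<exists>\<rho>. finite (\<rho> ` unit_square) \<and> \<rho> ` unit_square \<subseteq> unit_square \<and>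
      (\<forall>\<^sub>F n in sequentially. \<exists>A\<in>sets (M n). measure (M n) A \<ge> 1 - e \<and>
         (\<forall>\<omega>\<in>A. \<forall>t\<in>unit_square. \<bar>Ht n \<omega> t - Ht n \<omega> (\<rho> t)\<bar> \<le> e)) \<and>
      (\<exists>A\<in>sets N. measure N A \<ge> 1 - e \<and> (\<forall>\<omega>\<in>A. \<forall>t\<in>unit_square. \<bar>restrict (G \<omega>) unit_square t - restrict (G \<omega>) unit_square (\<rho> t)\<bar> \<le> e))"
    using X A(1,2) by (intro exI[of _ "grid K L"] conjI grid_finite grid_image KL(3,4)) blast+
qed

end

text \<open>The existence of the limit process is stated along with the convergence, which would
  otherwise risk being vacuous; the convergence holds for each of its versions.\<close>

theorem theorem4p2:
  fixes p :: "nat \<Rightarrow> nat"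
    and M :: "nat \<Rightarrow> 'a measure"
    and P R :: "nat \<Rightarrow> nat \<Rightarrow> nat \<Rightarrow> 'a \<Rightarrow> real"
  defines "H' \<equiv> \<lambda>n s t \<omega>. H n (p n) (\<lambda>i j. P n i j \<omega>) (\<lambda>i j. R n i j \<omega>) s t"
  defines "Htilde \<equiv> \<lambda>n \<omega>. \<lambda>(s, t) \<in> unit_square. (H' n s t \<omega> - (\<integral>\<omega>'. H' n s t \<omega>' \<partial>M n)) / sqrt (real n)"
  assumes p_pos: "\<And>n. p n > 0"
    and p_lim: "filterlim p at_top sequentially"
    and prob: "\<And>n. prob_space (M n)"
    and indep: "\<And>n. prob_space.indep_vars (M n) (\<lambda>_. borel)
        (case_sum (\<lambda>(i, j). P n i j) (\<lambda>(i, j). R n i j))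
        (({1..2 * n} \<times> {0..<p n}) <+> ({1..2 * n} \<times> {1..<p n}))"
    and P_beta: "\<And>n i j. i \<in> {1..2 * n} \<Longrightarrow> j \<in> {0..<p n} \<Longrightarrow>
        distributed (M n) lborel (P n i j)
          (beta_density ((real (p n) + 1) / 2 * (2 * real n - real i + 2) - real j / 2)
                        ((real (p n) + 1) / 2 * (2 * real n - real i + 2)))"
    and R_beta: "\<And>n i j. i \<in> {1..2 * n} \<Longrightarrow> j \<in> {1..<p n} \<Longrightarrow>
        distributed (M n) lborel (R n i j)
          (beta_density ((real (p n) + 1) / 2 * (2 * real n - real i + 2) - real j / 2) (real j / 2))"
  shows "(\<exists>(N :: (real \<times> real \<Rightarrow> real) measure) G.
            centered_continuous_gaussian_process N unit_square limit_kernel G) \<and>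
         (\<forall>(N :: 'b measure) G.
            centered_continuous_gaussian_process N unit_square limit_kernel G \<longrightarrow>
            converges_weakly (l_infinity unit_square) M Htilde N (\<lambda>\<omega>. restrict (G \<omega>) unit_square))"
proof -
  have arr: "beta_array (M n) (P n) (R n) n (p n)" if "n \<ge> 1" for n
    unfolding beta_array_def beta_array_axioms_def
    using prob indep P_beta R_beta that p_pos[of n] by simp
  interpret beta_arrays M P R p
    by (rule beta_arrays.intro) (rule arr prob p_pos p_lim | assumption)+
  have eq: "Htilde = Ht" by (intro ext) (simp only: Htilde_def H'_def Ht_def)
  show ?thesis unfolding eq by (intro conjI exI allI impI) (rule gaussian_sheet, erule Ht_converges)
qed

end
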